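(* In the setting described in the context (time discontinuous Galerkin discretization of degree $q\in\mathbb{N}$), let $(U_n)_{n\in\mathbb{N}}$ be a sequence of finite dimensional subspaces of $U$ with $\lim_{n\to\infty}U_n=U$ and let $(N_n)_{n\in\mathbb{N}}$ be a sequence of positive integers tending to infinity; put $k_n=T/N_n$. Let $f\in V'$, $\xi_0\in H$ and let $u\in W$ be the unique solution of $u'+\mathcal{A}u=f$, $u(0)-\Phi u(T)=\xi_0$. Then $$X=\lim_{n\to\infty}X_n\ \text{ in } Z\qquad\text{and}\qquad Y=\lim_{n\to\infty}Y_n\ \text{ in } Y.$$ Moreover, if for each $n\in\mathbb{N}$ $w_n\in W_n$ denotes the unique solution of the time discontinuous Galerkin scheme $$\langle w_n(0)-\Phi w_n(T),v\rangle_H=\langle\xi_0,v\rangle_H\quad\text{for all }v\in U_n,$$ $$\int_{(m-1)k_n}^{mk_n}\langle\partial_bw_n(t),v(t)\rangle_H\,dt+\langle w_{n,0}^{(m)}-w_n((m-1)k_n),v((m-1)k_n)\rangle_H+\int_{(m-1)k_n}^{mk_n}a(t,w_n(t),v(t))\,dt=\int_{(m-1)k_n}^{mk_n}\langle f(t),v(t)\rangle_{U',U}\,dt$$ for all $m=1,\dots,N_n$ and all polynomials $v:\mathbb{R}\to U_n$ of degree at most $q$, then $$\lim_{n\to\infty}\Big(\|u'-\widehat{\partial}w_n\|_{V'}+\|u-w_n\|_V+\sup_{t\in[0,T]}\|u(t)-w_n(t)\|_H\Big)=0.$$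
   Context: All vector spaces are real; $\mathbb{N}$ includes $0$. For a sequence $(E_n)$ of subspaces of a Banach space $E$, $\lim_{n\to\infty}E_n$ is the set of all $x\in E$ for which there are $x_n\in E_n$ with $x_n\to x$ in norm. Let $T>0$ and let $U,H$ be Hilbert spaces with $U$ continuously and densely embedded in $H$. $H$ is identified with a subspace of $U'$ by $\langle y,u\rangle_{U',U}=\langle y,u\rangle_H$. Put $V=L^2(0,T;U)$, $V'=L^2(0,T;U')$, $\mathbb{H}=L^2(0,T;H)$. $W=H^1(0,T;U')\cap L^2(0,T;U)$ is the space of $u\in V$ having a weak derivative $u'\in V'$, i.e. $\langle u',v\rangle_{V',V}=-\langle u,v'\rangle_{\mathbb{H}}$ for all $v\in C^1_c((0,T);U)$; elements of $W$ are identified with their continuous representatives in $C([0,T];H)$. Let $a:[0,T]\times U\times U\to\mathbb{R}$ be such that $a(t,\cdot,\cdot)$ is bilinear for all $t$, $a(\cdot,v,w)$ is measurable for all $v,w\in U$, $|a(t,v,w)|\le M\|v\|_U\|w\|_U$ for a.e. $t$ and all $v,w\in U$, with $M\ge1$, and $a(t,v,v)\ge\alpha\|v\|_U^2$ for all $t\in[0,T]$, $v\in U$, with $\alpha>0$. Define $\mathcal{A}\in\mathcal{L}(V,V')$ by $\langle\mathcal{A}v,w\rangle_{V',V}=\int_0^Ta(t,v(t),w(t))\,dt$. Let $\Phi:H\to H$ be linear with $\|\Phi\|\le1$. It is known that for all $f\in V'$, $\xi_0\in H$ the problem $u\in W$, $u'+\mathcal{A}u=f$, $u(0)-\Phi u(T)=\xi_0$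 has a unique solution. $G$ is the Banach space of bounded functions $w:[0,T]\to H$ (defined everywhere) which define an element of $V$, with $\|w\|_G^2=\sup_{t\in[0,T]}\|w(t)\|_H^2+\|w\|_V^2$. Put $Z=V'\times G$ with $\|(z_1,z_2)\|_Z^2=\|z_1\|_{V'}^2+\|z_2\|_G^2$, $Y=V\times H$ with $\|(y_1,y_2)\|_Y^2=\|y_1\|_V^2+\|y_2\|_H^2$, and $X=\{(u',u):u\in W\}\subset Z$. For each $n$: $W_n\subset G$ is the space of functions $w:[0,T]\to U_n$ such that for each $m=1,\dots,N_n$ there are $w_0^{(m)},\dots,w_q^{(m)}\in U_n$ with $w(t)=\sum_{i=0}^q\big(\frac{t-(m-1)k_n}{k_n}\big)^iw_i^{(m)}$ for all $t\in((m-1)k_n,mk_n]$ (the value $w(0)\in U_n$ is arbitrary); for $w=w_n$ these coefficients are denoted $w_{n,i}^{(m)}$. $V_n$ is the space of $v\in V$ whose restriction to each $((m-1)k_n,mk_n)$, $m=1,\dots,N_n$, is a polynomial in $t$ of degree at most $q$ with coefficients in $U_n$; $P^V_n$ is the orthogonal projection of $V$ onto $V_n$. For $w\in W_n$, $\partial_bw$ is the function equal to $w'(t)$ on each open interval $((m-1)k_n,mk_n)$. Let $\psi_0$ be the real polynomial of degree at most $q$ with $\int_0^1\psi_0(s)\,ds=1$ and $\int_0^1\psi_0(s)s^j\,ds=0$ for $j=1,\dots,q$. For $w\in W_n$ define $\partial w\in V_n$ by $$\partial w(t)=\partial_bw(t)+\frac1{k_n}\psi_0\Big(\frac{t-(m-1)k_n}{k_n}\Big)\big(w_0^{(m)}-w((m-1)k_n)\big),\quad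 t\in((m-1)k_n,mk_n),\ m=1,\dots,N_n,$$ and $\widehat{\partial}w\in V'$ by $\langle\widehat{\partial}w,v\rangle_{V',V}=\langle\partial w,P^V_nv\rangle_{\mathbb{H}}$ for all $v\in V$. Finally $X_n=\{(\widehat{\partial}w,w):w\in W_n\}\subset Z$ and $Y_n=V_n\times U_n\subset Y$. The scheme in the claim has a unique solution for every $n$. *)

theory Defs
  imports
    "HOL-Analysis.Analysis"
    "HOL-Computational_Algebra.Polynomial"
begin

text \<open>
  Elements of the Lebesgue spaces over \<open>(0,T)\<close> are represented by functions on \<open>real\<close>, identified
  when they agree almost everywhere on \<open>[0,T]\<close>; elements of \<open>G\<close> are represented by functions on
  \<open>real\<close> of which only the values on \<open>[0,T]\<close> matter. Norms are therefore seminorms on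
  representatives.

  The embedding of \<open>U\<close> into \<open>H\<close> is an explicit injective map \<open>j\<close>, and \<open>U'\<close> is the type
  \<open>'u \<Rightarrow>\<^sub>L real\<close>. The sort \<open>second_countable_topology\<close> on \<open>'u\<close> and \<open>'h\<close> is not an additional
  hypothesis: \<open>U\<close> is the limit of a sequence of finite dimensional subspaces, hence separable, and so
  is \<open>H\<close>, in which \<open>U\<close> is dense.
\<close>

definition lim_spaces :: "'e set \<Rightarrow> ('e::minus \<Rightarrow> real) \<Rightarrow> (nat \<Rightarrow> 'e set) \<Rightarrow> 'e set" where
  "lim_spaces E nrm S =
    {x \<in> E. \<exists>xs. (\<forall>n. xs n \<in> S n) \<and> (\<lambda>n. nrm (xs n - x)) \<longlonglongrightarrow> 0}"


subsection \<open>The spaces \<open>V\<close>, \<open>V'\<close>, \<open>W\<close>, \<open>G\<close>, \<open>Z\<close>, \<open>Y\<close>, \<open>X\<close>\<close>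

text \<open>
  \<open>V = L2 T\<close> at type \<open>real \<Rightarrow> 'u\<close> and \<open>V' = L2 T\<close> at type \<open>real \<Rightarrow> 'u \<Rightarrow>\<^sub>L real\<close>. Borel and strong
  measurability coincide here, since \<open>U\<close> and therefore the Hilbert space \<open>U'\<close> are separable.
\<close>

definition L2 :: "real \<Rightarrow> (real \<Rightarrow> 'b::real_normed_vector) set" where
  "L2 T = {v. v \<in> borel_measurable (lebesgue_on {0..T}) \<and>
              integrable (lebesgue_on {0..T}) (\<lambda>t. (norm (v t))\<^sup>2)}"

definition L2_norm :: "real \<Rightarrow> (real \<Rightarrow> 'b::real_normed_vector) \<Rightarrow> real" where
  "L2_norm T v = sqrt (LINT t|lebesgue_on {0..T}. (norm (v t))\<^sup>2)"

definition V_inner :: "real \<Rightarrow> (real \<Rightarrow> 'u::real_inner) \<Rightarrow> (real \<Rightarrow> 'u) \<Rightarrow> real" where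
  "V_inner T v w = (LINT t|lebesgue_on {0..T}. v t \<bullet> w t)"

definition H_inner :: "real \<Rightarrow> (real \<Rightarrow> 'h::real_inner) \<Rightarrow> (real \<Rightarrow> 'h) \<Rightarrow> real" where
  "H_inner T v w = (LINT t|lebesgue_on {0..T}. v t \<bullet> w t)"

definition V_pairing ::
  "real \<Rightarrow> (real \<Rightarrow> 'u::real_normed_vector \<Rightarrow>\<^sub>L real) \<Rightarrow> (real \<Rightarrow> 'u) \<Rightarrow> real" where
  "V_pairing T g v = (LINT t|lebesgue_on {0..T}. blinfun_apply (g t) (v t))"

text \<open>The \<open>U\<close>-valued function underlying an \<open>H\<close>-valued one; unspecified at \<open>t\<close> if \<open>w t \<notin> range j\<close>.\<close>

definition to_U :: "('u \<Rightarrow> 'h) \<Rightarrow> (real \<Rightarrow> 'h) \<Rightarrow> real \<Rightarrow> 'u" where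
  "to_U j w = (\<lambda>t. inv j (w t))"

definition defines_V ::
  "real \<Rightarrow> ('u::real_normed_vector \<Rightarrow> 'h) \<Rightarrow> (real \<Rightarrow> 'h) \<Rightarrow> bool" where
  "defines_V T j w \<longleftrightarrow>
    (AE t in lebesgue_on {0..T}. w t \<in> range j) \<and> to_U j w \<in> L2 T"

definition C1c :: "real \<Rightarrow> (real \<Rightarrow> 'u::real_normed_vector) set" where
  "C1c T = {v. v C1_differentiable_on UNIV \<and> closure {t. v t \<noteq> 0} \<subseteq> {0<..<T}}"

definition has_weak_deriv ::
  "real \<Rightarrow> ('u::real_inner \<Rightarrow> 'h::real_inner) \<Rightarrow> (real \<Rightarrow> 'h) \<Rightarrow> (real \<Rightarrow> 'u \<Rightarrow>\<^sub>L real) \<Rightarrow> bool" where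
  "has_weak_deriv T j u g \<longleftrightarrow> g \<in> L2 T \<and>
    (\<forall>v\<in>C1c T. V_pairing T g v = - H_inner T u (\<lambda>t. j (vector_derivative v (at t))))"

text \<open>Elements of \<open>W\<close> are given by their continuous representatives.\<close>

definition W_space :: "real \<Rightarrow> ('u::real_inner \<Rightarrow> 'h::real_inner) \<Rightarrow> (real \<Rightarrow> 'h) set" where
  "W_space T j = {u. continuous_on {0..T} u \<and> defines_V T j u \<and> (\<exists>g. has_weak_deriv T j u g)}"

definition G_space :: "real \<Rightarrow> ('u::real_normed_vector \<Rightarrow> 'h::real_normed_vector) \<Rightarrow> (real \<Rightarrow> 'h) set" where
  "G_space T j = {w. bounded (w ` {0..T}) \<and> defines_V T j w}"

definition G_norm :: "real \<Rightarrow> ('u::real_normed_vector \<Rightarrow> 'h::real_normed_vector) \<Rightarrow> (real \<Rightarrow> 'h) \<Rightarrow> real" where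
  "G_norm T j w = sqrt ((SUP t\<in>{0..T}. (norm (w t))\<^sup>2) + (L2_norm T (to_U j w))\<^sup>2)"

definition Z_space ::
  "real \<Rightarrow> ('u::real_normed_vector \<Rightarrow> 'h::real_normed_vector) \<Rightarrow>
    ((real \<Rightarrow> 'u \<Rightarrow>\<^sub>L real) \<times> (real \<Rightarrow> 'h)) set" where
  "Z_space T j = L2 T \<times> G_space T j"

definition Z_norm ::
  "real \<Rightarrow> ('u::real_normed_vector \<Rightarrow> 'h::real_normed_vector) \<Rightarrow>
    (real \<Rightarrow> 'u \<Rightarrow>\<^sub>L real) \<times> (real \<Rightarrow> 'h) \<Rightarrow> real" where
  "Z_norm T j z = sqrt ((L2_norm T (fst z))\<^sup>2 + (G_norm T j (snd z))\<^sup>2)"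

definition Y_space :: "real \<Rightarrow> ((real \<Rightarrow> 'u::real_normed_vector) \<times> 'h) set" where
  "Y_space T = L2 T \<times> UNIV"

definition Y_norm :: "real \<Rightarrow> (real \<Rightarrow> 'u::real_normed_vector) \<times> 'h::real_normed_vector \<Rightarrow> real" where
  "Y_norm T y = sqrt ((L2_norm T (fst y))\<^sup>2 + (norm (snd y))\<^sup>2)"

definition X_space ::
  "real \<Rightarrow> ('u::real_inner \<Rightarrow> 'h::real_inner) \<Rightarrow> ((real \<Rightarrow> 'u \<Rightarrow>\<^sub>L real) \<times> (real \<Rightarrow> 'h)) set" where
  "X_space T j = {(u', u). u \<in> W_space T j \<and> has_weak_deriv T j u u'}"


subsection \<open>The continuous problem\<close>

definition A_op ::
  "real \<Rightarrow> (real \<Rightarrow> 'u \<Rightarrow> 'u \<Rightarrow> real) \<Rightarrow> (real \<Rightarrow> 'u) \<Rightarrow> (real \<Rightarrow> 'u) \<Rightarrow> real" where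
  "A_op T a v w = (LINT t|lebesgue_on {0..T}. a t (v t) (w t))"

text \<open>The equation \<open>u' + A u = f\<close> is an equality of functionals on \<open>V\<close>.\<close>

definition is_solution ::
  "real \<Rightarrow> ('u::real_inner \<Rightarrow> 'h::real_inner) \<Rightarrow> (real \<Rightarrow> 'u \<Rightarrow> 'u \<Rightarrow> real) \<Rightarrow> ('h \<Rightarrow>\<^sub>L 'h) \<Rightarrow>
    (real \<Rightarrow> 'u \<Rightarrow>\<^sub>L real) \<Rightarrow> 'h \<Rightarrow> (real \<Rightarrow> 'h) \<Rightarrow> (real \<Rightarrow> 'u \<Rightarrow>\<^sub>L real) \<Rightarrow> bool" where
  "is_solution T j a \<Phi> f \<xi>0 u u' \<longleftrightarrow>
    u \<in> W_space T j \<and> has_weak_deriv T j u u' \<and>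
    (\<forall>v\<in>L2 T. V_pairing T u' v + A_op T a (to_U j u) v = V_pairing T f v) \<and>
    u 0 - blinfun_apply \<Phi> (u T) = \<xi>0"


subsection \<open>The discontinuous Galerkin spaces\<close>

text \<open>Below, \<open>S\<close> is the finite dimensional subspace of \<open>U\<close>, and \<open>k = T / N\<close> is the step size.\<close>

definition poly_funs :: "nat \<Rightarrow> 'u::real_vector set \<Rightarrow> (real \<Rightarrow> 'u) set" where
  "poly_funs q S = {v. \<exists>c. (\<forall>i\<le>q. c i \<in> S) \<and> (\<forall>t. v t = (\<Sum>i\<le>q. t ^ i *\<^sub>R c i))}"

definition local_expansion ::
  "real \<Rightarrow> nat \<Rightarrow> (real \<Rightarrow> 'u::real_vector) \<Rightarrow> nat \<Rightarrow> (nat \<Rightarrow> 'u) \<Rightarrow> bool" where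
  "local_expansion k q w m c \<longleftrightarrow>
    (\<forall>t\<in>{(real m - 1) * k<..real m * k}.
       w t = (\<Sum>i\<le>q. ((t - (real m - 1) * k) / k) ^ i *\<^sub>R c i))"

definition Wn_space ::
  "real \<Rightarrow> nat \<Rightarrow> nat \<Rightarrow> 'u::real_vector set \<Rightarrow> (real \<Rightarrow> 'u) set" where
  "Wn_space T N q S = {w. w 0 \<in> S \<and>
    (\<forall>m\<in>{1..N}. \<exists>c. (\<forall>i\<le>q. c i \<in> S) \<and> local_expansion (T / real N) q w m c)}"

text \<open>The coefficients \<open>c i\<close> with \<open>i \<le> q\<close> are uniquely determined by \<open>w\<close> in \<open>Wn_space T N q S\<close>.\<close>

definition dg_coeff :: "real \<Rightarrow> nat \<Rightarrow> (real \<Rightarrow> 'u::real_vector) \<Rightarrow> nat \<Rightarrow> nat \<Rightarrow> 'u" where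
  "dg_coeff k q w m i = (SOME c. local_expansion k q w m c) i"

definition Vn_space ::
  "real \<Rightarrow> nat \<Rightarrow> nat \<Rightarrow> 'u::real_normed_vector set \<Rightarrow> (real \<Rightarrow> 'u) set" where
  "Vn_space T N q S = {v \<in> L2 T. \<forall>m\<in>{1..N}. \<exists>p\<in>poly_funs q S.
    \<forall>t\<in>{(real m - 1) * (T / real N)<..<real m * (T / real N)}. v t = p t}"

definition Vn_proj ::
  "real \<Rightarrow> nat \<Rightarrow> nat \<Rightarrow> 'u::real_inner set \<Rightarrow> (real \<Rightarrow> 'u) \<Rightarrow> real \<Rightarrow> 'u" where
  "Vn_proj T N q S v = (SOME p. p \<in> Vn_space T N q S \<and>
    (\<forall>z\<in>Vn_space T N q S. V_inner T (v - p) z = 0))"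

definition psi0 :: "nat \<Rightarrow> real poly" where
  "psi0 q = (THE p. degree p \<le> q \<and> integral {0..1} (\<lambda>s. poly p s) = 1 \<and>
    (\<forall>i\<in>{1..q}. integral {0..1} (\<lambda>s. poly p s * s ^ i) = 0))"

text \<open>For \<open>t\<close> in the open interval \<open>((m-1)k, mk)\<close> the index \<open>m\<close> is \<open>\<lceil>t / k\<rceil>\<close>. The values of \<open>dg_b\<close>
  and \<open>dg_deriv\<close> at the nodes \<open>mk\<close> and outside \<open>[0,T]\<close> are immaterial.\<close>

definition dg_b :: "(real \<Rightarrow> 'u::real_normed_vector) \<Rightarrow> real \<Rightarrow> 'u" where
  "dg_b w t = vector_derivative w (at t)"

definition dg_deriv ::
  "real \<Rightarrow> nat \<Rightarrow> nat \<Rightarrow> (real \<Rightarrow> 'u::real_normed_vector) \<Rightarrow> real \<Rightarrow> 'u" where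
  "dg_deriv T N q w t =
    (let k = T / real N; m = nat \<lceil>t / k\<rceil>; s = (real m - 1) * k in
      dg_b w t + (1 / k * poly (psi0 q) ((t - s) / k)) *\<^sub>R (dg_coeff k q w m 0 - w s))"

text \<open>The functional on \<open>V\<close> extending \<open>dg_deriv\<close> by the projection, as an element of
  \<open>L2(0,T;U')\<close>; it is unique almost everywhere.\<close>

definition dg_hat ::
  "real \<Rightarrow> ('u::real_inner \<Rightarrow> 'h::real_inner) \<Rightarrow> nat \<Rightarrow> nat \<Rightarrow> 'u set \<Rightarrow>
    (real \<Rightarrow> 'u) \<Rightarrow> real \<Rightarrow> 'u \<Rightarrow>\<^sub>L real" where
  "dg_hat T j N q S w = (SOME g. g \<in> L2 T \<and>
    (\<forall>v\<in>L2 T. V_pairing T g v =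
       H_inner T (\<lambda>t. j (dg_deriv T N q w t)) (\<lambda>t. j (Vn_proj T N q S v t))))"

definition Xn_space ::
  "real \<Rightarrow> ('u::real_inner \<Rightarrow> 'h::real_inner) \<Rightarrow> nat \<Rightarrow> nat \<Rightarrow> 'u set \<Rightarrow>
    ((real \<Rightarrow> 'u \<Rightarrow>\<^sub>L real) \<times> (real \<Rightarrow> 'h)) set" where
  "Xn_space T j N q S = {(dg_hat T j N q S w, \<lambda>t. j (w t)) |w. w \<in> Wn_space T N q S}"

definition Yn_space ::
  "real \<Rightarrow> ('u::real_normed_vector \<Rightarrow> 'h) \<Rightarrow> nat \<Rightarrow> nat \<Rightarrow> 'u set \<Rightarrow> ((real \<Rightarrow> 'u) \<times> 'h) set" where
  "Yn_space T j N q S = Vn_space T N q S \<times> (j ` S)"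

definition dg_solution ::
  "real \<Rightarrow> ('u::real_inner \<Rightarrow> 'h::real_inner) \<Rightarrow> (real \<Rightarrow> 'u \<Rightarrow> 'u \<Rightarrow> real) \<Rightarrow> ('h \<Rightarrow>\<^sub>L 'h) \<Rightarrow>
    (real \<Rightarrow> 'u \<Rightarrow>\<^sub>L real) \<Rightarrow> 'h \<Rightarrow> nat \<Rightarrow> nat \<Rightarrow> 'u set \<Rightarrow> (real \<Rightarrow> 'u) \<Rightarrow> bool" where
  "dg_solution T j a \<Phi> f \<xi>0 N q S w \<longleftrightarrow>
    w \<in> Wn_space T N q S \<and>
    (\<forall>v\<in>S. (j (w 0) - blinfun_apply \<Phi> (j (w T))) \<bullet> j v = \<xi>0 \<bullet> j v) \<and>
    (\<forall>m\<in>{1..N}. \<forall>v\<in>poly_funs q S.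
      let k = T / real N; s = (real m - 1) * k; I = lebesgue_on {s..real m * k} in
        (LINT t|I. j (dg_b w t) \<bullet> j (v t))
        + j (dg_coeff k q w m 0 - w s) \<bullet> j (v s)
        + (LINT t|I. a t (w t) (v t))
        = (LINT t|I. blinfun_apply (f t) (v t)))"

end

theory Submission
  imports Defs
begin

text \<open>
  Elements of \<open>V'\<close> are represented by elements of \<open>V\<close> through the Riesz isomorphism of \<open>U\<close>. The
  functional \<open>dg_hat\<close> of \<open>w\<close> then becomes \<open>\<Pi> E (\<partial>w)\<close>, where \<open>\<Pi>\<close> is the orthogonal projection of \<open>U\<close> onto
  \<open>U n\<close> and \<open>E y\<close> represents \<open>x \<mapsto> j y \<bullet> j x\<close>.

  Stability: \<open>\<partial>w\<close> is tested with \<open>\<phi> w\<close>, where \<open>\<phi>\<close> is linear on each cell; a multiple of \<open>s \<psi>\<^sub>0(s)\<close>, which is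
  orthogonal to \<open>w'\<close> and vanishes at the left end of the cell, reduces the degree of this product to
  \<open>q\<close>. With \<open>\<phi> = 1\<close> this is the energy identity, \<open>\<phi>(t) = t\<close> bounds \<open>w(T)\<close>, and a function \<open>\<phi>\<close> that is \<open>1\<close> up to
  some cell, where it decreases to \<open>0\<close>, bounds \<open>w\<close> on this cell by \<open>w(0)\<close>. The value \<open>w(0)\<close> itself is not
  controlled by \<open>w\<close> and \<open>\<partial>w\<close> uniformly in \<open>n\<close>; it is controlled by \<open>w(T)\<close> because \<open>\<Phi>\<close> is a contraction.
  Applied to the difference of the discrete solution and a discrete approximation of \<open>u\<close>, this
  reduces the convergence to \<open>X = lim X\<^sub>n\<close>.

  Functions with a weak derivative are approximated by Bernstein polynomials of smooth local averages.
  The derivative of such a polynomial is a Bernstein polynomial of averages of the weak derivative, and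
  polynomials in \<open>t\<close> are interpolated directly. Conversely, a uniform limit of
  discrete functions is left continuous and has right limits; the increment across one cell,
  tested with a fixed vector, tends to zero, which excludes jumps.
\<close>

subsection \<open>Riesz representation and orthogonal projections\<close>

text \<open>No energy identity or trace theorem for \<open>W_space\<close> is used: its elements
  come with a continuous representative, every energy argument is carried out for discrete
  functions, and the continuous problem enters only through its equation, tested with discrete
  functions, and its boundary condition. The constants must not depend on the subspace or the mesh;
  they come from inequalities for polynomials on the reference interval [0,1] that hold in every
  inner product space, and every cell integral is transported there. The obstacle in the
  approximation is that u in V, its derivative in V' and u uniformly in H must be reached by the
  same functions, while the weak derivative is defined only by test functions with compact support
  in (0,T). Mollification would have to extend u beyond the end points; averages over small
  intervals inside (0,T) do not. Bernstein sums of such averages are finite sums of scalar functions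
  times vectors of U, so discretizing them reduces to scalar interpolation and projection of the
  vectors.\<close>

lemma riesz_representation:
  fixes f :: "'a::{real_inner,complete_space} \<Rightarrow> real"
  assumes f: "bounded_linear f"
  shows "\<exists>y. \<forall>x. f x = y \<bullet> x"
proof (cases "\<forall>x. f x = 0")
  case True then show ?thesis by (intro exI[of _ 0]) auto
next
  case False
  interpret f: bounded_linear f by fact
  obtain z where z: "f z \<noteq> 0" using False by auto
  \<comment> \<open>The representing vector will be a multiple of the element of least norm on this
    affine hyperplane.\<close>
  define A where "A = {x. f x = 1}"
  define d where "d = (INF x\<in>A. (norm x)\<^sup>2)"
  have "(1 / f z) *\<^sub>R z \<in> A" using z by (simp add: A_def f.scaleR)
  then have ne: "A \<noteq> {}" by auto
  have bdd: "bdd_below ((\<lambda>x. (norm x)\<^sup>2) ` A)" by (rule bdd_belowI[of _ 0]) auto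
  have low: "d \<le> (norm x)\<^sup>2" if "x \<in> A" for x
    unfolding d_def using bdd that by (rule cINF_lower)
  have "\<exists>x. x \<in> A \<and> (norm x)\<^sup>2 < d + inverse (real (Suc n))" for n
    using cInf_lessD[of "(\<lambda>x. (norm x)\<^sup>2) ` A" "d + inverse (real (Suc n))"] ne
    unfolding d_def by (auto simp: image_iff)
  then obtain X where XA: "\<And>n. X n \<in> A" and Xd: "\<And>n. (norm (X n))\<^sup>2 < d + inverse (real (Suc n))"
    by metis
  \<comment> \<open>Midpoints stay in \<open>A\<close>, so the parallelogram law makes the
    minimizing sequence Cauchy.\<close>
  have par: "(norm (X n - X m))\<^sup>2 \<le> 2 * inverse (real (Suc n)) + 2 * inverse (real (Suc m))" for n m
  proof -
    have "(1/2) *\<^sub>R (X n + X m) \<in> A" using XA[of n] XA[of m] by (simp add: A_def f.scaleR f.add)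
    from low[OF this] have "4 * d \<le> (norm (X n + X m))\<^sup>2" by (simp add: power_divide)
    moreover have "(norm (X n - X m))\<^sup>2 + (norm (X n + X m))\<^sup>2 = 2 * (norm (X n))\<^sup>2 + 2 * (norm (X m))\<^sup>2"
      by (simp add: power2_norm_eq_inner algebra_simps inner_commute)
    ultimately show ?thesis using Xd[of n] Xd[of m] by argo
  qed
  have "Cauchy X"
  proof (rule metric_CauchyI)
    fix e :: real assume e: "e > 0"
    then obtain k where k: "inverse (real (Suc k)) < e\<^sup>2 / 4" using reals_Archimedean[of "e\<^sup>2 / 4"] by auto
    show "\<exists>M. \<forall>m\<ge>M. \<forall>n\<ge>M. dist (X m) (X n) < e"
    proof (intro exI[of _ k] allI impI)
      fix m n assume mn: "k \<le> m" "k \<le> n"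
      have "inverse (real (Suc m)) \<le> inverse (real (Suc k))" "inverse (real (Suc n)) \<le> inverse (real (Suc k))"
        using mn by (auto simp: field_simps)
      then have "(norm (X m - X n))\<^sup>2 < e\<^sup>2" using par[of m n] k by argo
      then show "dist (X m) (X n) < e" using e by (simp add: dist_norm power_less_imp_less_base)
    qed
  qed
  then obtain x0 where x0: "X \<longlonglongrightarrow> x0" using Cauchy_convergent convergent_def by blast
  have fx0: "f x0 = 1"
    using LIMSEQ_unique[OF f.tendsto[OF x0]] XA by (auto simp: A_def)
  have "(norm x0)\<^sup>2 \<le> d"
  proof (rule LIMSEQ_le[of "\<lambda>n. (norm (X n))\<^sup>2" _ "\<lambda>n. d + inverse (real (Suc n))"])
    show "(\<lambda>n. (norm (X n))\<^sup>2) \<longlonglongrightarrow> (norm x0)\<^sup>2" by (intro tendsto_intros x0)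
    show "(\<lambda>n. d + inverse (real (Suc n))) \<longlonglongrightarrow> d" by (rule LIMSEQ_inverse_real_of_nat_add)
    show "\<exists>N. \<forall>n\<ge>N. (norm (X n))\<^sup>2 \<le> d + inverse (real (Suc n))" using Xd less_imp_le by blast
  qed
  then have x0_min: "(norm x0)\<^sup>2 \<le> (norm x)\<^sup>2" if "x \<in> A" for x using low[OF that] by linarith
  \<comment> \<open>Moving \<open>x0\<close> along the kernel of \<open>f\<close> does not leave
    \<open>A\<close>. The step \<open>t\<close> minimizes the resulting quadratic, and minimality of
    \<open>x0\<close> forces its linear coefficient to vanish.\<close>
  have orth: "x0 \<bullet> y = 0" if y: "f y = 0" for y
  proof (cases "y = 0")
    case False
    define t where "t = - (x0 \<bullet> y) / (y \<bullet> y)"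
    have yy: "y \<bullet> y > 0" using False by simp
    have "x0 + t *\<^sub>R y \<in> A" using fx0 y by (simp add: A_def f.add f.scaleR)
    from x0_min[OF this] have "0 \<le> 2 * t * (x0 \<bullet> y) + t\<^sup>2 * (y \<bullet> y)"
      unfolding power2_norm_eq_inner by (simp add: algebra_simps inner_commute power2_eq_square)
    also have "\<dots> = - (x0 \<bullet> y)\<^sup>2 / (y \<bullet> y)"
      using yy False by (simp add: t_def field_simps power2_eq_square)
    finally show ?thesis using yy False by (simp add: field_simps)
  qed simp
  have x0x0: "x0 \<bullet> x0 \<noteq> 0" using fx0 f.zero by auto
  show ?thesis
  proof (intro exI allI)
    fix x
    have "x0 \<bullet> (x - f x *\<^sub>R x0) = 0" by (rule orth) (simp add: f.diff f.scaleR fx0)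
    then show "f x = ((1 / (x0 \<bullet> x0)) *\<^sub>R x0) \<bullet> x" using x0x0 by (simp add: algebra_simps)
  qed
qed

lemma inner_ext: "x = y" if "\<And>z. x \<bullet> z = y \<bullet> (z::'a::real_inner)"
proof -
  have "(x - y) \<bullet> (x - y) = 0" using that[of "x - y"] by (simp add: inner_diff_left)
  then show ?thesis by simp
qed

definition riesz :: "'u::real_inner \<Rightarrow> 'u \<Rightarrow>\<^sub>L real" where "riesz y = blinfun_inner_right y"

definition riesz_inv :: "('u::real_inner \<Rightarrow>\<^sub>L real) \<Rightarrow> 'u" where
  "riesz_inv g = (SOME y. \<forall>x. blinfun_apply g x = y \<bullet> x)"

lemma riesz_apply [simp]: "blinfun_apply (riesz y) x = y \<bullet> x"
  by (simp add: riesz_def)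

lemma riesz_inv_inner: "riesz_inv g \<bullet> x = blinfun_apply g x" for g :: "'u::{real_inner,complete_space} \<Rightarrow>\<^sub>L real"
proof -
  have "\<exists>y. \<forall>x. blinfun_apply g x = y \<bullet> x"
    by (rule riesz_representation) (rule blinfun.bounded_linear_right)
  from someI_ex[OF this] show ?thesis unfolding riesz_inv_def by metis
qed

lemma riesz_riesz_inv [simp]: "riesz (riesz_inv g) = g" for g :: "'u::{real_inner,complete_space} \<Rightarrow>\<^sub>L real"
  by (rule blinfun_eqI) (simp add: riesz_inv_inner)

lemma riesz_inv_riesz [simp]: "riesz_inv (riesz y) = y" for y :: "'u::{real_inner,complete_space}"
  by (rule inner_ext) (simp add: riesz_inv_inner)

lemma norm_riesz [simp]: "norm (riesz y) = norm y"
proof (rule antisym)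
  show "norm (riesz y) \<le> norm y" by (rule norm_blinfun_bound) (auto simp: Cauchy_Schwarz_ineq2)
  show "norm y \<le> norm (riesz y)"
  proof (cases "y = 0")
    case False
    have "(norm y)\<^sup>2 \<le> norm (riesz y) * norm y"
      using norm_blinfun[of "riesz y" y] by (simp add: power2_norm_eq_inner)
    then show ?thesis using False by (simp add: power2_eq_square)
  qed simp
qed

lemma bounded_linear_riesz: "bounded_linear riesz"
  by (simp add: riesz_def[abs_def] bounded_linear_blinfun_inner_right)

lemma norm_riesz_inv [simp]: "norm (riesz_inv g) = norm g" for g :: "'u::{real_inner,complete_space} \<Rightarrow>\<^sub>L real"
  by (metis norm_riesz riesz_riesz_inv)

lemma riesz_diff: "riesz (x - y) = riesz x - riesz y"
  by (rule bounded_linear.linear[OF bounded_linear_riesz, THEN linear_diff])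

lemma riesz_inv_diff: "riesz_inv (f - g) = riesz_inv f - riesz_inv g" for g :: "'u::{real_inner,complete_space} \<Rightarrow>\<^sub>L real"
  by (metis riesz_diff riesz_riesz_inv riesz_inv_riesz)

lemma continuous_on_riesz_inv: "continuous_on A (riesz_inv :: _ \<Rightarrow> 'u::{real_inner,complete_space})"
proof -
  have "1-lipschitz_on A (riesz_inv :: _ \<Rightarrow> 'u)"
    by (rule lipschitz_onI) (auto simp: dist_norm simp flip: riesz_inv_diff)
  then show ?thesis by (rule lipschitz_on_continuous_on)
qed

text \<open>It represents, through the inner product of U, the functional on U that the
  identification of H with a subspace of U' attaches to \<open>j y\<close>; in Hilbert space terms
  it is the adjoint of \<open>j\<close> composed with \<open>j\<close>.\<close>

definition emb_adj :: "('u::real_inner \<Rightarrow> 'h::real_inner) \<Rightarrow> 'u \<Rightarrow> 'u" where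
  "emb_adj j y = (SOME z. \<forall>x. z \<bullet> x = j y \<bullet> j x)"

lemma emb_adj_inner:
  fixes j :: "'u::{real_inner,complete_space} \<Rightarrow> 'h::real_inner"
  assumes "bounded_linear j"
  shows "emb_adj j y \<bullet> x = j y \<bullet> j x"
proof -
  have "bounded_linear (\<lambda>x. j y \<bullet> j x)"
    using bounded_linear_compose[OF bounded_linear_inner_right assms] by simp
  from riesz_representation[OF this] have "\<exists>z. \<forall>x. z \<bullet> x = j y \<bullet> j x" by metis
  from someI_ex[OF this] show ?thesis unfolding emb_adj_def by blast
qed

lemma bounded_linear_emb_adj:
  fixes j :: "'u::{real_inner,complete_space} \<Rightarrow> 'h::real_inner"
  assumes j: "bounded_linear j"
  shows "bounded_linear (emb_adj j)"
proof -
  interpret j: bounded_linear j by fact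
  obtain K where K: "\<And>x. norm (j x) \<le> norm x * K" and K0: "K \<ge> 0" using j.nonneg_bounded by blast
  show ?thesis
  proof (rule bounded_linear_intro[of _ "K * K"])
    show "emb_adj j (x + y) = emb_adj j x + emb_adj j y" for x y
      by (rule inner_ext) (simp add: inner_add_left emb_adj_inner[OF j] j.add)
    show "emb_adj j (r *\<^sub>R x) = r *\<^sub>R emb_adj j x" for r x
      by (rule inner_ext) (simp add: emb_adj_inner[OF j] j.scaleR)
    fix x
    let ?z = "emb_adj j x"
    have "(norm ?z)\<^sup>2 = j x \<bullet> j ?z" by (simp add: power2_norm_eq_inner emb_adj_inner[OF j])
    also have "\<dots> \<le> norm (j x) * norm (j ?z)" by (rule norm_cauchy_schwarz)
    also have "\<dots> \<le> (norm x * K) * (norm ?z * K)" using K K0 by (intro mult_mono) auto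
    finally have "norm ?z * norm ?z \<le> norm ?z * (norm x * (K * K))" by (simp add: power2_eq_square algebra_simps)
    then show "norm ?z \<le> norm x * (K * K)"
      using K0 by (cases "norm ?z = 0") (auto dest: mult_left_le_imp_le)
  qed
qed

section \<open>Orthogonal projection onto a finite dimensional subspace\<close>

definition oproj :: "'u::real_inner set \<Rightarrow> 'u \<Rightarrow> 'u" where
  "oproj S x = (SOME p. p \<in> S \<and> (\<forall>s\<in>S. (x - p) \<bullet> s = 0))"

locale fin_subspace =
  fixes S :: "'u::real_inner set"
  assumes sub: "subspace S" and fin: "\<exists>B. finite B \<and> span B = S"
begin

lemma oproj_ex: "\<exists>p. p \<in> S \<and> (\<forall>s\<in>S. (x - p) \<bullet> s = 0)"
proof -
  obtain C where C: "finite C" "span C = S" "pairwise orthogonal C"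
    using fin basis_orthogonal by metis
  \<comment> \<open>The orthogonal spanning set \<open>C\<close> may contain 0, whose coefficient is
    a quotient by zero and hence 0.\<close>
  let ?p = "(\<Sum>b\<in>C. (b \<bullet> x / (b \<bullet> b)) *\<^sub>R b)"
  have "?p \<in> S" using C(2) by (metis (no_types, lifting) span_sum span_scale span_base)
  moreover have "(x - ?p) \<bullet> s = 0" if "s \<in> S" for s
  proof -
    have orth: "(x - ?p) \<bullet> c = 0" if c: "c \<in> C" for c
    proof -
      have "(\<Sum>b\<in>C. (b \<bullet> x / (b \<bullet> b)) * (b \<bullet> c)) = (\<Sum>b\<in>{c}. (b \<bullet> x / (b \<bullet> b)) * (b \<bullet> c))"
        using C(1,3) c by (intro sum.mono_neutral_right) (auto simp: pairwise_def orthogonal_def)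
      then show ?thesis
        by (cases "c = 0") (auto simp: inner_diff_left inner_sum_left inner_commute[of x c])
    qed
    have "s \<in> span C" using C(2) that by simp
    then show ?thesis
      by (induction s rule: span_induct_alt) (simp_all add: inner_add_right orth)
  qed
  ultimately show ?thesis by blast
qed

lemma oproj_in [simp]: "oproj S x \<in> S" and oproj_orth: "s \<in> S \<Longrightarrow> (x - oproj S x) \<bullet> s = 0"
  unfolding oproj_def using someI_ex[OF oproj_ex[of x]] by auto

lemma oproj_inner: "s \<in> S \<Longrightarrow> oproj S x \<bullet> s = x \<bullet> s"
  using oproj_orth[of s x] by (simp add: inner_diff_left)

lemma oproj_unique: "p \<in> S \<Longrightarrow> (\<And>s. s \<in> S \<Longrightarrow> p \<bullet> s = x \<bullet> s) \<Longrightarrow> oproj S x = p"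
proof -
  assume p: "p \<in> S" and *: "\<And>s. s \<in> S \<Longrightarrow> p \<bullet> s = x \<bullet> s"
  have d: "oproj S x - p \<in> S" using p sub by (simp add: subspace_diff)
  have "(oproj S x - p) \<bullet> (oproj S x - p) = 0"
    using *[OF d] oproj_inner[OF d, of x] by (simp add: inner_diff_left)
  then show ?thesis by simp
qed

lemma oproj_norm_le: "norm (oproj S x) \<le> norm x"
proof -
  have "(norm (oproj S x))\<^sup>2 = x \<bullet> oproj S x" by (simp add: power2_norm_eq_inner oproj_inner)
  also have "\<dots> \<le> norm x * norm (oproj S x)" by (rule norm_cauchy_schwarz)
  finally show ?thesis by (cases "oproj S x = 0") (auto simp: power2_eq_square)
qed

lemma oproj_best:
  assumes s: "s \<in> S" shows "norm (x - oproj S x) \<le> norm (x - s)"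
proof -
  have "(x - oproj S x) \<bullet> (oproj S x - s) = 0"
    by (rule oproj_orth) (simp add: subspace_diff sub s)
  then have "(norm (x - s))\<^sup>2 = (norm (x - oproj S x))\<^sup>2 + (norm (oproj S x - s))\<^sup>2"
    unfolding power2_norm_eq_inner by (simp add: algebra_simps inner_commute)
  then show ?thesis by (simp add: power2_le_imp_le)
qed

lemma bounded_linear_oproj: "bounded_linear (oproj S)"
proof (rule bounded_linear_intro[of _ 1])
  show "oproj S (x + y) = oproj S x + oproj S y" for x y
    by (rule oproj_unique) (auto simp: subspace_add sub inner_add_left oproj_inner)
  show "oproj S (r *\<^sub>R x) = r *\<^sub>R oproj S x" for r x
    by (rule oproj_unique) (auto simp: subspace_scale sub oproj_inner)
  show "norm (oproj S x) \<le> norm x * 1" for x using oproj_norm_le by simp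
qed

end

text \<open>The projection is the best approximation, so its error is dominated by that of any
  sequence witnessing the limit.\<close>

lemma oproj_tendsto:
  assumes "\<And>n. fin_subspace (U n)" "lim_spaces UNIV norm U = UNIV"
  shows "(\<lambda>n. oproj (U n) x) \<longlonglongrightarrow> x"
proof -
  have "x \<in> lim_spaces UNIV norm U" using assms(2) by simp
  then obtain xs where xs: "\<And>n. xs n \<in> U n" "(\<lambda>n. norm (xs n - x)) \<longlonglongrightarrow> 0"
    by (auto simp: lim_spaces_def)
  have "(\<lambda>n. norm (oproj (U n) x - x)) \<longlonglongrightarrow> 0"
  proof (rule tendsto_sandwich[OF _ _ tendsto_const xs(2)])
    show "\<forall>\<^sub>F n in sequentially. norm (oproj (U n) x - x) \<le> norm (xs n - x)"
      using fin_subspace.oproj_best[OF assms(1) xs(1)] by (simp add: norm_minus_commute)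
  qed simp
  then show ?thesis by (simp add: LIM_zero_iff tendsto_norm_zero_iff)
qed

subsection \<open>The spaces \<open>L2\<close>\<close>

text \<open>Lebesgue measure is complete, so the preimages under the two functions differ by
  measurable subsets of a null set. This covers functions that are unspecified at nodes or, like
  \<open>to_U\<close>, outside the range of \<open>j\<close>.\<close>

lemma AE_lebesgue_on_measurable_cong:
  assumes f: "f \<in> borel_measurable (lebesgue_on S)" and S: "S \<in> sets lebesgue"
    and fg: "AE x in lebesgue_on S. f x = g x"
  shows "g \<in> borel_measurable (lebesgue_on S)"
proof (rule measurableI)
  fix A :: "'b set" assume A: "A \<in> sets borel"
  obtain N where N2: "{x \<in> S. f x \<noteq> g x} \<subseteq> N" "emeasure (lebesgue_on S) N = 0" "N \<in> sets (lebesgue_on S)"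
    using fg by (rule AE_E) auto
  then have N: "N \<in> null_sets (lebesgue_on S)" "{x \<in> S. f x \<noteq> g x} \<subseteq> N" by (auto simp: null_setsI)
  have N': "N \<in> null_sets lebesgue"
    using N(1) S by (simp add: null_sets_restrict_space)
  have sub: "X \<in> sets (lebesgue_on S)" if "X \<subseteq> N" "X \<subseteq> S" for X
    using completion.complete2[OF that(1) N'] that(2) S
    by (auto simp: sets_restrict_space_iff)
  have 1: "f -` A \<inter> S \<in> sets (lebesgue_on S)" using measurable_sets[OF f A] by simp
  have "g -` A \<inter> S = (f -` A \<inter> S - (f -` A \<inter> S \<inter> {x. g x \<notin> A})) \<union> (g -` A \<inter> S \<inter> {x. f x \<notin> A})"
    by auto
  moreover have "\<dots> \<in> sets (lebesgue_on S)"
    by (intro sets.Un sets.Diff 1 sub) (use N(2) in auto)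
  ultimately show "g -` A \<inter> space (lebesgue_on S) \<in> sets (lebesgue_on S)" by simp
qed simp

abbreviation "I0 T \<equiv> lebesgue_on {0..T::real}"

lemma finite_measure_I0: "finite_measure (I0 T)"
  by (rule finite_measure_lebesgue_on) simp

lemma continuous_on_imp_measurable_I:
  fixes f :: "real \<Rightarrow> 'b::topological_space"
  assumes "continuous_on {a..b} f"
  shows "f \<in> borel_measurable (lebesgue_on {a..b})"
proof (rule measurableI)
  fix A :: "'b set" assume "A \<in> sets borel"
  have "f \<in> borel_measurable (restrict_space borel {a..b})"
    using assms by (rule borel_measurable_continuous_on_restrict)
  then have "f -` A \<inter> {a..b} \<in> sets (restrict_space borel {a..b})"
    using \<open>A \<in> sets borel\<close> by (auto dest!: measurable_sets simp: space_restrict_space)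
  then have "f -` A \<inter> {a..b} \<in> sets lborel" by (auto simp: sets_restrict_space_iff)
  then have "f -` A \<inter> {a..b} \<in> sets lebesgue" by (rule sets_completionI_sets)
  then show "f -` A \<inter> space (lebesgue_on {a..b}) \<in> sets (lebesgue_on {a..b})"
    by (auto simp: sets_restrict_space_iff)
qed simp

lemma L2I: "v \<in> borel_measurable (I0 T) \<Longrightarrow> integrable (I0 T) (\<lambda>t. (norm (v t))\<^sup>2) \<Longrightarrow> v \<in> L2 T"
  by (simp add: L2_def)

lemma L2_measurable: "v \<in> L2 T \<Longrightarrow> v \<in> borel_measurable (I0 T)"
  and L2_integrable: "v \<in> L2 T \<Longrightarrow> integrable (I0 T) (\<lambda>t. (norm (v t))\<^sup>2)"
  by (auto simp: L2_def)

lemma measurable_borel_fun: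
  assumes "f \<in> borel_measurable M" "continuous_on UNIV h"
  shows "(\<lambda>x. h (f x)) \<in> borel_measurable M"
  using measurable_compose[OF assms(1) borel_measurable_continuous_onI[OF assms(2)]] by simp

lemma L2_bound:
  fixes v :: "real \<Rightarrow> 'b::real_normed_vector" and w :: "real \<Rightarrow> 'c::real_normed_vector"
  assumes w: "w \<in> L2 T" and v: "v \<in> borel_measurable (I0 T)"
    and le: "AE t in I0 T. norm (v t) \<le> C * norm (w t)"
  shows "v \<in> L2 T"
proof (rule L2I[OF v])
  have m: "(\<lambda>t. (norm (v t))\<^sup>2) \<in> borel_measurable (I0 T)"
    by (rule measurable_borel_fun[OF v]) (intro continuous_intros)
  show "integrable (I0 T) (\<lambda>t. (norm (v t))\<^sup>2)"
  proof (rule Bochner_Integration.integrable_bound[OF _ m])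
    show "integrable (I0 T) (\<lambda>t. C\<^sup>2 * (norm (w t))\<^sup>2)" using L2_integrable[OF w] by simp
    show "AE t in I0 T. norm ((norm (v t))\<^sup>2) \<le> norm (C\<^sup>2 * (norm (w t))\<^sup>2)"
      using le
    proof eventually_elim
      case (elim t)
      have "(norm (v t))\<^sup>2 \<le> (C * norm (w t))\<^sup>2" by (rule power_mono) (use elim in auto)
      then show ?case by (simp add: power_mult_distrib abs_mult)
    qed
  qed
qed

lemma L2_bounded:
  fixes v :: "real \<Rightarrow> 'b::real_normed_vector"
  assumes v: "v \<in> borel_measurable (I0 T)" and le: "AE t in I0 T. norm (v t) \<le> C"
  shows "v \<in> L2 T"
proof (rule L2_bound[OF _ v, where w="\<lambda>t. 1::real" and C = C])
  interpret finite_measure "I0 T" by (rule finite_measure_I0)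
  show "(\<lambda>t. 1::real) \<in> L2 T" by (rule L2I) auto
qed (use le in simp)

lemma L2_continuous:
  fixes v :: "real \<Rightarrow> 'b::real_normed_vector"
  assumes "continuous_on {0..T} v" shows "v \<in> L2 T"
proof -
  have "bounded (v ` {0..T})" using assms by (intro compact_imp_bounded compact_continuous_image) auto
  then obtain B where "\<forall>t\<in>{0..T}. norm (v t) \<le> B" by (auto simp: bounded_iff)
  then show ?thesis
    by (intro L2_bounded[of _ _ B] continuous_on_imp_measurable_I assms AE_I2) auto
qed

lemma L2_scaleR: "v \<in> L2 T \<Longrightarrow> (\<lambda>t. c *\<^sub>R v t) \<in> L2 T"
  by (rule L2_bound[where w=v and C="\<bar>c\<bar>"], assumption, rule measurable_borel_fun[OF L2_measurable])
     (auto intro!: continuous_intros)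

lemma L2_zero: "(\<lambda>t. 0) \<in> L2 T"
  by (rule L2_continuous) auto

lemma L2_linear:
  assumes "v \<in> L2 T" "bounded_linear h" shows "(\<lambda>t. h (v t)) \<in> L2 T"
proof -
  obtain K where K: "\<And>x. norm (h x) \<le> norm x * K" using bounded_linear.bounded[OF assms(2)] by blast
  have "norm (h (v t)) \<le> K * norm (v t)" for t using K[of "v t"] by (simp add: mult.commute)
  moreover have "(\<lambda>t. h (v t)) \<in> borel_measurable (I0 T)"
    by (rule measurable_borel_fun[OF L2_measurable[OF assms(1)] linear_continuous_on[OF assms(2)]])
  ultimately show ?thesis using L2_bound[OF assms(1)] by blast
qed

lemma L2_add:
  fixes v w :: "real \<Rightarrow> 'b::{real_normed_vector,second_countable_topology}"
  assumes v: "v \<in> L2 T" and w: "w \<in> L2 T" shows "(\<lambda>t. v t + w t) \<in> L2 T"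
proof (rule L2I)
  note [measurable] = L2_measurable[OF v] L2_measurable[OF w]
  show m: "(\<lambda>t. v t + w t) \<in> borel_measurable (I0 T)" by measurable
  show "integrable (I0 T) (\<lambda>t. (norm (v t + w t))\<^sup>2)"
  proof (rule Bochner_Integration.integrable_bound)
    show "integrable (I0 T) (\<lambda>t. 2 * (norm (v t))\<^sup>2 + 2 * (norm (w t))\<^sup>2)"
      using L2_integrable[OF v] L2_integrable[OF w] by auto
    show "(\<lambda>t. (norm (v t + w t))\<^sup>2) \<in> borel_measurable (I0 T)" by measurable
    have "(norm (v t + w t))\<^sup>2 \<le> 2 * (norm (v t))\<^sup>2 + 2 * (norm (w t))\<^sup>2" for t
    proof -
      have "(norm (v t + w t))\<^sup>2 \<le> (norm (v t) + norm (w t))\<^sup>2"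
        by (rule power_mono) (auto simp: norm_triangle_ineq)
      moreover have "0 \<le> (norm (v t) - norm (w t))\<^sup>2" by simp
      ultimately show ?thesis unfolding power2_sum power2_diff by argo
    qed
    then show "AE t in I0 T. norm ((norm (v t + w t))\<^sup>2) \<le> norm (2 * (norm (v t))\<^sup>2 + 2 * (norm (w t))\<^sup>2)"
      by (intro AE_I2) auto
  qed
qed

lemma L2_minus: "v \<in> L2 T \<Longrightarrow> (\<lambda>t. - v t) \<in> L2 T"
  using L2_scaleR[of v T "-1"] by simp

lemma L2_diff:
  fixes v w :: "real \<Rightarrow> 'b::{real_normed_vector,second_countable_topology}"
  assumes v: "v \<in> L2 T" and w: "w \<in> L2 T" shows "(\<lambda>t. v t - w t) \<in> L2 T"
  using L2_add[OF v L2_minus[OF w]] by simp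

lemma L2_sum:
  fixes v :: "'i \<Rightarrow> real \<Rightarrow> 'b::{real_normed_vector,second_countable_topology}"
  assumes "\<And>i. i \<in> A \<Longrightarrow> v i \<in> L2 T" shows "(\<lambda>t. \<Sum>i\<in>A. v i t) \<in> L2 T"
  using assms by (induction A rule: infinite_finite_induct) (auto intro: L2_add L2_zero)

lemma L2_inner_integrable:
  fixes v w :: "real \<Rightarrow> 'u::{real_inner,second_countable_topology}"
  assumes v: "v \<in> L2 T" and w: "w \<in> L2 T"
  shows "integrable (I0 T) (\<lambda>t. v t \<bullet> w t)"
proof (rule Bochner_Integration.integrable_bound)
  note [measurable] = L2_measurable[OF v] L2_measurable[OF w]
  show "integrable (I0 T) (\<lambda>t. (norm (v t))\<^sup>2 + (norm (w t))\<^sup>2)"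
    using L2_integrable[OF v] L2_integrable[OF w] by auto
  show "(\<lambda>t. v t \<bullet> w t) \<in> borel_measurable (I0 T)" by measurable
  have "\<bar>v t \<bullet> w t\<bar> \<le> (norm (v t))\<^sup>2 + (norm (w t))\<^sup>2" for t
  proof -
    have "\<bar>v t \<bullet> w t\<bar> \<le> norm (v t) * norm (w t)" by (rule Cauchy_Schwarz_ineq2)
    moreover have "0 \<le> norm (v t) * norm (w t)" by simp
    moreover have "0 \<le> (norm (v t) - norm (w t))\<^sup>2" by simp
    ultimately show ?thesis unfolding power2_diff by linarith
  qed
  then show "AE t in I0 T. norm (v t \<bullet> w t) \<le> norm ((norm (v t))\<^sup>2 + (norm (w t))\<^sup>2)"
    by (intro AE_I2) auto
qed

lemma L2_norm_nonneg [simp]: "0 \<le> L2_norm T v"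
  by (simp add: L2_norm_def)

lemma L2_norm_sq: "(L2_norm T v)\<^sup>2 = (LINT t|I0 T. (norm (v t))\<^sup>2)"
  by (simp add: L2_norm_def)

lemma V_inner_self: "V_inner T v v = (L2_norm T v)\<^sup>2"
  by (simp add: V_inner_def L2_norm_sq power2_norm_eq_inner)

lemma V_inner_commute: "V_inner T v w = V_inner T w v"
  by (simp add: V_inner_def inner_commute)

lemma V_inner_add_left:
  fixes v w z :: "real \<Rightarrow> 'u::{real_inner,second_countable_topology}"
  assumes "v \<in> L2 T" "w \<in> L2 T" "z \<in> L2 T"
  shows "V_inner T (\<lambda>t. v t + w t) z = V_inner T v z + V_inner T w z"
  unfolding V_inner_def inner_add_left
  by (rule Bochner_Integration.integral_add) (intro L2_inner_integrable assms)+

lemma V_inner_diff_left: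
  fixes v w z :: "real \<Rightarrow> 'u::{real_inner,second_countable_topology}"
  assumes "v \<in> L2 T" "w \<in> L2 T" "z \<in> L2 T"
  shows "V_inner T (\<lambda>t. v t - w t) z = V_inner T v z - V_inner T w z"
  unfolding V_inner_def inner_diff_left
  by (rule Bochner_Integration.integral_diff) (intro L2_inner_integrable assms)+

lemma V_inner_scale_left: "V_inner T (\<lambda>t. c *\<^sub>R v t) z = c * V_inner T v z"
  by (simp add: V_inner_def)

lemma V_inner_diff_right:
  fixes v w z :: "real \<Rightarrow> 'u::{real_inner,second_countable_topology}"
  assumes "v \<in> L2 T" "w \<in> L2 T" "z \<in> L2 T"
  shows "V_inner T z (\<lambda>t. v t - w t) = V_inner T z v - V_inner T z w"
  using V_inner_diff_left[OF assms] by (simp add: V_inner_commute)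

lemma L2_norm_add_sq:
  fixes v w :: "real \<Rightarrow> 'u::{real_inner,second_countable_topology}"
  assumes v: "v \<in> L2 T" and w: "w \<in> L2 T"
  shows "(L2_norm T (\<lambda>t. v t + c *\<^sub>R w t))\<^sup>2 = (L2_norm T v)\<^sup>2 + 2 * c * V_inner T v w + c\<^sup>2 * (L2_norm T w)\<^sup>2"
proof -
  note s = L2_scaleR[OF w, of c]
  have "V_inner T (\<lambda>t. v t + c *\<^sub>R w t) (\<lambda>t. v t + c *\<^sub>R w t) =
     V_inner T v (\<lambda>t. v t + c *\<^sub>R w t) + c * V_inner T w (\<lambda>t. v t + c *\<^sub>R w t)"
    by (subst V_inner_add_left) (auto intro: v s L2_add simp: V_inner_scale_left)
  also have "\<dots> = (V_inner T v v + c * V_inner T w v) + c * (V_inner T v w + c * V_inner T w w)"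
    by (subst (1 2) V_inner_commute) (auto simp: V_inner_add_left v s w V_inner_scale_left)
  finally show ?thesis
    by (simp add: V_inner_self V_inner_commute[of T w v] algebra_simps power2_eq_square)
qed

lemma V_inner_Cauchy_Schwarz:
  fixes v w :: "real \<Rightarrow> 'u::{real_inner,second_countable_topology}"
  assumes v: "v \<in> L2 T" and w: "w \<in> L2 T"
  shows "\<bar>V_inner T v w\<bar> \<le> L2_norm T v * L2_norm T w"
proof -
  define a b x where "a = (L2_norm T v)\<^sup>2" and "b = (L2_norm T w)\<^sup>2" and "x = V_inner T v w"
  \<comment> \<open>The discriminant argument. As \<open>b = 0\<close> does not make
    \<open>w\<close> vanish, this case is separate: an affine function of \<open>c\<close> that is
    nonnegative everywhere has slope 0, since otherwise the \<open>c\<close> chosen below would give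
    the value -1.\<close>
  have q: "0 \<le> a + 2 * c * x + c\<^sup>2 * b" for c
    using L2_norm_add_sq[OF v w, of c] by (metis a_def b_def x_def zero_le_power2)
  have "x\<^sup>2 \<le> a * b"
  proof (cases "b = 0")
    case True
    have "x = 0"
    proof (rule ccontr)
      assume "x \<noteq> 0"
      have "a + 2 * (- (a + 1) / (2 * x)) * x = -1" using \<open>x \<noteq> 0\<close> by (simp add: field_simps)
      then show False using q[of "- (a + 1) / (2 * x)"] True by simp
    qed
    then show ?thesis using True by simp
  next
    case False
    then have "b > 0" by (simp add: b_def)
    moreover have "a + 2 * (- x / b) * x + (- x / b)\<^sup>2 * b = a - x\<^sup>2 / b"
      using False by (simp add: field_simps power2_eq_square)
    ultimately show ?thesis using q[of "- x / b"] by (metis diff_ge_0_iff_ge pos_divide_le_eq)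
  qed
  then have "x\<^sup>2 \<le> (L2_norm T v * L2_norm T w)\<^sup>2" by (simp add: a_def b_def power_mult_distrib)
  then show ?thesis unfolding x_def by (simp add: abs_le_square_iff flip: abs_le_square_iff)
qed

lemma L2_norm_triangle:
  fixes v w :: "real \<Rightarrow> 'u::{real_inner,second_countable_topology}"
  assumes v: "v \<in> L2 T" and w: "w \<in> L2 T"
  shows "L2_norm T (\<lambda>t. v t + w t) \<le> L2_norm T v + L2_norm T w"
proof (rule power2_le_imp_le)
  have "(L2_norm T (\<lambda>t. v t + w t))\<^sup>2 = (L2_norm T v)\<^sup>2 + 2 * V_inner T v w + (L2_norm T w)\<^sup>2"
    using L2_norm_add_sq[OF v w, of 1] by simp
  then show "(L2_norm T (\<lambda>t. v t + w t))\<^sup>2 \<le> (L2_norm T v + L2_norm T w)\<^sup>2"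
    using V_inner_Cauchy_Schwarz[OF v w] by (simp add: power2_sum)
qed simp

lemma L2_norm_minus_commute: "L2_norm T (\<lambda>t. v t - w t) = L2_norm T (\<lambda>t. w t - v t)"
  by (simp add: L2_norm_def norm_minus_commute)

lemma L2_norm_diff_triangle:
  fixes v w z :: "real \<Rightarrow> 'u::{real_inner,second_countable_topology}"
  assumes "v \<in> L2 T" "w \<in> L2 T" "z \<in> L2 T"
  shows "L2_norm T (\<lambda>t. v t - z t) \<le> L2_norm T (\<lambda>t. v t - w t) + L2_norm T (\<lambda>t. w t - z t)"
  using L2_norm_triangle[OF L2_diff[OF assms(1,2)] L2_diff[OF assms(2,3)]] by simp

lemma L2_norm_le_add_diff:
  fixes v w :: "real \<Rightarrow> 'u::{real_inner,second_countable_topology}"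
  assumes "v \<in> L2 T" "w \<in> L2 T"
  shows "L2_norm T v \<le> L2_norm T w + L2_norm T (\<lambda>t. v t - w t)"
  using L2_norm_triangle[OF assms(2) L2_diff[OF assms]] by simp

lemma L2_norm_cong_AE:
  assumes "AE t in I0 T. norm (v t) = norm (w t)" "v \<in> borel_measurable (I0 T)" "w \<in> borel_measurable (I0 T)"
  shows "L2_norm T v = L2_norm T w"
  unfolding L2_norm_def
  by (intro arg_cong[where f=sqrt] integral_cong_AE measurable_borel_fun[OF assms(2)] measurable_borel_fun[OF assms(3)])
     (use assms(1) in \<open>auto intro!: continuous_intros\<close>)

lemma L2_norm_cong: "(\<And>t. t \<in> {0..T} \<Longrightarrow> norm (v t) = norm (w t)) \<Longrightarrow> L2_norm T v = L2_norm T w"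
  unfolding L2_norm_def by (intro arg_cong[where f=sqrt] Bochner_Integration.integral_cong) auto

lemma L2_norm_mono:
  assumes w: "w \<in> L2 T" and v: "v \<in> L2 T" and le: "AE t in I0 T. norm (v t) \<le> C * norm (w t)" and C: "C \<ge> 0"
  shows "L2_norm T v \<le> C * L2_norm T w"
proof (rule power2_le_imp_le)
  have "(L2_norm T v)\<^sup>2 \<le> (LINT t|I0 T. C\<^sup>2 * (norm (w t))\<^sup>2)"
    unfolding L2_norm_sq
  proof (rule integral_mono_AE)
    show "AE t in I0 T. (norm (v t))\<^sup>2 \<le> C\<^sup>2 * (norm (w t))\<^sup>2"
      using le by eventually_elim (metis norm_ge_zero power_mono power_mult_distrib)
  qed (use L2_integrable[OF w] L2_integrable[OF v] in auto)
  then show "(L2_norm T v)\<^sup>2 \<le> (C * L2_norm T w)\<^sup>2" by (simp add: L2_norm_sq power_mult_distrib)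
qed (use C in simp)

lemma L2_norm_const: "T \<ge> 0 \<Longrightarrow> L2_norm T (\<lambda>t. c) = sqrt T * norm c"
  by (simp add: L2_norm_def measure_restrict_space real_sqrt_mult)

lemma L2_norm_le_sup:
  fixes v :: "real \<Rightarrow> 'u::real_normed_vector"
  assumes "T \<ge> 0" "v \<in> L2 T" "AE t in I0 T. norm (v t) \<le> B" "B \<ge> 0"
  shows "L2_norm T v \<le> sqrt T * B"
  using L2_norm_mono[of "\<lambda>t. 1::real" T v B] assms
  by (auto simp: L2_norm_const L2_continuous mult.commute)

lemma L2_integrable_vec:
  fixes v :: "real \<Rightarrow> 'u::{real_inner,banach,second_countable_topology}"
  assumes v: "v \<in> L2 T" shows "integrable (I0 T) v"
proof -
  interpret finite_measure "I0 T" by (rule finite_measure_I0)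
  have "(\<lambda>t. norm (v t)) \<in> borel_measurable (I0 T)"
    using L2_measurable[OF v] by measurable
  then have "integrable (I0 T) (\<lambda>t. norm (v t))"
    by (rule square_integrable_imp_integrable) (use L2_integrable[OF v] in simp)
  then show ?thesis using integrable_norm_cancel L2_measurable[OF v] by blast
qed

lemma L2_mult_bounded:
  fixes v :: "real \<Rightarrow> 'u::{real_normed_vector,second_countable_topology}"
  assumes v: "v \<in> L2 T" and f: "f \<in> borel_measurable (I0 T)" and b: "\<And>t. t \<in> {0..T} \<Longrightarrow> \<bar>f t\<bar> \<le> C"
  shows "(\<lambda>t. f t *\<^sub>R v t) \<in> L2 T"
proof (rule L2_bound[OF v])
  note [measurable] = f L2_measurable[OF v]
  show "(\<lambda>t. f t *\<^sub>R v t) \<in> borel_measurable (I0 T)" by measurable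
  show "AE t in I0 T. norm (f t *\<^sub>R v t) \<le> C * norm (v t)"
    using b by (intro AE_I2) (auto intro: mult_right_mono)
qed

lemma tendsto_L2_norm_dominated:
  fixes v :: "nat \<Rightarrow> real \<Rightarrow> 'u::{real_normed_vector,second_countable_topology}"
  assumes v: "\<And>n. v n \<in> borel_measurable (I0 T)" and w: "w \<in> L2 T"
    and lim: "AE t in I0 T. (\<lambda>n. v n t) \<longlonglongrightarrow> 0"
    and le: "\<And>n. AE t in I0 T. norm (v n t) \<le> C * norm (w t)"
  shows "(\<lambda>n. L2_norm T (v n)) \<longlonglongrightarrow> 0"
proof -
  have "(\<lambda>n. LINT t|I0 T. (norm (v n t))\<^sup>2) \<longlonglongrightarrow> (LINT t|I0 T. 0)"
  proof (rule integral_dominated_convergence)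
    show "(\<lambda>t. (norm (v n t))\<^sup>2) \<in> borel_measurable (I0 T)" for n
      by (rule measurable_borel_fun[OF v]) (intro continuous_intros)
    show "integrable (I0 T) (\<lambda>t. C\<^sup>2 * (norm (w t))\<^sup>2)" using L2_integrable[OF w] by simp
    show "AE t in I0 T. (\<lambda>n. (norm (v n t))\<^sup>2) \<longlonglongrightarrow> 0"
      using lim by eventually_elim (auto intro!: tendsto_eq_intros)
    show "AE t in I0 T. norm ((norm (v n t))\<^sup>2) \<le> C\<^sup>2 * (norm (w t))\<^sup>2" for n
      using le[of n] by eventually_elim (simp, metis norm_ge_zero power_mono power_mult_distrib)
  qed simp
  then have "(\<lambda>n. sqrt (LINT t|I0 T. (norm (v n t))\<^sup>2)) \<longlonglongrightarrow> sqrt 0"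
    by (intro tendsto_real_sqrt) simp
  then show ?thesis by (simp add: L2_norm_def)
qed

lemma AE_I0_not_null:
  assumes "negligible N" shows "AE t in I0 T. t \<notin> N"
proof -
  have "AE t in lebesgue. t \<notin> N" using assms by (intro AE_not_in) (simp add: negligible_iff_null_sets)
  then show ?thesis by (simp add: AE_restrict_space_iff eventually_mono)
qed

lemma L2_cong:
  assumes "\<And>t. t \<in> {0..T} \<Longrightarrow> v t = w t"
  shows "v \<in> L2 T \<longleftrightarrow> w \<in> L2 T"
proof -
  have "v \<in> borel_measurable (I0 T) \<longleftrightarrow> w \<in> borel_measurable (I0 T)"
    by (rule measurable_lebesgue_cong) (rule assms)
  moreover have "integrable (I0 T) (\<lambda>t. (norm (v t))\<^sup>2) \<longleftrightarrow> integrable (I0 T) (\<lambda>t. (norm (w t))\<^sup>2)"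
    by (rule Bochner_Integration.integrable_cong) (use assms in auto)
  ultimately show ?thesis by (simp add: L2_def)
qed

text \<open>Density of continuous scalar functions times fixed vectors, up to sums and limits.
  Closedness is used three times: to pass from continuous functions to indicators, from a function
  to another one that agrees with it on [0,T], and from simple functions to the whole space.\<close>

lemma L2_dense_induct [consumes 1, case_names add closed base]:
  fixes P :: "(real \<Rightarrow> 'u::{real_inner,second_countable_topology}) \<Rightarrow> bool"
  assumes v: "v \<in> L2 T"
    and add: "\<And>v w. v \<in> L2 T \<Longrightarrow> w \<in> L2 T \<Longrightarrow> P v \<Longrightarrow> P w \<Longrightarrow> P (\<lambda>t. v t + w t)"
    and closed: "\<And>v. v \<in> L2 T \<Longrightarrow> (\<And>\<epsilon>. \<epsilon> > 0 \<Longrightarrow> \<exists>w\<in>L2 T. P w \<and> L2_norm T (\<lambda>t. v t - w t) < \<epsilon>) \<Longrightarrow> P v"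
    and base: "\<And>\<phi> y. continuous_on UNIV \<phi> \<Longrightarrow> P (\<lambda>t. \<phi> t *\<^sub>R y)"
  shows "P v"
proof -
  have ind: "(\<lambda>t. indicat_real A t *\<^sub>R y) \<in> L2 T \<and> P (\<lambda>t. indicat_real A t *\<^sub>R y)" 
    if A: "A \<in> sets lebesgue" for A y
  proof -
    have mA: "indicat_real A \<in> borel_measurable (I0 T)"
      using A by (intro measurable_restrict_space1) auto
    have L2A: "(\<lambda>t. indicat_real A t *\<^sub>R y) \<in> L2 T"
    proof (rule L2_bounded[where C="norm y"])
      show "(\<lambda>t. indicat_real A t *\<^sub>R y) \<in> borel_measurable (I0 T)" using mA by measurable
    qed (auto simp: indicator_def)
    have "indicat_real A measurable_on UNIV"
      using A by (intro lebesgue_measurable_imp_measurable_on) auto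
    then obtain N g where N: "negligible N" and g: "\<And>n. continuous_on UNIV (g n)"
      and lim: "\<And>x. x \<notin> N \<Longrightarrow> (\<lambda>n. g n x) \<longlonglongrightarrow> indicat_real A x"
      by (auto simp: measurable_on_def)
    \<comment> \<open>Truncation to [0,1] leaves the limit unchanged and provides the
      domination.\<close>
    define h where "h n t = min 1 (max 0 (g n t :: real))" for n t
    have h: "continuous_on UNIV (h n)" for n unfolding h_def by (intro continuous_intros g)
    have hL2: "(\<lambda>t. h n t *\<^sub>R y) \<in> L2 T" for n
      by (intro L2_continuous continuous_intros continuous_on_subset[OF h]) auto
    have "(\<lambda>n. L2_norm T (\<lambda>t. indicat_real A t *\<^sub>R y - h n t *\<^sub>R y)) \<longlonglongrightarrow> 0"
    proof (rule tendsto_L2_norm_dominated[where w = "\<lambda>t. 1::real" and C = "norm y"])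
      show "(\<lambda>t. indicat_real A t *\<^sub>R y - h n t *\<^sub>R y) \<in> borel_measurable (I0 T)" for n
        by (intro L2_measurable L2_diff L2A hL2)
      show "AE t in I0 T. (\<lambda>n. indicat_real A t *\<^sub>R y - h n t *\<^sub>R y) \<longlonglongrightarrow> 0"
        using AE_I0_not_null[OF N]
      proof eventually_elim
        case (elim t)
        have "(\<lambda>n. indicat_real A t *\<^sub>R y - h n t *\<^sub>R y) \<longlonglongrightarrow> indicat_real A t *\<^sub>R y - min 1 (max 0 (indicat_real A t)) *\<^sub>R y"
          unfolding h_def by (intro tendsto_intros lim elim)
        then show ?case by (simp add: indicator_def split: if_splits)
      qed
      show "AE t in I0 T. norm (indicat_real A t *\<^sub>R y - h n t *\<^sub>R y) \<le> norm y * norm (1::real)" for n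
      proof (rule AE_I2)
        fix t
        have "norm (indicat_real A t *\<^sub>R y - h n t *\<^sub>R y) = \<bar>indicat_real A t - h n t\<bar> * norm y"
          by (simp flip: scaleR_diff_left)
        also have "\<dots> \<le> 1 * norm y"
          by (rule mult_right_mono) (auto simp: h_def indicator_def)
        finally show "norm (indicat_real A t *\<^sub>R y - h n t *\<^sub>R y) \<le> norm y * norm (1::real)" by simp
      qed
    qed (simp add: L2_continuous)
    note conv = this
    have "P (\<lambda>t. indicat_real A t *\<^sub>R y)"
    proof (rule closed[OF L2A])
      fix \<epsilon> :: real assume "\<epsilon> > 0"
      then obtain n where "L2_norm T (\<lambda>t. indicat_real A t *\<^sub>R y - h n t *\<^sub>R y) < \<epsilon>"
        using order_tendstoD(2)[OF conv] eventually_happens'[OF sequentially_bot] by blast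
      then show "\<exists>w\<in>L2 T. P w \<and> L2_norm T (\<lambda>t. indicat_real A t *\<^sub>R y - w t) < \<epsilon>"
        using base[OF h] hL2 by blast
    qed
    with L2A show ?thesis by blast
  qed
  have simple: "F \<in> L2 T \<and> P F" if F: "simple_function (I0 T) F" for F
  proof -
    define Y A where "Y = F ` {0..T}" and "A y = F -` {y} \<inter> {0..T}" for y
    have fin: "finite Y" and A: "A y \<in> sets (I0 T)" if "y \<in> Y" for y
      using F that by (auto simp: simple_function_def Y_def A_def)
    then have A': "A y \<in> sets lebesgue" if "y \<in> Y" for y
      using that by (auto simp: sets_restrict_space_iff)
    have finY: "finite Y" using F by (auto simp: simple_function_def Y_def)
    define G where "G Z t = (\<Sum>y\<in>Z. indicat_real (A y) t *\<^sub>R y)" for Z t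
    have "G Z \<in> L2 T \<and> P (G Z)" if "finite Z" "Z \<subseteq> Y" for Z
      using that
    proof (induction Z rule: finite_induct)
      case empty
      have "G {} = (\<lambda>t. 0 *\<^sub>R undefined)" by (simp add: G_def fun_eq_iff)
      then show ?case using base[of "\<lambda>t. 0" undefined] L2_zero by (simp add: G_def)
    next
      case (insert y Z)
      have "G (insert y Z) = (\<lambda>t. indicat_real (A y) t *\<^sub>R y + G Z t)"
        unfolding G_def using insert.hyps by (intro ext sum.insert)
      then show ?case using insert ind[OF A', of y y] by (auto intro!: add L2_add)
    qed
    then have G: "G Y \<in> L2 T" "P (G Y)" using finY by auto
    have FG: "F t = G Y t" if "t \<in> {0..T}" for t
    proof -
      have "G Y t = (\<Sum>y\<in>{F t}. indicat_real (A y) t *\<^sub>R y)"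
        unfolding G_def using that finY by (intro sum.mono_neutral_right) (auto simp: Y_def A_def indicator_def)
      moreover have "t \<in> A (F t)" using that by (auto simp: A_def)
      ultimately show ?thesis by simp
    qed
    have FL2: "F \<in> L2 T"
      by (rule L2_cong[THEN iffD2, OF FG G(1)])
    \<comment> \<open>\<open>F\<close> and \<open>G Y\<close> agree only on [0,T], so
      \<open>P\<close> is transferred by closedness, at distance zero.\<close>
    have "L2_norm T (\<lambda>t. F t - G Y t) = L2_norm T (\<lambda>t. 0::'u)"
      by (rule L2_norm_cong) (use FG in auto)
    then have "L2_norm T (\<lambda>t. F t - G Y t) = 0" by (simp add: L2_norm_def)
    then have "\<exists>w\<in>L2 T. P w \<and> L2_norm T (\<lambda>t. F t - w t) < \<epsilon>" if "\<epsilon> > 0" for \<epsilon>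
      using G that by (intro bexI[of _ "G Y"]) auto
    then have "P F" by (rule closed[OF FL2])
    with FL2 show ?thesis by blast
  qed
  obtain F where F: "\<And>i. simple_function (I0 T) (F i)" and lim: "\<And>t. t \<in> {0..T} \<Longrightarrow> (\<lambda>i. F i t) \<longlonglongrightarrow> v t"
    and dF: "\<And>i t. t \<in> {0..T} \<Longrightarrow> dist (F i t) 0 \<le> 2 * dist (v t) 0"
    using borel_measurable_implies_sequence_metric[OF L2_measurable[OF v], of 0, unfolded space_lebesgue_on]
    by metis
  have conv: "(\<lambda>i. L2_norm T (\<lambda>t. v t - F i t)) \<longlonglongrightarrow> 0"
  proof (rule tendsto_L2_norm_dominated[OF _ v, where C=3])
    show "(\<lambda>t. v t - F i t) \<in> borel_measurable (I0 T)" for i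
      using simple[OF F[of i]] v by (intro L2_measurable L2_diff) auto
    show "AE t in I0 T. (\<lambda>i. v t - F i t) \<longlonglongrightarrow> 0"
      using lim by (intro AE_I2) (auto intro!: tendsto_eq_intros)
    have "norm (v t - F i t) \<le> 3 * norm (v t)" if "t \<in> {0..T}" for i t
      using dF[OF that, of i] norm_triangle_ineq4[of "v t" "F i t"] by simp
    then show "AE t in I0 T. norm (v t - F i t) \<le> 3 * norm (v t)" for i by (intro AE_I2) auto
  qed
  show ?thesis
  proof (rule closed[OF v])
    fix \<epsilon> :: real assume "\<epsilon> > 0"
    then obtain i where "L2_norm T (\<lambda>t. v t - F i t) < \<epsilon>"
      using order_tendstoD(2)[OF conv] eventually_happens'[OF sequentially_bot] by blast
    then show "\<exists>w\<in>L2 T. P w \<and> L2_norm T (\<lambda>t. v t - w t) < \<epsilon>"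
      using simple[OF F[of i]] by blast
  qed
qed

text \<open>Limits of subspaces are described by best approximation; in this form they are visibly closed.\<close>

lemma approx_seq:
  fixes f :: "nat \<Rightarrow> 'e \<Rightarrow> real"
  assumes nn: "\<And>n y. f n y \<ge> 0" and ne: "\<And>n. S n \<noteq> {}"
    and ev: "\<And>\<epsilon>. \<epsilon> > 0 \<Longrightarrow> \<forall>\<^sub>F n in sequentially. \<exists>y\<in>S n. f n y < \<epsilon>"
  shows "\<exists>xs. (\<forall>n. xs n \<in> S n) \<and> (\<lambda>n. f n (xs n)) \<longlonglongrightarrow> 0"
proof -
  define d where "d n = (INF y\<in>S n. f n y)" for n
  have bdd: "bdd_below (f n ` S n)" for n by (rule bdd_belowI[of _ 0]) (use nn in auto)
  have dle: "d n \<le> f n y" if "y \<in> S n" for n y unfolding d_def using bdd that by (rule cINF_lower)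
  have "\<exists>y\<in>S n. f n y < d n + inverse (real (Suc n))" for n
    using cInf_lessD[of "f n ` S n" "d n + inverse (real (Suc n))"] ne[of n] unfolding d_def by auto
  then obtain xs where xs: "\<And>n. xs n \<in> S n" "\<And>n. f n (xs n) < d n + inverse (real (Suc n))" by metis
  have "(\<lambda>n. f n (xs n)) \<longlonglongrightarrow> 0"
  proof (rule tendstoI)
    fix \<epsilon> :: real assume e: "\<epsilon> > 0"
    have "\<forall>\<^sub>F n in sequentially. inverse (real (Suc n)) < \<epsilon> / 2"
      by (rule order_tendstoD(2)[OF LIMSEQ_inverse_real_of_nat]) (use e in simp)
    moreover have "\<forall>\<^sub>F n in sequentially. \<exists>y\<in>S n. f n y < \<epsilon> / 2" by (rule ev) (use e in simp)
    ultimately show "\<forall>\<^sub>F n in sequentially. dist (f n (xs n)) 0 < \<epsilon>"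
    proof eventually_elim
      case (elim n)
      then have "d n < \<epsilon> / 2" using dle by force
      then show ?case using xs(2)[of n] elim nn[of n "xs n"] by simp
    qed
  qed
  with xs(1) show ?thesis by blast
qed

subsection \<open>Polynomials on the reference interval\<close>

lemma poly_eq_sum_le:
  fixes p :: "'a::comm_semiring_1 poly"
  assumes "degree p \<le> n" shows "poly p x = (\<Sum>i\<le>n. coeff p i * x ^ i)"
  using arg_cong[OF poly_as_sum_of_monoms'[OF assms], of "\<lambda>p. poly p x"]
  by (simp add: poly_sum poly_monom)

lemma poly_prod_integrable: "(\<lambda>s. poly p s * poly g s) integrable_on {0..1::real}"
  by (intro integrable_continuous_real continuous_intros)

lemma integral_poly_square_pos:
  fixes p :: "real poly" assumes "p \<noteq> 0"
  shows "integral {0..1} (\<lambda>s. poly p s * poly p s) > 0"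
proof (rule ccontr)
  assume "\<not> ?thesis"
  moreover have nn: "integral {0..1} (\<lambda>s. poly p s * poly p s) \<ge> 0"
    by (rule integral_nonneg[OF poly_prod_integrable]) auto
  ultimately have "integral {0..1} (\<lambda>s. poly p s * poly p s) = 0" by simp
  moreover have "integral {0..1} (\<lambda>s. poly p s * poly p s) = 0 \<longleftrightarrow> (\<forall>s\<in>{0..1}. poly p s * poly p s = 0)"
    by (rule integral_eq_0_iff) (auto intro!: continuous_intros)
  ultimately have "\<forall>s\<in>{0..1}. poly p s * poly p s = 0" by blast
  then have "{0..1} \<subseteq> {s. poly p s = 0}" by auto
  then have "finite {0..1::real}" using poly_roots_finite[OF assms] finite_subset by blast
  then show False by (simp add: infinite_Icc)
qed

lemma integral_poly_mult:
  fixes p g :: "real poly"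
  assumes "degree g \<le> q"
  shows "integral {0..1} (\<lambda>s. poly p s * poly g s) = (\<Sum>i\<le>q. coeff g i * integral {0..1} (\<lambda>s. poly p s * s ^ i))"
proof -
  have "(\<lambda>s. poly p s * poly g s) = (\<lambda>s. \<Sum>i\<le>q. coeff g i * (poly p s * s ^ i))"
    using poly_eq_sum_le[OF assms] by (simp add: sum_distrib_left algebra_simps)
  then show ?thesis
    by (subst \<open>_ = _\<close>, subst integral_sum) (auto intro!: integrable_continuous_real continuous_intros)
qed

text \<open>Gram-Schmidt in disguise: a multiple of the monic polynomial \<open>h\<close> of degree
  \<open>Suc q\<close>, orthogonal to all lower powers, is added to a solution for \<open>q\<close>;
  this changes the last moment only.\<close>

lemma poly_moments_ex:
  "\<exists>p::real poly. degree p \<le> q \<and> (\<forall>i\<le>q. integral {0..1} (\<lambda>s. poly p s * s ^ i) = r i)"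
proof (induction q arbitrary: r)
  case 0
  show ?case by (rule exI[of _ "[:r 0:]"]) simp
next
  case (Suc q)
  obtain p0 :: "real poly" where p0: "degree p0 \<le> q" "\<forall>i\<le>q. integral {0..1} (\<lambda>s. poly p0 s * s ^ i) = r i"
    using Suc by blast
  obtain p1 :: "real poly" where p1: "degree p1 \<le> q"
      "\<forall>i\<le>q. integral {0..1} (\<lambda>s. poly p1 s * s ^ i) = integral {0..1} (\<lambda>s. s ^ (Suc q + i))"
    using Suc[of "\<lambda>i. integral {0..1} (\<lambda>s. s ^ (Suc q + i))"] by blast
  define h where "h = monom 1 (Suc q) - p1"
  have ph: "poly h s = s ^ Suc q - poly p1 s" for s by (simp add: h_def poly_monom)
  have "coeff h (Suc q) = 1" using p1(1) by (simp add: h_def coeff_eq_0)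
  then have hne: "h \<noteq> 0" by auto
  have dh: "degree h \<le> Suc q" unfolding h_def using p1(1) by (intro degree_diff_le) (auto simp: degree_monom_le)
  have h0: "integral {0..1} (\<lambda>s. poly h s * s ^ i) = 0" if "i \<le> q" for i
  proof -
    have "integral {0..1} (\<lambda>s. poly h s * s ^ i) = integral {0..1} (\<lambda>s. s ^ (Suc q + i) - poly p1 s * s ^ i)"
      by (rule integral_cong) (simp add: ph algebra_simps power_add)
    also have "\<dots> = integral {0..1} (\<lambda>s. s ^ (Suc q + i)) - integral {0..1} (\<lambda>s. poly p1 s * s ^ i)"
      by (rule integral_diff) (auto intro!: integrable_continuous_real continuous_intros)
    finally show ?thesis using p1(2) that by simp
  qed
  \<comment> \<open>When \<open>h\<close> is paired with itself only its leading term contributes,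
    so \<open>m\<close> is the squared norm of \<open>h\<close> and hence nonzero.\<close>
  define m where "m = integral {0..1} (\<lambda>s. poly h s * s ^ Suc q)"
  have "integral {0..1} (\<lambda>s. poly h s * poly h s) = m * coeff h (Suc q)"
    using integral_poly_mult[OF dh, of h] h0 by (simp add: m_def)
  then have m: "m \<noteq> 0" using integral_poly_square_pos[OF hne] by auto
  define l where "l = (r (Suc q) - integral {0..1} (\<lambda>s. poly p0 s * s ^ Suc q)) / m"
  have int: "integral {0..1} (\<lambda>s. poly (p0 + smult l h) s * s ^ i)
      = integral {0..1} (\<lambda>s. poly p0 s * s ^ i) + l * integral {0..1} (\<lambda>s. poly h s * s ^ i)" for i
  proof -
    have "integral {0..1} (\<lambda>s. poly (p0 + smult l h) s * s ^ i)
       = integral {0..1} (\<lambda>s. poly p0 s * s ^ i + l * (poly h s * s ^ i))"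
      by (rule integral_cong) (simp add: algebra_simps)
    also have "\<dots> = integral {0..1} (\<lambda>s. poly p0 s * s ^ i) + integral {0..1} (\<lambda>s. l * (poly h s * s ^ i))"
      by (rule integral_add) (auto intro!: integrable_continuous_real continuous_intros)
    finally show ?thesis by simp
  qed
  show ?case
  proof (intro exI[of _ "p0 + smult l h"] conjI allI impI)
    show "degree (p0 + smult l h) \<le> Suc q"
      using p0(1) dh by (intro degree_add_le) auto
    fix i assume "i \<le> Suc q"
    then consider "i \<le> q" | "i = Suc q" by linarith
    then show "integral {0..1} (\<lambda>s. poly (p0 + smult l h) s * s ^ i) = r i"
    proof cases
      case 1 then show ?thesis using int[of i] h0 p0(2) by simp
    next
      case 2
      have "integral {0..1} (\<lambda>s. poly (p0 + smult l h) s * s ^ Suc q)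
        = integral {0..1} (\<lambda>s. poly p0 s * s ^ Suc q) + l * m" unfolding m_def by (rule int)
      then show ?thesis using m 2 by (simp add: l_def)
    qed
  qed
qed

lemma poly_moments_unique:
  fixes p p' :: "real poly"
  assumes "degree p \<le> q" "degree p' \<le> q"
    and "\<And>i. i \<le> q \<Longrightarrow> integral {0..1} (\<lambda>s. poly p s * s ^ i) = integral {0..1} (\<lambda>s. poly p' s * s ^ i)"
  shows "p = p'"
proof (rule ccontr)
  assume "p \<noteq> p'"
  then have d: "p - p' \<noteq> 0" by simp
  have "integral {0..1} (\<lambda>s. poly (p - p') s * s ^ i) = 0" if "i \<le> q" for i
  proof -
    have "integral {0..1} (\<lambda>s. poly (p - p') s * s ^ i) = integral {0..1} (\<lambda>s. poly p s * s ^ i - poly p' s * s ^ i)"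
      by (rule integral_cong) (simp add: algebra_simps)
    also have "\<dots> = integral {0..1} (\<lambda>s. poly p s * s ^ i) - integral {0..1} (\<lambda>s. poly p' s * s ^ i)"
      by (rule integral_diff) (auto intro!: integrable_continuous_real continuous_intros)
    finally show ?thesis using assms(3) that by simp
  qed
  then have "integral {0..1} (\<lambda>s. poly (p - p') s * poly (p - p') s) = 0"
    using integral_poly_mult[of "p - p'" q "p - p'"] assms(1,2) by (simp add: degree_diff_le)
  then show False using integral_poly_square_pos[OF d] by simp
qed

text \<open>The basis of the polynomials of degree at most \<open>q\<close> that is dual to the
  monomials in L2(0,1): integration against \<open>theta q i\<close> reads off the coefficient of
  order \<open>i\<close>. It yields bounds for coefficients as well as the projection onto the
  discrete space, and \<open>psi0 q\<close> is its member for \<open>i = 0\<close>.\<close>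

definition theta :: "nat \<Rightarrow> nat \<Rightarrow> real poly" where
  "theta q i = (SOME p. degree p \<le> q \<and>
     (\<forall>l\<le>q. integral {0..1} (\<lambda>s. poly p s * s ^ l) = (if l = i then 1 else 0)))"

lemma theta: "degree (theta q i) \<le> q"
  "l \<le> q \<Longrightarrow> integral {0..1} (\<lambda>s. poly (theta q i) s * s ^ l) = (if l = i then 1 else 0)"
  using someI_ex[OF poly_moments_ex[of q "\<lambda>l. if l = i then 1 else 0"]] by (auto simp: theta_def)

lemma theta_integral:
  assumes "degree g \<le> q" "i \<le> q"
  shows "integral {0..1} (\<lambda>s. poly (theta q i) s * poly g s) = coeff g i"
  using assms by (simp add: integral_poly_mult[OF assms(1)] theta if_distrib cong: if_cong)

lemma psi0_eq: "psi0 q = theta q 0"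
  unfolding psi0_def
proof (rule the_equality)
  show "degree (theta q 0) \<le> q \<and> integral {0..1} (\<lambda>s. poly (theta q 0) s) = 1 \<and>
    (\<forall>i\<in>{1..q}. integral {0..1} (\<lambda>s. poly (theta q 0) s * s ^ i) = 0)"
    using theta(1)[of q 0] theta(2)[of 0 q 0] theta(2)[of _ q 0] by auto
next
  fix p :: "real poly"
  assume p: "degree p \<le> q \<and> integral {0..1} (\<lambda>s. poly p s) = 1 \<and>
    (\<forall>i\<in>{1..q}. integral {0..1} (\<lambda>s. poly p s * s ^ i) = 0)"
  show "p = theta q 0"
  proof (rule poly_moments_unique)
    fix i assume "i \<le> q"
    then show "integral {0..1} (\<lambda>s. poly p s * s ^ i) = integral {0..1} (\<lambda>s. poly (theta q 0) s * s ^ i)"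
      using p theta(2)[of i q 0] by (cases "i = 0") auto
  qed (use p theta in auto)
qed

lemma psi0_integral: "degree g \<le> q \<Longrightarrow> integral {0..1} (\<lambda>s. poly (psi0 q) s * poly g s) = poly g 0"
  by (simp add: psi0_eq theta_integral poly_0_coeff_0)

lemma degree_psi0: "degree (psi0 q) \<le> q"
  by (simp add: psi0_eq theta)

text \<open>If the degree were smaller, testing with \<open>s \<psi>\<^sub>0(s)\<close> would give \<open>\<integral> s \<psi>\<^sub>0\<^sup>2 = 0\<close>.\<close>

lemma psi0_lead: "coeff (psi0 q) q \<noteq> 0"
proof
  assume c: "coeff (psi0 q) q = 0"
  have d: "degree (pCons 0 (psi0 q)) \<le> q"
  proof (rule degree_le, intro allI impI)
    fix i assume i: "q < i"
    then obtain l where l: "i = Suc l" "l \<ge> q" by (cases i) auto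
    then show "coeff (pCons 0 (psi0 q)) i = 0"
      using c degree_psi0[of q] by (cases "l = q") (auto intro: coeff_eq_0)
  qed
  have "integral {0..1} (\<lambda>s. poly (psi0 q) s * poly (pCons 0 (psi0 q)) s) = 0"
    using psi0_integral[OF d] by simp
  moreover have "integral {0..1} (\<lambda>s. poly (psi0 q) s * poly (pCons 0 (psi0 q)) s) = 0
      \<longleftrightarrow> (\<forall>s\<in>{0..1}. poly (psi0 q) s * poly (pCons 0 (psi0 q)) s = 0)"
  proof (rule integral_eq_0_iff)
    fix s :: real assume s: "s \<in> {0..1}"
    have eq: "poly (psi0 q) s * poly (pCons 0 (psi0 q)) s = s * (poly (psi0 q) s)\<^sup>2"
      by (simp add: power2_eq_square)
    show "0 \<le> poly (psi0 q) s * poly (pCons 0 (psi0 q)) s" unfolding eq using s by simp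
  qed (auto intro!: continuous_intros)
  ultimately have "\<forall>s\<in>{0..1}. poly (psi0 q) s * poly (pCons 0 (psi0 q)) s = 0" by blast
  then have z: "poly (psi0 q) s = 0" if "s \<in> {0<..1}" for s
    using that by (auto dest!: bspec[where x=s])
  have "psi0 q = 0"
  proof (rule ccontr)
    assume "psi0 q \<noteq> 0"
    from poly_roots_finite[OF this] have "finite {0<..1::real}"
      by (rule rev_finite_subset) (use z in auto)
    then show False by (simp add: infinite_Ioc)
  qed
  then show False using psi0_integral[of 1 q] by simp
qed

section \<open>Polynomials with vector coefficients\<close>

definition vpoly :: "nat \<Rightarrow> (nat \<Rightarrow> 'a::real_vector) \<Rightarrow> real \<Rightarrow> 'a" where
  "vpoly q c s = (\<Sum>i\<le>q. s ^ i *\<^sub>R c i)"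

text \<open>The term of index 0 carries the factor 0, which makes the truncated subtraction in the
  exponent harmless.\<close>

definition vpoly' :: "nat \<Rightarrow> (nat \<Rightarrow> 'a::real_vector) \<Rightarrow> real \<Rightarrow> 'a" where
  "vpoly' q c s = (\<Sum>i\<le>q. (real i * s ^ (i - 1)) *\<^sub>R c i)"

lemma vpoly_0 [simp]: "vpoly q c 0 = c 0"
proof -
  have "vpoly q c 0 = (\<Sum>i\<in>{0}. 0 ^ i *\<^sub>R c i)"
    unfolding vpoly_def by (rule sum.mono_neutral_right) auto
  then show ?thesis by simp
qed

lemma vpoly_add: "vpoly q (\<lambda>i. c i + d i) s = vpoly q c s + vpoly q d s"
  by (simp add: vpoly_def scaleR_add_right sum.distrib)

lemma vpoly_diff: "vpoly q (\<lambda>i. c i - d i) s = vpoly q c s - vpoly q d s"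
  by (simp add: vpoly_def scaleR_diff_right sum_subtractf)

lemma vpoly_linear: "linear h \<Longrightarrow> h (vpoly q c s) = vpoly q (\<lambda>i. h (c i)) s"
  by (simp add: vpoly_def linear_sum linear_scale)

lemma vpoly'_linear: "linear h \<Longrightarrow> h (vpoly' q c s) = vpoly' q (\<lambda>i. h (c i)) s"
  by (simp add: vpoly'_def linear_sum linear_scale)

lemma vpoly_in_subspace: "subspace S \<Longrightarrow> (\<And>i. i \<le> q \<Longrightarrow> c i \<in> S) \<Longrightarrow> vpoly q c s \<in> S"
  unfolding vpoly_def by (auto intro!: subspace_sum subspace_scale)

lemma vpoly_has_vector_derivative:
  fixes c :: "nat \<Rightarrow> 'a::real_normed_vector"
  shows "(vpoly q c has_vector_derivative vpoly' q c s) (at s within A)"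
proof -
  have "((\<lambda>s. \<Sum>i\<le>q. s ^ i *\<^sub>R c i) has_vector_derivative (\<Sum>i\<le>q. (real i * s ^ (i - 1)) *\<^sub>R c i)) (at s within A)"
  proof (rule has_vector_derivative_sum)
    fix i
    have "((\<lambda>s. s ^ i) has_real_derivative real i * s ^ (i - 1)) (at s within A)"
      by (auto intro!: derivative_eq_intros)
    from has_vector_derivative_scaleR[OF this has_vector_derivative_const[of "c i"]]
    show "((\<lambda>s. s ^ i *\<^sub>R c i) has_vector_derivative (real i * s ^ (i - 1)) *\<^sub>R c i) (at s within A)" by simp
  qed
  then show ?thesis by (simp add: vpoly_def[abs_def] vpoly'_def)
qed

lemma continuous_on_vpoly [continuous_intros]:
  fixes c :: "nat \<Rightarrow> 'a::real_normed_vector"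
  shows "continuous_on A f \<Longrightarrow> continuous_on A (\<lambda>x. vpoly q c (f x))"
    and "continuous_on A f \<Longrightarrow> continuous_on A (\<lambda>x. vpoly' q c (f x))"
  by (auto simp: vpoly_def vpoly'_def intro!: continuous_intros)

text \<open>Testing with a fixed vector reduces statements on vector coefficients to the scalar
  polynomials for which \<open>theta\<close> and \<open>psi0\<close> are characterized.\<close>

lemma vpoly_inner_poly:
  "\<exists>g::real poly. degree g \<le> q \<and> (\<forall>s. poly g s = vpoly q c s \<bullet> x) \<and> (\<forall>i\<le>q. coeff g i = c i \<bullet> x)"
  for c :: "nat \<Rightarrow> 'a::real_inner"
proof (intro exI conjI allI impI)
  let ?g = "\<Sum>i\<le>q. monom (c i \<bullet> x) i"
  show "degree ?g \<le> q" by (rule degree_sum_le) (auto intro: order_trans[OF degree_monom_le])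
  show "poly ?g s = vpoly q c s \<bullet> x" for s
    by (simp add: poly_sum poly_monom vpoly_def inner_sum_left mult.commute)
  show "coeff ?g i = c i \<bullet> x" if "i \<le> q" for i
    using that by (simp add: coeff_sum)
qed

text \<open>A constant that depends on the degree alone; neither the space nor the mesh enters,
  which is what makes the stability estimate uniform.\<close>

definition coeff_const :: "nat \<Rightarrow> real" where
  "coeff_const q = (SOME C. C \<ge> 1 \<and> (\<forall>i\<le>q. \<forall>s\<in>{0..1}. (poly (theta q i) s)\<^sup>2 \<le> C))"

lemma coeff_const: "coeff_const q \<ge> 1" "i \<le> q \<Longrightarrow> s \<in> {0..1} \<Longrightarrow> (poly (theta q i) s)\<^sup>2 \<le> coeff_const q"
proof -
  have "\<exists>B. \<forall>s\<in>{0..1}. (poly (theta q i) s)\<^sup>2 \<le> B" for i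
  proof -
    have "compact ((\<lambda>s. (poly (theta q i) s)\<^sup>2) ` {0..1})"
      by (intro compact_continuous_image continuous_intros) auto
    then have "bounded ((\<lambda>s. (poly (theta q i) s)\<^sup>2) ` {0..1})" by (rule compact_imp_bounded)
    then show ?thesis by (fastforce simp: bounded_iff)
  qed
  then obtain B where B: "\<And>i s. s \<in> {0..1} \<Longrightarrow> (poly (theta q i) s)\<^sup>2 \<le> B i" by metis
  have "\<exists>C. C \<ge> 1 \<and> (\<forall>i\<le>q. \<forall>s\<in>{0..1}. (poly (theta q i) s)\<^sup>2 \<le> C)"
  proof (intro exI[of _ "1 + (\<Sum>i\<le>q. \<bar>B i\<bar>)"] conjI allI impI ballI)
    fix i s assume i: "i \<le> q" "s \<in> {0..1::real}"
    have "B i \<le> \<bar>B i\<bar>" by simp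
    also have "\<dots> \<le> (\<Sum>i\<le>q. \<bar>B i\<bar>)" using i by (intro member_le_sum) auto
    finally show "(poly (theta q i) s)\<^sup>2 \<le> 1 + (\<Sum>i\<le>q. \<bar>B i\<bar>)" using B[OF i(2), of i] by simp
  qed (simp add: sum_nonneg)
  from someI_ex[OF this] show "coeff_const q \<ge> 1" "i \<le> q \<Longrightarrow> s \<in> {0..1} \<Longrightarrow> (poly (theta q i) s)\<^sup>2 \<le> coeff_const q"
    unfolding coeff_const_def by blast+
qed

text \<open>Coefficient \<open>i\<close> is recovered by integration against
  \<open>theta q i\<close>. Testing this with \<open>c i\<close> itself, Young's inequality leaves
  half of the left side on the right, where it is absorbed. This is the equivalence of norms on
  polynomials, with one constant for all inner product spaces.\<close>

lemma vpoly_coeff_bound: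
  fixes c :: "nat \<Rightarrow> 'a::real_inner"
  assumes i: "i \<le> q"
  shows "(norm (c i))\<^sup>2 \<le> coeff_const q * integral {0..1} (\<lambda>s. (norm (vpoly q c s))\<^sup>2)"
proof -
  obtain g :: "real poly" where g: "degree g \<le> q" "\<And>s. poly g s = vpoly q c s \<bullet> c i" "\<And>l. l \<le> q \<Longrightarrow> coeff g l = c l \<bullet> c i"
    using vpoly_inner_poly[of q c "c i"] by blast
  have "(norm (c i))\<^sup>2 = integral {0..1} (\<lambda>s. poly (theta q i) s * poly g s)"
    using theta_integral[OF g(1) i] g(3)[OF i] by (simp add: power2_norm_eq_inner)
  also have "\<dots> \<le> integral {0..1} (\<lambda>s. (coeff_const q / 2) * (norm (vpoly q c s))\<^sup>2 + (norm (c i))\<^sup>2 / 2)"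
  proof (rule integral_le)
    fix s :: real assume s: "s \<in> {0..1}"
    let ?t = "poly (theta q i) s" and ?p = "norm (vpoly q c s)"
    have "?t * poly g s \<le> \<bar>?t\<bar> * (?p * norm (c i))"
    proof -
      have "?t * poly g s \<le> \<bar>?t\<bar> * \<bar>vpoly q c s \<bullet> c i\<bar>" unfolding g(2) abs_mult[symmetric] by (rule abs_ge_self)
      also have "\<dots> \<le> \<bar>?t\<bar> * (?p * norm (c i))" by (intro mult_left_mono Cauchy_Schwarz_ineq2) simp
      finally show ?thesis .
    qed
    moreover have "0 \<le> (\<bar>?t\<bar> * ?p - norm (c i))\<^sup>2" by simp
    moreover have "(\<bar>?t\<bar> * ?p)\<^sup>2 \<le> coeff_const q * ?p\<^sup>2"
      using coeff_const(2)[OF i s] by (simp add: power_mult_distrib mult_right_mono)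
    ultimately show "?t * poly g s \<le> (coeff_const q / 2) * ?p\<^sup>2 + (norm (c i))\<^sup>2 / 2"
      unfolding power2_diff by (simp add: algebra_simps)
  qed (auto intro!: integrable_continuous_real continuous_intros)
  also have "\<dots> = (coeff_const q / 2) * integral {0..1} (\<lambda>s. (norm (vpoly q c s))\<^sup>2) + (norm (c i))\<^sup>2 / 2"
    by (subst integral_add) (auto intro!: integrable_continuous_real continuous_intros)
  finally show ?thesis by simp
qed

lemma vpoly_sup_bound:
  fixes c :: "nat \<Rightarrow> 'a::real_inner"
  assumes s: "s \<in> {0..1}"
  shows "(norm (vpoly q c s))\<^sup>2 \<le> (real q + 1)\<^sup>2 * coeff_const q * integral {0..1} (\<lambda>s. (norm (vpoly q c s))\<^sup>2)"
proof -
  let ?I = "integral {0..1} (\<lambda>s. (norm (vpoly q c s))\<^sup>2)"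
  have I: "0 \<le> ?I" by (intro integral_nonneg integrable_continuous_real continuous_intros) auto
  have c: "norm (c i) \<le> sqrt (coeff_const q * ?I)" if "i \<le> q" for i
    using vpoly_coeff_bound[OF that, of c] by (rule real_le_rsqrt)
  have "norm (vpoly q c s) \<le> (\<Sum>i\<le>q. norm (s ^ i *\<^sub>R c i))" unfolding vpoly_def by (rule norm_sum)
  also have "\<dots> \<le> (\<Sum>i\<le>q. sqrt (coeff_const q * ?I))"
  proof (rule sum_mono)
    fix i assume "i \<in> {..q}"
    have "norm (s ^ i *\<^sub>R c i) \<le> 1 * norm (c i)"
      using s power_le_one[of s i] by (auto simp: power_abs intro!: mult_left_le_one_le)
    then show "norm (s ^ i *\<^sub>R c i) \<le> sqrt (coeff_const q * ?I)" using c[of i] \<open>i \<in> _\<close> by simp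
  qed
  also have "\<dots> = (real q + 1) * sqrt (coeff_const q * ?I)" by simp
  finally have "(norm (vpoly q c s))\<^sup>2 \<le> ((real q + 1) * sqrt (coeff_const q * ?I))\<^sup>2" by (rule power_mono) simp
  also have "\<dots> = (real q + 1)\<^sup>2 * coeff_const q * ?I" using I coeff_const(1)[of q] by (simp add: power_mult_distrib)
  finally show ?thesis .
qed

text \<open>The point 0 is excluded because cells are open on the left; it does not affect the
  integral that bounds the coefficients.\<close>

lemma vpoly_unique:
  fixes c d :: "nat \<Rightarrow> 'a::real_inner"
  assumes "\<And>s. s \<in> {0<..1} \<Longrightarrow> vpoly q c s = vpoly q d s" "i \<le> q"
  shows "c i = d i"
proof -
  have "integral {0..1} (\<lambda>s. (norm (vpoly q (\<lambda>i. c i - d i) s))\<^sup>2) = integral {0..1} (\<lambda>s::real. 0::real)"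
    by (rule integral_spike[of "{0}"]) (use assms(1) in \<open>auto simp: vpoly_diff\<close>)
  then show ?thesis using vpoly_coeff_bound[OF assms(2), of "\<lambda>i. c i - d i"] by simp
qed

text \<open>The right factor \<open>s \<psi>\<^sub>0(s) / lc(\<psi>\<^sub>0)\<close> vanishes at \<open>0\<close> and is orthogonal to the polynomials of
  degree below \<open>q\<close>; subtracting its multiples reduces the degree of \<open>(\<alpha> + \<beta> s) P(s)\<close> to \<open>q\<close>
  without changing the pairing with \<open>P'\<close> and the value at \<open>0\<close>.\<close>

definition radau :: "nat \<Rightarrow> real poly" where
  "radau q = smult (1 / coeff (psi0 q) q) (pCons 0 (psi0 q))"

text \<open>The term of degree \<open>q + 1\<close> in the product of
  \<open>\<alpha> + \<beta> * s\<close> with the polynomial has coefficient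
  \<open>\<beta> *\<^sub>R c q\<close>. As \<open>radau q\<close> is monic of degree
  \<open>q + 1\<close>, subtracting this multiple of it removes exactly that term. Coefficients are
  listed, rather than a product formed, since they have to lie in the discrete subspace.\<close>

definition wcoeff :: "nat \<Rightarrow> real \<Rightarrow> real \<Rightarrow> (nat \<Rightarrow> 'a::real_vector) \<Rightarrow> nat \<Rightarrow> 'a" where
  "wcoeff q \<alpha> \<beta> c i = \<alpha> *\<^sub>R c i + \<beta> *\<^sub>R ((if i = 0 then 0 else c (i - 1)) - coeff (radau q) i *\<^sub>R c q)"

lemma wcoeff_0 [simp]: "wcoeff q \<alpha> \<beta> c 0 = \<alpha> *\<^sub>R c 0"
  by (simp add: wcoeff_def radau_def)

lemma wcoeff_linear: "linear h \<Longrightarrow> h (wcoeff q \<alpha> \<beta> c i) = wcoeff q \<alpha> \<beta> (\<lambda>i. h (c i)) i"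
  by (simp add: wcoeff_def linear_add linear_diff linear_scale linear_0)

lemma wcoeff_in_subspace: "subspace S \<Longrightarrow> (\<And>i. i \<le> q \<Longrightarrow> c i \<in> S) \<Longrightarrow> i \<le> q \<Longrightarrow> wcoeff q \<alpha> \<beta> c i \<in> S"
  unfolding wcoeff_def by (auto intro!: subspace_add subspace_diff subspace_scale subspace_0)

lemma vpoly_wcoeff: "vpoly q (wcoeff q \<alpha> \<beta> c) s = (\<alpha> + \<beta> * s) *\<^sub>R vpoly q c s - (\<beta> * poly (radau q) s) *\<^sub>R c q"
proof -
  have deg: "degree (radau q) \<le> Suc q"
    unfolding radau_def using degree_psi0[of q]
    by (auto intro!: order_trans[OF degree_smult_le] order_trans[OF degree_pCons_le])
  have lead: "coeff (radau q) (Suc q) = 1" using psi0_lead[of q] by (simp add: radau_def)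
  have "poly (radau q) s = (\<Sum>i\<le>Suc q. coeff (radau q) i * s ^ i)" by (rule poly_eq_sum_le[OF deg])
  then have r: "(\<Sum>i\<le>q. s ^ i * coeff (radau q) i) = poly (radau q) s - s ^ Suc q"
    using lead by (simp add: mult.commute)
  have sh: "(\<Sum>i\<le>q. s ^ i *\<^sub>R (if i = 0 then 0 else c (i - 1))) = s *\<^sub>R vpoly q c s - s ^ Suc q *\<^sub>R c q"
  proof -
    have "(\<Sum>i\<le>Suc q. s ^ i *\<^sub>R (if i = 0 then 0 else c (i - 1))) = (\<Sum>i\<le>q. s ^ Suc i *\<^sub>R c i)"
      by (subst sum.atMost_Suc_shift) simp
    also have "\<dots> = s *\<^sub>R vpoly q c s" by (simp add: vpoly_def scaleR_sum_right)
    finally show ?thesis by (simp add: algebra_simps)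
  qed
  have "vpoly q (wcoeff q \<alpha> \<beta> c) s = \<alpha> *\<^sub>R vpoly q c s + \<beta> *\<^sub>R ((\<Sum>i\<le>q. s ^ i *\<^sub>R (if i = 0 then 0 else c (i - 1)))
     - (\<Sum>i\<le>q. s ^ i * coeff (radau q) i) *\<^sub>R c q)"
    unfolding vpoly_def wcoeff_def
    by (simp add: scaleR_add_right scaleR_diff_right sum.distrib sum_subtractf scaleR_sum_right scaleR_sum_left mult.left_commute mult.commute)
  also have "\<dots> = (\<alpha> + \<beta> * s) *\<^sub>R vpoly q c s - (\<beta> * poly (radau q) s) *\<^sub>R c q"
    unfolding sh r by (simp add: algebra_simps)
  finally show ?thesis .
qed

text \<open>The factor \<open>s\<close> of \<open>radau q\<close> is moved to the derivative, which
  becomes a polynomial of degree at most \<open>q\<close> vanishing at 0; \<open>psi0\<close>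
  integrates it to its value there.\<close>

lemma radau_orth:
  fixes c :: "nat \<Rightarrow> 'a::real_inner"
  shows "integral {0..1} (\<lambda>s. poly (radau q) s * (vpoly' q c s \<bullet> x)) = 0"
proof -
  obtain g :: "real poly" where g: "degree g \<le> q" "\<And>s. poly g s = vpoly q (\<lambda>i. real i *\<^sub>R c i) s \<bullet> x"
    using vpoly_inner_poly[of q "\<lambda>i. real i *\<^sub>R c i" x] by blast
  have "s *\<^sub>R vpoly' q c s = vpoly q (\<lambda>i. real i *\<^sub>R c i) s" for s
  proof -
    have eq: "s * (real i * s ^ (i - 1)) = s ^ i * real i" for i by (cases i) auto
    show ?thesis unfolding vpoly'_def vpoly_def scaleR_sum_right scaleR_scaleR by (simp only: eq)
  qed
  then have "s * (vpoly' q c s \<bullet> x) = poly g s" for s by (metis g(2) inner_scaleR_left)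
  then have "poly (radau q) s * (vpoly' q c s \<bullet> x) = (1 / coeff (psi0 q) q) * (poly (psi0 q) s * poly g s)" for s
    by (simp add: radau_def algebra_simps)
  moreover have "poly g 0 = 0" using g(2)[of 0] by simp
  ultimately show ?thesis using psi0_integral[OF g(1)] by simp
qed

text \<open>The multiple of \<open>radau q\<close> drops out, and the remaining integrand is the
  derivative of \<open>(\<alpha> + \<beta> * s) / 2\<close> times the squared norm, minus the
  contribution of the derivative of the weight. \<open>J\<close> is the jump at the left end and
  \<open>c 0 - J\<close> the value coming from the preceding cell; by polarization the jump is left
  with the factor \<open>\<alpha> / 2\<close>, a favourable sign for nonnegative weights.\<close>

lemma dg_local_identity:
  fixes c :: "nat \<Rightarrow> 'a::real_inner"
  shows "integral {0..1} (\<lambda>s. vpoly' q c s \<bullet> vpoly q (wcoeff q \<alpha> \<beta> c) s) + J \<bullet> wcoeff q \<alpha> \<beta> c 0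
    = (\<alpha> + \<beta>) / 2 * (norm (vpoly q c 1))\<^sup>2 - \<alpha> / 2 * (norm (c 0 - J))\<^sup>2 + \<alpha> / 2 * (norm J)\<^sup>2
      - \<beta> / 2 * integral {0..1} (\<lambda>s. (norm (vpoly q c s))\<^sup>2)"
proof -
  let ?P = "vpoly q c" and ?P' = "vpoly' q c"
  have "((\<lambda>s. (\<alpha> + \<beta> * s) / 2 * (?P s \<bullet> ?P s)) has_vector_derivative
      (\<alpha> + \<beta> * s) * (?P' s \<bullet> ?P s) + \<beta> / 2 * (norm (?P s))\<^sup>2) (at s within {0..1})" for s
  proof -
    have "((\<lambda>s. ?P s \<bullet> ?P s) has_real_derivative (2 * (?P' s \<bullet> ?P s))) (at s within {0..1})"
      unfolding has_real_derivative_iff_has_vector_derivative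
      by (rule has_vector_derivative_eq_rhs, rule bounded_bilinear.has_vector_derivative[OF bounded_bilinear_inner])
         (auto intro!: vpoly_has_vector_derivative simp: inner_commute)
    then have "((\<lambda>s. (\<alpha> + \<beta> * s) / 2 * (?P s \<bullet> ?P s)) has_real_derivative
      (\<alpha> + \<beta> * s) * (?P' s \<bullet> ?P s) + \<beta> / 2 * (norm (?P s))\<^sup>2) (at s within {0..1})"
      by (auto intro!: derivative_eq_intros simp: power2_norm_eq_inner algebra_simps)
    then show ?thesis by (simp add: has_real_derivative_iff_has_vector_derivative)
  qed
  from fundamental_theorem_of_calculus[OF _ this]
  have "((\<lambda>s. (\<alpha> + \<beta> * s) * (?P' s \<bullet> ?P s) + \<beta> / 2 * (norm (?P s))\<^sup>2) has_integral
     (\<alpha> + \<beta>) / 2 * (norm (?P 1))\<^sup>2 - \<alpha> / 2 * (norm (c 0))\<^sup>2) {0..1}"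
    by (simp add: power2_norm_eq_inner)
  then have "integral {0..1} (\<lambda>s. (\<alpha> + \<beta> * s) * (?P' s \<bullet> ?P s) + \<beta> / 2 * (norm (?P s))\<^sup>2)
     = (\<alpha> + \<beta>) / 2 * (norm (?P 1))\<^sup>2 - \<alpha> / 2 * (norm (c 0))\<^sup>2" by (rule integral_unique)
  moreover have "integral {0..1} (\<lambda>s. (\<alpha> + \<beta> * s) * (?P' s \<bullet> ?P s) + \<beta> / 2 * (norm (?P s))\<^sup>2)
    = integral {0..1} (\<lambda>s. (\<alpha> + \<beta> * s) * (?P' s \<bullet> ?P s)) + integral {0..1} (\<lambda>s. \<beta> / 2 * (norm (?P s))\<^sup>2)"
    by (rule integral_add) (auto intro!: integrable_continuous_real continuous_intros)
  ultimately have 1: "integral {0..1} (\<lambda>s. (\<alpha> + \<beta> * s) * (?P' s \<bullet> ?P s)) =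
    (\<alpha> + \<beta>) / 2 * (norm (?P 1))\<^sup>2 - \<alpha> / 2 * (norm (c 0))\<^sup>2 - \<beta> / 2 * integral {0..1} (\<lambda>s. (norm (?P s))\<^sup>2)"
    by simp
  have "integral {0..1} (\<lambda>s. ?P' s \<bullet> vpoly q (wcoeff q \<alpha> \<beta> c) s) =
     integral {0..1} (\<lambda>s. (\<alpha> + \<beta> * s) * (?P' s \<bullet> ?P s) - \<beta> * (poly (radau q) s * (?P' s \<bullet> c q)))"
    by (rule integral_cong) (simp add: vpoly_wcoeff inner_diff_right)
  also have "\<dots> = integral {0..1} (\<lambda>s. (\<alpha> + \<beta> * s) * (?P' s \<bullet> ?P s)) - integral {0..1} (\<lambda>s. \<beta> * (poly (radau q) s * (?P' s \<bullet> c q)))"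
    by (rule integral_diff) (auto intro!: integrable_continuous_real continuous_intros)
  finally have A: "integral {0..1} (\<lambda>s. ?P' s \<bullet> vpoly q (wcoeff q \<alpha> \<beta> c) s) = integral {0..1} (\<lambda>s. (\<alpha> + \<beta> * s) * (?P' s \<bullet> ?P s))"
    by (simp add: radau_orth)
  have Q: "(norm (c 0 - J))\<^sup>2 = (norm (c 0))\<^sup>2 - 2 * (J \<bullet> c 0) + (norm J)\<^sup>2"
    by (simp add: power2_norm_eq_inner algebra_simps inner_commute)
  show ?thesis unfolding A 1 Q wcoeff_0 by (simp add: field_simps)
qed

lemma psi0_vpoly_integral:
  fixes c :: "nat \<Rightarrow> 'a::real_inner"
  shows "integral {0..1} (\<lambda>s. poly (psi0 q) s * (J \<bullet> vpoly q c s)) = J \<bullet> c 0"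
proof -
  obtain g :: "real poly" where g: "degree g \<le> q" "\<And>s. poly g s = vpoly q c s \<bullet> J"
    using vpoly_inner_poly[of q c J] by blast
  show ?thesis using psi0_integral[OF g(1)] by (simp add: g(2) inner_commute)
qed

text \<open>The bound comes from estimating the square of a sum by twice the sum of the squares in
  \<open>vpoly_wcoeff\<close>: the first term gives 2, the second 8, because |\<beta>| is at most
  twice the bound of the weight.\<close>

definition weight_const :: "nat \<Rightarrow> real" where
  "weight_const q = (SOME K. K \<ge> 1 \<and> (\<forall>s\<in>{0..1}. 2 + 8 * (poly (radau q) s)\<^sup>2 * coeff_const q \<le> K))"

lemma weight_const: "weight_const q \<ge> 1" "s \<in> {0..1} \<Longrightarrow> 2 + 8 * (poly (radau q) s)\<^sup>2 * coeff_const q \<le> weight_const q"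
proof -
  have "compact ((\<lambda>s. 2 + 8 * (poly (radau q) s)\<^sup>2 * coeff_const q) ` {0..1})"
    by (intro compact_continuous_image continuous_intros) auto
  then have "bounded ((\<lambda>s. 2 + 8 * (poly (radau q) s)\<^sup>2 * coeff_const q) ` {0..1})" by (rule compact_imp_bounded)
  then obtain B where B0: "\<forall>x\<in>(\<lambda>s. 2 + 8 * (poly (radau q) s)\<^sup>2 * coeff_const q) ` {0..1}. norm x \<le> B"
    unfolding bounded_iff by blast
  have B: "\<bar>2 + 8 * (poly (radau q) s)\<^sup>2 * coeff_const q\<bar> \<le> B" if "s \<in> {0..1}" for s
    using bspec[OF B0 imageI[OF that]] by (simp only: real_norm_def)
  have "\<exists>K. K \<ge> 1 \<and> (\<forall>s\<in>{0..1}. 2 + 8 * (poly (radau q) s)\<^sup>2 * coeff_const q \<le> K)"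
    by (rule exI[of _ "max 1 B"]) (use B in fastforce)
  from someI_ex[OF this] show "weight_const q \<ge> 1" "s \<in> {0..1} \<Longrightarrow> 2 + 8 * (poly (radau q) s)\<^sup>2 * coeff_const q \<le> weight_const q"
    unfolding weight_const_def by blast+
qed

lemma vpoly_wcoeff_bound:
  fixes c :: "nat \<Rightarrow> 'a::real_inner"
  assumes m: "\<bar>\<alpha>\<bar> \<le> m" "\<bar>\<alpha> + \<beta>\<bar> \<le> m"
  shows "integral {0..1} (\<lambda>s. (norm (vpoly q (wcoeff q \<alpha> \<beta> c) s))\<^sup>2) \<le> weight_const q * m\<^sup>2 * integral {0..1} (\<lambda>s. (norm (vpoly q c s))\<^sup>2)"
proof -
  let ?I = "integral {0..1} (\<lambda>s. (norm (vpoly q c s))\<^sup>2)"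
  have m0: "m \<ge> 0" using m by simp
  have I: "0 \<le> ?I" by (intro integral_nonneg integrable_continuous_real continuous_intros) auto
  have "integral {0..1} (\<lambda>s. (norm (vpoly q (wcoeff q \<alpha> \<beta> c) s))\<^sup>2)
      \<le> integral {0..1} (\<lambda>s. 2 * m\<^sup>2 * (norm (vpoly q c s))\<^sup>2 + (weight_const q - 2) * m\<^sup>2 * ?I)"
  proof (rule integral_le)
    fix s :: real assume s: "s \<in> {0..1}"
    let ?r = "poly (radau q) s"
    \<comment> \<open>The weight is affine, so its bound on [0,1] follows from the two end
      points.\<close>
    have "\<bar>\<alpha> + \<beta> * s\<bar> \<le> m"
    proof -
      have "\<alpha> + \<beta> * s = (1 - s) * \<alpha> + s * (\<alpha> + \<beta>)" by (simp add: algebra_simps)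
      also have "\<bar>\<dots>\<bar> \<le> (1 - s) * \<bar>\<alpha>\<bar> + s * \<bar>\<alpha> + \<beta>\<bar>"
        using s by (intro order_trans[OF abs_triangle_ineq]) (auto simp: abs_mult)
      also have "\<dots> \<le> (1 - s) * m + s * m" using s m by (intro add_mono mult_left_mono) auto
      finally show ?thesis by (simp add: algebra_simps)
    qed
    then have a: "norm ((\<alpha> + \<beta> * s) *\<^sub>R vpoly q c s) \<le> m * norm (vpoly q c s)" by (simp add: mult_right_mono)
    have "\<bar>\<beta>\<bar> \<le> 2 * m" using m by simp
    then have b: "norm ((\<beta> * ?r) *\<^sub>R c q) \<le> (2 * m) * (\<bar>?r\<bar> * norm (c q))"
      using mult_right_mono[of "\<bar>\<beta>\<bar>" "2 * m" "\<bar>?r\<bar> * norm (c q)"] by (simp add: abs_mult mult.assoc)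
    have "norm (vpoly q (wcoeff q \<alpha> \<beta> c) s) \<le> m * norm (vpoly q c s) + (2 * m) * (\<bar>?r\<bar> * norm (c q))"
      unfolding vpoly_wcoeff using norm_triangle_ineq4 a b by (meson add_mono order_trans)
    then have "(norm (vpoly q (wcoeff q \<alpha> \<beta> c) s))\<^sup>2 \<le> (m * norm (vpoly q c s) + (2 * m) * (\<bar>?r\<bar> * norm (c q)))\<^sup>2"
      by (rule power_mono) simp
    also have "\<dots> \<le> 2 * (m * norm (vpoly q c s))\<^sup>2 + 2 * ((2 * m) * (\<bar>?r\<bar> * norm (c q)))\<^sup>2"
    proof -
      have "(x + y)\<^sup>2 \<le> 2 * x\<^sup>2 + 2 * y\<^sup>2" for x y :: real
        using zero_le_power2[of "x - y"] unfolding power2_sum power2_diff by argo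
      then show ?thesis .
    qed
    also have "\<dots> = 2 * m\<^sup>2 * (norm (vpoly q c s))\<^sup>2 + (8 * ?r\<^sup>2 * m\<^sup>2) * (norm (c q))\<^sup>2"
      by (simp add: power_mult_distrib)
    also have "\<dots> \<le> 2 * m\<^sup>2 * (norm (vpoly q c s))\<^sup>2 + (8 * ?r\<^sup>2 * m\<^sup>2) * (coeff_const q * ?I)"
      using vpoly_coeff_bound[of q q c] by (intro add_left_mono mult_left_mono) auto
    also have "\<dots> = 2 * m\<^sup>2 * (norm (vpoly q c s))\<^sup>2 + (8 * ?r\<^sup>2 * coeff_const q) * (m\<^sup>2 * ?I)" by simp
    also have "\<dots> \<le> 2 * m\<^sup>2 * (norm (vpoly q c s))\<^sup>2 + (weight_const q - 2) * (m\<^sup>2 * ?I)"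
      using weight_const(2)[OF s, of q] I by (intro add_left_mono mult_right_mono) auto
    finally show "(norm (vpoly q (wcoeff q \<alpha> \<beta> c) s))\<^sup>2 \<le> 2 * m\<^sup>2 * (norm (vpoly q c s))\<^sup>2 + (weight_const q - 2) * m\<^sup>2 * ?I"
      by (simp add: mult.assoc)
  qed (auto intro!: integrable_continuous_real continuous_intros)
  also have "\<dots> = 2 * m\<^sup>2 * ?I + (weight_const q - 2) * m\<^sup>2 * ?I"
    by (subst integral_add) (auto intro!: integrable_continuous_real continuous_intros)
  finally show ?thesis by (simp add: algebra_simps)
qed

subsection \<open>Functions on a uniform grid\<close>

lemma integrable_on_subinterval_I0:
  fixes f :: "real \<Rightarrow> 'b::{banach,second_countable_topology}"
  assumes "integrable (I0 T) f" "{a..b} \<subseteq> {0..T}"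
  shows "integrable (lebesgue_on {a..b}) f"
proof -
  have "set_integrable lebesgue {0..T} f" using assms(1) by (simp add: integrable_restrict_space set_integrable_def)
  then have "set_integrable lebesgue {a..b} f" by (rule set_integrable_subset) (use assms(2) in auto)
  then show ?thesis by (simp add: integrable_restrict_space set_integrable_def)
qed

locale grid =
  fixes T :: real and N :: nat
  assumes T_pos: "T > 0" and N_pos: "N > 0"
begin

definition "k = T / real N"
definition "cell m = {(real m - 1) * k <..< real m * k}"
definition "loc m t = (t - (real m - 1) * k) / k"

lemma k_pos: "k > 0" using T_pos N_pos by (simp add: k_def)
lemma N_k: "real N * k = T" using N_pos by (simp add: k_def)

lemma node_le_T: "m \<le> N \<Longrightarrow> real m * k \<le> T"
  using k_pos N_k mult_right_mono[of "real m" "real N" k] by simp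

lemma cell_subset: "m \<in> {1..N} \<Longrightarrow> cell m \<subseteq> {0..T}"
proof -
  assume m: "m \<in> {1..N}"
  have "0 \<le> (real m - 1) * k" using m k_pos by simp
  then show ?thesis using node_le_T[of m] m by (auto simp: cell_def)
qed

lemma icell_subset: "m \<in> {1..N} \<Longrightarrow> {(real m - 1) * k..real m * k} \<subseteq> {0..T}"
proof -
  assume m: "m \<in> {1..N}"
  have "0 \<le> (real m - 1) * k" using m k_pos by simp
  then show ?thesis using node_le_T[of m] m by auto
qed

lemma loc_cell: "t \<in> cell m \<Longrightarrow> loc m t \<in> {0<..<1}"
  using k_pos by (auto simp: cell_def loc_def field_simps)

lemma loc_icell: "t \<in> {(real m - 1) * k..real m * k} \<Longrightarrow> loc m t \<in> {0..1}"
  using k_pos by (auto simp: loc_def field_simps)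

lemma cell_index: "t \<in> {(real m - 1) * k <.. real m * k} \<Longrightarrow> nat \<lceil>t / k\<rceil> = m"
proof -
  assume "t \<in> {(real m - 1) * k <.. real m * k}"
  then have "real m - 1 < t / k" "t / k \<le> real m" using k_pos by (auto simp: field_simps)
  then have "\<lceil>t / k\<rceil> = int m" by (intro ceiling_unique) auto
  then show ?thesis by simp
qed

lemma in_hcell:
  assumes "t \<in> {0<..T}"
  obtains m where "m \<in> {1..N}" "t \<in> {(real m - 1) * k <.. real m * k}"
proof
  let ?m = "nat \<lceil>t / k\<rceil>"
  have p: "t / k > 0" using assms k_pos by simp
  then have c: "\<lceil>t / k\<rceil> \<ge> 1" by linarith
  then have rm: "real ?m = of_int \<lceil>t / k\<rceil>" by simp
  have "t / k \<le> real N" using assms k_pos N_k by (simp add: field_simps)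
  then have "\<lceil>t / k\<rceil> \<le> int N" by (simp add: ceiling_le_iff)
  then show "?m \<in> {1..N}" using c unfolding atLeastAtMost_iff by linarith
  have "real ?m - 1 < t / k" "t / k \<le> real ?m" unfolding rm by linarith+
  then show "t \<in> {(real ?m - 1) * k <.. real ?m * k}" using k_pos by (simp add: field_simps)
qed

lemma cover: "{0..T} \<subseteq> (\<Union>m\<in>{1..N}. cell m) \<union> (\<lambda>m. real m * k) ` {0..N}"
proof
  fix t assume t: "t \<in> {0..T}"
  show "t \<in> (\<Union>m\<in>{1..N}. cell m) \<union> (\<lambda>m. real m * k) ` {0..N}"
  proof (cases "t = 0")
    case True then show ?thesis by (auto intro!: image_eqI[of _ _ 0])
  next
    case False
    then have "t \<in> {0<..T}" using t by auto
    then obtain m where m: "m \<in> {1..N}" "t \<in> {(real m - 1) * k <.. real m * k}" by (rule in_hcell)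
    show ?thesis
    proof (cases "t = real m * k")
      case True then show ?thesis using m(1) by auto
    next
      case False then show ?thesis using m by (auto simp: cell_def)
    qed
  qed
qed

lemma AE_cell: "AE t in I0 T. \<exists>m\<in>{1..N}. t \<in> cell m"
proof -
  have "AE t in I0 T. t \<notin> (\<lambda>m. real m * k) ` {0..N}"
    by (rule AE_I0_not_null) (simp add: negligible_finite)
  then have "AE t in I0 T. t \<notin> (\<lambda>m. real m * k) ` {0..N} \<and> t \<in> {0..T}"
    by (rule AE_conjI) (rule AE_I2, simp)
  then show ?thesis by eventually_elim (use cover in auto)
qed

lemma AE_cellI: "(\<And>m t. m \<in> {1..N} \<Longrightarrow> t \<in> cell m \<Longrightarrow> P t) \<Longrightarrow> AE t in I0 T. P t"
  using AE_cell by eventually_elim auto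

text \<open>The open cells and the nodes cover [0,T]; the nodes enter as singletons, since nothing
  is known about \<open>f\<close> there.\<close>

lemma pw_measurable:
  fixes f :: "real \<Rightarrow> 'b::topological_space"
  assumes h: "\<And>m. m \<in> {1..N} \<Longrightarrow> continuous_on {0..1} (h m)"
    and fh: "\<And>m t. m \<in> {1..N} \<Longrightarrow> t \<in> cell m \<Longrightarrow> f t = h m (loc m t)"
  shows "f \<in> borel_measurable (I0 T)"
proof (rule measurable_piecewise_restrict)
  let ?C = "cell ` {1..N} \<union> (\<lambda>m. {real m * k}) ` {0..N}"
  show "countable ?C" by (auto intro: countable_finite)
  show "space (I0 T) \<subseteq> \<Union>?C" using cover by auto
  fix \<Omega> assume \<Omega>: "\<Omega> \<in> ?C"
  from \<Omega> consider m where "m \<in> {1..N}" "\<Omega> = cell m" | m where "m \<le> N" "\<Omega> = {real m * k}" by auto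
  then have sub: "\<Omega> \<subseteq> {0..T}" by cases (use cell_subset node_le_T k_pos in auto)
  have leb: "\<Omega> \<in> sets lebesgue" using \<Omega> by (auto simp: cell_def)
  then show "\<Omega> \<inter> space (I0 T) \<in> sets (I0 T)" using sub by (auto simp: sets_restrict_space_iff)
  have res: "restrict_space (I0 T) \<Omega> = lebesgue_on \<Omega>"
    using sub leb by (simp add: restrict_restrict_space Int_absorb1)
  show "f \<in> borel_measurable (restrict_space (I0 T) \<Omega>)"
  proof (cases "\<exists>m\<in>{1..N}. \<Omega> = cell m")
    case True
    then obtain m where m: "m \<in> {1..N}" "\<Omega> = cell m" by blast
    have "continuous_on {(real m - 1) * k..real m * k} (\<lambda>t. h m (loc m t))"
    proof (rule continuous_on_compose2[OF h[OF m(1)]])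
      show "continuous_on {(real m - 1) * k..real m * k} (loc m)"
        unfolding loc_def[abs_def] by (intro continuous_intros) (use k_pos in auto)
    qed (use loc_icell in blast)
    then have "(\<lambda>t. h m (loc m t)) \<in> borel_measurable (lebesgue_on {(real m - 1) * k..real m * k})"
      by (rule continuous_on_imp_measurable_I)
    then have "(\<lambda>t. h m (loc m t)) \<in> borel_measurable (lebesgue_on \<Omega>)"
      by (rule measurable_restrict_mono) (auto simp: m(2) cell_def)
    then show ?thesis unfolding res
      using measurable_lebesgue_cong[of \<Omega> f "\<lambda>t. h m (loc m t)" borel] fh[OF m(1)] m(2) by blast
  next
    case False
    then obtain x where "\<Omega> = {x}" using \<Omega> by auto
    then show ?thesis unfolding res
      using measurable_lebesgue_cong[of \<Omega> f "\<lambda>t. f x" borel] by auto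
  qed
qed

lemma pw_L2:
  fixes f :: "real \<Rightarrow> 'b::real_normed_vector"
  assumes h: "\<And>m. m \<in> {1..N} \<Longrightarrow> continuous_on {0..1} (h m)"
    and fh: "\<And>m t. m \<in> {1..N} \<Longrightarrow> t \<in> cell m \<Longrightarrow> f t = h m (loc m t)"
  shows "f \<in> L2 T"
proof -
  have "\<exists>B. \<forall>s\<in>{0..1}. norm (h m s) \<le> B" if "m \<in> {1..N}" for m
  proof -
    have "bounded (h m ` {0..1})" using h[OF that] by (intro compact_imp_bounded compact_continuous_image) auto
    then show ?thesis by (auto simp: bounded_iff)
  qed
  then obtain B where B: "\<And>m s. m \<in> {1..N} \<Longrightarrow> s \<in> {0..1} \<Longrightarrow> norm (h m s) \<le> B m" by metis
  have "norm (f t) \<le> (\<Sum>m\<in>{1..N}. \<bar>B m\<bar>)" if m: "m \<in> {1..N}" "t \<in> cell m" for m t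
  proof -
    have "norm (f t) \<le> B m" using fh[OF m] B[OF m(1)] loc_cell[OF m(2)] by auto
    also have "\<dots> \<le> \<bar>B m\<bar>" by simp
    also have "\<dots> \<le> (\<Sum>m\<in>{1..N}. \<bar>B m\<bar>)" using m(1) by (intro member_le_sum) auto
    finally show ?thesis .
  qed
  then show ?thesis by (intro L2_bounded[OF pw_measurable[OF h fh]] AE_cellI)
qed

lemma sum_cells_integral:
  fixes f :: "real \<Rightarrow> real"
  assumes f: "integrable (I0 T) f"
  shows "(LINT t|I0 T. f t) = (\<Sum>m=1..N. LINT t|lebesgue_on {(real m - 1) * k..real m * k}. f t)"
proof -
  have fi: "f integrable_on {0..T}" using has_integral_integral_lebesgue_on[OF f] by (auto simp: integrable_on_def)
  have "integral {0..real n * k} f = (\<Sum>m=1..n. LINT t|lebesgue_on {(real m - 1) * k..real m * k}. f t)" if "n \<le> N" for n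
    using that
  proof (induction n)
    case (Suc n)
    have "integral {0..real n * k} f + integral {real n * k..real (Suc n) * k} f = integral {0..real (Suc n) * k} f"
    proof (rule Henstock_Kurzweil_Integration.integral_combine)
      show "f integrable_on {0..real (Suc n) * k}"
        by (rule integrable_on_subinterval[OF fi]) (use node_le_T[OF Suc.prems] in auto)
    qed (use k_pos in \<open>auto intro: mult_right_mono\<close>)
    moreover have "integral {real n * k..real (Suc n) * k} f
       = (LINT t|lebesgue_on {(real (Suc n) - 1) * k..real (Suc n) * k}. f t)"
      using lebesgue_integral_eq_integral[OF integrable_on_subinterval_I0[OF f icell_subset[of "Suc n"]]] Suc.prems
      by simp
    ultimately show ?case using Suc by simp
  qed simp
  from this[of N] show ?thesis using lebesgue_integral_eq_integral[OF f] N_k by simp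
qed

lemma AE_icell:
  assumes "m \<in> {1..N}" shows "AE t in lebesgue_on {(real m - 1) * k..real m * k}. t \<in> cell m"
proof -
  let ?a = "(real m - 1) * k" and ?b = "real m * k"
  have "AE t in lebesgue. t \<notin> {?a, ?b}"
    by (intro AE_not_in) (simp add: negligible_iff_null_sets[symmetric] negligible_finite)
  then have "AE t in lebesgue_on {?a..?b}. t \<notin> {?a, ?b}"
    by (subst AE_restrict_space_iff) (auto elim: eventually_mono)
  then have "AE t in lebesgue_on {?a..?b}. t \<notin> {?a, ?b} \<and> t \<in> {?a..?b}"
    by (rule AE_conjI) (rule AE_I2, simp)
  then show ?thesis by eventually_elim (auto simp: cell_def)
qed

lemma cell_integral:
  fixes f h :: "real \<Rightarrow> real"
  assumes m: "m \<in> {1..N}" and h: "continuous_on {0..1} h"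
    and fh: "\<And>t. t \<in> cell m \<Longrightarrow> f t = h (loc m t)"
  shows "integrable (lebesgue_on {(real m - 1) * k..real m * k}) f"
    and "(LINT t|lebesgue_on {(real m - 1) * k..real m * k}. f t) = k * integral {0..1} h"
proof -
  let ?a = "(real m - 1) * k" and ?b = "real m * k"
  have cont: "continuous_on {?a..?b} (\<lambda>t. h (loc m t))"
  proof (rule continuous_on_compose2[OF h])
    show "continuous_on {?a..?b} (loc m)"
      unfolding loc_def[abs_def] by (intro continuous_intros) (use k_pos in auto)
  qed (use loc_icell in blast)
  then have int: "integrable (lebesgue_on {?a..?b}) (\<lambda>t. h (loc m t))"
    by (rule continuous_imp_integrable_real)
  have ae: "AE t in lebesgue_on {?a..?b}. h (loc m t) = f t"
    using AE_icell[OF m] by eventually_elim (rule fh[symmetric])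
  have meas: "f \<in> borel_measurable (lebesgue_on {?a..?b})"
    by (rule AE_lebesgue_on_measurable_cong[OF borel_measurable_integrable[OF int] _ ae]) simp
  show fi: "integrable (lebesgue_on {?a..?b}) f"
    by (rule integrable_cong_AE_imp[OF int meas]) (use ae in eventually_elim, simp)
  have "(LINT t|lebesgue_on {?a..?b}. f t) = (LINT t|lebesgue_on {?a..?b}. h (loc m t))"
    by (rule integral_cong_AE) (use meas int ae in \<open>auto elim: eventually_mono\<close>)
  also have "\<dots> = integral {?a..?b} (\<lambda>t. h (loc m t))" by (rule lebesgue_integral_eq_integral[OF int]) simp
  also have "\<dots> = k * integral {0..1} h"
  proof -
    have "(h has_integral integral {0..1} h) {0..1}"
      using h by (intro integrable_integral integrable_continuous_real)
    then have "((\<lambda>x. h ((1 / k) * x + (- ?a / k))) has_integral (1 / \<bar>1 / k\<bar>) *\<^sub>R integral {0..1} h)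
        ((\<lambda>x. (1 / (1 / k)) *\<^sub>R x + - ((1 / (1 / k)) *\<^sub>R (- ?a / k))) ` {0..1})"
      using has_integral_affinity01[of h "integral {0..1} h" "1 / k" "- ?a / k"] k_pos by (simp add: mult.commute)
    moreover have "(\<lambda>x. (1 / (1 / k)) *\<^sub>R x + - ((1 / (1 / k)) *\<^sub>R (- ?a / k))) ` {0..1} = {?a..?b}"
    proof -
      have eq: "(\<lambda>x. (1 / (1 / k)) *\<^sub>R x + - ((1 / (1 / k)) *\<^sub>R (- ?a / k))) = (\<lambda>x. k * x + ?a)"
        using k_pos by (simp add: fun_eq_iff field_simps)
      show ?thesis unfolding eq
        using k_pos image_affinity_atLeastAtMost[of k ?a 0 1] by (simp add: algebra_simps)
    qed
    moreover have "(1 / k) * x + (- ?a / k) = loc m x" for x by (simp add: loc_def diff_divide_distrib)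
    ultimately show ?thesis using k_pos by (auto intro: integral_unique)
  qed
  finally show "(LINT t|lebesgue_on {?a..?b}. f t) = k * integral {0..1} h" .
qed

lemma pw_integral:
  fixes f :: "real \<Rightarrow> real"
  assumes h: "\<And>m. m \<in> {1..N} \<Longrightarrow> continuous_on {0..1} (h m)"
    and fh: "\<And>m t. m \<in> {1..N} \<Longrightarrow> t \<in> cell m \<Longrightarrow> f t = h m (loc m t)"
  shows "integrable (I0 T) f" "(LINT t|I0 T. f t) = (\<Sum>m=1..N. k * integral {0..1} (h m))"
proof -
  show i: "integrable (I0 T) f" by (rule L2_integrable_vec[OF pw_L2[OF h fh]])
  show "(LINT t|I0 T. f t) = (\<Sum>m=1..N. k * integral {0..1} (h m))"
    unfolding sum_cells_integral[OF i] by (intro sum.cong refl cell_integral(2) h fh) auto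
qed

text \<open>The coefficients are carried explicitly, because membership in the discrete subspace and
  all cell integrals are expressed through them. Values at the nodes stay free, which suits
  functions that matter only up to null sets.\<close>

definition pw :: "nat \<Rightarrow> (nat \<Rightarrow> nat \<Rightarrow> 'a::real_vector) \<Rightarrow> (real \<Rightarrow> 'a) \<Rightarrow> bool" where
  "pw q D v \<longleftrightarrow> (\<forall>m\<in>{1..N}. \<forall>t\<in>cell m. v t = vpoly q (D m) (loc m t))"

lemma pwD: "pw q D v \<Longrightarrow> m \<in> {1..N} \<Longrightarrow> t \<in> cell m \<Longrightarrow> v t = vpoly q (D m) (loc m t)"
  by (auto simp: pw_def)

lemma pw_in_L2:
  fixes v :: "real \<Rightarrow> 'a::real_normed_vector"
  assumes "pw q D v" shows "v \<in> L2 T"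
  by (rule pw_L2[of "\<lambda>m. vpoly q (D m)"]) (auto intro: continuous_intros pwD[OF assms])

definition pwf :: "nat \<Rightarrow> (nat \<Rightarrow> nat \<Rightarrow> 'a::real_vector) \<Rightarrow> real \<Rightarrow> 'a" where
  "pwf q D t = vpoly q (D (nat \<lceil>t / k\<rceil>)) (loc (nat \<lceil>t / k\<rceil>) t)"

lemma pw_pwf: "pw q D (pwf q D)"
proof -
  have "nat \<lceil>t / k\<rceil> = m" if "t \<in> cell m" for t m
    by (rule cell_index) (use that in \<open>auto simp: cell_def\<close>)
  then show ?thesis by (simp add: pw_def pwf_def)
qed

lemma pw_L2_norm:
  fixes v :: "real \<Rightarrow> 'a::real_normed_vector"
  assumes "pw q D v"
  shows "(L2_norm T v)\<^sup>2 = (\<Sum>m=1..N. k * integral {0..1} (\<lambda>s. (norm (vpoly q (D m) s))\<^sup>2))"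
  unfolding L2_norm_sq
  by (rule pw_integral(2)) (auto intro!: continuous_intros simp: pwD[OF assms])

end

subsection \<open>The discrete derivative\<close>

lemma poly_funs_iff_vpoly: "v \<in> poly_funs q S \<longleftrightarrow> (\<exists>c. (\<forall>i\<le>q. c i \<in> S) \<and> v = vpoly q c)"
  by (auto simp: poly_funs_def vpoly_def fun_eq_iff)

text \<open>An affine substitution combines the coefficients linearly, so they stay in
  \<open>S\<close>. It translates between powers of \<open>t\<close>, as in
  \<open>poly_funs\<close>, and powers of \<open>loc m t\<close>.\<close>

lemma vpoly_affine:
  assumes S: "subspace S" and c: "\<And>i. i \<le> q \<Longrightarrow> c i \<in> S"
  shows "\<exists>d. (\<forall>i\<le>q. d i \<in> S) \<and> (\<forall>t. vpoly q c (a * t + b) = vpoly q d t)"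
proof (intro exI conjI allI impI)
  let ?p = "\<lambda>i. [:b, a:] ^ i"
  let ?d = "\<lambda>l. \<Sum>i\<le>q. coeff (?p i) l *\<^sub>R c i"
  show "?d l \<in> S" for l using c by (auto intro!: subspace_sum subspace_scale S)
  fix t
  have deg: "degree (?p i) \<le> q" if "i \<le> q" for i
  proof -
    have "degree (?p i) \<le> degree [:b, a:] * i" by (rule degree_power_le)
    also have "\<dots> \<le> 1 * i" by (rule mult_right_mono) auto
    finally show ?thesis using that by simp
  qed
  have pow: "(a * t + b) ^ i = (\<Sum>l\<le>q. coeff (?p i) l * t ^ l)" if "i \<le> q" for i
    unfolding poly_eq_sum_le[OF deg[OF that], symmetric] by (simp add: algebra_simps)
  have "vpoly q c (a * t + b) = (\<Sum>i\<le>q. (\<Sum>l\<le>q. coeff (?p i) l * t ^ l) *\<^sub>R c i)"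
    unfolding vpoly_def by (intro sum.cong refl) (simp only: atMost_iff pow)
  also have "\<dots> = vpoly q ?d t"
    unfolding vpoly_def scaleR_sum_left scaleR_sum_right by (subst sum.swap) (simp add: mult.commute)
  finally show "vpoly q c (a * t + b) = vpoly q ?d t" .
qed

locale dg = fin_subspace S + grid T N
  for S :: "'u::{real_inner,banach,second_countable_topology} set" and T :: real and N :: nat +
  fixes j :: "'u \<Rightarrow> 'h::{real_inner,banach,second_countable_topology}" and q :: nat
  assumes j: "bounded_linear j"
begin

sublocale j: bounded_linear j by (rule j)

abbreviation "Cf z m \<equiv> dg_coeff k q z m"
definition "jump z m = Cf z m 0 - z ((real m - 1) * k)"
abbreviation "Wn \<equiv> Wn_space T N q S"

lemma Wn_expansion:
  assumes "z \<in> Wn" "m \<in> {1..N}" "t \<in> {(real m - 1) * k <.. real m * k}"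
  shows "z t = vpoly q (Cf z m) (loc m t)"
proof -
  obtain c where "local_expansion k q z m c" using assms(1,2) unfolding Wn_space_def k_def by blast
  then have "local_expansion k q z m (Cf z m)"
    unfolding dg_coeff_def by (metis someI)
  then show ?thesis using assms(3) by (simp add: local_expansion_def vpoly_def loc_def)
qed

text \<open>\<open>dg_coeff\<close> is a choice, so every explicit expansion, for instance that of a
  linear combination, has to be identified with it by uniqueness.\<close>

lemma dg_coeff_unique:
  assumes z: "z \<in> Wn" and m: "m \<in> {1..N}" and i: "i \<le> q"
    and e: "\<And>t. t \<in> {(real m - 1) * k <.. real m * k} \<Longrightarrow> z t = vpoly q c (loc m t)"
  shows "Cf z m i = c i"
proof (rule vpoly_unique[OF _ i])
  fix s :: real assume s: "s \<in> {0<..1}"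
  let ?t = "(real m - 1) * k + k * s"
  have "k * s \<le> k" using s k_pos by (simp add: mult_left_le)
  then have t: "?t \<in> {(real m - 1) * k <.. real m * k}" using s k_pos by (auto simp: algebra_simps)
  have "loc m ?t = s" using k_pos by (simp add: loc_def)
  then show "vpoly q (Cf z m) s = vpoly q c s" using e[OF t] Wn_expansion[OF z m t] by simp
qed

lemma dg_coeff_in:
  assumes z: "z \<in> Wn" and m: "m \<in> {1..N}" and i: "i \<le> q"
  shows "Cf z m i \<in> S"
proof -
  obtain c where c: "\<forall>i\<le>q. c i \<in> S" "local_expansion k q z m c"
    using z m unfolding Wn_space_def k_def by blast
  have "Cf z m i = c i"
    by (rule dg_coeff_unique[OF z m i]) (use c(2) in \<open>simp add: local_expansion_def vpoly_def loc_def\<close>)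
  then show ?thesis using c(1) i by simp
qed

lemma WnI:
  assumes "z 0 \<in> S"
    and "\<And>m i. m \<in> {1..N} \<Longrightarrow> i \<le> q \<Longrightarrow> c m i \<in> S"
    and "\<And>m t. m \<in> {1..N} \<Longrightarrow> t \<in> {(real m - 1) * k <.. real m * k} \<Longrightarrow> z t = vpoly q (c m) (loc m t)"
  shows "z \<in> Wn"
proof -
  have "\<exists>c. (\<forall>i\<le>q. c i \<in> S) \<and> local_expansion (T / real N) q z m c" if m: "m \<in> {1..N}" for m
    by (rule exI[of _ "c m"]) (use assms m in \<open>auto simp: local_expansion_def vpoly_def loc_def k_def\<close>)
  with assms(1) show ?thesis by (simp add: Wn_space_def)
qed

lemma Wn_in_S: "z \<in> Wn \<Longrightarrow> t \<in> {0..T} \<Longrightarrow> z t \<in> S"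
proof (cases "t = 0")
  case False
  assume z: "z \<in> Wn" and "t \<in> {0..T}"
  then have "t \<in> {0<..T}" using False by auto
  then obtain m where m: "m \<in> {1..N}" "t \<in> {(real m - 1) * k <.. real m * k}" by (rule in_hcell)
  show ?thesis unfolding Wn_expansion[OF z m] by (rule vpoly_in_subspace[OF sub]) (rule dg_coeff_in[OF z m(1)])
qed (simp add: Wn_space_def)

lemma Wn_lincomb:
  assumes z: "z \<in> Wn" and y: "y \<in> Wn"
  shows "(\<lambda>t. a *\<^sub>R z t + b *\<^sub>R y t) \<in> Wn" (is "?w \<in> Wn")
    and "m \<in> {1..N} \<Longrightarrow> i \<le> q \<Longrightarrow> Cf (\<lambda>t. a *\<^sub>R z t + b *\<^sub>R y t) m i = a *\<^sub>R Cf z m i + b *\<^sub>R Cf y m i"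
proof -
  let ?c = "\<lambda>m i. a *\<^sub>R Cf z m i + b *\<^sub>R Cf y m i"
  have e: "?w t = vpoly q (?c m) (loc m t)" if "m \<in> {1..N}" "t \<in> {(real m - 1) * k <.. real m * k}" for m t
    unfolding Wn_expansion[OF z that] Wn_expansion[OF y that]
    by (simp add: vpoly_add vpoly_linear[OF linear_scaleR])
  show w: "?w \<in> Wn"
  proof (rule WnI[where c = ?c])
    show "?w 0 \<in> S" using z y by (auto simp: Wn_space_def intro!: subspace_add[OF sub] subspace_scale[OF sub])
  qed (auto intro!: subspace_add[OF sub] subspace_scale[OF sub] dg_coeff_in z y e)
  show "Cf ?w m i = ?c m i" if "m \<in> {1..N}" "i \<le> q"
    by (rule dg_coeff_unique[OF w that]) (rule e[OF that(1)])
qed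

lemma Wn_pw: "z \<in> Wn \<Longrightarrow> pw q (Cf z) z"
  unfolding pw_def by (intro ballI Wn_expansion) (auto simp: cell_def)

lemma Wn_L2: "z \<in> Wn \<Longrightarrow> z \<in> L2 T"
  by (rule pw_in_L2[OF Wn_pw])

lemma dg_b_cell:
  assumes z: "z \<in> Wn" and m: "m \<in> {1..N}" and t: "t \<in> cell m"
  shows "dg_b z t = (1 / k) *\<^sub>R vpoly' q (Cf z m) (loc m t)"
proof -
  have "(loc m has_real_derivative 1 / k) (at t)"
    unfolding loc_def[abs_def] using k_pos by (auto intro!: derivative_eq_intros)
  then have "(vpoly q (Cf z m) \<circ> loc m has_vector_derivative (1 / k) *\<^sub>R vpoly' q (Cf z m) (loc m t)) (at t)"
    by (intro vector_diff_chain_at vpoly_has_vector_derivative) (simp add: has_real_derivative_iff_has_vector_derivative)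
  then have "(z has_vector_derivative (1 / k) *\<^sub>R vpoly' q (Cf z m) (loc m t)) (at t)"
  proof (rule has_vector_derivative_transform_within_open[of _ _ _ "cell m"])
    show "open (cell m)" by (simp add: cell_def)
    show "(vpoly q (Cf z m) \<circ> loc m) x = z x" if "x \<in> cell m" for x
      using pwD[OF Wn_pw[OF z] m that] by simp
  qed (rule t)
  then show ?thesis unfolding dg_b_def by (rule vector_derivative_at)
qed

lemma dg_deriv_cell:
  assumes z: "z \<in> Wn" and m: "m \<in> {1..N}" and t: "t \<in> cell m"
  shows "dg_deriv T N q z t = (1 / k) *\<^sub>R (vpoly' q (Cf z m) (loc m t) + poly (psi0 q) (loc m t) *\<^sub>R jump z m)"
proof -
  have i: "nat \<lceil>t / k\<rceil> = m" by (rule cell_index) (use t in \<open>auto simp: cell_def\<close>)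
  show ?thesis
    unfolding dg_deriv_def k_def[symmetric] Let_def i dg_b_cell[OF assms] jump_def loc_def
    by (simp add: scaleR_add_right)
qed

text \<open>The Riesz representative of the functional \<open>dg_hat\<close>; it takes its values in \<open>S\<close>, so that no
  projection is needed when it is paired with elements of \<open>Vn_space\<close>.\<close>

definition "Gam z t = oproj S (emb_adj j (dg_deriv T N q z t))"

abbreviation "BB \<equiv> \<lambda>x. oproj S (emb_adj j x)"

lemma linear_BB: "linear BB"
  using bounded_linear_compose[OF bounded_linear_oproj bounded_linear_emb_adj[OF j]]
  by (simp add: bounded_linear.linear)

lemma BB_inner: "s \<in> S \<Longrightarrow> BB x \<bullet> s = j x \<bullet> j s"
  by (simp add: oproj_inner emb_adj_inner[OF j])

text \<open>Differentiation shifts the index, so the top coefficient receives a contribution from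
  the jump only.\<close>

definition "Gam_coeff z m i = (1 / k) *\<^sub>R BB ((if i < q then real (Suc i) *\<^sub>R Cf z m (Suc i) else 0) + coeff (psi0 q) i *\<^sub>R jump z m)"

lemma vpoly'_as_vpoly: "vpoly' q c s = vpoly q (\<lambda>i. if i < q then real (Suc i) *\<^sub>R c (Suc i) else 0) s"
proof (cases q)
  case (Suc p)
  have "vpoly' q c s = (\<Sum>i\<le>p. (real (Suc i) * s ^ i) *\<^sub>R c (Suc i))"
    unfolding vpoly'_def Suc by (subst sum.atMost_Suc_shift) simp
  also have "\<dots> = vpoly q (\<lambda>i. if i < q then real (Suc i) *\<^sub>R c (Suc i) else 0) s"
    unfolding vpoly_def Suc by (simp add: mult.commute)
  finally show ?thesis .
qed (simp add: vpoly'_def vpoly_def)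

lemma Gam_pw: "z \<in> Wn \<Longrightarrow> pw q (Gam_coeff z) (Gam z)"
  unfolding pw_def
proof (intro ballI)
  fix m t assume z: "z \<in> Wn" and m: "m \<in> {1..N}" and t: "t \<in> cell m"
  let ?s = "loc m t"
  have psi: "poly (psi0 q) ?s *\<^sub>R x = vpoly q (\<lambda>i. coeff (psi0 q) i *\<^sub>R x) ?s" for x :: 'u
    by (simp add: vpoly_def poly_eq_sum_le[OF degree_psi0] scaleR_sum_left mult.commute)
  show "Gam z t = vpoly q (Gam_coeff z m) ?s"
    unfolding Gam_def dg_deriv_cell[OF z m t] vpoly'_as_vpoly psi vpoly_add[symmetric]
      linear_scale[OF linear_BB] vpoly_linear[OF linear_BB] vpoly_linear[OF linear_scaleR]
    unfolding Gam_coeff_def ..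
qed

lemma Gam_coeff_in: "Gam_coeff z m i \<in> S"
  unfolding Gam_coeff_def by (intro subspace_scale[OF sub] oproj_in)

lemma Gam_L2: "z \<in> Wn \<Longrightarrow> Gam z \<in> L2 T"
  by (rule pw_in_L2[OF Gam_pw])

lemma Gam_lincomb_cell:
  assumes z: "z \<in> Wn" and y: "y \<in> Wn" and m: "m \<in> {1..N}" and t: "t \<in> cell m"
  shows "Gam (\<lambda>t. a *\<^sub>R z t + b *\<^sub>R y t) t = a *\<^sub>R Gam z t + b *\<^sub>R Gam y t"
proof -
  let ?w = "\<lambda>t. a *\<^sub>R z t + b *\<^sub>R y t"
  note w = Wn_lincomb(1)[OF z y, of a b]
  have "dg_deriv T N q ?w t = a *\<^sub>R dg_deriv T N q z t + b *\<^sub>R dg_deriv T N q y t"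
  proof -
    have v: "vpoly' q (Cf ?w m) (loc m t) = a *\<^sub>R vpoly' q (Cf z m) (loc m t) + b *\<^sub>R vpoly' q (Cf y m) (loc m t)"
      unfolding vpoly'_def scaleR_sum_right sum.distrib[symmetric]
      by (intro sum.cong refl) (simp add: Wn_lincomb(2)[OF z y m] scaleR_add_right mult.commute)
    have J: "jump ?w m = a *\<^sub>R jump z m + b *\<^sub>R jump y m"
      by (simp add: jump_def Wn_lincomb(2)[OF z y m] algebra_simps)
    show ?thesis unfolding dg_deriv_cell[OF z m t] dg_deriv_cell[OF y m t] dg_deriv_cell[OF w m t] v J
      by (simp add: algebra_simps)
  qed
  then show ?thesis unfolding Gam_def by (simp add: linear_add[OF linear_BB] linear_scale[OF linear_BB])
qed

lemma Gam_inner_cell: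
  assumes z: "z \<in> Wn" and m: "m \<in> {1..N}" and t: "t \<in> cell m" and x: "x \<in> S"
  shows "Gam z t \<bullet> x = (1 / k) * (vpoly' q (\<lambda>i. j (Cf z m i)) (loc m t) \<bullet> j x + poly (psi0 q) (loc m t) * (j (jump z m) \<bullet> j x))"
  unfolding Gam_def BB_inner[OF x] dg_deriv_cell[OF z m t]
  by (simp add: j.scaleR j.add vpoly'_linear[OF j.linear] inner_add_left)

text \<open>Integration against \<open>psi0\<close> evaluates a polynomial of degree at most
  \<open>q\<close> at the left end of the cell. Hence the jump, which \<open>dg_deriv\<close>
  spreads over the cell, pairs like a point evaluation, exactly as in the scheme.\<close>

lemma Gam_pairing:
  assumes z: "z \<in> Wn" and v: "pw q D v" and D: "\<And>m i. m \<in> {1..N} \<Longrightarrow> i \<le> q \<Longrightarrow> D m i \<in> S"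
  shows "V_inner T (Gam z) v = (\<Sum>m=1..N. integral {0..1} (\<lambda>s. vpoly' q (\<lambda>i. j (Cf z m i)) s \<bullet> vpoly q (\<lambda>i. j (D m i)) s)
      + j (jump z m) \<bullet> j (D m 0))"
proof -
  let ?h = "\<lambda>m s. (1 / k) * (vpoly' q (\<lambda>i. j (Cf z m i)) s \<bullet> vpoly q (\<lambda>i. j (D m i)) s
     + poly (psi0 q) s * (j (jump z m) \<bullet> vpoly q (\<lambda>i. j (D m i)) s))"
  have "V_inner T (Gam z) v = (\<Sum>m=1..N. k * integral {0..1} (?h m))"
    unfolding V_inner_def
  proof (rule pw_integral(2))
    fix m t assume m: "m \<in> {1..N}" and t: "t \<in> cell m"
    have vS: "v t \<in> S" unfolding pwD[OF v m t] by (rule vpoly_in_subspace[OF sub D[OF m]])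
    have jv: "j (v t) = vpoly q (\<lambda>i. j (D m i)) (loc m t)"
      unfolding pwD[OF v m t] by (rule vpoly_linear[OF j.linear])
    show "Gam z t \<bullet> v t = ?h m (loc m t)" unfolding Gam_inner_cell[OF z m t vS] jv ..
  qed (use k_pos in \<open>auto intro!: continuous_intros\<close>)
  also have "\<dots> = (\<Sum>m=1..N. integral {0..1} (\<lambda>s. vpoly' q (\<lambda>i. j (Cf z m i)) s \<bullet> vpoly q (\<lambda>i. j (D m i)) s)
      + j (jump z m) \<bullet> j (D m 0))"
  proof (rule sum.cong[OF refl])
    fix m
    have "k * integral {0..1} (?h m) = integral {0..1} (\<lambda>s. vpoly' q (\<lambda>i. j (Cf z m i)) s \<bullet> vpoly q (\<lambda>i. j (D m i)) s
       + poly (psi0 q) s * (j (jump z m) \<bullet> vpoly q (\<lambda>i. j (D m i)) s))"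
      using k_pos by simp
    also have "\<dots> = integral {0..1} (\<lambda>s. vpoly' q (\<lambda>i. j (Cf z m i)) s \<bullet> vpoly q (\<lambda>i. j (D m i)) s) + j (jump z m) \<bullet> j (D m 0)"
      by (subst integral_add) (auto intro!: integrable_continuous_real continuous_intros simp: psi0_vpoly_integral)
    finally show "k * integral {0..1} (?h m) = \<dots>" .
  qed
  finally show ?thesis .
qed

section \<open>Discrete test functions and the projection onto them\<close>

lemma Vn_iff_pw: "v \<in> Vn_space T N q S \<longleftrightarrow> v \<in> L2 T \<and> (\<exists>D. (\<forall>m\<in>{1..N}. \<forall>i\<le>q. D m i \<in> S) \<and> pw q D v)"
proof safe
  assume v: "v \<in> Vn_space T N q S"
  then show "v \<in> L2 T" by (simp add: Vn_space_def)
  have "\<exists>d. (\<forall>i\<le>q. d i \<in> S) \<and> (\<forall>t\<in>cell m. v t = vpoly q d (loc m t))" if m: "m \<in> {1..N}" for m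
  proof -
    obtain p where p: "p \<in> poly_funs q S" "\<forall>t\<in>cell m. v t = p t"
      using v m unfolding Vn_space_def cell_def k_def by blast
    then obtain c where c: "\<forall>i\<le>q. c i \<in> S" "\<And>t. t \<in> cell m \<Longrightarrow> v t = vpoly q c t"
      by (auto simp: poly_funs_iff_vpoly)
    obtain d where d: "\<forall>i\<le>q. d i \<in> S" "\<And>t. vpoly q c (k * t + (real m - 1) * k) = vpoly q d t"
      using vpoly_affine[OF sub, of q c k "(real m - 1) * k"] c(1) by blast
    have "vpoly q c t = vpoly q d (loc m t)" for t
      unfolding d(2)[symmetric] using k_pos by (simp add: loc_def)
    then show ?thesis using c d(1) by auto
  qed
  then show "\<exists>D. (\<forall>m\<in>{1..N}. \<forall>i\<le>q. D m i \<in> S) \<and> pw q D v" unfolding pw_def by metis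
next
  fix D assume v: "v \<in> L2 T" "pw q D v" and D: "\<forall>m\<in>{1..N}. \<forall>i\<le>q. D m i \<in> S"
  have "\<exists>p\<in>poly_funs q S. \<forall>t\<in>cell m. v t = p t" if m: "m \<in> {1..N}" for m
  proof -
    obtain d where d: "\<forall>i\<le>q. d i \<in> S" "\<And>t. vpoly q (D m) ((1 / k) * t + (- (real m - 1))) = vpoly q d t"
      using vpoly_affine[OF sub, of q "D m" "1 / k" "- (real m - 1)"] D m by blast
    have "(1 / k) * t + (- (real m - 1)) = loc m t" for t using k_pos by (simp add: loc_def field_simps)
    then have "vpoly q (D m) (loc m t) = vpoly q d t" for t
      unfolding d(2)[symmetric] by (simp only:)
    then show ?thesis using pwD[OF v(2) m] d(1) by (intro bexI[of _ "vpoly q d"]) (auto simp: poly_funs_iff_vpoly)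
  qed
  then show "v \<in> Vn_space T N q S" using v(1) by (auto simp: Vn_space_def cell_def k_def)
qed

text \<open>The projection is written down: local moments of \<open>v\<close> are projected to
  \<open>S\<close> and recombined with the dual basis \<open>theta\<close>. Existence is what gives
  the choice in \<open>Vn_proj\<close> its meaning.\<close>

lemma Vn_proj_ex:
  assumes v: "v \<in> L2 T"
  shows "\<exists>p. p \<in> Vn_space T N q S \<and> (\<forall>z\<in>Vn_space T N q S. V_inner T (v - p) z = 0)"
proof -
  let ?w = "\<lambda>m i t. indicat_real (cell m) t * loc m t ^ i"
  have wm: "?w m i \<in> borel_measurable (I0 T)" for m i
  proof -
    have "loc m \<in> borel_measurable (I0 T)"
      unfolding loc_def[abs_def] using k_pos by (intro continuous_on_imp_measurable_I continuous_intros) auto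
    moreover have "indicat_real (cell m) \<in> borel_measurable (I0 T)"
      by (intro measurable_restrict_space1 borel_measurable_indicator) (simp add: cell_def)
    ultimately show ?thesis by measurable
  qed
  have wb: "\<bar>?w m i t\<bar> \<le> 1" for m i t
    using loc_cell[of t m] by (auto simp: indicator_def power_abs intro!: power_le_one)
  have wL2: "(\<lambda>t. ?w m i t *\<^sub>R v t) \<in> L2 T" for m i
    by (rule L2_mult_bounded[OF v wm wb])
  \<comment> \<open>The projected moment of order \<open>i\<close> over cell \<open>m\<close>, in
    reference coordinates; the factor \<open>1 / k\<close> compensates the length of the
    cell.\<close>
  define a where "a m i = (1 / k) *\<^sub>R oproj S (LINT t|I0 T. ?w m i t *\<^sub>R v t)" for m i
  have aS: "a m i \<in> S" for m i unfolding a_def by (intro subspace_scale[OF sub] oproj_in)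
  define D where "D m l = (\<Sum>i\<le>q. coeff (theta q i) l *\<^sub>R a m i)" for m l
  have DS: "D m l \<in> S" for m l unfolding D_def by (intro subspace_sum[OF sub] subspace_scale[OF sub] aS)
  have Dv: "vpoly q (D m) s = (\<Sum>i\<le>q. poly (theta q i) s *\<^sub>R a m i)" for m s
  proof -
    have "(\<Sum>i\<le>q. poly (theta q i) s *\<^sub>R a m i) = (\<Sum>i\<le>q. \<Sum>l\<le>q. (coeff (theta q i) l * s ^ l) *\<^sub>R a m i)"
      by (simp add: poly_eq_sum_le[OF theta(1)] scaleR_sum_left)
    also have "\<dots> = vpoly q (D m) s"
      unfolding vpoly_def D_def scaleR_sum_right by (subst sum.swap) (simp add: mult.commute)
    finally show ?thesis ..
  qed
  define p where "p = pwf q D"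
  have pp: "pw q D p" unfolding p_def by (rule pw_pwf)
  have pV: "p \<in> Vn_space T N q S" unfolding Vn_iff_pw using pp DS pw_in_L2[OF pp] by blast
  have "V_inner T (v - p) z = 0" if z: "z \<in> Vn_space T N q S" for z
  proof -
    obtain E where E0: "\<forall>m\<in>{1..N}. \<forall>i\<le>q. E m i \<in> S" and zE: "pw q E z" and zL: "z \<in> L2 T"
      using z unfolding Vn_iff_pw by blast
    then have E: "\<And>m i. m \<in> {1..N} \<Longrightarrow> i \<le> q \<Longrightarrow> E m i \<in> S" by blast
    have "V_inner T v z = (LINT t|I0 T. (\<Sum>m=1..N. \<Sum>l\<le>q. (?w m l t *\<^sub>R v t) \<bullet> E m l))"
      unfolding V_inner_def
    proof (rule integral_cong_AE)
      show "(\<lambda>t. v t \<bullet> z t) \<in> borel_measurable (I0 T)"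
        by (rule borel_measurable_integrable[OF L2_inner_integrable[OF v zL]])
      show "(\<lambda>t. \<Sum>m=1..N. \<Sum>l\<le>q. (?w m l t *\<^sub>R v t) \<bullet> E m l) \<in> borel_measurable (I0 T)"
        using L2_measurable[OF wL2] by measurable
      show "AE t in I0 T. v t \<bullet> z t = (\<Sum>m=1..N. \<Sum>l\<le>q. (?w m l t *\<^sub>R v t) \<bullet> E m l)"
      proof (rule AE_cellI)
        fix m t assume m: "m \<in> {1..N}" and t: "t \<in> cell m"
        have other: "t \<notin> cell m'" if "m' \<noteq> m" for m'
        proof
          assume t': "t \<in> cell m'"
          have "nat \<lceil>t / k\<rceil> = m" by (rule cell_index) (use t in \<open>auto simp: cell_def\<close>)
          moreover have "nat \<lceil>t / k\<rceil> = m'" by (rule cell_index) (use t' in \<open>auto simp: cell_def\<close>)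
          ultimately show False using that by simp
        qed
        have "(\<Sum>m=1..N. \<Sum>l\<le>q. (?w m l t *\<^sub>R v t) \<bullet> E m l) = (\<Sum>m\<in>{m}. \<Sum>l\<le>q. (?w m l t *\<^sub>R v t) \<bullet> E m l)"
          using m other by (intro sum.mono_neutral_right) auto
        also have "\<dots> = (\<Sum>l\<le>q. loc m t ^ l * (v t \<bullet> E m l))" using t by simp
        also have "\<dots> = v t \<bullet> z t" unfolding pwD[OF zE m t] vpoly_def inner_sum_right by simp
        finally show "v t \<bullet> z t = (\<Sum>m=1..N. \<Sum>l\<le>q. (?w m l t *\<^sub>R v t) \<bullet> E m l)" ..
      qed
    qed
    also have "\<dots> = (\<Sum>m=1..N. \<Sum>l\<le>q. (LINT t|I0 T. ?w m l t *\<^sub>R v t) \<bullet> E m l)"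
      using L2_integrable_vec[OF wL2] by (simp add: integral_sum' del: inner_scaleR_left)
    also have "\<dots> = (\<Sum>m=1..N. k * (\<Sum>l\<le>q. a m l \<bullet> E m l))"
      unfolding sum_distrib_left a_def using E k_pos by (intro sum.cong refl) (simp add: oproj_inner)
    finally have 1: "V_inner T v z = (\<Sum>m=1..N. k * (\<Sum>l\<le>q. a m l \<bullet> E m l))" .
    have "V_inner T p z = (\<Sum>m=1..N. k * integral {0..1} (\<lambda>s. vpoly q (D m) s \<bullet> vpoly q (E m) s))"
      unfolding V_inner_def
      by (rule pw_integral(2)) (auto intro!: continuous_intros simp: pwD[OF pp] pwD[OF zE])
    also have "\<dots> = (\<Sum>m=1..N. k * (\<Sum>l\<le>q. a m l \<bullet> E m l))"
    proof (intro sum.cong refl arg_cong[where f="\<lambda>x. k * x"])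
      fix m
      have "integral {0..1} (\<lambda>s. vpoly q (D m) s \<bullet> vpoly q (E m) s) =
        integral {0..1} (\<lambda>s. \<Sum>i\<le>q. \<Sum>l\<le>q. (poly (theta q i) s * s ^ l) * (a m i \<bullet> E m l))"
        unfolding Dv unfolding vpoly_def inner_sum_left
        by (rule integral_cong) (simp add: inner_sum_right sum_distrib_left mult.assoc mult.left_commute)
      also have "\<dots> = (\<Sum>i\<le>q. \<Sum>l\<le>q. integral {0..1} (\<lambda>s. poly (theta q i) s * s ^ l) * (a m i \<bullet> E m l))"
        by (subst integral_sum; (subst integral_sum)?) (auto intro!: integrable_continuous_real continuous_intros)
      also have "\<dots> = (\<Sum>i\<le>q. a m i \<bullet> E m i)"
        by (intro sum.cong refl) (simp add: theta(2) if_distrib[of "\<lambda>x. x * _"] cong: if_cong)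
      finally show "integral {0..1} (\<lambda>s. vpoly q (D m) s \<bullet> vpoly q (E m) s) = (\<Sum>i\<le>q. a m i \<bullet> E m i)" .
    qed
    finally have "V_inner T v z - V_inner T p z = 0" using 1 by simp
    moreover have "V_inner T (v - p) z = V_inner T v z - V_inner T p z"
      using V_inner_diff_left[OF v pw_in_L2[OF pp] zL] by (simp add: fun_diff_def)
    ultimately show ?thesis by simp
  qed
  with pV show ?thesis by blast
qed

lemma Vn_proj:
  assumes "v \<in> L2 T"
  shows "Vn_proj T N q S v \<in> Vn_space T N q S"
    and "z \<in> Vn_space T N q S \<Longrightarrow> V_inner T (v - Vn_proj T N q S v) z = 0"
  using someI_ex[OF Vn_proj_ex[OF assms]] unfolding Vn_proj_def by auto

lemma H_inner_proj:
  assumes z: "z \<in> Wn" and v: "v \<in> L2 T"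
  shows "H_inner T (\<lambda>t. j (dg_deriv T N q z t)) (\<lambda>t. j (Vn_proj T N q S v t)) = V_inner T (Gam z) v"
proof -
  let ?p = "Vn_proj T N q S v"
  obtain E where E0: "\<forall>m\<in>{1..N}. \<forall>i\<le>q. E m i \<in> S" and pE: "pw q E ?p" and pL: "?p \<in> L2 T"
    using Vn_proj(1)[OF v] unfolding Vn_iff_pw by blast
  then have E: "\<And>m i. m \<in> {1..N} \<Longrightarrow> i \<le> q \<Longrightarrow> E m i \<in> S" by blast
  have GV: "Gam z \<in> Vn_space T N q S" unfolding Vn_iff_pw using Gam_pw[OF z] Gam_L2[OF z] Gam_coeff_in by blast
  have "V_inner T (\<lambda>t. v t - ?p t) (Gam z) = 0" using Vn_proj(2)[OF v GV] by (simp add: fun_diff_def)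
  then have "V_inner T (Gam z) v = V_inner T (Gam z) ?p"
    using V_inner_diff_left[OF v pL Gam_L2[OF z]] by (simp add: V_inner_commute)
  also have "\<dots> = H_inner T (\<lambda>t. j (dg_deriv T N q z t)) (\<lambda>t. j (?p t))"
    unfolding V_inner_def H_inner_def
  proof (rule integral_cong_AE)
    have eq: "Gam z t \<bullet> ?p t = j (dg_deriv T N q z t) \<bullet> j (?p t)" if m: "m \<in> {1..N}" and t: "t \<in> cell m" for m t
    proof -
      have "?p t \<in> S" unfolding pwD[OF pE m t] by (rule vpoly_in_subspace[OF sub E[OF m]])
      then show ?thesis unfolding Gam_def by (rule BB_inner)
    qed
    then show ae: "AE t in I0 T. Gam z t \<bullet> ?p t = j (dg_deriv T N q z t) \<bullet> j (?p t)" by (rule AE_cellI)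
    show m: "(\<lambda>t. Gam z t \<bullet> ?p t) \<in> borel_measurable (I0 T)"
      by (rule borel_measurable_integrable[OF L2_inner_integrable[OF Gam_L2[OF z] pL]])
    show "(\<lambda>t. j (dg_deriv T N q z t) \<bullet> j (?p t)) \<in> borel_measurable (I0 T)"
      by (rule AE_lebesgue_on_measurable_cong[OF m _ ae]) simp
  qed
  finally show ?thesis ..
qed

end

lemma riesz_inv_L2:
  fixes g :: "real \<Rightarrow> 'u::{real_inner,complete_space} \<Rightarrow>\<^sub>L real"
  assumes "g \<in> L2 T" shows "(\<lambda>t. riesz_inv (g t)) \<in> L2 T"
  by (rule L2_bound[OF assms, where C=1], rule measurable_borel_fun[OF L2_measurable[OF assms] continuous_on_riesz_inv]) auto

lemma V_pairing_eq:
  fixes g :: "real \<Rightarrow> 'u::{real_inner,complete_space} \<Rightarrow>\<^sub>L real"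
  shows "V_pairing T g v = V_inner T (\<lambda>t. riesz_inv (g t)) v"
  by (simp add: V_pairing_def V_inner_def riesz_inv_inner)

lemma L2_norm_diff_riesz_inv:
  fixes g :: "real \<Rightarrow> 'u::{real_inner,complete_space} \<Rightarrow>\<^sub>L real"
  shows "L2_norm T (g - h) = L2_norm T (\<lambda>t. riesz_inv (g t) - riesz_inv (h t))"
  by (rule L2_norm_cong) (simp flip: riesz_inv_diff)

context dg begin

text \<open>The Riesz image of \<open>Gam z\<close> is a witness for the choice, by
  \<open>H_inner_proj\<close>.\<close>

lemma dg_hat:
  assumes z: "z \<in> Wn"
  shows "dg_hat T j N q S z \<in> L2 T" and "v \<in> L2 T \<Longrightarrow> V_pairing T (dg_hat T j N q S z) v = V_inner T (Gam z) v"
proof -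
  have "(\<lambda>t. riesz (Gam z t)) \<in> L2 T" by (rule L2_linear[OF Gam_L2[OF z] bounded_linear_riesz])
  moreover have "V_pairing T (\<lambda>t. riesz (Gam z t)) v = V_inner T (Gam z) v" for v by (simp add: V_pairing_eq)
  ultimately have "\<exists>g. g \<in> L2 T \<and> (\<forall>v\<in>L2 T. V_pairing T g v =
       H_inner T (\<lambda>t. j (dg_deriv T N q z t)) (\<lambda>t. j (Vn_proj T N q S v t)))"
    using H_inner_proj[OF z] by (intro exI[of _ "\<lambda>t. riesz (Gam z t)"]) auto
  from someI_ex[OF this] show "dg_hat T j N q S z \<in> L2 T" 
    "v \<in> L2 T \<Longrightarrow> V_pairing T (dg_hat T j N q S z) v = V_inner T (Gam z) v"
    unfolding dg_hat_def using H_inner_proj[OF z] by auto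
qed

text \<open>\<open>dg_hat\<close> is known only through its pairings. Its difference from
  \<open>Gam z\<close>, paired with itself, gives 0, so the two are interchangeable in every
  distance.\<close>

lemma dg_hat_norm:
  assumes z: "z \<in> Wn" and g: "G \<in> L2 T"
  shows "L2_norm T (\<lambda>t. riesz_inv (dg_hat T j N q S z t) - G t) = L2_norm T (\<lambda>t. Gam z t - G t)"
proof -
  let ?h = "\<lambda>t. riesz_inv (dg_hat T j N q S z t)"
  note h = riesz_inv_L2[OF dg_hat(1)[OF z]] and Gz = Gam_L2[OF z]
  let ?d = "\<lambda>t. ?h t - Gam z t"
  have d: "?d \<in> L2 T" by (rule L2_diff[OF h Gz])
  have "V_inner T ?d ?d = 0"
    using dg_hat(2)[OF z d] V_inner_diff_left[OF h Gz d] by (simp add: V_pairing_eq)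
  then have 0: "L2_norm T ?d = 0" by (simp add: V_inner_self)
  show ?thesis
  proof (rule antisym)
    show "L2_norm T (\<lambda>t. ?h t - G t) \<le> L2_norm T (\<lambda>t. Gam z t - G t)"
      using L2_norm_diff_triangle[OF h Gz g] 0 by simp
    show "L2_norm T (\<lambda>t. Gam z t - G t) \<le> L2_norm T (\<lambda>t. ?h t - G t)"
      using L2_norm_diff_triangle[OF Gz h g] 0 by (simp add: L2_norm_minus_commute[of T "Gam z"])
  qed
qed

end

subsection \<open>Stability\<close>

context dg begin

abbreviation "node_energy z m \<equiv> (norm (j (z (real m * k))))\<^sup>2"
abbreviation "cell_energy z m \<equiv> integral {0..1} (\<lambda>s. (norm (vpoly q (\<lambda>i. j (Cf z m i)) s))\<^sup>2)"

text \<open>The weight equals \<open>\<alpha> m\<close> at the left and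
  \<open>\<alpha> m + \<beta> m\<close> at the right end of cell \<open>m\<close>; if it is
  continuous across the nodes, the node terms telescope.\<close>

lemma weighted_identity:
  assumes z: "z \<in> Wn" and v: "pw q (\<lambda>m. wcoeff q (\<alpha> m) (\<beta> m) (Cf z m)) v"
  shows "V_inner T (Gam z) v = (\<Sum>m=1..N. (\<alpha> m + \<beta> m) / 2 * node_energy z m
     - \<alpha> m / 2 * (norm (j (z ((real m - 1) * k))))\<^sup>2 + \<alpha> m / 2 * (norm (j (jump z m)))\<^sup>2
     - \<beta> m / 2 * cell_energy z m)"
proof -
  have "V_inner T (Gam z) v = (\<Sum>m=1..N. integral {0..1} (\<lambda>s. vpoly' q (\<lambda>i. j (Cf z m i)) s
      \<bullet> vpoly q (\<lambda>i. j (wcoeff q (\<alpha> m) (\<beta> m) (Cf z m) i)) s) + j (jump z m) \<bullet> j (wcoeff q (\<alpha> m) (\<beta> m) (Cf z m) 0))"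
    by (rule Gam_pairing[OF z v]) (intro wcoeff_in_subspace[OF sub] dg_coeff_in[OF z])
  also have "\<dots> = (\<Sum>m=1..N. (\<alpha> m + \<beta> m) / 2 * node_energy z m
     - \<alpha> m / 2 * (norm (j (z ((real m - 1) * k))))\<^sup>2 + \<alpha> m / 2 * (norm (j (jump z m)))\<^sup>2
     - \<beta> m / 2 * cell_energy z m)"
  proof (rule sum.cong[OF refl])
    fix m assume m: "m \<in> {1..N}"
    have wcoeff: "j (wcoeff q (\<alpha> m) (\<beta> m) (Cf z m) i) = wcoeff q (\<alpha> m) (\<beta> m) (\<lambda>i. j (Cf z m i)) i" for i
      by (rule wcoeff_linear[OF j.linear])
    have "vpoly q (\<lambda>i. j (Cf z m i)) 1 = j (vpoly q (Cf z m) 1)" by (simp add: vpoly_linear[OF j.linear])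
    also have "vpoly q (Cf z m) 1 = z (real m * k)"
      using Wn_expansion[OF z m, of "real m * k"] k_pos by (simp add: loc_def algebra_simps)
    finally have 1: "vpoly q (\<lambda>i. j (Cf z m i)) 1 = j (z (real m * k))" .
    have 0: "j (Cf z m 0) - j (jump z m) = j (z ((real m - 1) * k))" by (simp add: jump_def j.diff)
    show "integral {0..1} (\<lambda>s. vpoly' q (\<lambda>i. j (Cf z m i)) s
      \<bullet> vpoly q (\<lambda>i. j (wcoeff q (\<alpha> m) (\<beta> m) (Cf z m) i)) s) + j (jump z m) \<bullet> j (wcoeff q (\<alpha> m) (\<beta> m) (Cf z m) 0)
     = (\<alpha> m + \<beta> m) / 2 * node_energy z m
     - \<alpha> m / 2 * (norm (j (z ((real m - 1) * k))))\<^sup>2 + \<alpha> m / 2 * (norm (j (jump z m)))\<^sup>2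
     - \<beta> m / 2 * cell_energy z m"
      unfolding wcoeff dg_local_identity 0 1 ..
  qed
  finally show ?thesis .
qed

lemma weighted_norm:
  assumes z: "z \<in> Wn" and v: "pw q (\<lambda>m. wcoeff q (\<alpha> m) (\<beta> m) (Cf z m)) v"
    and b: "\<And>m. m \<in> {1..N} \<Longrightarrow> \<bar>\<alpha> m\<bar> \<le> c \<and> \<bar>\<alpha> m + \<beta> m\<bar> \<le> c" and c: "c \<ge> 0"
  shows "L2_norm T v \<le> sqrt (weight_const q) * c * L2_norm T z"
proof (rule power2_le_imp_le)
  have "(L2_norm T v)\<^sup>2 \<le> (\<Sum>m=1..N. k * (weight_const q * c\<^sup>2 * integral {0..1} (\<lambda>s. (norm (vpoly q (Cf z m) s))\<^sup>2)))"
    unfolding pw_L2_norm[OF v]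
    by (intro sum_mono mult_left_mono vpoly_wcoeff_bound) (use b k_pos in auto)
  also have "\<dots> = weight_const q * c\<^sup>2 * (L2_norm T z)\<^sup>2"
    unfolding pw_L2_norm[OF Wn_pw[OF z]] by (simp add: sum_distrib_left algebra_simps)
  finally show "(L2_norm T v)\<^sup>2 \<le> (sqrt (weight_const q) * c * L2_norm T z)\<^sup>2"
    using weight_const(1)[of q] by (simp add: power_mult_distrib)
qed (use c weight_const(1)[of q] in simp)

lemma Gam_weighted_le:
  assumes z: "z \<in> Wn" and v: "pw q (\<lambda>m. wcoeff q (\<alpha> m) (\<beta> m) (Cf z m)) v"
    and b: "\<And>m. m \<in> {1..N} \<Longrightarrow> \<bar>\<alpha> m\<bar> \<le> c \<and> \<bar>\<alpha> m + \<beta> m\<bar> \<le> c" and c: "c \<ge> 0"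
  shows "V_inner T (Gam z) v \<le> sqrt (weight_const q) * c * L2_norm T (Gam z) * L2_norm T z"
proof -
  have "V_inner T (Gam z) v \<le> L2_norm T (Gam z) * L2_norm T v"
    using V_inner_Cauchy_Schwarz[OF Gam_L2[OF z] pw_in_L2[OF v]] by simp
  also have "\<dots> \<le> L2_norm T (Gam z) * (sqrt (weight_const q) * c * L2_norm T z)"
    by (intro mult_left_mono weighted_norm[OF z v b c]) auto
  finally show ?thesis by (simp add: algebra_simps)
qed

lemma sum_node_telescope: "(\<Sum>m=1..n. f (real m) - f (real m - 1)) = f (real n) - f (0::real)" for f :: "real \<Rightarrow> real"
  by (induction n) auto

lemma energy_inequality:
  assumes z: "z \<in> Wn"
  shows "(norm (j (z T)))\<^sup>2 - (norm (j (z 0)))\<^sup>2 \<le> 2 * V_inner T (Gam z) z"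
proof -
  have v: "pw q (\<lambda>m. wcoeff q 1 0 (Cf z m)) z"
    using Wn_pw[OF z] by (simp add: pw_def vpoly_wcoeff)
  have "(norm (j (z T)))\<^sup>2 - (norm (j (z 0)))\<^sup>2
      = (\<Sum>m=1..N. (norm (j (z (real m * k))))\<^sup>2 - (norm (j (z ((real m - 1) * k))))\<^sup>2)"
    using sum_node_telescope[of "\<lambda>x. (norm (j (z (x * k))))\<^sup>2" N] N_k by simp
  also have "\<dots> \<le> (\<Sum>m=1..N. 2 * ((1 + 0) / 2 * node_energy z m
     - 1 / 2 * (norm (j (z ((real m - 1) * k))))\<^sup>2 + 1 / 2 * (norm (j (jump z m)))\<^sup>2
     - 0 / 2 * cell_energy z m))"
    by (rule sum_mono) simp
  also have "\<dots> = 2 * V_inner T (Gam z) z"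
    unfolding weighted_identity[OF z v] by (simp add: sum_distrib_left)
  finally show ?thesis .
qed

lemma final_value_bound:
  assumes z: "z \<in> Wn"
  shows "T * (norm (j (z T)))\<^sup>2 \<le> (onorm j)\<^sup>2 * (L2_norm T z)\<^sup>2 + 2 * sqrt (weight_const q) * T * L2_norm T (Gam z) * L2_norm T z"
proof -
  \<comment> \<open>Left value and increment of the weight \<open>t\<close> on cell
    \<open>m\<close>. Since this weight vanishes at 0, \<open>z 0\<close> does not enter, and the
    jumps have nonnegative factors and can be discarded.\<close>
  let ?\<alpha> = "\<lambda>m. (real m - 1) * k" and ?\<beta> = "\<lambda>m. k"
  define v where "v = pwf q (\<lambda>m. wcoeff q (?\<alpha> m) (?\<beta> m) (Cf z m))"
  have v: "pw q (\<lambda>m. wcoeff q (?\<alpha> m) (?\<beta> m) (Cf z m)) v" unfolding v_def by (rule pw_pwf)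
  have "T * (norm (j (z T)))\<^sup>2 - 0 * (norm (j (z 0)))\<^sup>2
    = (\<Sum>m=1..N. real m * k * node_energy z m - (real m - 1) * k * (norm (j (z ((real m - 1) * k))))\<^sup>2)"
    using sum_node_telescope[of "\<lambda>x. x * k * (norm (j (z (x * k))))\<^sup>2" N] N_k by simp
  also have "\<dots> \<le> (\<Sum>m=1..N. 2 * ((?\<alpha> m + ?\<beta> m) / 2 * node_energy z m
     - ?\<alpha> m / 2 * (norm (j (z ((real m - 1) * k))))\<^sup>2 + ?\<alpha> m / 2 * (norm (j (jump z m)))\<^sup>2
     - ?\<beta> m / 2 * cell_energy z m) + k * cell_energy z m)"
  proof (rule sum_mono)
    fix m assume "m \<in> {1..N}"
    then have "0 \<le> ?\<alpha> m * (norm (j (jump z m)))\<^sup>2" using k_pos by simp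
    then show "real m * k * node_energy z m - (real m - 1) * k * (norm (j (z ((real m - 1) * k))))\<^sup>2 \<le>
      2 * ((?\<alpha> m + ?\<beta> m) / 2 * node_energy z m
     - ?\<alpha> m / 2 * (norm (j (z ((real m - 1) * k))))\<^sup>2 + ?\<alpha> m / 2 * (norm (j (jump z m)))\<^sup>2
     - ?\<beta> m / 2 * cell_energy z m) + k * cell_energy z m"
      by (simp add: field_simps)
  qed
  also have "\<dots> = 2 * V_inner T (Gam z) v + (\<Sum>m=1..N. k * cell_energy z m)"
    unfolding weighted_identity[OF z v] by (simp only: sum.distrib sum_distrib_left)
  also have "(\<Sum>m=1..N. k * cell_energy z m) = (L2_norm T (\<lambda>t. j (z t)))\<^sup>2"
  proof -
    have "pw q (\<lambda>m i. j (Cf z m i)) (\<lambda>t. j (z t))"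
      using Wn_pw[OF z] by (simp add: pw_def vpoly_linear[OF j.linear])
    from pw_L2_norm[OF this] show ?thesis by simp
  qed
  also have "\<dots> \<le> (onorm j * L2_norm T z)\<^sup>2"
    using onorm[OF j] onorm_pos_le[OF j]
    by (intro power_mono L2_norm_mono[OF Wn_L2[OF z] L2_linear[OF Wn_L2[OF z] j]] AE_I2) auto
  also have "V_inner T (Gam z) v \<le> sqrt (weight_const q) * T * L2_norm T (Gam z) * L2_norm T z"
  proof (rule Gam_weighted_le[OF z v])
    fix m assume m: "m \<in> {1..N}"
    have "?\<alpha> m \<ge> 0" "?\<alpha> m \<le> real m * k" using m k_pos by auto
    moreover have "?\<alpha> m + ?\<beta> m = real m * k" by (simp add: algebra_simps)
    ultimately show "\<bar>?\<alpha> m\<bar> \<le> T \<and> \<bar>?\<alpha> m + ?\<beta> m\<bar> \<le> T" using node_le_T[of m] m k_pos by auto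
  qed (use T_pos in simp)
  finally show ?thesis by (simp add: power_mult_distrib algebra_simps)
qed

lemma sup_bound:
  assumes z: "z \<in> Wn" and t: "t \<in> {0..T}"
  shows "(norm (j (z t)))\<^sup>2 \<le> (real q + 1)\<^sup>2 * coeff_const q * ((norm (j (z 0)))\<^sup>2
     + 2 * sqrt (weight_const q) * L2_norm T (Gam z) * L2_norm T z)"
proof -
  let ?G = "sqrt (weight_const q) * L2_norm T (Gam z) * L2_norm T z"
  have B1: "1 \<le> (real q + 1)\<^sup>2 * coeff_const q" using mult_mono[of 1 "(real q + 1)\<^sup>2" 1 "coeff_const q"] coeff_const(1)[of q] by simp
  have G: "?G \<ge> 0" using weight_const(1)[of q] by simp
  show ?thesis
  proof (cases "t = 0")
    case True
    have "1 * (norm (j (z 0)))\<^sup>2 \<le> (real q + 1)\<^sup>2 * coeff_const q * ((norm (j (z 0)))\<^sup>2 + 2 * ?G)"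
      using B1 G by (intro mult_mono) auto
    then show ?thesis using True by (simp add: mult.assoc)
  next
    case False
    then have "t \<in> {0<..T}" using t by auto
    then obtain n where n: "n \<in> {1..N}" "t \<in> {(real n - 1) * k <.. real n * k}" by (rule in_hcell)
    \<comment> \<open>On cell \<open>n\<close> the weight falls from 1 to 0, so the value at its
      right end disappears and \<open>cell_energy\<close> appears with a positive sign. Being an
      integral over the reference interval, it bounds the supremum over the cell without any power
      of \<open>k\<close>.\<close>
    let ?\<alpha> = "\<lambda>m. if m \<le> n then 1 else 0 :: real" and ?\<beta> = "\<lambda>m. if m = n then -1 else 0 :: real"
    define v where "v = pwf q (\<lambda>m. wcoeff q (?\<alpha> m) (?\<beta> m) (Cf z m))"
    have v: "pw q (\<lambda>m. wcoeff q (?\<alpha> m) (?\<beta> m) (Cf z m)) v" unfolding v_def by (rule pw_pwf)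
    \<comment> \<open>What remains of the summands after doubling them and discarding the jumps;
      their sum telescopes up to the left end of cell \<open>n\<close> and ends with
      \<open>cell_energy z n\<close>.\<close>
    let ?d = "\<lambda>m. if m < n then node_energy z m - (norm (j (z ((real m - 1) * k))))\<^sup>2
        else if m = n then cell_energy z m - (norm (j (z ((real m - 1) * k))))\<^sup>2 else 0"
    obtain n' where n': "n = Suc n'" using n(1) by (cases n) auto
    have "(\<Sum>m=1..N. ?d m) = (\<Sum>m=1..n. ?d m)"
      using n(1) by (intro sum.mono_neutral_right) auto
    also have "\<dots> = (\<Sum>m=1..n'. ?d m) + ?d n" by (simp add: n')
    also have "(\<Sum>m=1..n'. ?d m) = (\<Sum>m=1..n'. (norm (j (z (real m * k))))\<^sup>2 - (norm (j (z ((real m - 1) * k))))\<^sup>2)"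
      by (rule sum.cong) (auto simp: n')
    also have "\<dots> = (norm (j (z (real n' * k))))\<^sup>2 - (norm (j (z 0)))\<^sup>2"
      using sum_node_telescope[of "\<lambda>x. (norm (j (z (x * k))))\<^sup>2" n'] by simp
    finally have "(\<Sum>m=1..N. ?d m) = cell_energy z n - (norm (j (z 0)))\<^sup>2" by (simp add: n')
    moreover have "(\<Sum>m=1..N. ?d m) \<le> 2 * V_inner T (Gam z) v"
      unfolding weighted_identity[OF z v] sum_distrib_left
      by (rule sum_mono) auto
    moreover have "V_inner T (Gam z) v \<le> sqrt (weight_const q) * 1 * L2_norm T (Gam z) * L2_norm T z"
      by (rule Gam_weighted_le[OF z v]) auto
    ultimately have P: "cell_energy z n \<le> (norm (j (z 0)))\<^sup>2 + 2 * ?G" by simp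
    have "norm (j (z t)) = norm (vpoly q (\<lambda>i. j (Cf z n i)) (loc n t))"
      by (simp add: Wn_expansion[OF z n] vpoly_linear[OF j.linear])
    also have "(\<dots>)\<^sup>2 \<le> (real q + 1)\<^sup>2 * coeff_const q * cell_energy z n"
      by (rule vpoly_sup_bound, rule loc_icell) (use n(2) in auto)
    also have "\<dots> \<le> (real q + 1)\<^sup>2 * coeff_const q * ((norm (j (z 0)))\<^sup>2 + 2 * ?G)"
      using P B1 by (intro mult_left_mono) auto
    finally show ?thesis by (simp add: mult.assoc)
  qed
qed

end

text \<open>\<eta> and \<gamma> stand for the norms of a discrete function and of its discrete
  derivative, \<open>g\<close> for their pairing, \<open>x0\<close> and \<open>xT\<close> for the
  norms of the end values, \<delta> for the data. The assumptions are circular: \<open>xT\<close> is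
  bounded through \<eta> and \<gamma>, and \<eta> through \<open>x0\<close> and \<open>xT\<close>.
  The circle closes because \<open>x0^2 - xT^2\<close> is at most
  \<open>2 * \<delta> * xT + \<delta>^2\<close>, so that the data enter every product.\<close>

lemma stability_algebra:
  fixes \<alpha> M K \<kappa> T B :: real
  assumes pos: "\<alpha> > 0" "M \<ge> 0" "\<kappa> \<ge> 0" "T > 0" "B \<ge> 0"
  shows "\<exists>C\<ge>0. \<forall>\<eta> \<gamma> \<delta> g x0 xT. 0 \<le> \<eta> \<longrightarrow> 0 \<le> \<gamma> \<longrightarrow> 0 \<le> \<delta> \<longrightarrow> 0 \<le> x0 \<longrightarrow> 0 \<le> xT \<longrightarrow>
     xT\<^sup>2 - x0\<^sup>2 \<le> 2 * g \<longrightarrow> g + \<alpha> * \<eta>\<^sup>2 \<le> \<delta> * \<eta> \<longrightarrow> \<gamma> \<le> M * \<eta> + \<delta> \<longrightarrow> x0 \<le> xT + \<delta> \<longrightarrow>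
     T * xT\<^sup>2 \<le> K\<^sup>2 * \<eta>\<^sup>2 + 2 * \<kappa> * T * \<gamma> * \<eta> \<longrightarrow>
     \<eta> \<le> C * \<delta> \<and> \<gamma> \<le> C * \<delta> \<and> (\<forall>s. s\<^sup>2 \<le> B * (x0\<^sup>2 + 2 * \<kappa> * \<gamma> * \<eta>) \<longrightarrow> s \<le> C * \<delta>)"
proof -
  \<comment> \<open>\<open>c\<close> is such that \<open>xT^2\<close> is at most
    \<open>c * (\<eta> + \<delta>)^2\<close>; \<open>C1\<close>, \<open>C2\<close>,
    \<open>C3\<close> and \<open>C4\<close> are the resulting factors of \<delta> for \<eta>,
    \<gamma>, \<open>x0\<close> and the supremum.\<close>
  define c where "c = K\<^sup>2 / T + 2 * \<kappa> * M + 2 * \<kappa>"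
  define C1 where "C1 = max 1 (2 * (1 + sqrt c) / \<alpha>)"
  define C2 where "C2 = M * C1 + 1"
  define C3 where "C3 = sqrt c * (C1 + 1) + 1"
  define C4 where "C4 = sqrt (B * (C3\<^sup>2 + 2 * \<kappa> * C2 * C1))"
  have c0: "c \<ge> 0" unfolding c_def using pos by (intro add_nonneg_nonneg) auto
  have C: "C1 \<ge> 1" "C2 \<ge> 0" "C3 \<ge> 0" using pos c0 unfolding C1_def C2_def C3_def by auto
  have C4: "C4 \<ge> 0" unfolding C4_def using pos C by simp
  show ?thesis
  proof (intro exI[of _ "max C1 (max C2 C4)"] conjI allI impI)
    show "0 \<le> max C1 (max C2 C4)" using C by simp
    fix \<eta> \<gamma> \<delta> g x0 xT :: real
    assume nn: "0 \<le> \<eta>" "0 \<le> \<gamma>" "0 \<le> \<delta>" "0 \<le> x0" "0 \<le> xT"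
      and 1: "xT\<^sup>2 - x0\<^sup>2 \<le> 2 * g" and 2: "g + \<alpha> * \<eta>\<^sup>2 \<le> \<delta> * \<eta>" and 3: "\<gamma> \<le> M * \<eta> + \<delta>"
      and 4: "x0 \<le> xT + \<delta>" and 5: "T * xT\<^sup>2 \<le> K\<^sup>2 * \<eta>\<^sup>2 + 2 * \<kappa> * T * \<gamma> * \<eta>"
    have "T * xT\<^sup>2 \<le> K\<^sup>2 * \<eta>\<^sup>2 + 2 * \<kappa> * T * (M * \<eta> + \<delta>) * \<eta>"
      by (rule order_trans[OF 5]) (use 3 nn pos in \<open>intro add_left_mono mult_right_mono mult_left_mono, auto\<close>)
    then have "xT\<^sup>2 \<le> (K\<^sup>2 * \<eta>\<^sup>2 + 2 * \<kappa> * T * (M * \<eta> + \<delta>) * \<eta>) / T"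
      using pos by (simp add: pos_le_divide_eq mult.commute)
    also have "\<dots> = (K\<^sup>2 / T + 2 * \<kappa> * M) * \<eta>\<^sup>2 + 2 * \<kappa> * (\<delta> * \<eta>)"
      using pos by (simp add: field_simps power2_eq_square)
    also have "\<dots> \<le> c * \<eta>\<^sup>2 + c * (\<delta> * \<eta>)"
    proof -
      have "K\<^sup>2 / T + 2 * \<kappa> * M \<le> c" "2 * \<kappa> \<le> c" using pos by (auto simp: c_def)
      then show ?thesis using nn by (intro add_mono mult_right_mono) auto
    qed
    also have "\<dots> \<le> c * (\<eta> + \<delta>)\<^sup>2"
      using c0 nn by (simp add: power2_sum algebra_simps)
    finally have "xT\<^sup>2 \<le> (sqrt c * (\<eta> + \<delta>))\<^sup>2" using c0 by (simp add: power_mult_distrib)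
    then have xT: "xT \<le> sqrt c * (\<eta> + \<delta>)" by (rule power2_le_imp_le) (use c0 nn in simp)
    have "x0\<^sup>2 \<le> (xT + \<delta>)\<^sup>2" using 4 nn by (intro power_mono) auto
    moreover have "(xT + \<delta>)\<^sup>2 = xT\<^sup>2 + 2 * (\<delta> * xT) + \<delta>\<^sup>2" by (simp add: power2_sum)
    ultimately have "\<alpha> * \<eta>\<^sup>2 \<le> \<delta> * \<eta> + \<delta> * xT + \<delta>\<^sup>2"
      using 1 2 zero_le_power2[of \<delta>] by linarith
    also have "\<dots> \<le> \<delta> * \<eta> + \<delta> * (sqrt c * (\<eta> + \<delta>)) + \<delta>\<^sup>2"
      using xT nn by (intro add_mono mult_left_mono) auto
    also have "\<dots> = (1 + sqrt c) * (\<delta> * \<eta> + \<delta>\<^sup>2)" by (simp add: algebra_simps power2_eq_square)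
    finally have main: "\<alpha> * \<eta>\<^sup>2 \<le> (1 + sqrt c) * (\<delta> * \<eta> + \<delta>\<^sup>2)" .
    \<comment> \<open>If \<eta> exceeds \<delta>, then \<open>\<delta>^2\<close> is at most
      \<open>\<delta> * \<eta>\<close> and one factor \<eta> cancels.\<close>
    have e: "\<eta> \<le> C1 * \<delta>"
    proof (cases "\<eta> \<le> \<delta>")
      case True
      then show ?thesis using C(1) nn mult_right_mono[of 1 C1 \<delta>] by simp
    next
      case False
      then have "\<delta>\<^sup>2 \<le> \<delta> * \<eta>" using nn by (simp add: power2_eq_square mult_left_mono)
      then have "(1 + sqrt c) * (\<delta> * \<eta> + \<delta>\<^sup>2) \<le> (1 + sqrt c) * (2 * (\<delta> * \<eta>))"
        using c0 by (intro mult_left_mono) auto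
      then have "\<eta> * (\<alpha> * \<eta>) \<le> \<eta> * (2 * (1 + sqrt c) * \<delta>)" using main by (simp add: power2_eq_square algebra_simps)
      then have "\<alpha> * \<eta> \<le> 2 * (1 + sqrt c) * \<delta>" using False nn by (auto dest: mult_left_le_imp_le)
      then have "\<eta> \<le> 2 * (1 + sqrt c) / \<alpha> * \<delta>" using pos by (simp add: field_simps)
      also have "\<dots> \<le> C1 * \<delta>" unfolding C1_def using nn by (intro mult_right_mono) auto
      finally show ?thesis .
    qed
    have g: "\<gamma> \<le> C2 * \<delta>"
    proof -
      have "M * \<eta> \<le> M * (C1 * \<delta>)" using e pos by (intro mult_left_mono) auto
      then show ?thesis using 3 by (simp add: C2_def algebra_simps)
    qed
    have x0: "x0 \<le> C3 * \<delta>"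
    proof -
      have "sqrt c * (\<eta> + \<delta>) \<le> sqrt c * (C1 * \<delta> + \<delta>)" using e c0 by (intro mult_left_mono) auto
      then show ?thesis using 4 xT by (simp add: C3_def algebra_simps)
    qed
    have "C1 * \<delta> \<le> max C1 (max C2 C4) * \<delta>" "C2 * \<delta> \<le> max C1 (max C2 C4) * \<delta>"
      using nn by (auto intro!: mult_right_mono)
    then show "\<eta> \<le> max C1 (max C2 C4) * \<delta>" "\<gamma> \<le> max C1 (max C2 C4) * \<delta>" using e g by linarith+
    fix s assume s: "s\<^sup>2 \<le> B * (x0\<^sup>2 + 2 * \<kappa> * \<gamma> * \<eta>)"
    also have "\<dots> \<le> B * ((C3 * \<delta>)\<^sup>2 + 2 * \<kappa> * (C2 * \<delta>) * (C1 * \<delta>))"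
      using pos nn e g x0 C by (intro mult_left_mono add_mono power_mono mult_mono) auto
    also have "\<dots> = (C4 * \<delta>)\<^sup>2"
      unfolding C4_def using pos C by (simp add: power_mult_distrib algebra_simps power2_eq_square)
    finally have "s \<le> C4 * \<delta>" by (rule power2_le_imp_le) (use C4 nn in simp)
    also have "\<dots> \<le> max C1 (max C2 C4) * \<delta>" using nn by (intro mult_right_mono) auto
    finally show "s \<le> max C1 (max C2 C4) * \<delta>" .
  qed
qed

text \<open>The constant has to be fixed before the subspace and the number of cells; therefore
  these are quantified inside, under the locale predicate \<open>dg\<close>.\<close>

lemma dg_stability:
  fixes j :: "'u::{real_inner,banach,second_countable_topology} \<Rightarrow> 'h::{real_inner,banach,second_countable_topology}"
  assumes "\<alpha> > 0" "M \<ge> 0" "T > 0"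
  shows "\<exists>C\<ge>0. \<forall>S N z \<delta>. dg S T N j \<longrightarrow> z \<in> Wn_space T N q S \<longrightarrow> 0 \<le> \<delta> \<longrightarrow>
     V_inner T (dg.Gam S T N j q z) z + \<alpha> * (L2_norm T z)\<^sup>2 \<le> \<delta> * L2_norm T z \<longrightarrow>
     L2_norm T (dg.Gam S T N j q z) \<le> M * L2_norm T z + \<delta> \<longrightarrow>
     norm (j (z 0)) \<le> norm (j (z T)) + \<delta> \<longrightarrow>
     L2_norm T z \<le> C * \<delta> \<and> L2_norm T (dg.Gam S T N j q z) \<le> C * \<delta> \<and> (\<forall>t\<in>{0..T}. norm (j (z t)) \<le> C * \<delta>)"
proof -
  have k: "sqrt (weight_const q) \<ge> 0" "(real q + 1)\<^sup>2 * coeff_const q \<ge> 0" using weight_const(1)[of q] coeff_const(1)[of q] by auto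
  obtain C where C0: "C \<ge> 0" and C: "\<And>\<eta> \<gamma> \<delta> g x0 xT. 0 \<le> \<eta> \<Longrightarrow> 0 \<le> \<gamma> \<Longrightarrow> 0 \<le> \<delta> \<Longrightarrow> 0 \<le> x0 \<Longrightarrow> 0 \<le> xT \<Longrightarrow>
     xT\<^sup>2 - x0\<^sup>2 \<le> 2 * g \<Longrightarrow> g + \<alpha> * \<eta>\<^sup>2 \<le> \<delta> * \<eta> \<Longrightarrow> \<gamma> \<le> M * \<eta> + \<delta> \<Longrightarrow> x0 \<le> xT + \<delta> \<Longrightarrow>
     T * xT\<^sup>2 \<le> (onorm j)\<^sup>2 * \<eta>\<^sup>2 + 2 * sqrt (weight_const q) * T * \<gamma> * \<eta> \<Longrightarrow>
     \<eta> \<le> C * \<delta> \<and> \<gamma> \<le> C * \<delta> \<and> (\<forall>s. s\<^sup>2 \<le> ((real q + 1)\<^sup>2 * coeff_const q) * (x0\<^sup>2 + 2 * sqrt (weight_const q) * \<gamma> * \<eta>) \<longrightarrow> s \<le> C * \<delta>)"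
    using stability_algebra[OF assms(1,2) k(1) assms(3) k(2), of "onorm j"] by blast
  show ?thesis
  proof (intro exI[of _ C] conjI allI impI C0)
    fix S N z \<delta>
    assume "dg S T N j" and z: "z \<in> Wn_space T N q S" and d: "0 \<le> \<delta>"
      and h2: "V_inner T (dg.Gam S T N j q z) z + \<alpha> * (L2_norm T z)\<^sup>2 \<le> \<delta> * L2_norm T z"
      and h1: "L2_norm T (dg.Gam S T N j q z) \<le> M * L2_norm T z + \<delta>"
      and h3: "norm (j (z 0)) \<le> norm (j (z T)) + \<delta>"
    interpret dg S T N j q by fact
    note * = C[OF L2_norm_nonneg L2_norm_nonneg d norm_ge_zero norm_ge_zero
        energy_inequality[OF z] h2 h1 h3 final_value_bound[OF z]]
    show "L2_norm T z \<le> C * \<delta>" "L2_norm T (Gam z) \<le> C * \<delta>" using * by auto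
    show "\<forall>t\<in>{0..T}. norm (j (z t)) \<le> C * \<delta>" using * sup_bound[OF z] by auto
  qed
qed

subsection \<open>Limits of discrete functions\<close>

context dg begin

text \<open>Against a constant the derivative integrates to the increment inside the cell, and the
  jump adds the increment across its left node, so only node values remain.\<close>

lemma Gam_const_pairing:
  assumes z: "z \<in> Wn" and d: "\<And>m. m \<in> {1..N} \<Longrightarrow> d m \<in> S"
    and v: "\<And>m t. m \<in> {1..N} \<Longrightarrow> t \<in> cell m \<Longrightarrow> v t = d m"
  shows "V_inner T (Gam z) v = (\<Sum>m=1..N. (j (z (real m * k)) - j (z ((real m - 1) * k))) \<bullet> j (d m))"
proof -
  let ?D = "\<lambda>m (i::nat). if i = 0 then d m else 0"
  have D: "vpoly q (?D m) s = d m" for m s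
  proof -
    have "vpoly q (?D m) s = (\<Sum>i\<in>{0}. s ^ i *\<^sub>R ?D m i)"
      unfolding vpoly_def by (rule sum.mono_neutral_right) auto
    then show ?thesis by simp
  qed
  have "pw q ?D v" by (simp add: pw_def v D)
  then have "V_inner T (Gam z) v = (\<Sum>m=1..N. integral {0..1} (\<lambda>s. vpoly' q (\<lambda>i. j (Cf z m i)) s
      \<bullet> vpoly q (\<lambda>i. j (?D m i)) s) + j (jump z m) \<bullet> j (?D m 0))"
    by (rule Gam_pairing[OF z, where D = ?D]) (use d subspace_0[OF sub] in auto)
  also have "\<dots> = (\<Sum>m=1..N. (j (z (real m * k)) - j (z ((real m - 1) * k))) \<bullet> j (d m))"
  proof (rule sum.cong[OF refl])
    fix m assume m: "m \<in> {1..N}"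
    let ?P = "vpoly q (\<lambda>i. j (Cf z m i))" and ?P' = "vpoly' q (\<lambda>i. j (Cf z m i))"
    have jD: "vpoly q (\<lambda>i. j (?D m i)) s = j (d m)" for s
      using vpoly_linear[OF j.linear, of q "?D m" s] D[of m s] by simp
    have "((\<lambda>s. ?P s \<bullet> j (d m)) has_vector_derivative ?P' s \<bullet> j (d m)) (at s within {0..1})" for s
      by (rule bounded_linear.has_vector_derivative[OF bounded_linear_inner_left vpoly_has_vector_derivative])
    from fundamental_theorem_of_calculus[OF _ this]
    have "integral {0..1} (\<lambda>s. ?P' s \<bullet> j (d m)) = ?P 1 \<bullet> j (d m) - ?P 0 \<bullet> j (d m)"
      by (intro integral_unique) simp
    moreover have "?P 1 = j (z (real m * k))"
      using Wn_expansion[OF z m, of "real m * k"] k_pos vpoly_linear[OF j.linear, of q "Cf z m" 1]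
      by (simp add: loc_def algebra_simps)
    moreover have "j (jump z m) = ?P 0 - j (z ((real m - 1) * k))" by (simp add: jump_def j.diff)
    ultimately show "integral {0..1} (\<lambda>s. ?P' s \<bullet> vpoly q (\<lambda>i. j (?D m i)) s) + j (jump z m) \<bullet> j (?D m 0)
      = (j (z (real m * k)) - j (z ((real m - 1) * k))) \<bullet> j (d m)"
      unfolding jD by (simp add: inner_diff_left)
  qed
  finally show ?thesis .
qed

text \<open>The factor \<open>sqrt k\<close> is the source of smallness when increments across a
  single cell are estimated.\<close>

lemma const_cell_norm:
  assumes n: "n \<in> {1..N}" and v: "\<And>m t. m \<in> {1..N} \<Longrightarrow> t \<in> cell m \<Longrightarrow> v t = (if m = n then x else (0::'a::real_normed_vector))"
  shows "v \<in> L2 T" "L2_norm T v = sqrt k * norm x"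
proof -
  let ?D = "\<lambda>m (i::nat). if m = n then x else 0"
  have D: "vpoly 0 (?D m) s = (if m = n then x else 0)" for m s by (simp add: vpoly_def)
  have p: "pw 0 ?D v" unfolding pw_def D using v by blast
  show "v \<in> L2 T" by (rule pw_in_L2[OF p])
  have "(L2_norm T v)\<^sup>2 = (\<Sum>m=1..N. k * integral {0..1} (\<lambda>s::real. (norm (vpoly 0 (?D m) s))\<^sup>2))"
    by (rule pw_L2_norm[OF p])
  also have "\<dots> = (\<Sum>m=1..N. if m = n then k * (norm x)\<^sup>2 else 0)"
    by (rule sum.cong) (auto simp: vpoly_def)
  also have "\<dots> = (sqrt k * norm x)\<^sup>2" using n k_pos by (simp add: power_mult_distrib)
  finally show "L2_norm T v = sqrt k * norm x"
    using k_pos by (simp add: power2_eq_iff_nonneg)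
qed

lemma continuous_vpoly_loc: "continuous (at t) (\<lambda>t. vpoly q c (loc m t))"
  for c :: "nat \<Rightarrow> 'a::real_normed_vector"
proof -
  have "continuous_on UNIV (\<lambda>t. vpoly q c (loc m t))"
    unfolding loc_def by (intro continuous_intros) (use k_pos in auto)
  then show ?thesis by (simp add: continuous_on_eq_continuous_at)
qed

lemma Wn_left_cont:
  assumes z: "z \<in> Wn" and t: "t \<in> {0<..T}"
  shows "(z \<longlongrightarrow> z t) (at t within {0..t})"
proof -
  obtain m where m: "m \<in> {1..N}" "t \<in> {(real m - 1) * k <.. real m * k}" using in_hcell[OF t] .
  have "((\<lambda>t. vpoly q (Cf z m) (loc m t)) \<longlongrightarrow> vpoly q (Cf z m) (loc m t)) (at t within {0..t})"
    using continuous_vpoly_loc[of t "Cf z m" m] unfolding continuous_at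
    by (rule tendsto_within_subset) simp
  moreover have "\<forall>\<^sub>F s in at t within {0..t}. vpoly q (Cf z m) (loc m s) = z s"
    unfolding eventually_at_topological
    by (rule exI[of _ "{(real m - 1) * k <..}"]) (use m Wn_expansion[OF z m(1)] in auto)
  ultimately show ?thesis
    unfolding Wn_expansion[OF z m] by (rule Lim_transform_eventually)
qed

lemma Wn_right_lim:
  assumes z: "z \<in> Wn" and t: "t \<in> {0..<T}"
  shows "\<exists>r. (z \<longlongrightarrow> r) (at t within {t..T})"
proof -
  \<comment> \<open>If \<open>t\<close> is a node, this is the cell to its right, whereas the
    ceiling would give the one to its left.\<close>
  define m where "m = Suc (nat \<lfloor>t / k\<rfloor>)"
  have p: "t / k \<ge> 0" using t k_pos by simp
  have rm: "real m = of_int \<lfloor>t / k\<rfloor> + 1" using p by (simp add: m_def)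
  have "t / k < real N" using t k_pos N_k by (simp add: field_simps)
  then have "\<lfloor>t / k\<rfloor> < int N" by (simp add: floor_less_iff)
  then have m: "m \<in> {1..N}" using p by (simp add: m_def) linarith
  have "real m - 1 \<le> t / k" "t / k < real m" unfolding rm by linarith+
  then have tm: "(real m - 1) * k \<le> t" "t < real m * k" using k_pos by (auto simp: field_simps)
  have "((\<lambda>t. vpoly q (Cf z m) (loc m t)) \<longlongrightarrow> vpoly q (Cf z m) (loc m t)) (at t within {t..T})"
    using continuous_vpoly_loc[of t "Cf z m" m] unfolding continuous_at
    by (rule tendsto_within_subset) simp
  moreover have "\<forall>\<^sub>F s in at t within {t..T}. vpoly q (Cf z m) (loc m s) = z s"
    unfolding eventually_at_topological
    by (rule exI[of _ "{..<real m * k}"]) (use m tm Wn_expansion[OF z m] in auto)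
  ultimately have "(z \<longlongrightarrow> vpoly q (Cf z m) (loc m t)) (at t within {t..T})"
    by (rule Lim_transform_eventually)
  then show ?thesis ..
qed

end

lemma V_inner_tendsto:
  fixes v :: "nat \<Rightarrow> real \<Rightarrow> 'u::{real_inner,second_countable_topology}"
  assumes g: "\<And>n. g n \<in> L2 T" "G \<in> L2 T" "(\<lambda>n. L2_norm T (\<lambda>t. g n t - G t)) \<longlonglongrightarrow> 0"
    and v: "\<And>n. v n \<in> L2 T" "V \<in> L2 T" "(\<lambda>n. L2_norm T (\<lambda>t. v n t - V t)) \<longlonglongrightarrow> 0"
  shows "(\<lambda>n. V_inner T (g n) (v n)) \<longlonglongrightarrow> V_inner T G V"
proof (rule LIM_zero_cancel, rule Lim_null_comparison)
  let ?a = "\<lambda>n. L2_norm T (\<lambda>t. g n t - G t)" and ?b = "\<lambda>n. L2_norm T (\<lambda>t. v n t - V t)"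
  show "\<forall>\<^sub>F n in sequentially. norm (V_inner T (g n) (v n) - V_inner T G V) \<le> ?a n * (L2_norm T V + ?b n) + L2_norm T G * ?b n"
  proof (rule always_eventually, rule allI)
    fix n
    have "V_inner T (g n) (v n) - V_inner T G V = V_inner T (\<lambda>t. g n t - G t) (v n) + V_inner T G (\<lambda>t. v n t - V t)"
      by (simp add: V_inner_diff_left[OF g(1,2) v(1)] V_inner_diff_right[OF v(1,2) g(2)])
    moreover have "\<bar>V_inner T (\<lambda>t. g n t - G t) (v n)\<bar> \<le> ?a n * L2_norm T (v n)"
      by (rule V_inner_Cauchy_Schwarz[OF L2_diff[OF g(1,2)] v(1)])
    moreover have "?a n * L2_norm T (v n) \<le> ?a n * (L2_norm T V + ?b n)"
      by (intro mult_left_mono L2_norm_le_add_diff v) auto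
    moreover have "\<bar>V_inner T G (\<lambda>t. v n t - V t)\<bar> \<le> L2_norm T G * ?b n"
      by (rule V_inner_Cauchy_Schwarz[OF g(2) L2_diff[OF v(1,2)]])
    ultimately show "norm (V_inner T (g n) (v n) - V_inner T G V) \<le> ?a n * (L2_norm T V + ?b n) + L2_norm T G * ?b n"
      by simp
  qed
  have "(\<lambda>n. ?a n * (L2_norm T V + ?b n) + L2_norm T G * ?b n) \<longlonglongrightarrow> 0 * (L2_norm T V + 0) + L2_norm T G * 0"
    by (intro tendsto_intros g v)
  then show "(\<lambda>n. ?a n * (L2_norm T V + ?b n) + L2_norm T G * ?b n) \<longlonglongrightarrow> 0" by simp
qed

lemma C1c_D:
  assumes "v \<in> C1c T"
  obtains v' where "\<And>t. (v has_vector_derivative v' t) (at t)" "continuous_on UNIV v'" "v 0 = 0" "v T = 0"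
    "\<And>t. vector_derivative v (at t) = v' t"
proof -
  obtain v' where v': "\<And>t. (v has_vector_derivative v' t) (at t)" "continuous_on UNIV v'"
    using assms by (auto simp: C1c_def C1_differentiable_on_def)
  have "{t. v t \<noteq> 0} \<subseteq> {0<..<T}" using assms closure_subset[of "{t. v t \<noteq> 0}"] by (auto simp: C1c_def)
  then have "v 0 = 0" "v T = 0" by auto
  with v' show ?thesis by (intro that[of v'] vector_derivative_at) auto
qed

lemma bounded_on_interval:
  fixes g :: "real \<Rightarrow> 'b::real_normed_vector"
  assumes "continuous_on {a..b} g"
  shows "\<exists>B\<ge>0. \<forall>t\<in>{a..b}. norm (g t) \<le> B"
proof -
  have "bounded (g ` {a..b})" using assms by (intro compact_imp_bounded compact_continuous_image) auto
  then obtain B where "\<forall>t\<in>{a..b}. norm (g t) \<le> B" by (auto simp: bounded_iff)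
  then show ?thesis by (intro exI[of _ "max 0 B"]) auto
qed

section \<open>Sequences of discretizations\<close>

locale dg_seq =
  fixes T :: real and j :: "'u::{real_inner,banach,second_countable_topology} \<Rightarrow> 'h::{real_inner,banach,second_countable_topology}"
    and q :: nat and U :: "nat \<Rightarrow> 'u set" and N :: "nat \<Rightarrow> nat"
  assumes dg: "\<And>n. dg (U n) T (N n) j" and dense: "closure (range j) = UNIV" and inj: "inj j"
    and U_lim: "lim_spaces UNIV norm U = UNIV" and N_lim: "filterlim N at_top sequentially"
begin

abbreviation "Gm n \<equiv> dg.Gam (U n) T (N n) j q"
abbreviation "kk n \<equiv> grid.k T (N n)"
abbreviation "Wnn n \<equiv> Wn_space T (N n) q (U n)"

sublocale D: dg "U n" T "N n" j q for n by (rule dg)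

lemma oproj_lim: "(\<lambda>n. oproj (U n) x) \<longlonglongrightarrow> x"
  by (rule oproj_tendsto[OF _ U_lim]) (rule D.fin_subspace_axioms)

lemma oproj_lim_seq:
  assumes "y \<longlonglongrightarrow> y0" shows "(\<lambda>n. oproj (U n) (y n)) \<longlonglongrightarrow> y0"
proof (rule LIM_zero_cancel, rule Lim_null_comparison)
  show "\<forall>\<^sub>F n in sequentially. norm (oproj (U n) (y n) - y0) \<le> norm (y n - y0) + norm (oproj (U n) y0 - y0)"
  proof (rule always_eventually, rule allI)
    fix n
    have "oproj (U n) (y n) - y0 = oproj (U n) (y n - y0) + (oproj (U n) y0 - y0)"
      by (simp add: linear_diff[OF bounded_linear.linear[OF D.bounded_linear_oproj]])
    then show "norm (oproj (U n) (y n) - y0) \<le> norm (y n - y0) + norm (oproj (U n) y0 - y0)"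
      by (smt (verit) D.oproj_norm_le norm_triangle_ineq)
  qed
  have "(\<lambda>n. norm (y n - y0) + norm (oproj (U n) y0 - y0)) \<longlonglongrightarrow> norm (y0 - y0) + norm (y0 - y0)"
    by (intro tendsto_intros assms oproj_lim)
  then show "(\<lambda>n. norm (y n - y0) + norm (oproj (U n) y0 - y0)) \<longlonglongrightarrow> 0" by simp
qed

lemma kk_lim: "kk \<longlonglongrightarrow> 0"
proof -
  have "filterlim (\<lambda>n. real (N n)) at_top sequentially"
    by (rule filterlim_compose[OF filterlim_real_sequentially N_lim])
  then have "(\<lambda>n. T / real (N n)) \<longlonglongrightarrow> 0"
    by (rule real_tendsto_divide_at_top[OF tendsto_const])
  then show ?thesis by (simp add: D.k_def)
qed

lemma inner_dense_0:
  assumes "\<And>x. y \<bullet> j x = 0" shows "y = 0"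
proof -
  have "closed {z. y \<bullet> z = 0}" by (intro closed_Collect_eq continuous_intros)
  then have "closure (range j) \<subseteq> {z. y \<bullet> z = 0}" by (rule closure_minimal[rotated]) (use assms in auto)
  then have "y \<bullet> y = 0" using dense by blast
  then show ?thesis by simp
qed

end

text \<open>The setting for showing that limits of elements of \<open>Xn_space\<close> lie in
  \<open>X_space\<close>. Of convergence in \<open>Z_norm\<close> it keeps the L2 convergence of the
  derivatives and the uniform convergence in H.\<close>

locale dg_limit = dg_seq +
  fixes z :: "nat \<Rightarrow> real \<Rightarrow> 'a" and G w
  assumes z: "\<And>n. z n \<in> Wnn n" and G: "G \<in> L2 T"
    and lim_G: "(\<lambda>n. L2_norm T (\<lambda>t. Gm n (z n) t - G t)) \<longlonglongrightarrow> 0"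
    and lim_w: "uniform_limit {0..T} (\<lambda>n t. j (z n t)) w sequentially"
begin

lemma lim_at: assumes "\<And>n. s n \<in> {0..T}" "(\<lambda>n. w (s n)) \<longlonglongrightarrow> y"
  shows "(\<lambda>n. j (z n (s n))) \<longlonglongrightarrow> y"
proof -
  have "(\<lambda>n. j (z n (s n)) - w (s n)) \<longlonglongrightarrow> 0"
  proof (rule tendstoI)
    fix e :: real assume "e > 0"
    from uniform_limitD[OF lim_w this]
    show "\<forall>\<^sub>F n in sequentially. dist (j (z n (s n)) - w (s n)) 0 < e"
      by eventually_elim (use assms(1) in \<open>auto simp: dist_norm\<close>)
  qed
  from tendsto_add[OF this assms(2)] show ?thesis by simp
qed

lemma Gam_norm_lim: "(\<lambda>n. L2_norm T (Gm n (z n)) * sqrt (kk n)) \<longlonglongrightarrow> 0"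
proof (rule Lim_null_comparison)
  show "\<forall>\<^sub>F n in sequentially. norm (L2_norm T (Gm n (z n)) * sqrt (kk n))
      \<le> (L2_norm T G + L2_norm T (\<lambda>t. Gm n (z n) t - G t)) * sqrt (kk n)"
    using L2_norm_le_add_diff[OF D.Gam_L2[OF z] G] less_imp_le[OF D.k_pos]
    by (intro always_eventually allI) (auto simp: abs_mult intro!: mult_right_mono)
  have "(\<lambda>n. (L2_norm T G + L2_norm T (\<lambda>t. Gm n (z n) t - G t)) * sqrt (kk n)) \<longlonglongrightarrow> (L2_norm T G + 0) * sqrt 0"
    by (intro tendsto_intros lim_G kk_lim)
  then show "(\<lambda>n. (L2_norm T G + L2_norm T (\<lambda>t. Gm n (z n) t - G t)) * sqrt (kk n)) \<longlonglongrightarrow> 0" by simp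
qed

lemma left_cont: "t \<in> {0..T} \<Longrightarrow> (w \<longlongrightarrow> w t) (at t within {0..t})"
proof (cases "t = 0")
  case False
  assume t: "t \<in> {0..T}"
  show ?thesis
  proof (rule swap_uniform_limit)
    show "\<forall>\<^sub>F n in sequentially. ((\<lambda>t. j (z n t)) \<longlongrightarrow> j (z n t)) (at t within {0..t})"
      using t False by (intro always_eventually allI D.j.tendsto D.Wn_left_cont[OF z]) auto
    show "(\<lambda>n. j (z n t)) \<longlonglongrightarrow> w t" by (rule lim_at[of "\<lambda>n. t"]) (use t in auto)
    show "uniform_limit {0..t} (\<lambda>n t. j (z n t)) w sequentially"
      by (rule uniform_limit_on_subset[OF lim_w]) (use t in auto)
  qed simp
qed (simp add: at_within_def)

text \<open>Uniform convergence makes the right limits of the \<open>z n\<close> a Cauchy sequence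
  and permits the interchange of limits. That the result equals \<open>w t\<close> cannot be seen in
  this way, since the \<open>z n\<close> jump at nodes.\<close>

lemma right_lim:
  assumes t: "t \<in> {0..<T}" shows "\<exists>L. (w \<longlongrightarrow> L) (at t within {t..T})"
proof -
  obtain r0 where r0: "\<And>n. (z n \<longlongrightarrow> r0 n) (at t within {t..T})"
    using D.Wn_right_lim[OF z t] by metis
  define r where "r n = j (r0 n)" for n
  have r: "((\<lambda>t. j (z n t)) \<longlongrightarrow> r n) (at t within {t..T})" for n
    unfolding r_def by (rule D.j.tendsto[OF r0])
  have nb: "at t within {t..T} \<noteq> bot" using t by (simp add: at_within_Icc_at_right)
  have "Cauchy r"
  proof (rule metric_CauchyI)
    fix e :: real assume e: "e > 0"
    then have "\<forall>\<^sub>F n in sequentially. \<forall>t\<in>{0..T}. dist (j (z n t)) (w t) < e / 4"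
      by (intro uniform_limitD[OF lim_w]) simp
    then obtain M where M: "\<And>n t. n \<ge> M \<Longrightarrow> t \<in> {0..T} \<Longrightarrow> dist (j (z n t)) (w t) < e / 4"
      unfolding eventually_sequentially by blast
    show "\<exists>M. \<forall>m\<ge>M. \<forall>n\<ge>M. dist (r m) (r n) < e"
    proof (intro exI[of _ M] allI impI)
      fix m n assume mn: "M \<le> m" "M \<le> n"
      have "dist (r m) (r n) \<le> e / 2"
      proof (rule tendsto_upperbound[OF tendsto_dist[OF r r] _ nb])
        have "dist (j (z m s)) (j (z n s)) \<le> e / 2" if "s \<in> {t..T}" for s
          using M[OF mn(1), of s] M[OF mn(2), of s] that t dist_triangle_half_r[of "w s" "j (z m s)" "e/2" "j (z n s)"]
          by (auto simp: dist_commute)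
        then show "\<forall>\<^sub>F s in at t within {t..T}. dist (j (z m s)) (j (z n s)) \<le> e / 2"
          by (auto simp: eventually_at_filter)
      qed
      then show "dist (r m) (r n) < e" using e by simp
    qed
  qed
  then obtain L where L: "r \<longlonglongrightarrow> L" using Cauchy_convergent convergent_def by blast
  have "(w \<longlongrightarrow> L) (at t within {t..T})"
  proof (rule swap_uniform_limit[OF _ L])
    show "\<forall>\<^sub>F n in sequentially. ((\<lambda>t. j (z n t)) \<longlongrightarrow> r n) (at t within {t..T})" using r by simp
    show "uniform_limit {t..T} (\<lambda>n t. j (z n t)) w sequentially"
      by (rule uniform_limit_on_subset[OF lim_w]) (use t in auto)
  qed simp
  then show ?thesis ..
qed

text \<open>Across the cell to the right of \<open>t\<close> the increment of \<open>z n\<close>, tested with a fixed \<open>x\<close>, is the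
  pairing of \<open>Gm n (z n)\<close> with a function supported on this cell, hence tends to zero.\<close>

lemma right_cont:
  assumes t: "t \<in> {0..<T}" shows "(w \<longlongrightarrow> w t) (at t within {t..T})"
proof -
  obtain L where L: "(w \<longlongrightarrow> L) (at t within {t..T})" using right_lim[OF t] by blast
  \<comment> \<open>Selects the cell with \<open>a n \<le> t < b n\<close>. Left continuity is
    applied at \<open>a n\<close>, which may equal \<open>t\<close>, and the right limit at
    \<open>b n\<close>, which never does.\<close>
  define i where "i n = nat \<lfloor>t / kk n\<rfloor>" for n
  define a b where "a n = real (i n) * kk n" and "b n = real (Suc (i n)) * kk n" for n
  have ri: "real (i n) \<le> t / kk n" "t / kk n < real (i n) + 1" for n
  proof -
    have "t / kk n \<ge> 0" using t D.k_pos[of n] by simp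
    then have "real (i n) = of_int \<lfloor>t / kk n\<rfloor>" by (simp add: i_def)
    then show "real (i n) \<le> t / kk n" "t / kk n < real (i n) + 1" by linarith+
  qed
  have ab: "a n \<le> t" "t < b n" "b n = a n + kk n" for n
    using ri[of n] D.k_pos[of n] by (auto simp: a_def b_def field_simps)
  have iN: "Suc (i n) \<in> {1..N n}" for n
  proof -
    have "t / kk n < real (N n)" using t D.k_pos[of n] D.N_k[of n] by (simp add: field_simps)
    then have "real (i n) < real (N n)" using ri(1)[of n] by linarith
    then show ?thesis by simp
  qed
  have aT: "a n \<in> {0..T}" and bT: "b n \<in> {0..T}" for n
    using ab[of n] t D.node_le_T[of "Suc (i n)" n] iN[of n] D.k_pos[of n]
    by (auto simp: a_def b_def)
  have kl: "(\<lambda>n. t - kk n) \<longlonglongrightarrow> t" "(\<lambda>n. t + kk n) \<longlonglongrightarrow> t"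
    using tendsto_diff[OF tendsto_const[of t] kk_lim] tendsto_add[OF tendsto_const[of t] kk_lim] by auto
  have al: "a \<longlonglongrightarrow> t"
  proof (rule tendsto_sandwich[OF _ _ kl(1) tendsto_const])
    have "t - kk n \<le> a n" for n using ab(2,3)[of n] by linarith
    then show "\<forall>\<^sub>F n in sequentially. t - kk n \<le> a n" by (intro always_eventually allI)
  qed (use ab in \<open>auto intro!: always_eventually\<close>)
  have bl: "b \<longlonglongrightarrow> t"
  proof (rule tendsto_sandwich[OF _ _ tendsto_const kl(2)])
    have "b n \<le> t + kk n" "t \<le> b n" for n using ab[of n] by linarith+
    then show "\<forall>\<^sub>F n in sequentially. b n \<le> t + kk n" "\<forall>\<^sub>F n in sequentially. t \<le> b n"
      by (intro always_eventually allI; simp)+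
  qed
  have wa: "(\<lambda>n. w (a n)) \<longlonglongrightarrow> w t"
  proof -
    have "continuous (at t within {0..t}) w" using left_cont t by (simp add: continuous_within)
    then show ?thesis
      using al aT ab(1) by (auto simp: continuous_within_sequentially o_def)
  qed
  have wb: "(\<lambda>n. w (b n)) \<longlonglongrightarrow> L"
  proof (rule filterlim_compose[OF L])
    have "b n \<noteq> t" "b n \<in> {t..T}" for n using ab(2)[of n] bT[of n] by auto
    then show "filterlim b (at t within {t..T}) sequentially"
      by (simp add: filterlim_at bl)
  qed
  have d: "(\<lambda>n. j (z n (b n)) - j (z n (a n))) \<longlonglongrightarrow> L - w t"
    by (intro tendsto_diff lim_at aT bT wa wb)
  \<comment> \<open>Test functions must take values in \<open>U n\<close>, so \<open>x\<close> is
    replaced by its projections, which converge to it.\<close>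
  have "(L - w t) \<bullet> j x = 0" for x
  proof -
    let ?x = "\<lambda>n. oproj (U n) x"
    have "(\<lambda>n. (j (z n (b n)) - j (z n (a n))) \<bullet> j (?x n)) \<longlonglongrightarrow> (L - w t) \<bullet> j x"
      by (intro tendsto_inner d D.j.tendsto oproj_lim)
    moreover have "(\<lambda>n. (j (z n (b n)) - j (z n (a n))) \<bullet> j (?x n)) \<longlonglongrightarrow> 0"
    proof (rule Lim_null_comparison)
      show "\<forall>\<^sub>F n in sequentially. norm ((j (z n (b n)) - j (z n (a n))) \<bullet> j (?x n))
         \<le> (L2_norm T (Gm n (z n)) * sqrt (kk n)) * norm x"
      proof (rule always_eventually, rule allI)
        fix n
        let ?m = "Suc (i n)"
        define d where "d m = (if m = ?m then ?x n else 0)" for m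
        define v where "v = grid.pwf T (N n) 0 (\<lambda>m i. d m)"
        have v: "v t = d m" if "m \<in> {1..N n}" "t \<in> grid.cell T (N n) m" for m t
          using D.pwD[OF D.pw_pwf[of n 0 "\<lambda>m i. d m"] that] unfolding v_def by (simp add: vpoly_def)
        have "V_inner T (Gm n (z n)) v = (\<Sum>m=1..N n. (j (z n (real m * kk n)) - j (z n ((real m - 1) * kk n))) \<bullet> j (d m))"
          by (rule D.Gam_const_pairing[OF z _ v]) (auto simp: d_def subspace_0[OF D.sub])
        also have "\<dots> = (\<Sum>m\<in>{?m}. (j (z n (real m * kk n)) - j (z n ((real m - 1) * kk n))) \<bullet> j (d m))"
          using iN[of n] by (intro sum.mono_neutral_right) (auto simp: d_def D.j.zero)
        also have "\<dots> = (j (z n (b n)) - j (z n (a n))) \<bullet> j (?x n)" by (simp add: a_def b_def d_def)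
        finally have eq: "(j (z n (b n)) - j (z n (a n))) \<bullet> j (?x n) = V_inner T (Gm n (z n)) v" ..
        have vn: "v \<in> L2 T" "L2_norm T v = sqrt (kk n) * norm (?x n)"
          using D.const_cell_norm[OF iN, where v=v and x="?x n"] v by (auto simp: d_def)
        have "norm (V_inner T (Gm n (z n)) v) \<le> L2_norm T (Gm n (z n)) * (sqrt (kk n) * norm (?x n))"
          using V_inner_Cauchy_Schwarz[OF D.Gam_L2[OF z] vn(1)] vn(2) by simp
        also have "\<dots> \<le> L2_norm T (Gm n (z n)) * (sqrt (kk n) * norm x)"
          using D.k_pos[of n] by (intro mult_left_mono D.oproj_norm_le) auto
        finally show "norm ((j (z n (b n)) - j (z n (a n))) \<bullet> j (?x n))
         \<le> (L2_norm T (Gm n (z n)) * sqrt (kk n)) * norm x" unfolding eq by (simp add: mult.assoc)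
      qed
      show "(\<lambda>n. (L2_norm T (Gm n (z n)) * sqrt (kk n)) * norm x) \<longlonglongrightarrow> 0"
        using tendsto_mult[OF Gam_norm_lim tendsto_const[of "norm x"]] by simp
    qed
    ultimately show ?thesis by (rule LIMSEQ_unique)
  qed
  then have "L = w t" using inner_dense_0[of "L - w t"] by simp
  with L show ?thesis by simp
qed

lemma limit_continuous: "continuous_on {0..T} w"
  unfolding continuous_on_def
proof
  fix t assume t: "t \<in> {0..T}"
  have "(w \<longlongrightarrow> w t) (at t within {t..T})"
  proof (cases "t = T")
    case False then show ?thesis using t by (intro right_cont) auto
  qed (simp add: at_within_def)
  with left_cont[OF t] have "(w \<longlongrightarrow> w t) (at t within ({0..t} \<union> {t..T}))"
    by (simp add: Lim_within_Un)
  moreover have "{0..t} \<union> {t..T} = {0..T}" using t by auto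
  ultimately show "(w \<longlongrightarrow> w t) (at t within {0..T})" by simp
qed

text \<open>Summation by parts on the grid: the pairing with samples of \<open>v\<close> at the left
  nodes turns into values of \<open>z n\<close> at the right nodes against increments of
  \<open>v\<close>, and the boundary terms vanish with \<open>v\<close> at 0 and
  \<open>T\<close>.\<close>

lemma limit_weak_deriv:
  assumes v: "v \<in> C1c T"
  shows "V_inner T G v = - H_inner T w (\<lambda>t. j (vector_derivative v (at t)))"
proof -
  obtain v' where v': "\<And>t. (v has_vector_derivative v' t) (at t)" "continuous_on UNIV v'"
    and v0: "v 0 = 0" "v T = 0" and vd: "\<And>t. vector_derivative v (at t) = v' t"
    using C1c_D[OF v] by blast
  have vc: "continuous_on UNIV v"
    using v'(1) by (meson continuous_at_imp_continuous_on has_vector_derivative_continuous)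
  have vL: "v \<in> L2 T" by (rule L2_continuous[OF continuous_on_subset[OF vc]]) simp
  \<comment> \<open>The right end of the cell containing \<open>t\<close>; its left end is then
    \<open>\<sigma> n t - kk n\<close>.\<close>
  define \<sigma> where "\<sigma> n t = real (nat \<lceil>t / kk n\<rceil>) * kk n" for n t
  have \<sigma>cell: "\<sigma> n t = real m * kk n" if "t \<in> grid.cell T (N n) m" for n m t
  proof -
    have "nat \<lceil>t / kk n\<rceil> = m" by (rule D.cell_index) (use that in \<open>auto simp: D.cell_def\<close>)
    then show ?thesis by (simp add: \<sigma>_def)
  qed
  have \<sigma>: "\<sigma> n t \<in> {0..T}" "t \<le> \<sigma> n t" "\<sigma> n t - kk n < t" "\<sigma> n t - kk n \<in> {0..T}" if t: "t \<in> {0<..T}" for n t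
  proof -
    obtain m where m: "m \<in> {1..N n}" "t \<in> {(real m - 1) * kk n <.. real m * kk n}" using D.in_hcell[OF t] .
    have e: "\<sigma> n t = real m * kk n" using D.cell_index[OF m(2)] by (simp add: \<sigma>_def)
    show "t \<le> \<sigma> n t" "\<sigma> n t - kk n < t" using m(2) by (auto simp: e algebra_simps)
    have "(real m - 1) * kk n \<ge> 0" using m D.k_pos[of n] by simp
    then show "\<sigma> n t \<in> {0..T}" "\<sigma> n t - kk n \<in> {0..T}"
      using D.node_le_T[of m n] m D.k_pos[of n] by (auto simp: e algebra_simps)
  qed
  have \<sigma>lim: "(\<lambda>n. \<sigma> n t) \<longlonglongrightarrow> t" "(\<lambda>n. \<sigma> n t - kk n) \<longlonglongrightarrow> t" if t: "t \<in> {0<..T}" for t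
  proof -
    have kl: "(\<lambda>n. t + kk n) \<longlonglongrightarrow> t" using tendsto_add[OF tendsto_const[of t] kk_lim] by auto
    have "\<sigma> n t \<le> t + kk n" for n using \<sigma>(3)[OF t, of n] by simp
    then show 1: "(\<lambda>n. \<sigma> n t) \<longlonglongrightarrow> t"
      by (intro tendsto_sandwich[OF _ _ tendsto_const kl] always_eventually allI) (use \<sigma>[OF t] in auto)
    show "(\<lambda>n. \<sigma> n t - kk n) \<longlonglongrightarrow> t" using tendsto_diff[OF 1 kk_lim] by simp
  qed
  define d where "d n m = oproj (U n) (v ((real m - 1) * kk n))" for n m
  define vn where "vn n t = oproj (U n) (v (\<sigma> n t - kk n))" for n t
  have vnc: "vn n t = d n m" if "t \<in> grid.cell T (N n) m" for n m t
    unfolding vn_def d_def \<sigma>cell[OF that] by (simp add: algebra_simps)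
  have vnL: "vn n \<in> L2 T" for n
    by (rule D.pw_L2[of n "\<lambda>m s. d n m"]) (auto simp: vnc)
  \<comment> \<open>Increments of the test function are integrals of \<open>v'\<close> over the
    cells, so the sum obtained by parts becomes a single integral, with \<open>z n\<close> frozen at
    the right ends.\<close>
  define F where "F n t = j (z n (\<sigma> n t)) \<bullet> j (oproj (U n) (v' t))" for n t
  have blp: "bounded_linear (\<lambda>y. x \<bullet> j (oproj (U n) y))" for x n
    using bounded_linear_compose[OF bounded_linear_inner_right bounded_linear_compose[OF D.j D.bounded_linear_oproj]] .
  have main: "V_inner T (Gm n (z n)) (vn n) = - (LINT t|I0 T. F n t)" and FM: "F n \<in> borel_measurable (I0 T)" for n
  proof -
    define f where "f x = j (z n (x * kk n))" for x
    define h where "h x = j (oproj (U n) (v (x * kk n)))" for x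
    have h0: "h 0 = 0" "h (real (N n)) = 0"
      using v0 by (simp_all add: h_def D.N_k linear_0[OF bounded_linear.linear[OF D.bounded_linear_oproj]] D.j.zero)
    have vs: "continuous_on {0..1} (\<lambda>s. v' ((real m - 1) * kk n + kk n * s))" for m
      by (rule continuous_on_compose2[OF v'(2)]) (auto intro!: continuous_intros)
    have hc: "continuous_on {0..1} (\<lambda>s. f (real m) \<bullet> j (oproj (U n) (v' ((real m - 1) * kk n + kk n * s))))" for m
      by (rule continuous_on_compose2[OF linear_continuous_on[OF blp] vs subset_UNIV])
    have parts: "(\<Sum>m=1..M. (f (real m) - f (real m - 1)) \<bullet> h (real m - 1))
       = f (real M) \<bullet> h (real M) - f 0 \<bullet> h 0 - (\<Sum>m=1..M. f (real m) \<bullet> (h (real m) - h (real m - 1)))" for M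
      by (induction M) (auto simp: inner_diff_left inner_diff_right)
    have "V_inner T (Gm n (z n)) (vn n) = (\<Sum>m=1..N n. (j (z n (real m * kk n)) - j (z n ((real m - 1) * kk n))) \<bullet> j (d n m))"
    proof (rule D.Gam_const_pairing[OF z])
      show "d n m \<in> U n" for m unfolding d_def by (rule D.oproj_in)
      show "vn n t = d n m" if "t \<in> grid.cell T (N n) m" for m t by (rule vnc[OF that])
    qed
    also have "\<dots> = (\<Sum>m=1..N n. (f (real m) - f (real m - 1)) \<bullet> h (real m - 1))"
      by (simp add: d_def f_def h_def)
    also have "(\<Sum>m=1..N n. (f (real m) - f (real m - 1)) \<bullet> h (real m - 1)) = - (\<Sum>m=1..N n. f (real m) \<bullet> (h (real m) - h (real m - 1)))"
      unfolding parts h0 by simp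
    also have "(\<Sum>m=1..N n. f (real m) \<bullet> (h (real m) - h (real m - 1)))
       = (\<Sum>m=1..N n. kk n * integral {0..1} (\<lambda>s. f (real m) \<bullet> j (oproj (U n) (v' ((real m - 1) * kk n + kk n * s)))))"
    proof (rule sum.cong[OF refl])
      fix m assume m: "m \<in> {1..N n}"
      let ?l = "\<lambda>y. f (real m) \<bullet> j (oproj (U n) y)"
      have "((\<lambda>s. ?l (v ((real m - 1) * kk n + kk n * s))) has_vector_derivative
          ?l (kk n *\<^sub>R v' ((real m - 1) * kk n + kk n * s))) (at s within {0..1})" for s
      proof (rule bounded_linear.has_vector_derivative[OF blp])
        have "((\<lambda>s. (real m - 1) * kk n + kk n * s) has_vector_derivative kk n) (at s within {0..1})"
          unfolding has_real_derivative_iff_has_vector_derivative[symmetric] by (auto intro!: derivative_eq_intros)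
        from vector_diff_chain_within[OF this has_vector_derivative_at_within[OF v'(1)]]
        show "((\<lambda>s. v ((real m - 1) * kk n + kk n * s)) has_vector_derivative kk n *\<^sub>R v' ((real m - 1) * kk n + kk n * s)) (at s within {0..1})"
          by (simp add: o_def)
      qed
      from fundamental_theorem_of_calculus[OF _ this]
      have "integral {0..1} (\<lambda>s. ?l (kk n *\<^sub>R v' ((real m - 1) * kk n + kk n * s))) = ?l (v (real m * kk n)) - ?l (v ((real m - 1) * kk n))"
        by (intro integral_unique) (simp add: algebra_simps)
      moreover have "?l (kk n *\<^sub>R y) = kk n * ?l y" for y
        using linear_scale[OF bounded_linear.linear[OF blp[of "f (real m)" n]], of "kk n" y] by simp
      ultimately show "f (real m) \<bullet> (h (real m) - h (real m - 1)) = kk n * integral {0..1} (\<lambda>s. ?l (v' ((real m - 1) * kk n + kk n * s)))"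
        by (simp add: h_def inner_diff_right)
    qed
    also have "\<dots> = (LINT t|I0 T. F n t)"
    proof (rule D.pw_integral(2)[symmetric])
      fix m t assume m: "m \<in> {1..N n}" and t: "t \<in> grid.cell T (N n) m"
      have "(real m - 1) * kk n + kk n * grid.loc T (N n) m t = t" using D.k_pos[of n] by (simp add: D.loc_def)
      then show "F n t = f (real m) \<bullet> j (oproj (U n) (v' ((real m - 1) * kk n + kk n * grid.loc T (N n) m t)))"
        by (simp add: F_def f_def \<sigma>cell[OF t])
    qed (rule hc)
    finally show "V_inner T (Gm n (z n)) (vn n) = - (LINT t|I0 T. F n t)" .
    show "F n \<in> borel_measurable (I0 T)"
    proof (rule D.pw_measurable)
      fix m t assume m: "m \<in> {1..N n}" and t: "t \<in> grid.cell T (N n) m"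
      have "(real m - 1) * kk n + kk n * grid.loc T (N n) m t = t" using D.k_pos[of n] by (simp add: D.loc_def)
      then show "F n t = f (real m) \<bullet> j (oproj (U n) (v' ((real m - 1) * kk n + kk n * grid.loc T (N n) m t)))"
        by (simp add: F_def f_def \<sigma>cell[OF t])
    qed (rule hc)
  qed
  have AE0: "AE t in I0 T. t \<in> {0<..T}"
  proof -
    have "AE t in I0 T. t \<notin> {0}" by (rule AE_I0_not_null) simp
    then have "AE t in I0 T. t \<notin> {0} \<and> t \<in> {0..T}" by (rule AE_conjI) (rule AE_I2, simp)
    then show ?thesis by eventually_elim auto
  qed
  obtain Bv where Bv: "\<And>t. t \<in> {0..T} \<Longrightarrow> norm (v t) \<le> Bv"
    using bounded_on_interval[OF continuous_on_subset[OF vc subset_UNIV]] by blast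
  obtain Bd where Bd: "Bd \<ge> 0" "\<And>t. t \<in> {0..T} \<Longrightarrow> norm (v' t) \<le> Bd"
    using bounded_on_interval[OF continuous_on_subset[OF v'(2) subset_UNIV]] by blast
  obtain Bw where Bw: "\<And>t. t \<in> {0..T} \<Longrightarrow> norm (w t) \<le> Bw" "Bw \<ge> 0"
    using bounded_on_interval[OF limit_continuous] by blast
  have vnlim: "(\<lambda>n. L2_norm T (\<lambda>t. vn n t - v t)) \<longlonglongrightarrow> 0"
  proof (rule tendsto_L2_norm_dominated[where w="\<lambda>t. 1::real" and C="2 * Bv"])
    show "(\<lambda>t. vn n t - v t) \<in> borel_measurable (I0 T)" for n by (intro L2_measurable L2_diff vnL vL)
    show "AE t in I0 T. (\<lambda>n. vn n t - v t) \<longlonglongrightarrow> 0"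
      using AE0
    proof eventually_elim
      case (elim t)
      have "(\<lambda>n. v (\<sigma> n t - kk n)) \<longlonglongrightarrow> v t"
        using continuous_on_tendsto_compose[OF vc \<sigma>lim(2)[OF elim]] by simp
      from oproj_lim_seq[OF this] show ?case unfolding vn_def by (rule LIM_zero)
    qed
    show "AE t in I0 T. norm (vn n t - v t) \<le> 2 * Bv * norm (1::real)" for n
      using AE0
    proof eventually_elim
      case (elim t)
      have "norm (vn n t) \<le> Bv" unfolding vn_def
        using D.oproj_norm_le Bv[OF \<sigma>(4)[OF elim]] order_trans by blast
      moreover have "norm (v t) \<le> Bv" using Bv[of t] elim by auto
      ultimately show ?case using norm_triangle_ineq4[of "vn n t" "v t"] by simp
    qed
  qed (simp add: L2_continuous)
  have 1: "(\<lambda>n. V_inner T (Gm n (z n)) (vn n)) \<longlonglongrightarrow> V_inner T G v"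
    by (rule V_inner_tendsto[OF D.Gam_L2[OF z] G lim_G vnL vL vnlim])
  have "\<forall>\<^sub>F n in sequentially. \<forall>t\<in>{0..T}. dist (j (z n t)) (w t) < 1"
    by (intro uniform_limitD[OF lim_w]) simp
  \<comment> \<open>Uniform convergence bounds \<open>z n\<close> only from some index on, so
    dominated convergence is applied to the shifted sequence.\<close>
  then obtain n0 where n0: "\<And>n t. n \<ge> n0 \<Longrightarrow> t \<in> {0..T} \<Longrightarrow> dist (j (z n t)) (w t) < 1"
    unfolding eventually_sequentially by blast
  have zb: "norm (j (z n t)) \<le> Bw + 1" if "n \<ge> n0" "t \<in> {0..T}" for n t
    using n0[OF that] Bw(1)[OF that(2)] norm_triangle_ineq2[of "j (z n t)" "w t"] by (simp add: dist_norm)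
  have "(\<lambda>n. LINT t|I0 T. F (n + n0) t) \<longlonglongrightarrow> (LINT t|I0 T. w t \<bullet> j (v' t))"
  proof (rule integral_dominated_convergence)
    show "(\<lambda>t. w t \<bullet> j (v' t)) \<in> borel_measurable (I0 T)"
      by (intro continuous_on_imp_measurable_I continuous_intros limit_continuous
          continuous_on_compose2[OF linear_continuous_on[OF D.j]] continuous_on_subset[OF v'(2)]) auto
    show "F (n + n0) \<in> borel_measurable (I0 T)" for n by (rule FM)
    show "integrable (I0 T) (\<lambda>t. (Bw + 1) * (onorm j * Bd))"
      using finite_measure_I0[of T] by (rule finite_measure.integrable_const)
    show "AE t in I0 T. (\<lambda>n. F (n + n0) t) \<longlonglongrightarrow> w t \<bullet> j (v' t)"
      using AE0
    proof eventually_elim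
      case (elim t)
      have "(\<lambda>n. w (\<sigma> n t)) \<longlonglongrightarrow> w t"
        using continuous_on_tendsto_compose[OF limit_continuous \<sigma>lim(1)[OF elim]] elim \<sigma>(1)[OF elim] by auto
      then have "(\<lambda>n. F n t) \<longlonglongrightarrow> w t \<bullet> j (v' t)"
        unfolding F_def by (intro tendsto_inner lim_at \<sigma>(1)[OF elim] D.j.tendsto oproj_lim)
      then show ?case by (rule LIMSEQ_ignore_initial_segment)
    qed
    show "AE t in I0 T. norm (F (n + n0) t) \<le> (Bw + 1) * (onorm j * Bd)" for n
      using AE0
    proof eventually_elim
      case (elim t)
      let ?n = "n + n0"
      have "norm (F ?n t) \<le> norm (j (z ?n (\<sigma> ?n t))) * norm (j (oproj (U ?n) (v' t)))"
        unfolding F_def real_norm_def by (rule Cauchy_Schwarz_ineq2)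
      also have "\<dots> \<le> (Bw + 1) * (onorm j * Bd)"
      proof (rule mult_mono)
        have "norm (j (oproj (U ?n) (v' t))) \<le> onorm j * norm (oproj (U ?n) (v' t))" by (rule onorm[OF D.j])
        also have "\<dots> \<le> onorm j * Bd"
          using onorm_pos_le[OF D.j] D.oproj_norm_le[of ?n "v' t"] Bd(2)[of t] elim
          by (intro mult_left_mono) auto
        finally show "norm (j (oproj (U ?n) (v' t))) \<le> onorm j * Bd" .
      qed (use zb[OF _ \<sigma>(1)[OF elim]] Bw in auto)
      finally show ?case .
    qed
  qed
  then have "(\<lambda>n. LINT t|I0 T. F n t) \<longlonglongrightarrow> (LINT t|I0 T. w t \<bullet> j (v' t))" by (rule LIMSEQ_offset)
  then have "(\<lambda>n. V_inner T (Gm n (z n)) (vn n)) \<longlonglongrightarrow> - (LINT t|I0 T. w t \<bullet> j (v' t))"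
    unfolding main by (rule tendsto_minus)
  with 1 have "V_inner T G v = - (LINT t|I0 T. w t \<bullet> j (v' t))" by (rule LIMSEQ_unique)
  then show ?thesis by (simp add: H_inner_def vd)
qed

end

subsection \<open>Bernstein--Kantorovich operators\<close>

text \<open>For \<open>m = 0\<close> the first term is cut off by hand, because \<open>m - 1\<close>
  would be 0 again.\<close>

lemma Bernstein_has_derivative:
  "(Bernstein (Suc p) m has_real_derivative real (Suc p) * ((if m = 0 then 0 else Bernstein p (m - 1) x) - Bernstein p m x)) (at x)"
proof -
  have d: "(Bernstein (Suc p) m has_real_derivative
      real (Suc p choose m) * (real m * x ^ (m - 1) * (1 - x) ^ (Suc p - m) - x ^ m * (real (Suc p - m) * (1 - x) ^ (Suc p - m - 1)))) (at x)"
    unfolding Bernstein_def[abs_def]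
    by (rule DERIV_cong) (auto intro!: derivative_eq_intros simp: algebra_simps)
  have 1: "real (Suc p choose m) * (real m * x ^ (m - 1) * (1 - x) ^ (Suc p - m)) = real (Suc p) * (if m = 0 then 0 else Bernstein p (m - 1) x)"
  proof (cases m)
    case (Suc l)
    have "real (Suc l * (Suc p choose Suc l)) = real (Suc p * (p choose l))"
      by (simp only: Suc_times_binomial_eq[of p l] mult.commute)
    then have "real (Suc p choose Suc l) * real (Suc l) = real (Suc p) * real (p choose l)"
      by (simp only: of_nat_mult mult.commute)
    then show ?thesis using Suc by (simp add: Bernstein_def mult.assoc[symmetric])
  qed simp
  have 2: "real (Suc p choose m) * (x ^ m * (real (Suc p - m) * (1 - x) ^ (Suc p - m - 1))) = real (Suc p) * Bernstein p m x"
  proof (cases "m \<le> p")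
    case True
    have "(Suc p - m) * (Suc p choose m) = Suc p * (p choose m)"
      using binomial_absorb_comp[of "Suc p" m] by simp
    then have e: "real (Suc p choose m) * real (Suc p - m) = real (Suc p) * real (p choose m)"
      by (metis of_nat_mult mult.commute)
    have "Suc p - m - 1 = p - m" using True by simp
    then have "real (Suc p choose m) * (x ^ m * (real (Suc p - m) * (1 - x) ^ (Suc p - m - 1)))
       = (real (Suc p choose m) * real (Suc p - m)) * (x ^ m * (1 - x) ^ (p - m))"
      by (simp only: mult_ac)
    then show ?thesis unfolding e Bernstein_def by (simp only: mult_ac)
  next
    case False
    then have "p choose m = 0" "real (Suc p - m) = 0" by (auto simp: binomial_eq_0)
    then show ?thesis by (simp add: Bernstein_def)
  qed
  show ?thesis using d unfolding right_diff_distrib 1 2 .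
qed

text \<open>Abel summation: the derivative of a Bernstein sum is a Bernstein sum of degree one less,
  with forward differences as coefficients. Averages of the weak derivative will enter as such
  differences.\<close>

lemma Bernstein_sum_derivative:
  fixes y :: "nat \<Rightarrow> 'a::real_normed_vector"
  shows "(\<Sum>m\<le>Suc p. (real (Suc p) * ((if m = 0 then 0 else Bernstein p (m - 1) x) - Bernstein p m x)) *\<^sub>R y m)
    = real (Suc p) *\<^sub>R (\<Sum>m\<le>p. Bernstein p m x *\<^sub>R (y (Suc m) - y m))"
proof -
  have z: "Bernstein p (Suc p) x = 0" by (simp add: Bernstein_def)
  have "(\<Sum>m\<le>Suc p. ((if m = 0 then 0 else Bernstein p (m - 1) x) - Bernstein p m x) *\<^sub>R y m)
     = (\<Sum>m\<le>Suc p. (if m = 0 then 0 else Bernstein p (m - 1) x) *\<^sub>R y m) - (\<Sum>m\<le>Suc p. Bernstein p m x *\<^sub>R y m)"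
    by (simp add: scaleR_diff_left sum_subtractf del: sum.atMost_Suc)
  also have "(\<Sum>m\<le>Suc p. (if m = 0 then 0 else Bernstein p (m - 1) x) *\<^sub>R y m) = (\<Sum>m\<le>p. Bernstein p m x *\<^sub>R y (Suc m))"
    by (subst sum.atMost_Suc_shift) simp
  also have "(\<Sum>m\<le>Suc p. Bernstein p m x *\<^sub>R y m) = (\<Sum>m\<le>p. Bernstein p m x *\<^sub>R y m)" by (simp add: z)
  finally have "(\<Sum>m\<le>Suc p. ((if m = 0 then 0 else Bernstein p (m - 1) x) - Bernstein p m x) *\<^sub>R y m)
     = (\<Sum>m\<le>p. Bernstein p m x *\<^sub>R (y (Suc m) - y m))"
    by (simp add: scaleR_diff_right sum_subtractf)
  then show ?thesis by (simp only: scaleR_scaleR[symmetric] scaleR_sum_right[symmetric])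
qed

lemma continuous_on_Bernstein [continuous_intros]:
  "continuous_on A f \<Longrightarrow> continuous_on A (\<lambda>x. Bernstein n m (f x))"
  unfolding Bernstein_def by (intro continuous_intros)

lemma Bernstein_integral:
  assumes T: "T > 0" and m: "m \<le> n"
  shows "(LINT t|I0 T. Bernstein n m (t / T)) = T / (real n + 1)"
proof -
  \<comment> \<open>Coefficients with a single nonzero forward difference, at \<open>m\<close>. Thus
    \<open>?F\<close> is a primitive of a multiple of the given polynomial, with end values 0 and
    1.\<close>
  let ?y = "\<lambda>l. if m < l then 1 else (0::real)"
  let ?F = "\<lambda>t. \<Sum>l\<le>Suc n. Bernstein (Suc n) l (t / T) *\<^sub>R ?y l"
  have "(?F has_real_derivative ((real n + 1) / T * Bernstein n m (t / T))) (at t within {0..T})" for t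
  proof -
    have "((\<lambda>t. Bernstein (Suc n) l (t / T)) has_real_derivative
      (real (Suc n) * ((if l = 0 then 0 else Bernstein n (l - 1) (t/T)) - Bernstein n l (t/T))) * (1 / T)) (at t within {0..T})" for l
    proof (rule DERIV_chain2[OF Bernstein_has_derivative])
      show "((\<lambda>t. t / T) has_real_derivative 1 / T) (at t within {0..T})"
        using T by (auto intro!: derivative_eq_intros)
    qed
    then have "(?F has_real_derivative (\<Sum>l\<le>Suc n. (real (Suc n) * ((if l = 0 then 0 else Bernstein n (l - 1) (t/T)) - Bernstein n l (t/T))) * (1 / T) * ?y l)) (at t within {0..T})"
      unfolding real_scaleR_def by (intro DERIV_sum DERIV_cmult_right)
    also have "(\<Sum>l\<le>Suc n. (real (Suc n) * ((if l = 0 then 0 else Bernstein n (l - 1) (t/T)) - Bernstein n l (t/T))) * (1 / T) * ?y l)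
       = (1 / T) * (\<Sum>l\<le>Suc n. (real (Suc n) * ((if l = 0 then 0 else Bernstein n (l - 1) (t/T)) - Bernstein n l (t/T))) *\<^sub>R ?y l)"
      unfolding sum_distrib_left real_scaleR_def by (intro sum.cong refl) (simp only: mult_ac)
    also have "\<dots> = (1 / T) * (real (Suc n) * (\<Sum>l\<le>n. Bernstein n l (t/T) * (?y (Suc l) - ?y l)))"
      using arg_cong[OF Bernstein_sum_derivative[of n "t / T" ?y], of "\<lambda>x. (1 / T) * x"]
      by (simp only: real_scaleR_def)
    also have "(\<Sum>l\<le>n. Bernstein n l (t/T) * (?y (Suc l) - ?y l)) = (\<Sum>l\<in>{m}. Bernstein n l (t/T) * (?y (Suc l) - ?y l))"
      using m by (intro sum.mono_neutral_right) auto
    finally show ?thesis by (rule DERIV_cong) simp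
  qed
  then have H: "((\<lambda>t. (real n + 1) / T * Bernstein n m (t / T)) has_integral (?F T - ?F 0)) {0..T}"
    using T by (intro fundamental_theorem_of_calculus) (auto simp: has_real_derivative_iff_has_vector_derivative[symmetric])
  have A1: "?F T = 1"
  proof -
    have "?F T = (\<Sum>l\<in>{Suc n}. Bernstein (Suc n) l (T / T) *\<^sub>R ?y l)"
      using T by (intro sum.mono_neutral_right) (auto simp: Bernstein_def)
    then show ?thesis using T m by (simp add: Bernstein_def)
  qed
  have A2: "?F 0 = 0"
    by (rule sum.neutral) (auto simp: Bernstein_def)
  have "integral {0..T} (\<lambda>t. (real n + 1) / T * Bernstein n m (t / T)) = 1"
    using integral_unique[OF H] unfolding A1 A2 by simp
  then have "(real n + 1) / T * integral {0..T} (\<lambda>t. Bernstein n m (t / T)) = 1"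
    by (simp only: Henstock_Kurzweil_Integration.integral_mult_right)
  then have "integral {0..T} (\<lambda>t. Bernstein n m (t / T)) = T / (real n + 1)"
    using T by (simp add: field_simps)
  moreover have "integrable (I0 T) (\<lambda>t. Bernstein n m (t / T))"
    using T by (intro continuous_imp_integrable_real continuous_intros) auto
  ultimately show ?thesis by (simp add: lebesgue_integral_eq_integral)
qed

text \<open>The left side is the variance \<open>x * (1 - x) / n\<close> of a binomial mean.\<close>

lemma Bernstein_variance:
  assumes x: "x \<in> {0..1}" and n: "n > 0"
  shows "(\<Sum>m\<le>n. Bernstein n m x * (real m / real n - x)\<^sup>2) \<le> 1 / real n"
proof -
  have "(\<Sum>m\<le>n. Bernstein n m x * (real m - real n * x)\<^sup>2)
     = (\<Sum>m\<le>n. real m * (real m - 1) * Bernstein n m x + (1 - 2 * real n * x) * (real m * Bernstein n m x) + (real n * x)\<^sup>2 * Bernstein n m x)"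
    by (intro sum.cong refl) (simp add: power2_eq_square algebra_simps)
  also have "\<dots> = real n * x * (1 - x)"
    unfolding sum.distrib sum_distrib_left[symmetric] sum_kk_Bernstein sum_k_Bernstein sum_Bernstein
    by (simp add: algebra_simps power2_eq_square)
  also have "\<dots> \<le> real n"
  proof -
    have "x * (1 - x) \<le> 1" using x by (intro mult_le_one) auto
    from mult_left_mono[OF this, of "real n"] show ?thesis by (simp add: mult.assoc)
  qed
  finally have le: "(\<Sum>m\<le>n. Bernstein n m x * (real m - real n * x)\<^sup>2) \<le> real n" .
  have "(\<Sum>m\<le>n. Bernstein n m x * (real m / real n - x)\<^sup>2) = (\<Sum>m\<le>n. Bernstein n m x * (real m - real n * x)\<^sup>2) / (real n)\<^sup>2"
    unfolding sum_divide_distrib using n by (intro sum.cong refl) (simp add: field_simps power2_eq_square)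
  also have "\<dots> \<le> real n / (real n)\<^sup>2" using le by (rule divide_right_mono) simp
  finally show ?thesis using n by (simp add: power2_eq_square)
qed

lemma inner_le_squares:
  fixes x y :: "'a::real_inner"
  shows "x \<bullet> y \<le> (norm x)\<^sup>2 / 2 + (norm y)\<^sup>2 / 2" "x \<bullet> y \<le> (norm x)\<^sup>2 + (norm y)\<^sup>2 / 4"
proof -
  have "0 \<le> (norm x - norm y)\<^sup>2" "0 \<le> (norm x - norm y / 2)\<^sup>2" by simp_all
  then show "x \<bullet> y \<le> (norm x)\<^sup>2 / 2 + (norm y)\<^sup>2 / 2" "x \<bullet> y \<le> (norm x)\<^sup>2 + (norm y)\<^sup>2 / 4"
    using norm_cauchy_schwarz[of x y] by (auto simp: power2_diff power_divide)
qed

text \<open>Jensen's inequality, obtained by pairing the sum with itself and absorbing half of its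
  square.\<close>

lemma convex_sum_norm_sq:
  fixes y :: "nat \<Rightarrow> 'a::real_inner"
  assumes b: "\<And>m. m \<le> n \<Longrightarrow> b m \<ge> 0" "(\<Sum>m\<le>n. b m) = 1"
  shows "(norm (\<Sum>m\<le>n. b m *\<^sub>R y m))\<^sup>2 \<le> (\<Sum>m\<le>n. b m * (norm (y m))\<^sup>2)"
proof -
  let ?s = "\<Sum>m\<le>n. b m *\<^sub>R y m"
  have "(norm ?s)\<^sup>2 = (\<Sum>m\<le>n. b m * (y m \<bullet> ?s))"
    unfolding power2_norm_eq_inner by (subst inner_sum_left) simp
  also have "\<dots> \<le> (\<Sum>m\<le>n. b m * ((norm (y m))\<^sup>2 / 2 + (norm ?s)\<^sup>2 / 2))"
  proof (intro sum_mono mult_left_mono)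
    fix m
    show "y m \<bullet> ?s \<le> (norm (y m))\<^sup>2 / 2 + (norm ?s)\<^sup>2 / 2" by (rule inner_le_squares(1))
  qed (use b in auto)
  also have "\<dots> = (\<Sum>m\<le>n. b m * (norm (y m))\<^sup>2) / 2 + (\<Sum>m\<le>n. b m) * ((norm ?s)\<^sup>2 / 2)"
    by (simp add: distrib_left sum.distrib sum_divide_distrib sum_distrib_right)
  finally show ?thesis using b(2) by simp
qed

text \<open>Bernstein polynomials with point values replaced by weighted averages. The averages make the
  operators bounded on \<open>L2\<close>, and a suitable choice of the weights makes them commute with weak
  derivatives.\<close>

locale kantorovich =
  fixes T :: real and w :: "nat \<Rightarrow> nat \<Rightarrow> real \<Rightarrow> real" and D :: "nat \<Rightarrow> nat" and r \<rho> :: "nat \<Rightarrow> real" and A :: real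
  assumes T_pos: "T > 0"
    and w_cont: "\<And>n m. continuous_on UNIV (w n m)"
    and w_nonneg: "\<And>n m t. 0 \<le> w n m t"
    and w_supp: "\<And>n m t. m \<le> D n \<Longrightarrow> t \<in> {0..T} \<Longrightarrow> w n m t \<noteq> 0 \<Longrightarrow> \<bar>t - T * (real m / real (D n))\<bar> \<le> r n"
    and w_int: "\<And>n m. m \<le> D n \<Longrightarrow> \<bar>(LINT t|I0 T. w n m t) - 1\<bar> \<le> \<rho> n"
    and w_sum: "\<And>n t. t \<in> {0..T} \<Longrightarrow> T / (real (D n) + 1) * (\<Sum>m\<le>D n. w n m t) \<le> A"
    and \<rho>: "\<And>n. \<rho> n \<le> 1" "\<rho> \<longlonglongrightarrow> 0" and r: "r \<longlonglongrightarrow> 0" and D_lim: "filterlim D at_top sequentially"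
    and A: "A \<ge> 0"
begin

definition avg :: "nat \<Rightarrow> nat \<Rightarrow> (real \<Rightarrow> 'a::{real_inner,banach,second_countable_topology}) \<Rightarrow> 'a" where
  "avg n m F = (LINT t|I0 T. w n m t *\<^sub>R F t)"

definition Op :: "nat \<Rightarrow> (real \<Rightarrow> 'a::{real_inner,banach,second_countable_topology}) \<Rightarrow> real \<Rightarrow> 'a" where
  "Op n F t = (\<Sum>m\<le>D n. Bernstein (D n) m (t / T) *\<^sub>R avg n m F)"

lemma w_measurable: "w n m \<in> borel_measurable (I0 T)"
  by (rule continuous_on_imp_measurable_I) (rule continuous_on_subset[OF w_cont], simp)

lemma w_bounded: "\<exists>B. \<forall>t\<in>{0..T}. \<bar>w n m t\<bar> \<le> B"
proof -
  have "compact (w n m ` {0..T})" by (intro compact_continuous_image continuous_on_subset[OF w_cont]) auto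
  from compact_imp_bounded[OF this] show ?thesis by (auto simp: bounded_iff)
qed

lemma w_L2: "F \<in> L2 T \<Longrightarrow> (\<lambda>t. w n m t *\<^sub>R F t) \<in> L2 T"
  for F :: "real \<Rightarrow> 'a::{real_normed_vector,second_countable_topology}"
  using w_bounded[of n m] L2_mult_bounded[OF _ w_measurable] by blast

lemma w_integrable: "integrable (I0 T) (w n m)"
  by (rule continuous_imp_integrable_real) (rule continuous_on_subset[OF w_cont], simp)

lemma w_int_le: "m \<le> D n \<Longrightarrow> (LINT t|I0 T. w n m t) \<le> 2"
  using w_int[of m n] \<rho>(1)[of n] by simp

lemma x_in: "t \<in> {0..T} \<Longrightarrow> t / T \<in> {0..1}" using T_pos by auto

lemma avg_add:
  fixes F H :: "real \<Rightarrow> 'a::{real_inner,banach,second_countable_topology}"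
  assumes "F \<in> L2 T" "H \<in> L2 T" shows "avg n m (\<lambda>t. F t + H t) = avg n m F + avg n m H"
  unfolding avg_def scaleR_add_right
  by (rule Bochner_Integration.integral_add) (intro L2_integrable_vec w_L2 assms)+

lemma avg_diff:
  fixes F H :: "real \<Rightarrow> 'a::{real_inner,banach,second_countable_topology}"
  assumes "F \<in> L2 T" "H \<in> L2 T" shows "avg n m (\<lambda>t. F t - H t) = avg n m F - avg n m H"
  unfolding avg_def scaleR_diff_right
  by (rule Bochner_Integration.integral_diff) (intro L2_integrable_vec w_L2 assms)+

lemma Op_add:
  fixes F H :: "real \<Rightarrow> 'a::{real_inner,banach,second_countable_topology}"
  assumes "F \<in> L2 T" "H \<in> L2 T" shows "Op n (\<lambda>t. F t + H t) t = Op n F t + Op n H t"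
  unfolding Op_def avg_add[OF assms] by (simp add: scaleR_add_right sum.distrib)

lemma Op_diff:
  fixes F H :: "real \<Rightarrow> 'a::{real_inner,banach,second_countable_topology}"
  assumes "F \<in> L2 T" "H \<in> L2 T" shows "Op n (\<lambda>t. F t - H t) t = Op n F t - Op n H t"
  unfolding Op_def avg_diff[OF assms] by (simp add: scaleR_diff_right sum_subtractf)

lemma Op_L2: "Op n F \<in> L2 T"
  unfolding Op_def[abs_def] by (intro L2_continuous continuous_intros) (use T_pos in auto)

lemma w_F_integrable:
  fixes F :: "real \<Rightarrow> 'a::{real_inner,banach,second_countable_topology}"
  assumes F: "F \<in> L2 T" shows "integrable (I0 T) (\<lambda>t. w n m t * (norm (F t))\<^sup>2)"
  using L2_inner_integrable[OF w_L2[OF F, of n m] F] by (simp add: power2_norm_eq_inner)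

text \<open>The mass of the weight is at most 2, so Young's inequality is used with the factor 1/4
  on the square of the average: half of that square remains on the right and is absorbed.\<close>

lemma avg_norm_sq:
  fixes F :: "real \<Rightarrow> 'a::{real_inner,banach,second_countable_topology}"
  assumes F: "F \<in> L2 T" and m: "m \<le> D n"
  shows "(norm (avg n m F))\<^sup>2 \<le> 2 * (LINT t|I0 T. w n m t * (norm (F t))\<^sup>2)"
proof -
  let ?z = "avg n m F"
  have "(norm ?z)\<^sup>2 = (LINT t|I0 T. (w n m t *\<^sub>R F t) \<bullet> ?z)"
    unfolding power2_norm_eq_inner avg_def
    by (rule integral_inner_left[symmetric]) (rule L2_integrable_vec[OF w_L2[OF F]])
  also have "\<dots> \<le> (LINT t|I0 T. w n m t * (norm (F t))\<^sup>2 + w n m t * ((norm ?z)\<^sup>2 / 4))"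
  proof (rule integral_mono)
    show "integrable (I0 T) (\<lambda>t. (w n m t *\<^sub>R F t) \<bullet> ?z)"
      by (rule integrable_inner_left) (rule L2_integrable_vec[OF w_L2[OF F]])
    show "integrable (I0 T) (\<lambda>t. w n m t * (norm (F t))\<^sup>2 + w n m t * ((norm ?z)\<^sup>2 / 4))"
      by (intro Bochner_Integration.integrable_add w_F_integrable[OF F] integrable_mult_left w_integrable)
    fix t
    have "F t \<bullet> ?z \<le> (norm (F t))\<^sup>2 + (norm ?z)\<^sup>2 / 4" by (rule inner_le_squares(2))
    then have "w n m t * (F t \<bullet> ?z) \<le> w n m t * ((norm (F t))\<^sup>2 + (norm ?z)\<^sup>2 / 4)"
      using w_nonneg by (rule mult_left_mono)
    then show "(w n m t *\<^sub>R F t) \<bullet> ?z \<le> w n m t * (norm (F t))\<^sup>2 + w n m t * ((norm ?z)\<^sup>2 / 4)"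
      by (simp add: distrib_left)
  qed
  also have "\<dots> = (LINT t|I0 T. w n m t * (norm (F t))\<^sup>2) + (LINT t|I0 T. w n m t) * ((norm ?z)\<^sup>2 / 4)"
  proof -
    have "(LINT t|I0 T. w n m t * (norm (F t))\<^sup>2 + w n m t * ((norm ?z)\<^sup>2 / 4))
       = (LINT t|I0 T. w n m t * (norm (F t))\<^sup>2) + (LINT t|I0 T. w n m t * ((norm ?z)\<^sup>2 / 4))"
      by (rule Bochner_Integration.integral_add) (intro w_F_integrable[OF F] integrable_mult_left w_integrable)+
    also have "(LINT t|I0 T. w n m t * ((norm ?z)\<^sup>2 / 4)) = (LINT t|I0 T. w n m t) * ((norm ?z)\<^sup>2 / 4)"
      by (rule Bochner_Integration.integral_mult_left_zero)
    finally show ?thesis .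
  qed
  also have "\<dots> \<le> (LINT t|I0 T. w n m t * (norm (F t))\<^sup>2) + 2 * ((norm ?z)\<^sup>2 / 4)"
    by (intro add_left_mono mult_right_mono w_int_le m) simp
  finally show ?thesis by simp
qed

text \<open>After Jensen's inequality the Bernstein polynomials enter through their integrals, all
  equal to T / (d + 1) for degree d; the assumption \<open>w_sum\<close> then bounds the sum of the
  weights at every point.\<close>

lemma Op_bounded:
  fixes F :: "real \<Rightarrow> 'a::{real_inner,banach,second_countable_topology}"
  assumes F: "F \<in> L2 T"
  shows "L2_norm T (Op n F) \<le> sqrt (2 * A) * L2_norm T F"
proof (rule power2_le_imp_le)
  let ?d = "D n" and ?B = "\<lambda>m t. Bernstein (D n) m (t / T)"
  have Bi: "integrable (I0 T) (?B m)" for m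
    using T_pos by (intro continuous_imp_integrable_real continuous_intros) auto
  have "(L2_norm T (Op n F))\<^sup>2 \<le> (LINT t|I0 T. (\<Sum>m\<le>?d. ?B m t * (norm (avg n m F))\<^sup>2))"
    unfolding L2_norm_sq
  proof (rule integral_mono)
    show "integrable (I0 T) (\<lambda>t. (norm (Op n F t))\<^sup>2)" by (rule L2_integrable[OF Op_L2])
    show "integrable (I0 T) (\<lambda>t. \<Sum>m\<le>?d. ?B m t * (norm (avg n m F))\<^sup>2)"
      by (intro Bochner_Integration.integrable_sum integrable_mult_left Bi)
    fix t assume "t \<in> space (I0 T)"
    then show "(norm (Op n F t))\<^sup>2 \<le> (\<Sum>m\<le>?d. ?B m t * (norm (avg n m F))\<^sup>2)"
      unfolding Op_def using x_in[of t] by (intro convex_sum_norm_sq) (auto intro: Bernstein_nonneg)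
  qed
  also have "\<dots> = (\<Sum>m\<le>?d. T / (real ?d + 1) * (norm (avg n m F))\<^sup>2)"
    by (subst Bochner_Integration.integral_sum) (auto intro!: Bi sum.cong simp: Bernstein_integral[OF T_pos])
  also have "\<dots> \<le> (\<Sum>m\<le>?d. T / (real ?d + 1) * (2 * (LINT t|I0 T. w n m t * (norm (F t))\<^sup>2)))"
    using T_pos by (intro sum_mono mult_left_mono avg_norm_sq[OF F]) auto
  also have "\<dots> = (LINT t|I0 T. 2 * ((T / (real ?d + 1) * (\<Sum>m\<le>?d. w n m t)) * (norm (F t))\<^sup>2))"
    by (simp add: sum_distrib_left sum_distrib_right mult.assoc w_F_integrable[OF F] mult.left_commute[of _ 2])
  also have "\<dots> \<le> (LINT t|I0 T. 2 * (A * (norm (F t))\<^sup>2))"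
  proof (rule integral_mono)
    show "integrable (I0 T) (\<lambda>t. 2 * ((T / (real ?d + 1) * (\<Sum>m\<le>?d. w n m t)) * (norm (F t))\<^sup>2))"
      by (simp add: sum_distrib_left sum_distrib_right mult.assoc w_F_integrable[OF F])
    show "integrable (I0 T) (\<lambda>t. 2 * (A * (norm (F t))\<^sup>2))" using L2_integrable[OF F] by simp
    fix t assume "t \<in> space (I0 T)"
    then have "T / (real ?d + 1) * (\<Sum>m\<le>?d. w n m t) \<le> A" by (intro w_sum) simp
    then show "2 * ((T / (real ?d + 1) * (\<Sum>m\<le>?d. w n m t)) * (norm (F t))\<^sup>2) \<le> 2 * (A * (norm (F t))\<^sup>2)"
      by (intro mult_left_mono mult_right_mono) auto
  qed
  also have "\<dots> = (sqrt (2 * A) * L2_norm T F)\<^sup>2" using A by (simp add: power_mult_distrib L2_norm_sq)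
  finally show "(L2_norm T (Op n F))\<^sup>2 \<le> (sqrt (2 * A) * L2_norm T F)\<^sup>2" .
qed (use A in simp)

text \<open>The quadratic majorant of the oscillation of \<open>g\<close> reduces uniform
  convergence to second moments: the size of the support contributes \<open>(r n)^2\<close>, the
  distance from \<open>t\<close> to the node is left for the Bernstein variance, and the defect of
  the mass gives the term with \<rho>.\<close>

lemma avg_error:
  fixes g :: "real \<Rightarrow> 'a::{real_inner,banach,second_countable_topology}"
  assumes g: "g \<in> L2 T" and m: "m \<le> D n" and t: "t \<in> {0..T}" and K: "K \<ge> 0" "\<epsilon> \<ge> 0"
    and mod: "\<And>s. s \<in> {0..T} \<Longrightarrow> norm (g s - g t) \<le> \<epsilon> + K * (s - t)\<^sup>2"
  shows "norm (avg n m g - g t) \<le> 2 * (\<epsilon> + 2 * K * (r n)\<^sup>2 + 2 * K * (T * (real m / real (D n)) - t)\<^sup>2) + \<rho> n * norm (g t)"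
proof -
  let ?tm = "T * (real m / real (D n))"
  let ?c = "\<epsilon> + 2 * K * (r n)\<^sup>2 + 2 * K * (?tm - t)\<^sup>2"
  interpret finite_measure "I0 T" by (rule finite_measure_I0)
  have cL: "(\<lambda>s. g t) \<in> L2 T" by (rule L2_continuous) simp
  have c0: "?c \<ge> 0" using K by (intro add_nonneg_nonneg mult_nonneg_nonneg) auto
  have "avg n m g - g t = avg n m (\<lambda>s. g s - g t) + ((LINT s|I0 T. w n m s) - 1) *\<^sub>R g t"
    unfolding avg_diff[OF g cL] by (simp add: avg_def w_integrable scaleR_diff_left)
  moreover have "norm (avg n m (\<lambda>s. g s - g t)) \<le> 2 * ?c"
  proof -
    have "norm (avg n m (\<lambda>s. g s - g t)) \<le> (LINT s|I0 T. w n m s * ?c)"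
      unfolding avg_def
    proof (rule Bochner_Integration.integral_norm_bound_integral)
      show "integrable (I0 T) (\<lambda>s. w n m s *\<^sub>R (g s - g t))" by (rule L2_integrable_vec[OF w_L2[OF L2_diff[OF g cL]]])
      show "integrable (I0 T) (\<lambda>s. w n m s * ?c)" by (intro integrable_mult_left w_integrable)
      fix s assume "s \<in> space (I0 T)"
      then have s: "s \<in> {0..T}" by simp
      show "norm (w n m s *\<^sub>R (g s - g t)) \<le> w n m s * ?c"
      proof (cases "w n m s = 0")
        case False
        have "(s - t)\<^sup>2 \<le> 2 * (s - ?tm)\<^sup>2 + 2 * (?tm - t)\<^sup>2"
        proof -
          have "(a + b)\<^sup>2 \<le> 2 * a\<^sup>2 + 2 * b\<^sup>2" for a b :: real
            using zero_le_power2[of "a - b"] unfolding power2_sum power2_diff by argo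
          from this[of "s - ?tm" "?tm - t"] show ?thesis by simp
        qed
        moreover have "(s - ?tm)\<^sup>2 \<le> (r n)\<^sup>2"
          using power_mono[OF w_supp[OF m s False], of 2] by simp
        ultimately have "(s - t)\<^sup>2 \<le> 2 * (r n)\<^sup>2 + 2 * (?tm - t)\<^sup>2" by linarith
        from mult_left_mono[OF this K(1)] have "norm (g s - g t) \<le> ?c" using mod[OF s] by (simp add: algebra_simps)
        then show ?thesis using w_nonneg by (simp add: mult_left_mono)
      qed simp
    qed
    also have "\<dots> = (LINT s|I0 T. w n m s) * ?c" by simp
    also have "\<dots> \<le> 2 * ?c" using w_int_le[OF m] c0 by (rule mult_right_mono)
    finally show ?thesis .
  qed
  moreover have "norm (((LINT s|I0 T. w n m s) - 1) *\<^sub>R g t) \<le> \<rho> n * norm (g t)"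
    using w_int[OF m] by (simp add: mult_right_mono)
  ultimately show ?thesis using norm_triangle_mono by metis
qed

lemma Op_uniform:
  fixes g :: "real \<Rightarrow> 'a::{real_inner,banach,second_countable_topology}"
  assumes g: "continuous_on {0..T} g" and e: "\<epsilon> > 0"
  shows "\<forall>\<^sub>F n in sequentially. \<forall>t\<in>{0..T}. norm (Op n g t - g t) < \<epsilon>"
proof -
  have gL: "g \<in> L2 T" by (rule L2_continuous[OF g])
  obtain B where B: "B \<ge> 0" "\<And>t. t \<in> {0..T} \<Longrightarrow> norm (g t) \<le> B"
    using bounded_on_interval[OF g] by blast
  have "uniformly_continuous_on {0..T} g" using g by (intro compact_uniformly_continuous) auto
  then obtain d where d: "d > 0" "\<And>s t. s \<in> {0..T} \<Longrightarrow> t \<in> {0..T} \<Longrightarrow> dist s t < d \<Longrightarrow> dist (g s) (g t) < \<epsilon> / 4"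
    using e unfolding uniformly_continuous_on_def by (metis divide_pos_pos zero_less_numeral)
  \<comment> \<open>Beyond distance \<open>d\<close> the term \<open>K * (s - t)^2\<close> is at
    least the trivial bound \<open>2 * B\<close> of the oscillation.\<close>
  define K where "K = 2 * B / d\<^sup>2"
  have K: "K \<ge> 0" using B d by (simp add: K_def)
  have mod: "norm (g s - g t) \<le> \<epsilon> / 4 + K * (s - t)\<^sup>2" if s: "s \<in> {0..T}" and t: "t \<in> {0..T}" for s t
  proof (cases "dist s t < d")
    case True
    then have "norm (g s - g t) < \<epsilon> / 4" using d(2)[OF s t] by (simp add: dist_norm)
    then show ?thesis using K by (smt (verit) mult_nonneg_nonneg zero_le_power2)
  next
    case False
    then have "d\<^sup>2 \<le> \<bar>s - t\<bar>\<^sup>2" using d(1) by (intro power_mono) (auto simp: dist_real_def)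
    then have "2 * B * 1 \<le> 2 * B * ((s - t)\<^sup>2 / d\<^sup>2)" using B d by (intro mult_left_mono) auto
    then have "2 * B \<le> K * (s - t)\<^sup>2" by (simp add: K_def)
    moreover have "norm (g s - g t) \<le> 2 * B" using norm_triangle_ineq4[of "g s" "g t"] B(2)[OF s] B(2)[OF t] by simp
    ultimately show ?thesis using e by simp
  qed
  \<comment> \<open>The bound of \<open>avg_error\<close> averaged with the Bernstein weights: these
    sum to 1, and their variance contributes \<open>T^2 / D n\<close>.\<close>
  let ?E = "\<lambda>n. \<epsilon> / 2 + (4 * K * (r n)\<^sup>2 + 4 * K * T\<^sup>2 * (1 / real (D n)) + \<rho> n * B)"
  have "(\<lambda>n. 1 / real (D n)) \<longlonglongrightarrow> 0"
    by (rule real_tendsto_divide_at_top[OF tendsto_const]) (rule filterlim_compose[OF filterlim_real_sequentially D_lim])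
  then have "?E \<longlonglongrightarrow> \<epsilon> / 2 + (4 * K * 0\<^sup>2 + 4 * K * T\<^sup>2 * 0 + 0 * B)"
    by (intro tendsto_intros r \<rho>(2))
  then have "\<forall>\<^sub>F n in sequentially. ?E n < \<epsilon>" by (rule order_tendstoD(2)) (use e in simp)
  moreover have "\<forall>\<^sub>F n in sequentially. D n > 0"
    using D_lim eventually_gt_at_top[of 0] by (auto simp: filterlim_iff)
  ultimately show ?thesis
  proof eventually_elim
    case (elim n)
    show ?case
    proof
      fix t assume t: "t \<in> {0..T}"
      let ?b = "\<lambda>m. Bernstein (D n) m (t / T)" and ?tm = "\<lambda>m. T * (real m / real (D n))"
      have b: "?b m \<ge> 0" for m using x_in[OF t] by (auto intro: Bernstein_nonneg)
      have rho0: "\<rho> n \<ge> 0" using w_int[of 0 n] by (meson abs_ge_zero le0 order_trans)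
      have c0: "0 \<le> \<epsilon> / 2 + 4 * K * (r n)\<^sup>2 + \<rho> n * B"
        using e K B(1) rho0 by (intro add_nonneg_nonneg mult_nonneg_nonneg) auto
      have "Op n g t - g t = (\<Sum>m\<le>D n. ?b m *\<^sub>R (avg n m g - g t))"
        unfolding Op_def scaleR_diff_right sum_subtractf scaleR_sum_left[symmetric] by simp
      also have "norm \<dots> \<le> (\<Sum>m\<le>D n. ?b m * norm (avg n m g - g t))"
        by (rule order_trans[OF norm_sum]) (simp add: b)
      also have "\<dots> \<le> (\<Sum>m\<le>D n. ?b m * (\<epsilon> / 2 + 4 * K * (r n)\<^sup>2 + \<rho> n * B + 4 * K * (?tm m - t)\<^sup>2))"
      proof (intro sum_mono mult_left_mono b)
        fix m assume "m \<in> {..D n}"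
        then have "norm (avg n m g - g t) \<le> 2 * (\<epsilon> / 4 + 2 * K * (r n)\<^sup>2 + 2 * K * (?tm m - t)\<^sup>2) + \<rho> n * norm (g t)"
          by (intro avg_error[OF gL _ t K]) (use e mod t in auto)
        moreover have "\<rho> n * norm (g t) \<le> \<rho> n * B" using rho0 B(2)[OF t] by (rule mult_left_mono[rotated])
        ultimately show "norm (avg n m g - g t) \<le> \<epsilon> / 2 + 4 * K * (r n)\<^sup>2 + \<rho> n * B + 4 * K * (?tm m - t)\<^sup>2"
          by (simp add: algebra_simps)
      qed
      also have "\<dots> = (\<epsilon> / 2 + 4 * K * (r n)\<^sup>2 + \<rho> n * B) * (\<Sum>m\<le>D n. ?b m) + 4 * K * (\<Sum>m\<le>D n. ?b m * (?tm m - t)\<^sup>2)"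
      proof -
        have "(\<Sum>m\<le>N. b m * (c + l * e m)) = c * (\<Sum>m\<le>N. b m) + l * (\<Sum>m\<le>N. b m * e m)" for N b c l and e :: "nat \<Rightarrow> real"
          by (simp add: distrib_left sum.distrib sum_distrib_left mult_ac)
        then show ?thesis .
      qed
      also have "(\<Sum>m\<le>D n. ?b m * (?tm m - t)\<^sup>2) = T\<^sup>2 * (\<Sum>m\<le>D n. ?b m * (real m / real (D n) - t / T)\<^sup>2)"
        unfolding sum_distrib_left
      proof (intro sum.cong refl)
        fix m
        have "?tm m - t = T * (real m / real (D n) - t / T)" using T_pos by (simp add: right_diff_distrib)
        then show "?b m * (?tm m - t)\<^sup>2 = T\<^sup>2 * (?b m * (real m / real (D n) - t / T)\<^sup>2)"
          by (simp only: power_mult_distrib mult_ac)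
      qed
      also have "(\<epsilon> / 2 + 4 * K * (r n)\<^sup>2 + \<rho> n * B) * (\<Sum>m\<le>D n. ?b m) + 4 * K * (T\<^sup>2 * (\<Sum>m\<le>D n. ?b m * (real m / real (D n) - t / T)\<^sup>2))
         \<le> (\<epsilon> / 2 + 4 * K * (r n)\<^sup>2 + \<rho> n * B) * 1 + 4 * K * (T\<^sup>2 * (1 / real (D n)))"
        using Bernstein_variance[OF x_in[OF t], of "D n"] elim(2) K c0
        by (intro add_mono mult_left_mono) auto
      also have "\<dots> = ?E n" by (simp add: mult.assoc)
      finally show "norm (Op n g t - g t) < \<epsilon>" using elim(1) by simp
    qed
  qed
qed

text \<open>Uniform boundedness on L2 together with uniform convergence on a dense class.\<close>

lemma Op_tendsto:
  fixes F :: "real \<Rightarrow> 'a::{real_inner,banach,second_countable_topology}"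
  assumes "F \<in> L2 T"
  shows "(\<lambda>n. L2_norm T (\<lambda>t. Op n F t - F t)) \<longlonglongrightarrow> 0"
  using assms
proof (induction F rule: L2_dense_induct)
  case (add v w)
  show ?case
  proof (rule Lim_null_comparison)
    show "\<forall>\<^sub>F n in sequentially. norm (L2_norm T (\<lambda>t. Op n (\<lambda>t. v t + w t) t - (v t + w t)))
       \<le> L2_norm T (\<lambda>t. Op n v t - v t) + L2_norm T (\<lambda>t. Op n w t - w t)"
    proof (rule always_eventually, rule allI)
      fix n
      have "(\<lambda>t. Op n (\<lambda>t. v t + w t) t - (v t + w t)) = (\<lambda>t. (Op n v t - v t) + (Op n w t - w t))"
        by (simp add: Op_add[OF add(1,2)] fun_eq_iff)
      then show "norm (L2_norm T (\<lambda>t. Op n (\<lambda>t. v t + w t) t - (v t + w t)))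
       \<le> L2_norm T (\<lambda>t. Op n v t - v t) + L2_norm T (\<lambda>t. Op n w t - w t)"
        using L2_norm_triangle[OF L2_diff[OF Op_L2[of n v] add(1)] L2_diff[OF Op_L2[of n w] add(2)]] by simp
    qed
    show "(\<lambda>n. L2_norm T (\<lambda>t. Op n v t - v t) + L2_norm T (\<lambda>t. Op n w t - w t)) \<longlonglongrightarrow> 0"
      using tendsto_add[OF add(3,4)] by simp
  qed
next
  case (closed v)
  show ?case
  proof (rule tendstoI)
    fix e :: real assume e: "e > 0"
    define c where "c = sqrt (2 * A) + 1"
    have c: "c > 0" unfolding c_def using A by (simp add: add_nonneg_pos)
    obtain w where w: "w \<in> L2 T" "(\<lambda>n. L2_norm T (\<lambda>t. Op n w t - w t)) \<longlonglongrightarrow> 0"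
      "L2_norm T (\<lambda>t. v t - w t) < e / 2 / c"
      using closed(2)[of "e / 2 / c"] e c by auto
    have "\<forall>\<^sub>F n in sequentially. L2_norm T (\<lambda>t. Op n w t - w t) < e / 2"
      by (rule order_tendstoD(2)[OF w(2)]) (use e in simp)
    then show "\<forall>\<^sub>F n in sequentially. dist (L2_norm T (\<lambda>t. Op n v t - v t)) 0 < e"
    proof eventually_elim
      case (elim n)
      note vw = L2_diff[OF closed(1) w(1)]
      let ?a = "\<lambda>t. Op n (\<lambda>t. v t - w t) t" and ?b = "\<lambda>t. Op n w t - w t" and ?c = "\<lambda>t. w t - v t"
      have eq: "(\<lambda>t. Op n v t - v t) = (\<lambda>t. (?a t + ?b t) + ?c t)"
        by (simp add: Op_diff[OF closed(1) w(1)] fun_eq_iff)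
      have "L2_norm T (\<lambda>t. Op n v t - v t) \<le> (L2_norm T ?a + L2_norm T ?b) + L2_norm T ?c"
        unfolding eq
        using L2_norm_triangle[OF L2_add[OF Op_L2 L2_diff[OF Op_L2 w(1)]] L2_diff[OF w(1) closed(1)], of n "\<lambda>t. v t - w t" n w]
          L2_norm_triangle[OF Op_L2[of n "\<lambda>t. v t - w t"] L2_diff[OF Op_L2[of n w] w(1)]] by linarith
      also have "L2_norm T ?a \<le> sqrt (2 * A) * L2_norm T (\<lambda>t. v t - w t)" by (rule Op_bounded[OF vw])
      also have "L2_norm T ?c = L2_norm T (\<lambda>t. v t - w t)" by (rule L2_norm_minus_commute)
      finally have "L2_norm T (\<lambda>t. Op n v t - v t) \<le> c * L2_norm T (\<lambda>t. v t - w t) + L2_norm T ?b"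
        by (simp add: c_def algebra_simps)
      moreover have "c * L2_norm T (\<lambda>t. v t - w t) \<le> e / 2"
        using mult_left_mono[OF less_imp_le[OF w(3)], of c] c by simp
      ultimately show ?case using elim by simp
    qed
  qed
next
  case (base \<phi> y)
  let ?g = "\<lambda>t. \<phi> t *\<^sub>R y"
  have g: "continuous_on {0..T} ?g" by (intro continuous_intros continuous_on_subset[OF base]) auto
  show ?case
  proof (rule tendstoI)
    fix e :: real assume e: "e > 0"
    let ?e = "e / (2 * sqrt T)"
    have e': "?e > 0" using e T_pos by simp
    show "\<forall>\<^sub>F n in sequentially. dist (L2_norm T (\<lambda>t. Op n ?g t - ?g t)) 0 < e"
      using Op_uniform[OF g e']
    proof eventually_elim
      case (elim n)
      have "L2_norm T (\<lambda>t. Op n ?g t - ?g t) \<le> sqrt T * ?e"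
        by (rule L2_norm_le_sup) (use elim T_pos e' in \<open>auto intro!: AE_I2 L2_diff Op_L2 L2_continuous[OF g] less_imp_le\<close>)
      also have "\<dots> = e / 2" using T_pos by simp
      finally show ?case using e by simp
    qed
  qed
qed

end

section \<open>Spline weights for the averages\<close>

lemma max_power_has_derivative:
  "((\<lambda>x. (max 0 x) ^ (n + 2)) has_real_derivative (real n + 2) * (max 0 x) ^ (n + 1)) (at x)"
proof -
  consider "x < 0" | "x > 0" | "x = 0" by linarith
  then show ?thesis
  proof cases
    case 1
    have "((\<lambda>x. 0) has_real_derivative (real n + 2) * (max 0 x) ^ (n + 1)) (at x)" using 1 by simp
    then show ?thesis
      by (rule has_field_derivative_transform_within_open[where S = "{..<0}"]) (use 1 in auto)
  next
    case 2
    have "((\<lambda>x. x ^ (n + 2)) has_real_derivative (real n + 2) * (max 0 x) ^ (n + 1)) (at x)"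
      using 2 DERIV_pow[of "n + 2" x] by (simp add: add.commute)
    then show ?thesis
      by (rule has_field_derivative_transform_within_open[where S = "{0<..}"]) (use 2 in auto)
  next
    case 3
    have "(\<lambda>h. ((max 0 (0 + h)) ^ (n + 2) - (max 0 0) ^ (n + 2)) / h) \<midarrow>0\<rightarrow> (0::real)"
    proof (rule Lim_null_comparison)
      have "norm (((max 0 (0 + h)) ^ (n + 2) - (max 0 0) ^ (n + 2)) / h) \<le> \<bar>h\<bar> ^ (n + 1)" for h :: real
      proof (cases "h = 0")
        case False
        have "(max 0 h) ^ (n + 2) / \<bar>h\<bar> \<le> \<bar>h\<bar> ^ (n + 2) / \<bar>h\<bar>"
          by (intro divide_right_mono power_mono) auto
        also have "\<dots> = \<bar>h\<bar> ^ (n + 1)" using False by simp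
        finally have "(max 0 h) ^ (n + 2) / \<bar>h\<bar> \<le> \<bar>h\<bar> ^ (n + 1)" .
        moreover have "norm ((max 0 h) ^ (n + 2) / h) = (max 0 h) ^ (n + 2) / \<bar>h\<bar>"
          unfolding real_norm_def abs_divide by (simp only: abs_of_nonneg[OF zero_le_power[OF max.cobounded1]])
        ultimately show ?thesis by (simp only: add_0_left max.idem power_0_left) simp
      qed simp
      then show "\<forall>\<^sub>F h in at (0::real). norm (((max 0 (0 + h)) ^ (n + 2) - (max 0 0) ^ (n + 2)) / h) \<le> \<bar>h\<bar> ^ (n + 1)"
        by (intro always_eventually allI)
      have "((\<lambda>h. \<bar>h\<bar> ^ (n + 1)) \<longlongrightarrow> \<bar>0\<bar> ^ (n + 1)) (at (0::real))" by (intro tendsto_intros)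
      then show "((\<lambda>h. \<bar>h\<bar> ^ (n + 1)) \<longlongrightarrow> 0) (at (0::real))" by simp
    qed
    then show ?thesis using 3 by (simp add: DERIV_def)
  qed
qed

text \<open>A quadratic spline rising from \<open>0\<close> to \<open>1\<close> on \<open>[1/4, 3/4]\<close>.\<close>

definition step :: "real \<Rightarrow> real" where
  "step s = 8 * (max 0 (s - 1/4))\<^sup>2 - 16 * (max 0 (s - 1/2))\<^sup>2 + 8 * (max 0 (s - 3/4))\<^sup>2"

definition step' :: "real \<Rightarrow> real" where
  "step' s = 16 * max 0 (s - 1/4) - 32 * max 0 (s - 1/2) + 16 * max 0 (s - 3/4)"

text \<open>An antiderivative of \<open>step\<close>, from which the integral of \<open>bump\<close>
  is computed.\<close>

definition step_int :: "real \<Rightarrow> real" where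
  "step_int s = 8/3 * (max 0 (s - 1/4)) ^ 3 - 16/3 * (max 0 (s - 1/2)) ^ 3 + 8/3 * (max 0 (s - 3/4)) ^ 3"

lemma max_power_shift_derivative:
  "((\<lambda>s. (max 0 (s - a)) ^ (n + 2)) has_real_derivative (real n + 2) * (max 0 (s - a)) ^ (n + 1)) (at s)"
proof -
  have "((\<lambda>s. s - a) has_real_derivative 1) (at s)" by (auto intro!: derivative_eq_intros)
  from DERIV_chain2[where f = "\<lambda>x. (max 0 x) ^ (n + 2)" and g = "\<lambda>s. s - a", OF max_power_has_derivative this]
  show ?thesis by (simp only: mult_1_right)
qed

lemma step_deriv: "(step has_real_derivative step' s) (at s)"
proof -
  have d: "((\<lambda>s. (max 0 (s - a))\<^sup>2) has_real_derivative 2 * max 0 (s - a)) (at s)" for a s :: real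
    using max_power_shift_derivative[where n=0] by (simp add: numeral_2_eq_2)
  have "(step has_real_derivative 8 * (2 * max 0 (s - 1/4)) - 16 * (2 * max 0 (s - 1/2)) + 8 * (2 * max 0 (s - 3/4))) (at s)"
    unfolding step_def[abs_def] by (intro DERIV_add DERIV_diff DERIV_cmult d)
  then show ?thesis by (rule DERIV_cong) (simp add: step'_def)
qed

lemma step_int_deriv: "(step_int has_real_derivative step s) (at s)"
proof -
  have d: "((\<lambda>s. (max 0 (s - a)) ^ 3) has_real_derivative 3 * (max 0 (s - a))\<^sup>2) (at s)" for a s :: real
    using max_power_shift_derivative[where n=1] by (simp add: numeral_3_eq_3 numeral_2_eq_2)
  have "(step_int has_real_derivative 8/3 * (3 * (max 0 (s - 1/4))\<^sup>2) - 16/3 * (3 * (max 0 (s - 1/2))\<^sup>2) + 8/3 * (3 * (max 0 (s - 3/4))\<^sup>2)) (at s)"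
    unfolding step_int_def[abs_def] by (intro DERIV_add DERIV_diff DERIV_cmult d)
  then show ?thesis by (rule DERIV_cong) (simp add: step_def)
qed

lemma step'_cont: "continuous_on A step'"
  unfolding step'_def[abs_def] by (intro continuous_intros)

lemma step_cont: "continuous_on A step"
  unfolding step_def[abs_def] by (intro continuous_intros)

lemma step'_bounds: "0 \<le> step' s" "step' s \<le> 4" "s \<le> 1/4 \<Longrightarrow> step' s = 0" "3/4 \<le> s \<Longrightarrow> step' s = 0"
  by (auto simp: step'_def max_def)

lemma step_values: "s \<le> 1/4 \<Longrightarrow> step s = 0" "3/4 \<le> s \<Longrightarrow> step s = 1"
  by (auto simp: step_def max_def power2_eq_square algebra_simps)

lemma step_int_values: "s \<le> 1/4 \<Longrightarrow> step_int s = 0" "3/4 \<le> s \<Longrightarrow> step_int s = s - 1/2"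
  by (auto simp: step_int_def max_def power3_eq_cube field_simps)

lemma step_mono: "s \<le> s' \<Longrightarrow> step s \<le> step s'"
  by (rule DERIV_nonneg_imp_nondecreasing) (use step_deriv step'_bounds(1) in blast)+

lemma step_range: "0 \<le> step s" "step s \<le> 1"
proof -
  show "0 \<le> step s" using step_mono[of "min s 0" s] step_values(1)[of "min s 0"] by simp
  show "step s \<le> 1" using step_mono[of s "max s 1"] step_values(2)[of "max s 1"] by simp
qed

context
  fixes T :: real assumes T: "T > 0"
begin

text \<open>Since \<open>bump n m\<close> has derivative \<open>w1 n m - w1 n (m + 1)\<close> and support in the open interval, the
  differences of consecutive \<open>w1\<close>-averages of a function are multiples of \<open>w2\<close>-averages of its weak
  derivative.\<close>

definition "width n = T / (real n + 2)"
text \<open>The index runs from 0 to \<open>n + 1\<close>; the weights live in the interiors of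
  consecutive intervals of length \<open>width n\<close>, which tile [0,T].\<close>

definition "w1 n m t = (1 / width n) * step' (t / width n - real m)"
definition "bump n m t = step (t / width n - real m) - step (t / width n - real m - 1)"
text \<open>The factor is the one produced by differentiating a Bernstein polynomial of degree
  \<open>n + 1\<close> in \<open>t / T\<close>, so averages of the derivative appear without any
  further factor. As \<open>bump n m\<close> has integral \<open>width n\<close>, the mass is (n +
  1) / (n + 2); this is the origin of the tolerance \<open>1 / (real n + 2)\<close>.\<close>

definition "w2 n m t = (real n + 1) / T * bump n m t"

lemma width_pos: "width n > 0" using T by (simp add: width_def)

lemma T_width: "T / width n = real n + 2" using T by (simp add: width_def)

lemma width_lim: "width \<longlonglongrightarrow> 0"
proof -
  have "filterlim (\<lambda>n. real n + 2) at_top sequentially"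
    by (rule filterlim_at_top_mono[OF filterlim_real_sequentially]) (auto intro: always_eventually)
  then show ?thesis unfolding width_def[abs_def] by (rule real_tendsto_divide_at_top[OF tendsto_const])
qed

lemma bump_deriv: "(bump n m has_real_derivative (w1 n m t - w1 n (Suc m) t)) (at t)"
proof -
  have d: "((\<lambda>t. step (t / width n - b)) has_real_derivative step' (t / width n - b) * (1 / width n)) (at t)" for b
    by (rule DERIV_chain2[OF step_deriv]) (use width_pos[of n] in \<open>auto intro!: derivative_eq_intros\<close>)
  have "bump n m = (\<lambda>t. step (t / width n - real m) - step (t / width n - (real m + 1)))"
    by (simp add: bump_def fun_eq_iff algebra_simps)
  then have "(bump n m has_real_derivative step' (t / width n - real m) * (1 / width n) - step' (t / width n - (real m + 1)) * (1 / width n)) (at t)"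
    by (simp only:) (intro DERIV_diff d)
  then show ?thesis by (rule DERIV_cong) (simp add: w1_def add.commute)
qed

lemma w1_cont: "continuous_on A (w1 n m)"
  unfolding w1_def[abs_def]
  by (intro continuous_intros continuous_on_compose2[OF step'_cont[of UNIV]]) (use width_pos[of n] in auto)

lemma bump_cont: "continuous_on A (bump n m)"
  unfolding bump_def[abs_def]
  by (intro continuous_intros continuous_on_compose2[OF step_cont[of UNIV]]) (use width_pos[of n] in auto)

lemma bump_nonneg: "0 \<le> bump n m t"
  unfolding bump_def using step_mono[of "t / width n - real m - 1" "t / width n - real m"] by simp

lemma bump_supp:
  assumes "bump n m t \<noteq> 0"
  shows "width n * (real m + 1/4) \<le> t" "t \<le> width n * (real m + 7/4)"
proof -
  have "\<not> t / width n - real m < 1/4"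
  proof
    assume "t / width n - real m < 1/4"
    then have "bump n m t = 0" by (simp add: bump_def step_values(1))
    then show False using assms by simp
  qed
  then show "width n * (real m + 1/4) \<le> t" using width_pos[of n] by (simp add: field_simps)
  have "\<not> t / width n - real m > 7/4"
  proof
    assume "t / width n - real m > 7/4"
    then have "bump n m t = 0" by (simp add: bump_def step_values(2))
    then show False using assms by simp
  qed
  then show "t \<le> width n * (real m + 7/4)" using width_pos[of n] by (simp add: field_simps)
qed

lemma rho_lim: "(\<lambda>n. 1 / (real n + 2)) \<longlonglongrightarrow> 0"
proof -
  have "filterlim (\<lambda>n. real n + 2) at_top sequentially"
    by (rule filterlim_at_top_mono[OF filterlim_real_sequentially]) (auto intro: always_eventually)
  then show ?thesis by (rule real_tendsto_divide_at_top[OF tendsto_const])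
qed

lemma r_lim: "(\<lambda>n. 4 * width n) \<longlonglongrightarrow> 0"
  using tendsto_mult[OF tendsto_const[of 4] width_lim] by simp

lemma kantorovich_w1: "kantorovich T w1 (\<lambda>n. n + 1) (\<lambda>n. 4 * width n) (\<lambda>n. 1 / (real n + 2)) 4"
proof
  show "continuous_on UNIV (w1 n m)" for n m by (rule w1_cont)
  show "0 \<le> w1 n m t" for n m t unfolding w1_def using step'_bounds(1) width_pos[of n] by simp
  show "\<bar>t - T * (real m / real (n + 1))\<bar> \<le> 4 * width n" if m: "m \<le> n + 1" and nz: "w1 n m t \<noteq> 0" for n m t
  proof -
    have "1/4 < t / width n - real m" "t / width n - real m < 3/4"
      using nz step'_bounds(3,4)[of "t / width n - real m"] by (auto simp: w1_def not_le[symmetric])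
    then have 1: "\<bar>t - width n * real m\<bar> \<le> width n" using width_pos[of n] by (simp add: field_simps abs_le_iff)
    \<comment> \<open>The nodes divide [0,T] into n + 1 parts but the supports into n + 2, so the
      two grids drift apart, by at most one width.\<close>
    have "T * (real m / real (n + 1)) - width n * real m = width n * (real m / (real n + 1))"
      unfolding width_def by (simp add: field_simps)
    moreover have "0 \<le> real m / (real n + 1)" "real m / (real n + 1) \<le> 1" using m by auto
    ultimately have 2: "\<bar>T * (real m / real (n + 1)) - width n * real m\<bar> \<le> width n"
      using width_pos[of n] mult_left_le[of "real m / (real n + 1)" "width n"]
      by (simp only: abs_of_nonneg mult_nonneg_nonneg less_imp_le)
    show ?thesis using 1 2 width_pos[of n] by linarith
  qed
  show "\<bar>(LINT t|I0 T. w1 n m t) - 1\<bar> \<le> 1 / (real n + 2)" if m: "m \<le> n + 1" for n m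
  proof -
    have d: "((\<lambda>t. step (t / width n - real m)) has_real_derivative w1 n m t) (at t)" for t
      unfolding w1_def
      by (rule DERIV_cong, rule DERIV_chain2[OF step_deriv, where Db = "1 / width n"])
         (use width_pos[of n] in \<open>auto intro!: derivative_eq_intros\<close>)
    have "(w1 n m has_integral (step (T / width n - real m) - step (0 / width n - real m))) {0..T}"
      using T d by (intro fundamental_theorem_of_calculus)
        (auto simp: has_real_derivative_iff_has_vector_derivative intro: has_vector_derivative_at_within)
    moreover have "step (T / width n - real m) = 1" using m by (intro step_values(2)) (simp add: T_width)
    moreover have "step (0 / width n - real m) = 0" by (rule step_values(1)) simp
    ultimately have "integral {0..T} (w1 n m) = 1" by (simp add: integral_unique)
    then show ?thesis
      using lebesgue_integral_eq_integral[OF continuous_imp_integrable_real[OF w1_cont]] by simp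
  qed
  show "T / (real (n + 1) + 1) * (\<Sum>m\<le>n + 1. w1 n m t) \<le> 4" for n t
  proof -
    let ?x = "t / width n"
    have "T / (real (n + 1) + 1) * (\<Sum>m\<le>n + 1. w1 n m t) = (\<Sum>m\<le>n + 1. step' (?x - real m))"
      using T unfolding sum_distrib_left w1_def width_def by (intro sum.cong refl) (simp add: add.commute)
    \<comment> \<open>The supports are disjoint, so only the weight of the interval containing
      \<open>t\<close> contributes.\<close>
    also have "\<dots> \<le> (\<Sum>m\<le>n + 1. if m = nat \<lfloor>?x\<rfloor> then 4 else 0)"
    proof (rule sum_mono)
      fix m
      show "step' (?x - real m) \<le> (if m = nat \<lfloor>?x\<rfloor> then 4 else 0)"
      proof (cases "step' (?x - real m) = 0")
        case False
        then have a: "1/4 < ?x - real m" "?x - real m < 3/4"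
          using step'_bounds(3,4)[of "?x - real m"] by (auto simp: not_le[symmetric])
        have "\<lfloor>?x\<rfloor> = int m" unfolding floor_eq_iff of_int_of_nat_eq using a by linarith
        then show ?thesis using step'_bounds(2) by simp
      qed simp
    qed
    also have "\<dots> \<le> 4" by simp
    finally show ?thesis .
  qed
  show "filterlim (\<lambda>n. n + 1) at_top sequentially" by (rule filterlim_add_const_nat_at_top)
qed (use T rho_lim r_lim in auto)

lemma kantorovich_w2: "kantorovich T w2 (\<lambda>n. n) (\<lambda>n. 4 * width n) (\<lambda>n. 1 / (real n + 2)) 4"
proof
  show "continuous_on UNIV (w2 n m)" for n m
    unfolding w2_def[abs_def] by (intro continuous_intros bump_cont) (use T in auto)
  show "0 \<le> w2 n m t" for n m t unfolding w2_def using bump_nonneg T by simp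
  show "\<bar>t - T * (real m / real n)\<bar> \<le> 4 * width n" if m: "m \<le> n" and nz: "w2 n m t \<noteq> 0" for n m t
  proof -
    have "bump n m t \<noteq> 0" using nz by (auto simp: w2_def)
    from bump_supp[OF this] have 1: "\<bar>t - width n * real m\<bar> \<le> 2 * width n"
      using width_pos[of n] by (simp add: field_simps abs_le_iff)
    have 2: "\<bar>T * (real m / real n) - width n * real m\<bar> \<le> 2 * width n"
    proof (cases "n = 0")
      case False
      have "T * (real m / real n) - width n * real m = 2 * width n * (real m / real n)"
        unfolding width_def using False by (simp add: field_simps)
      moreover have "0 \<le> real m / real n" "real m / real n \<le> 1" using m by (auto simp: divide_le_eq)
      ultimately show ?thesis
        using width_pos[of n] mult_left_le[of "real m / real n" "2 * width n"]
        by (simp only: abs_of_nonneg mult_nonneg_nonneg less_imp_le zero_le_numeral)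
    qed (use m width_pos[of n] in simp)
    show ?thesis using 1 2 width_pos[of n] by linarith
  qed
  show "\<bar>(LINT t|I0 T. w2 n m t) - 1\<bar> \<le> 1 / (real n + 2)" if m: "m \<le> n" for n m
  proof -
    let ?Q = "\<lambda>t. width n * (step_int (t / width n - real m) - step_int (t / width n - real m - 1))"
    have d: "((\<lambda>t. width n * step_int (t / width n - b)) has_real_derivative step (t / width n - b)) (at t)" for t b
    proof (rule DERIV_cong, rule DERIV_cmult, rule DERIV_chain2[OF step_int_deriv, where Db = "1 / width n"])
      show "((\<lambda>t. t / width n - b) has_real_derivative 1 / width n) (at t)"
        using width_pos[of n] by (auto intro!: derivative_eq_intros)
    qed (use width_pos[of n] in simp)
    have "(?Q has_real_derivative bump n m t) (at t)" for t
      using DERIV_diff[OF d[of "real m" t] d[of "real m + 1" t]]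
      by (simp add: bump_def right_diff_distrib diff_diff_eq)
    then have "(bump n m has_integral (?Q T - ?Q 0)) {0..T}"
      using T by (intro fundamental_theorem_of_calculus)
        (auto simp: has_real_derivative_iff_has_vector_derivative intro: has_vector_derivative_at_within)
    moreover have "?Q T - ?Q 0 = width n"
      using m by (simp add: T_width step_int_values)
    ultimately have "integral {0..T} (bump n m) = width n" by (simp add: integral_unique)
    then have "(LINT t|I0 T. bump n m t) = width n"
      using lebesgue_integral_eq_integral[OF continuous_imp_integrable_real[OF bump_cont]] by simp
    then have eq: "(LINT t|I0 T. w2 n m t) = (real n + 1) / (real n + 2)"
      using T by (simp add: w2_def width_def)
    have "(real n + 1) / (real n + 2) - 1 = - (1 / (real n + 2))" by (simp add: field_simps)
    then show ?thesis unfolding eq by simp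
  qed
  show "T / (real n + 1) * (\<Sum>m\<le>n. w2 n m t) \<le> 4" for n t
  proof -
    have "T / (real n + 1) * (\<Sum>m\<le>n. w2 n m t) = (\<Sum>m\<le>n. bump n m t)"
      using T unfolding sum_distrib_left w2_def by (intro sum.cong refl) simp
    \<comment> \<open>Each \<open>bump\<close> is a difference of consecutive shifts of
      \<open>step\<close>, so the sum telescopes.\<close>
    also have "(\<Sum>m\<le>l. bump n m t) = step (t / width n) - step (t / width n - real l - 1)" for l
      by (induction l) (auto simp: bump_def algebra_simps)
    finally show ?thesis
      using step_range(1)[of "t / width n - real n - 1"] step_range(2)[of "t / width n"] by linarith
  qed
qed (use T rho_lim r_lim in \<open>auto intro: filterlim_ident\<close>)

end

subsection \<open>Approximation of functions with a weak derivative\<close>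

lemma psi0_0: "poly (psi0 0) s = 1"
proof -
  obtain c where c: "psi0 0 = [:c:]" using degree_psi0[of 0] by (metis degree_0_id le_zero_eq)
  have "integral {0..1} (\<lambda>s. poly (psi0 0) s * poly 1 s) = poly 1 0" by (rule psi0_integral) simp
  then show ?thesis by (simp add: c)
qed

lemma vpoly_affine_coeffs:
  shows "vpoly q (\<lambda>i. (if i = 0 then a else if i = 1 then b else 0) *\<^sub>R x) s = (if q = 0 then a else a + s * b) *\<^sub>R x"
    and "vpoly' q (\<lambda>i. (if i = 0 then a else if i = 1 then b else 0) *\<^sub>R x) s = (if q = 0 then 0 else b) *\<^sub>R (x :: 'a::real_vector)"
proof -
  let ?c = "\<lambda>i::nat. (if i = 0 then a else if i = 1 then b else 0) *\<^sub>R x"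
  have "vpoly q ?c s = (\<Sum>i\<in>{..q} \<inter> {0, 1}. s ^ i *\<^sub>R ?c i)"
    unfolding vpoly_def by (rule sum.mono_neutral_right) auto
  moreover have "vpoly' q ?c s = (\<Sum>i\<in>{..q} \<inter> {0, 1}. (real i * s ^ (i - 1)) *\<^sub>R ?c i)"
    unfolding vpoly'_def by (rule sum.mono_neutral_right) auto
  moreover have "{..q} \<inter> {0, 1} = (if q = 0 then {0} else {0, 1})" by auto
  ultimately show "vpoly q ?c s = (if q = 0 then a else a + s * b) *\<^sub>R x" "vpoly' q ?c s = (if q = 0 then 0 else b) *\<^sub>R x"
    by (auto simp: scaleR_add_left)
qed

context dg begin

text \<open>Interpolation by piecewise linear functions, and by piecewise constant ones if \<open>q = 0\<close>. In
  both cases the discrete derivative is the difference quotient.\<close>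

definition intp :: "(real \<Rightarrow> real) \<Rightarrow> real \<Rightarrow> real" where
  "intp \<phi> t = (if t \<le> 0 then \<phi> 0 else let m = nat \<lceil>t / k\<rceil> in
     if q = 0 then \<phi> (real m * k)
     else \<phi> ((real m - 1) * k) + loc m t * (\<phi> (real m * k) - \<phi> ((real m - 1) * k)))"

abbreviation "intp_coeff \<phi> x m i \<equiv> (if i = 0 then (if q = 0 then \<phi> (real m * k) else \<phi> ((real m - 1) * k))
   else if i = 1 then \<phi> (real m * k) - \<phi> ((real m - 1) * k) else 0) *\<^sub>R x"

lemma intp_hcell:
  assumes "m \<in> {1..N}" and t: "t \<in> {(real m - 1) * k <.. real m * k}"
  shows "intp \<phi> t = (if q = 0 then \<phi> (real m * k)
     else \<phi> ((real m - 1) * k) + loc m t * (\<phi> (real m * k) - \<phi> ((real m - 1) * k)))"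
proof -
  have "(real m - 1) * k \<ge> 0" using assms k_pos by simp
  then have "\<not> t \<le> 0" using t by auto
  then show ?thesis using cell_index[OF t] by (simp add: intp_def Let_def)
qed

lemma intp_vpoly:
  assumes "m \<in> {1..N}" "t \<in> {(real m - 1) * k <.. real m * k}"
  shows "intp \<phi> t *\<^sub>R x = vpoly q (intp_coeff \<phi> x m) (loc m t)"
  unfolding intp_hcell[OF assms] by (subst vpoly_affine_coeffs) auto

lemma intp_Wn: "x \<in> S \<Longrightarrow> (\<lambda>t. intp \<phi> t *\<^sub>R x) \<in> Wn"
proof (rule WnI[where c = "intp_coeff \<phi> x"])
  show "x \<in> S \<Longrightarrow> intp \<phi> 0 *\<^sub>R x \<in> S" by (rule subspace_scale[OF sub])
  show "x \<in> S \<Longrightarrow> intp_coeff \<phi> x m i \<in> S" for m i by (rule subspace_scale[OF sub])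
qed (rule intp_vpoly)

lemma intp_node: "m \<le> N \<Longrightarrow> intp \<phi> (real m * k) = \<phi> (real m * k)"
proof (cases "m = 0")
  case False
  assume "m \<le> N"
  then have m: "m \<in> {1..N}" using False by auto
  have "real m * k \<in> {(real m - 1) * k <.. real m * k}" using k_pos by (simp add: algebra_simps)
  moreover have "loc m (real m * k) = 1" using k_pos by (simp add: loc_def algebra_simps)
  ultimately show ?thesis using intp_hcell[OF m] by simp
qed (simp add: intp_def)

text \<open>If \<open>q = 0\<close>, the whole increment sits in the jump and \<open>psi0\<close> is
  1; otherwise the interpolant is continuous at the nodes, so the jump vanishes and the slope
  remains.\<close>

lemma intp_deriv:
  assumes x: "x \<in> S" and m: "m \<in> {1..N}" and t: "t \<in> cell m"
  shows "dg_deriv T N q (\<lambda>t. intp \<phi> t *\<^sub>R x) t = ((\<phi> (real m * k) - \<phi> ((real m - 1) * k)) / k) *\<^sub>R x"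
proof -
  let ?z = "\<lambda>t. intp \<phi> t *\<^sub>R x"
  have z: "?z \<in> Wn" by (rule intp_Wn[OF x])
  have c: "Cf ?z m i = intp_coeff \<phi> x m i" if "i \<le> q" for i
    by (rule dg_coeff_unique[OF z m that]) (rule intp_vpoly[OF m])
  have "m - 1 \<le> N" using m by auto
  from intp_node[OF this, of \<phi>] have "intp \<phi> ((real m - 1) * k) = \<phi> ((real m - 1) * k)"
    using m by (simp add: of_nat_diff)
  then have J: "jump ?z m = (if q = 0 then \<phi> (real m * k) - \<phi> ((real m - 1) * k) else 0) *\<^sub>R x"
    using c[of 0] by (simp add: jump_def scaleR_diff_left)
  have "vpoly' q (Cf ?z m) (loc m t) = vpoly' q (intp_coeff \<phi> x m) (loc m t)"
    unfolding vpoly'_def using c by (intro sum.cong refl) simp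
  also have "\<dots> = (if q = 0 then 0 else \<phi> (real m * k) - \<phi> ((real m - 1) * k)) *\<^sub>R x"
    by (rule vpoly_affine_coeffs(2))
  finally show ?thesis
    unfolding dg_deriv_cell[OF z m t] J by (simp add: psi0_0)
qed

lemma intp_error:
  assumes mod: "\<And>s t. s \<in> {0..T} \<Longrightarrow> t \<in> {0..T} \<Longrightarrow> \<bar>s - t\<bar> \<le> k \<Longrightarrow> \<bar>\<phi> s - \<phi> t\<bar> \<le> \<omega>" and t: "t \<in> {0..T}" and \<omega>: "\<omega> \<ge> 0"
  shows "\<bar>intp \<phi> t - \<phi> t\<bar> \<le> \<omega>"
proof (cases "t = 0")
  case False
  then have "t \<in> {0<..T}" using t by auto
  then obtain m where m: "m \<in> {1..N}" "t \<in> {(real m - 1) * k <.. real m * k}" by (rule in_hcell)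
  let ?a = "(real m - 1) * k" and ?b = "real m * k"
  have ab: "?a \<in> {0..T}" "?b \<in> {0..T}" "?b - ?a = k"
    using icell_subset[OF m(1)] k_pos by (auto simp: algebra_simps)
  have 1: "\<bar>\<phi> ?a - \<phi> t\<bar> \<le> \<omega>" "\<bar>\<phi> ?b - \<phi> t\<bar> \<le> \<omega>"
  proof -
    have "\<bar>?a - t\<bar> \<le> k" "\<bar>?b - t\<bar> \<le> k" using m(2) ab(3) by auto
    then show "\<bar>\<phi> ?a - \<phi> t\<bar> \<le> \<omega>" "\<bar>\<phi> ?b - \<phi> t\<bar> \<le> \<omega>" using mod ab(1,2) t by blast+
  qed
  show ?thesis
  proof (cases "q = 0")
    case True then show ?thesis using intp_hcell[OF m] 1 by simp
  next
    case False
    let ?l = "loc m t"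
    have l: "0 \<le> ?l" "?l \<le> 1" using loc_icell[of t m] m(2) by auto
    have "intp \<phi> t - \<phi> t = (1 - ?l) * (\<phi> ?a - \<phi> t) + ?l * (\<phi> ?b - \<phi> t)"
      using intp_hcell[OF m] False by (simp add: algebra_simps)
    also have "\<bar>\<dots>\<bar> \<le> (1 - ?l) * \<bar>\<phi> ?a - \<phi> t\<bar> + ?l * \<bar>\<phi> ?b - \<phi> t\<bar>"
      using l by (intro order_trans[OF abs_triangle_ineq]) (simp add: abs_mult)
    also have "\<dots> \<le> (1 - ?l) * \<omega> + ?l * \<omega>" using l 1 by (intro add_mono mult_left_mono) auto
    finally show ?thesis by (simp add: algebra_simps)
  qed
qed (use \<omega> in \<open>simp add: intp_def\<close>)

lemma diff_quotient_error:
  assumes \<phi>: "\<And>t. (\<phi> has_real_derivative \<phi>' t) (at t)"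
    and mod: "\<And>s t. s \<in> {0..T} \<Longrightarrow> t \<in> {0..T} \<Longrightarrow> \<bar>s - t\<bar> \<le> k \<Longrightarrow> \<bar>\<phi>' s - \<phi>' t\<bar> \<le> \<omega>"
    and m: "m \<in> {1..N}" and t: "t \<in> cell m"
  shows "\<bar>(\<phi> (real m * k) - \<phi> ((real m - 1) * k)) / k - \<phi>' t\<bar> \<le> \<omega>"
proof -
  let ?a = "(real m - 1) * k" and ?b = "real m * k"
  have "?a < ?b" using k_pos by (simp add: algebra_simps)
  then obtain x where x: "?a < x" "x < ?b" "\<phi> ?b - \<phi> ?a = (?b - ?a) * \<phi>' x"
    using MVT2[of ?a ?b \<phi> \<phi>'] \<phi> by blast
  have "?b - ?a = k" by (simp add: algebra_simps)
  then have "(\<phi> ?b - \<phi> ?a) / k = \<phi>' x" using x(3) k_pos by simp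
  moreover have "\<bar>\<phi>' x - \<phi>' t\<bar> \<le> \<omega>"
    using icell_subset[OF m] x t cell_subset[OF m] by (intro mod) (auto simp: cell_def abs_le_iff algebra_simps)
  ultimately show ?thesis by simp
qed

end

section \<open>Functions that are approximable together with their derivative\<close>

context dg_seq begin

text \<open>\<open>G\<close> represents the derivative, \<open>u\<close> is the function in V and
  \<open>h\<close> the same function in H. The latter is a separate argument because its values
  count at every \<open>t\<close>, whereas \<open>u\<close> matters only almost everywhere.\<close>

definition appr :: "(real \<Rightarrow> 'u) \<Rightarrow> (real \<Rightarrow> 'u) \<Rightarrow> (real \<Rightarrow> 'h) \<Rightarrow> bool" where
  "appr G u h \<longleftrightarrow> (\<forall>\<epsilon>>0. \<forall>\<^sub>F n in sequentially. \<exists>z\<in>Wnn n. L2_norm T (\<lambda>t. Gm n z t - G t) < \<epsilon> \<and>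
     L2_norm T (\<lambda>t. z t - u t) < \<epsilon> \<and> (\<forall>t\<in>{0..T}. norm (j (z t) - h t) < \<epsilon>))"

lemma apprD: "appr G u h \<Longrightarrow> \<epsilon> > 0 \<Longrightarrow> \<forall>\<^sub>F n in sequentially. \<exists>z\<in>Wnn n. L2_norm T (\<lambda>t. Gm n z t - G t) < \<epsilon> \<and>
     L2_norm T (\<lambda>t. z t - u t) < \<epsilon> \<and> (\<forall>t\<in>{0..T}. norm (j (z t) - h t) < \<epsilon>)"
  by (simp add: appr_def)

lemma appr_add:
  assumes 1: "appr G1 u1 h1" and 2: "appr G2 u2 h2" and L: "G1 \<in> L2 T" "G2 \<in> L2 T" "u1 \<in> L2 T" "u2 \<in> L2 T"
  shows "appr (\<lambda>t. G1 t + G2 t) (\<lambda>t. u1 t + u2 t) (\<lambda>t. h1 t + h2 t)"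
  unfolding appr_def
proof (intro allI impI)
  fix \<epsilon> :: real assume e: "\<epsilon> > 0"
  then have e2: "\<epsilon> / 2 > 0" by simp
  show "\<forall>\<^sub>F n in sequentially. \<exists>z\<in>Wnn n. L2_norm T (\<lambda>t. Gm n z t - (G1 t + G2 t)) < \<epsilon> \<and>
     L2_norm T (\<lambda>t. z t - (u1 t + u2 t)) < \<epsilon> \<and> (\<forall>t\<in>{0..T}. norm (j (z t) - (h1 t + h2 t)) < \<epsilon>)"
    using apprD[OF 1 e2] apprD[OF 2 e2]
  proof eventually_elim
    case (elim n)
    from elim(1) obtain z1 where z1: "z1 \<in> Wnn n" "L2_norm T (\<lambda>t. Gm n z1 t - G1 t) < \<epsilon> / 2"
      "L2_norm T (\<lambda>t. z1 t - u1 t) < \<epsilon> / 2" "\<forall>t\<in>{0..T}. norm (j (z1 t) - h1 t) < \<epsilon> / 2" by blast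
    from elim(2) obtain z2 where z2: "z2 \<in> Wnn n" "L2_norm T (\<lambda>t. Gm n z2 t - G2 t) < \<epsilon> / 2"
      "L2_norm T (\<lambda>t. z2 t - u2 t) < \<epsilon> / 2" "\<forall>t\<in>{0..T}. norm (j (z2 t) - h2 t) < \<epsilon> / 2" by blast
    let ?z = "\<lambda>t. 1 *\<^sub>R z1 t + 1 *\<^sub>R z2 t"
    have z: "?z \<in> Wnn n" by (rule D.Wn_lincomb(1)[OF z1(1) z2(1)])
    note GL = D.Gam_L2[OF z1(1)] D.Gam_L2[OF z2(1)] D.Gam_L2[OF z]
    have "L2_norm T (\<lambda>t. Gm n ?z t - (G1 t + G2 t)) = L2_norm T (\<lambda>t. (Gm n z1 t - G1 t) + (Gm n z2 t - G2 t))"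
    proof (rule L2_norm_cong_AE)
      show "AE t in I0 T. norm (Gm n ?z t - (G1 t + G2 t)) = norm ((Gm n z1 t - G1 t) + (Gm n z2 t - G2 t))"
      proof (rule D.AE_cellI)
        fix m t assume "m \<in> {1..N n}" "t \<in> grid.cell T (N n) m"
        from D.Gam_lincomb_cell[OF z1(1) z2(1) this, of 1 1]
        show "norm (Gm n ?z t - (G1 t + G2 t)) = norm ((Gm n z1 t - G1 t) + (Gm n z2 t - G2 t))"
          by (simp add: algebra_simps)
      qed
    qed (intro L2_measurable L2_diff L2_add GL L)+
    also have "\<dots> \<le> L2_norm T (\<lambda>t. Gm n z1 t - G1 t) + L2_norm T (\<lambda>t. Gm n z2 t - G2 t)"
      by (intro L2_norm_triangle L2_diff GL L)
    finally have a: "L2_norm T (\<lambda>t. Gm n ?z t - (G1 t + G2 t)) < \<epsilon>" using z1(2) z2(2) by simp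
    have "L2_norm T (\<lambda>t. ?z t - (u1 t + u2 t)) = L2_norm T (\<lambda>t. (z1 t - u1 t) + (z2 t - u2 t))"
      by (simp add: algebra_simps)
    also have "\<dots> \<le> L2_norm T (\<lambda>t. z1 t - u1 t) + L2_norm T (\<lambda>t. z2 t - u2 t)"
      by (intro L2_norm_triangle L2_diff D.Wn_L2[OF z1(1)] D.Wn_L2[OF z2(1)] L)
    finally have b: "L2_norm T (\<lambda>t. ?z t - (u1 t + u2 t)) < \<epsilon>" using z1(3) z2(3) by simp
    have c: "norm (j (?z t) - (h1 t + h2 t)) < \<epsilon>" if "t \<in> {0..T}" for t
    proof -
      have eq: "j (?z t) - (h1 t + h2 t) = (j (z1 t) - h1 t) + (j (z2 t) - h2 t)" by (simp add: D.j.add)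
      show ?thesis unfolding eq
        using norm_triangle_ineq[of "j (z1 t) - h1 t" "j (z2 t) - h2 t"] bspec[OF z1(4) that] bspec[OF z2(4) that]
        by linarith
    qed
    show ?case using a b c z by blast
  qed
qed

lemma appr_closed:
  assumes L: "G \<in> L2 T" "u \<in> L2 T"
    and a: "\<And>\<epsilon>. \<epsilon> > 0 \<Longrightarrow> \<exists>G' u' h'. appr G' u' h' \<and> G' \<in> L2 T \<and> u' \<in> L2 T \<and> L2_norm T (\<lambda>t. G' t - G t) < \<epsilon> \<and>
      L2_norm T (\<lambda>t. u' t - u t) < \<epsilon> \<and> (\<forall>t\<in>{0..T}. norm (h' t - h t) < \<epsilon>)"
  shows "appr G u h"
  unfolding appr_def
proof (intro allI impI)
  fix \<epsilon> :: real assume "\<epsilon> > 0"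
  then have e2: "\<epsilon> / 2 > 0" by simp
  from a[OF e2] obtain G' u' h' where A: "appr G' u' h'" "G' \<in> L2 T" "u' \<in> L2 T"
      "L2_norm T (\<lambda>t. G' t - G t) < \<epsilon> / 2" "L2_norm T (\<lambda>t. u' t - u t) < \<epsilon> / 2" "\<forall>t\<in>{0..T}. norm (h' t - h t) < \<epsilon> / 2"
    by blast
  show "\<forall>\<^sub>F n in sequentially. \<exists>z\<in>Wnn n. L2_norm T (\<lambda>t. Gm n z t - G t) < \<epsilon> \<and>
     L2_norm T (\<lambda>t. z t - u t) < \<epsilon> \<and> (\<forall>t\<in>{0..T}. norm (j (z t) - h t) < \<epsilon>)"
    using apprD[OF A(1) e2]
  proof eventually_elim
    case (elim n)
    then obtain z where z: "z \<in> Wnn n" "L2_norm T (\<lambda>t. Gm n z t - G' t) < \<epsilon> / 2"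
      "L2_norm T (\<lambda>t. z t - u' t) < \<epsilon> / 2" "\<forall>t\<in>{0..T}. norm (j (z t) - h' t) < \<epsilon> / 2" by blast
    have "L2_norm T (\<lambda>t. Gm n z t - G t) < \<epsilon>"
      using L2_norm_diff_triangle[OF D.Gam_L2[OF z(1)] A(2) L(1)] z(2) A(4) by simp
    moreover have "L2_norm T (\<lambda>t. z t - u t) < \<epsilon>"
      using L2_norm_diff_triangle[OF D.Wn_L2[OF z(1)] A(3) L(2)] z(3) A(5) by simp
    moreover have "norm (j (z t) - h t) < \<epsilon>" if "t \<in> {0..T}" for t
      using norm_triangle_ineq[of "j (z t) - h' t" "h' t - h t"] bspec[OF z(4) that] bspec[OF A(6) that] by simp
    ultimately show ?case using z(1) by blast
  qed
qed

lemma uniform_modulus: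
  fixes g :: "real \<Rightarrow> real"
  assumes "continuous_on {0..T} g" "\<omega> > 0"
  shows "\<exists>d>0. \<forall>s\<in>{0..T}. \<forall>t\<in>{0..T}. \<bar>s - t\<bar> < d \<longrightarrow> \<bar>g s - g t\<bar> \<le> \<omega>"
proof -
  have "uniformly_continuous_on {0..T} g" using assms(1) by (intro compact_uniformly_continuous) auto
  then obtain d where "d > 0" "\<And>s t. s \<in> {0..T} \<Longrightarrow> t \<in> {0..T} \<Longrightarrow> dist t s < d \<Longrightarrow> dist (g t) (g s) < \<omega>"
    using assms(2) unfolding uniformly_continuous_on_def by blast
  then show ?thesis by (intro exI[of _ d]) (auto simp: dist_real_def less_imp_le)
qed

text \<open>For a scalar function times a vector the two discretizations separate: the function is
  interpolated, the vector projected. The vector in the derivative is projected both before and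
  after \<open>emb_adj j\<close>; it still converges, since the projections are
  contractions.\<close>

lemma appr_base:
  assumes \<phi>: "\<And>t. (\<phi> has_real_derivative \<phi>' t) (at t)" and \<phi>': "continuous_on UNIV \<phi>'"
  shows "appr (\<lambda>t. \<phi>' t *\<^sub>R emb_adj j y) (\<lambda>t. \<phi> t *\<^sub>R y) (\<lambda>t. \<phi> t *\<^sub>R j y)"
  unfolding appr_def
proof (intro allI impI)
  fix \<epsilon> :: real assume e: "\<epsilon> > 0"
  let ?E = "emb_adj j"
  note E = bounded_linear_emb_adj[OF D.j]
  have \<phi>c: "continuous_on A \<phi>" for A using \<phi> DERIV_isCont by (blast intro: continuous_at_imp_continuous_on)
  obtain B where B: "B \<ge> 0" "\<And>t. t \<in> {0..T} \<Longrightarrow> \<bar>\<phi> t\<bar> \<le> B"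
    using bounded_on_interval[OF \<phi>c[of "{0..T}"]] by auto
  obtain B' where B': "B' \<ge> 0" "\<And>t. t \<in> {0..T} \<Longrightarrow> \<bar>\<phi>' t\<bar> \<le> B'"
    using bounded_on_interval[OF continuous_on_subset[OF \<phi>' subset_UNIV], of 0 T] by auto
  \<comment> \<open>\<open>C\<close> collects the factors of \<omega> in the pointwise estimates,
    \<open>K\<close> the factors for passing from these to L2 and to H; the summand 1 makes the
    bounds strict.\<close>
  define C where "C = (onorm ?E * norm y + B') + (norm y + B) + 1"
  define K where "K = 1 + sqrt T + onorm j"
  have T0: "T > 0" by (rule D.T_pos)
  have p: "0 \<le> onorm ?E * norm y" by (intro mult_nonneg_nonneg onorm_pos_le[OF E]) simp
  have C: "C > 0" unfolding C_def using p B(1) B'(1) norm_ge_zero[of y] by linarith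
  have "sqrt T \<ge> 0" using T0 by simp
  then have K: "K > 0" "sqrt T < K" "onorm j < K"
    unfolding K_def using onorm_pos_le[OF D.j] by linarith+
  define \<omega> where "\<omega> = \<epsilon> / (K * C)"
  have \<omega>: "\<omega> > 0" and KCw: "K * (\<omega> * C) = \<epsilon>" using e C K by (auto simp: \<omega>_def)
  obtain d where d: "d > 0" "\<And>s t. s \<in> {0..T} \<Longrightarrow> t \<in> {0..T} \<Longrightarrow> \<bar>s - t\<bar> < d \<Longrightarrow> \<bar>\<phi> s - \<phi> t\<bar> \<le> \<omega>"
    using uniform_modulus[OF \<phi>c \<omega>] by blast
  obtain d' where d': "d' > 0" "\<And>s t. s \<in> {0..T} \<Longrightarrow> t \<in> {0..T} \<Longrightarrow> \<bar>s - t\<bar> < d' \<Longrightarrow> \<bar>\<phi>' s - \<phi>' t\<bar> \<le> \<omega>"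
    using uniform_modulus[OF continuous_on_subset[OF \<phi>' subset_UNIV] \<omega>] by blast
  let ?x = "\<lambda>n. oproj (U n) y"
  have Elim: "(\<lambda>n. oproj (U n) (?E (?x n))) \<longlonglongrightarrow> ?E y"
    by (intro oproj_lim_seq bounded_linear.tendsto[OF E] oproj_lim)
  have "\<forall>\<^sub>F n in sequentially. kk n < min d d'" by (rule order_tendstoD(2)[OF kk_lim]) (use d d' in simp)
  moreover have "\<forall>\<^sub>F n in sequentially. dist (?x n) y < \<omega>" by (rule tendstoD[OF oproj_lim \<omega>])
  moreover have "\<forall>\<^sub>F n in sequentially. dist (oproj (U n) (?E (?x n))) (?E y) < \<omega>" by (rule tendstoD[OF Elim \<omega>])
  ultimately show "\<forall>\<^sub>F n in sequentially. \<exists>z\<in>Wnn n. L2_norm T (\<lambda>t. Gm n z t - \<phi>' t *\<^sub>R ?E y) < \<epsilon> \<and>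
     L2_norm T (\<lambda>t. z t - \<phi> t *\<^sub>R y) < \<epsilon> \<and> (\<forall>t\<in>{0..T}. norm (j (z t) - \<phi> t *\<^sub>R j y) < \<epsilon>)"
  proof eventually_elim
    case (elim n)
    let ?i = "dg.intp T (N n) q \<phi>" let ?z = "\<lambda>t. ?i t *\<^sub>R ?x n"
    have z: "?z \<in> Wnn n" by (rule D.intp_Wn) (rule D.oproj_in)
    have mod: "\<bar>\<phi> s - \<phi> t\<bar> \<le> \<omega>" "\<bar>\<phi>' s - \<phi>' t\<bar> \<le> \<omega>" if "s \<in> {0..T}" "t \<in> {0..T}" "\<bar>s - t\<bar> \<le> kk n" for s t
      using d(2) d'(2) that elim(1) by auto
    have zb: "norm (?z t - \<phi> t *\<^sub>R y) \<le> \<omega> * C" if t: "t \<in> {0..T}" for t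
    proof -
      have "?z t - \<phi> t *\<^sub>R y = (?i t - \<phi> t) *\<^sub>R ?x n + \<phi> t *\<^sub>R (?x n - y)"
        by (simp add: algebra_simps)
      also have "norm \<dots> \<le> \<bar>?i t - \<phi> t\<bar> * norm (?x n) + \<bar>\<phi> t\<bar> * norm (?x n - y)"
        by (rule order_trans[OF norm_triangle_ineq]) simp
      also have "\<dots> \<le> \<omega> * norm y + B * \<omega>"
        using D.intp_error[of n \<phi> \<omega> t] mod t \<omega> D.oproj_norm_le B elim(2)
        by (intro add_mono mult_mono) (auto simp: dist_norm)
      also have "\<dots> = \<omega> * (norm y + B)" by (simp add: algebra_simps)
      also have "\<dots> \<le> \<omega> * C" using \<omega> p B'(1) unfolding C_def by (intro mult_left_mono) auto
      finally show ?thesis .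
    qed
    have b: "L2_norm T (\<lambda>t. ?z t - \<phi> t *\<^sub>R y) < \<epsilon>"
    proof -
      have L: "(\<lambda>t. \<phi> t *\<^sub>R y) \<in> L2 T" by (intro L2_continuous continuous_intros \<phi>c)
      have "L2_norm T (\<lambda>t. ?z t - \<phi> t *\<^sub>R y) \<le> sqrt T * (\<omega> * C)"
        by (rule L2_norm_le_sup) (use zb T0 \<omega> C in \<open>auto intro!: AE_I2 L2_diff D.Wn_L2[OF z] L\<close>)
      also have "\<dots> < K * (\<omega> * C)" using K \<omega> C by (intro mult_strict_right_mono) auto
      finally show ?thesis by (simp add: KCw)
    qed
    have c: "norm (j (?z t) - \<phi> t *\<^sub>R j y) < \<epsilon>" if t: "t \<in> {0..T}" for t
    proof -
      have "j (?z t) - \<phi> t *\<^sub>R j y = j (?z t - \<phi> t *\<^sub>R y)" by (simp add: D.j.diff D.j.scaleR)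
      also have "norm \<dots> \<le> onorm j * norm (?z t - \<phi> t *\<^sub>R y)" by (rule onorm[OF D.j])
      also have "\<dots> \<le> onorm j * (\<omega> * C)" using zb[OF t] onorm_pos_le[OF D.j] by (rule mult_left_mono)
      also have "\<dots> < K * (\<omega> * C)" using K \<omega> C by (intro mult_strict_right_mono) auto
      finally show ?thesis by (simp add: KCw)
    qed
    have a: "L2_norm T (\<lambda>t. Gm n ?z t - \<phi>' t *\<^sub>R ?E y) < \<epsilon>"
    proof -
      have L: "(\<lambda>t. \<phi>' t *\<^sub>R ?E y) \<in> L2 T" by (intro L2_continuous continuous_intros continuous_on_subset[OF \<phi>']) auto
      let ?p = "oproj (U n) (?E (?x n))"
      have "AE t in I0 T. norm (Gm n ?z t - \<phi>' t *\<^sub>R ?E y) \<le> \<omega> * C"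
      proof (rule D.AE_cellI)
        fix m t assume m: "m \<in> {1..N n}" and t: "t \<in> grid.cell T (N n) m"
        have t': "t \<in> {0..T}" using D.cell_subset[OF m] t by blast
        let ?d = "(\<phi> (real m * kk n) - \<phi> ((real m - 1) * kk n)) / kk n"
        have "Gm n ?z t = ?d *\<^sub>R ?p"
          unfolding D.Gam_def D.intp_deriv[OF D.oproj_in m t] by (rule linear_scale[OF D.linear_BB])
        then have "Gm n ?z t - \<phi>' t *\<^sub>R ?E y = (?d - \<phi>' t) *\<^sub>R ?p + \<phi>' t *\<^sub>R (?p - ?E y)"
          by (simp add: algebra_simps)
        also have "norm \<dots> \<le> \<bar>?d - \<phi>' t\<bar> * norm ?p + \<bar>\<phi>' t\<bar> * norm (?p - ?E y)"
          by (rule order_trans[OF norm_triangle_ineq]) simp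
        also have "\<dots> \<le> \<omega> * (onorm ?E * norm y) + B' * \<omega>"
        proof (intro add_mono mult_mono)
          show "\<bar>?d - \<phi>' t\<bar> \<le> \<omega>" by (rule D.diff_quotient_error[OF \<phi> mod(2) m t])
          have "norm ?p \<le> norm (?E (?x n))" by (rule D.oproj_norm_le)
          also have "\<dots> \<le> onorm ?E * norm (?x n)" by (rule onorm[OF E])
          also have "\<dots> \<le> onorm ?E * norm y" using onorm_pos_le[OF E] by (intro mult_left_mono D.oproj_norm_le)
          finally show "norm ?p \<le> onorm ?E * norm y" .
        qed (use \<omega> B' t' elim(3) in \<open>auto simp: dist_norm\<close>)
        also have "\<dots> = \<omega> * (onorm ?E * norm y + B')" by (simp add: algebra_simps)
        also have "\<dots> \<le> \<omega> * C" using \<omega> B(1) unfolding C_def by (intro mult_left_mono) auto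
        finally show "norm (Gm n ?z t - \<phi>' t *\<^sub>R ?E y) \<le> \<omega> * C" .
      qed
      then have "L2_norm T (\<lambda>t. Gm n ?z t - \<phi>' t *\<^sub>R ?E y) \<le> sqrt T * (\<omega> * C)"
        by (intro L2_norm_le_sup) (use T0 \<omega> C in \<open>auto intro!: L2_diff D.Gam_L2[OF z] L\<close>)
      also have "\<dots> < K * (\<omega> * C)" using K \<omega> C by (intro mult_strict_right_mono) auto
      finally show ?thesis by (simp add: KCw)
    qed
    show ?case using a b c z by blast
  qed
qed

lemma appr_sum:
  fixes l :: nat
  assumes \<phi>: "\<And>m t. (\<phi> m has_real_derivative \<phi>' m t) (at t)" and \<phi>': "\<And>m. continuous_on UNIV (\<phi>' m)"
  shows "appr (\<lambda>t. \<Sum>m\<le>l. \<phi>' m t *\<^sub>R emb_adj j (y m)) (\<lambda>t. \<Sum>m\<le>l. \<phi> m t *\<^sub>R y m) (\<lambda>t. \<Sum>m\<le>l. \<phi> m t *\<^sub>R j (y m))"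
proof (induction l)
  case 0
  show ?case using appr_base[OF \<phi> \<phi>', of 0 "y 0"] by simp
next
  case (Suc l)
  have \<phi>c: "continuous_on A (\<phi> m)" for A m using \<phi> DERIV_isCont by (blast intro: continuous_at_imp_continuous_on)
  have L: "(\<lambda>t. \<phi> m t *\<^sub>R x) \<in> L2 T" "(\<lambda>t. \<phi>' m t *\<^sub>R x) \<in> L2 T" for m and x :: 'u
    by (intro L2_continuous continuous_intros \<phi>c, intro L2_continuous continuous_intros continuous_on_subset[OF \<phi>'] subset_UNIV)
  show ?case unfolding sum.atMost_Suc
    by (intro appr_add Suc appr_base[OF \<phi> \<phi>'] L2_sum L)
qed

lemma appr_Bernstein:
  "appr (\<lambda>t. \<Sum>m\<le>n + 1. (real (Suc n) * ((if m = 0 then 0 else Bernstein n (m - 1) (t / T)) - Bernstein n m (t / T)) * (1 / T)) *\<^sub>R emb_adj j (y m))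
     (\<lambda>t. \<Sum>m\<le>n + 1. Bernstein (n + 1) m (t / T) *\<^sub>R y m) (\<lambda>t. \<Sum>m\<le>n + 1. Bernstein (n + 1) m (t / T) *\<^sub>R j (y m))"
proof (rule appr_sum)
  have T0: "T > 0" by (rule D.T_pos)
  fix m
  show "((\<lambda>t. Bernstein (n + 1) m (t / T)) has_real_derivative
      real (Suc n) * ((if m = 0 then 0 else Bernstein n (m - 1) (t / T)) - Bernstein n m (t / T)) * (1 / T)) (at t)" for t
    unfolding Suc_eq_plus1[symmetric]
    by (rule DERIV_chain2[OF Bernstein_has_derivative]) (use T0 in \<open>auto intro!: derivative_eq_intros\<close>)
  show "continuous_on UNIV (\<lambda>t. real (Suc n) * ((if m = 0 then 0 else Bernstein n (m - 1) (t / T)) - Bernstein n m (t / T)) * (1 / T))"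
    by (cases "m = 0") (use T0 in \<open>auto intro!: continuous_intros\<close>)
qed

text \<open>The two families of weights are matched so that the derivative of
  \<open>K1.Op n uU\<close> is represented by \<open>K2.Op n G\<close> exactly. These Bernstein sums
  have coefficients obtained from vectors of U and are approximable; the convergence of both
  operators and closedness do the rest.\<close>

lemma appr_weak_deriv:
  assumes u: "continuous_on {0..T} u" and uU: "uU \<in> L2 T" "AE t in I0 T. j (uU t) = u t" and G: "G \<in> L2 T"
    and wd: "\<And>v. v \<in> C1c T \<Longrightarrow> V_inner T G v = - H_inner T u (\<lambda>t. j (vector_derivative v (at t)))"
  shows "appr G uU u"
proof -
  have T0: "T > 0" by (rule D.T_pos)
  interpret K1: kantorovich T "w1 T" "\<lambda>n. n + 1" "\<lambda>n. 4 * width T n" "\<lambda>n. 1 / (real n + 2)" 4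
    by (rule kantorovich_w1[OF T0])
  interpret K2: kantorovich T "w2 T" "\<lambda>n. n" "\<lambda>n. 4 * width T n" "\<lambda>n. 1 / (real n + 2)" 4
    by (rule kantorovich_w2[OF T0])
  have uL: "u \<in> L2 T" by (rule L2_continuous[OF u])
  \<comment> \<open>The averages in H are images of averages in U, so one family of vectors of U
    serves both the convergence in V and the uniform convergence in H.\<close>
  have avg_j: "K1.avg n m u = j (K1.avg n m uU)" for n m
  proof -
    have "j (K1.avg n m uU) = (LINT t|I0 T. j (w1 T n m t *\<^sub>R uU t))"
      unfolding K1.avg_def
      by (rule integral_bounded_linear[OF D.j, symmetric]) (rule L2_integrable_vec[OF K1.w_L2[OF uU(1)]])
    also have "\<dots> = K1.avg n m u"
      unfolding K1.avg_def
    proof (rule integral_cong_AE)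
      show "(\<lambda>t. j (w1 T n m t *\<^sub>R uU t)) \<in> borel_measurable (I0 T)"
        by (rule L2_measurable[OF L2_linear[OF K1.w_L2[OF uU(1)] D.j]])
      show "(\<lambda>t. w1 T n m t *\<^sub>R u t) \<in> borel_measurable (I0 T)" by (rule L2_measurable[OF K1.w_L2[OF uL]])
      show "AE t in I0 T. j (w1 T n m t *\<^sub>R uU t) = w1 T n m t *\<^sub>R u t"
        using uU(2) by eventually_elim (simp add: D.j.scaleR)
    qed
    finally show ?thesis ..
  qed
  have bL: "(\<lambda>t. bump T n m t *\<^sub>R G t) \<in> L2 T" for n m
  proof -
    obtain B where "\<And>t. t \<in> {0..T} \<Longrightarrow> \<bar>bump T n m t\<bar> \<le> B"
      using bounded_on_interval[OF bump_cont[OF T0], of 0 T n m] unfolding real_norm_def by blast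
    then show ?thesis by (rule L2_mult_bounded[OF G continuous_on_imp_measurable_I[OF bump_cont[OF T0]]])
  qed
  \<comment> \<open>The weak derivative is tested with \<open>bump\<close> times a vector;
    differentiating the bump produces the two consecutive weights \<open>w1\<close>.\<close>
  have key: "emb_adj j (K1.avg n (Suc m) uU - K1.avg n m uU) = (LINT t|I0 T. bump T n m t *\<^sub>R G t)" if m: "m \<le> n" for n m
  proof (rule inner_ext)
    fix x :: 'u
    have wpos: "width T n > 0" by (rule width_pos[OF T0])
    let ?v = "\<lambda>t. bump T n m t *\<^sub>R x"
    have vd: "(?v has_vector_derivative (w1 T n m t - w1 T n (Suc m) t) *\<^sub>R x) (at t)" for t
      using has_vector_derivative_scaleR[OF bump_deriv[OF T0] has_vector_derivative_const[of x]] by simp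
    have v: "?v \<in> C1c T"
      unfolding C1c_def
    proof (intro CollectI conjI)
      show "?v C1_differentiable_on UNIV"
        unfolding C1_differentiable_on_def
        by (intro exI[of _ "\<lambda>t. (w1 T n m t - w1 T n (Suc m) t) *\<^sub>R x"])
           (auto intro!: continuous_intros w1_cont[OF T0] vd)
      \<comment> \<open>The flat parts of \<open>step\<close> before 1/4 and after 3/4 keep the
        support away from 0 and \<open>T\<close> even for the first and the last bump.\<close>
      have "closure {t. ?v t \<noteq> 0} \<subseteq> {width T n * (real m + 1/4) .. width T n * (real m + 7/4)}"
        by (rule closure_minimal) (use bump_supp[OF T0] in auto)
      also have "\<dots> \<subseteq> {0<..<T}"
      proof -
        have "width T n * (real m + 1/4) > 0" using wpos by simp
        moreover have "width T n * (real m + 7/4) < width T n * (real n + 2)"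
          using wpos m by (intro mult_strict_left_mono) auto
        moreover have "width T n * (real n + 2) = T" by (simp add: width_def[OF T0])
        ultimately show ?thesis by auto
      qed
      finally show "closure {t. ?v t \<noteq> 0} \<subseteq> {0<..<T}" .
    qed
    have "(LINT t|I0 T. bump T n m t *\<^sub>R G t) \<bullet> x = (LINT t|I0 T. (bump T n m t *\<^sub>R G t) \<bullet> x)"
      by (rule integral_inner_left[symmetric]) (rule L2_integrable_vec[OF bL])
    also have "\<dots> = V_inner T G ?v" unfolding V_inner_def by (rule Bochner_Integration.integral_cong) auto
    also have "\<dots> = - H_inner T u (\<lambda>t. j (vector_derivative ?v (at t)))" by (rule wd[OF v])
    also have "\<dots> = (LINT t|I0 T. (w1 T n (Suc m) t *\<^sub>R u t) \<bullet> j x - (w1 T n m t *\<^sub>R u t) \<bullet> j x)"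
      unfolding H_inner_def vector_derivative_at[OF vd] D.j.scaleR
      by (subst Bochner_Integration.integral_minus[symmetric], rule Bochner_Integration.integral_cong) (auto simp: algebra_simps)
    also have "\<dots> = (LINT t|I0 T. (w1 T n (Suc m) t *\<^sub>R u t) \<bullet> j x) - (LINT t|I0 T. (w1 T n m t *\<^sub>R u t) \<bullet> j x)"
      by (rule Bochner_Integration.integral_diff) (intro integrable_inner_left L2_integrable_vec K1.w_L2[OF uL])+
    also have "\<dots> = K1.avg n (Suc m) u \<bullet> j x - K1.avg n m u \<bullet> j x"
      unfolding K1.avg_def
      by (intro arg_cong2[where f=minus] integral_inner_left L2_integrable_vec K1.w_L2[OF uL])
    also have "\<dots> = j (K1.avg n (Suc m) uU - K1.avg n m uU) \<bullet> j x"
      unfolding avg_j by (simp add: D.j.diff inner_diff_left)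
    finally show "emb_adj j (K1.avg n (Suc m) uU - K1.avg n m uU) \<bullet> x = (LINT t|I0 T. bump T n m t *\<^sub>R G t) \<bullet> x"
      by (simp add: emb_adj_inner[OF D.j])
  qed
  let ?E = "emb_adj j"
  note E = bounded_linear_emb_adj[OF D.j]
  have base: "appr (K2.Op n G) (K1.Op n uU) (K1.Op n u)" for n
  proof -
    let ?\<phi> = "\<lambda>m t. Bernstein (n + 1) m (t / T)"
    let ?b = "\<lambda>m t. real (Suc n) * ((if m = 0 then 0 else Bernstein n (m - 1) (t / T)) - Bernstein n m (t / T))"
    let ?\<phi>' = "\<lambda>m t. ?b m t * (1 / T)"
    let ?y = "\<lambda>m. K1.avg n m uU"
    have "appr (\<lambda>t. \<Sum>m\<le>n + 1. ?\<phi>' m t *\<^sub>R ?E (?y m)) (\<lambda>t. \<Sum>m\<le>n + 1. ?\<phi> m t *\<^sub>R ?y m) (\<lambda>t. \<Sum>m\<le>n + 1. ?\<phi> m t *\<^sub>R j (?y m))"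
      by (rule appr_Bernstein)
    moreover have "(\<lambda>t. \<Sum>m\<le>n + 1. ?\<phi> m t *\<^sub>R ?y m) = K1.Op n uU" by (intro ext) (simp only: K1.Op_def)
    moreover have "(\<lambda>t. \<Sum>m\<le>n + 1. ?\<phi> m t *\<^sub>R j (?y m)) = K1.Op n u" by (intro ext) (simp only: K1.Op_def avg_j)
    moreover have "(\<lambda>t. \<Sum>m\<le>n + 1. ?\<phi>' m t *\<^sub>R ?E (?y m)) = K2.Op n G"
    proof
      fix t
      have "(\<Sum>m\<le>n + 1. ?\<phi>' m t *\<^sub>R ?E (?y m)) = (1 / T) *\<^sub>R (\<Sum>m\<le>Suc n. ?b m t *\<^sub>R ?E (?y m))"
        unfolding scaleR_sum_right Suc_eq_plus1[symmetric] by (intro sum.cong refl) (simp only: scaleR_scaleR mult.commute)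
      also have "\<dots> = (1 / T) *\<^sub>R (real (Suc n) *\<^sub>R (\<Sum>m\<le>n. Bernstein n m (t / T) *\<^sub>R (?E (?y (Suc m)) - ?E (?y m))))"
        by (simp only: Bernstein_sum_derivative)
      also have "\<dots> = (\<Sum>m\<le>n. Bernstein n m (t / T) *\<^sub>R K2.avg n m G)"
        unfolding scaleR_sum_right
      proof (intro sum.cong refl)
        fix m assume m: "m \<in> {..n}"
        have "K2.avg n m G = ((real n + 1) / T) *\<^sub>R (LINT t|I0 T. bump T n m t *\<^sub>R G t)"
          unfolding K2.avg_def w2_def[OF T0] scaleR_scaleR[symmetric]
          by (rule integral_scaleR_right)
        then show "(1 / T) *\<^sub>R real (Suc n) *\<^sub>R Bernstein n m (t / T) *\<^sub>R (?E (?y (Suc m)) - ?E (?y m)) = Bernstein n m (t / T) *\<^sub>R K2.avg n m G"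
          using key[of m n] m by (simp add: linear_diff[OF bounded_linear.linear[OF E]] add.commute mult.commute)
      qed
      finally show "(\<Sum>m\<le>n + 1. ?\<phi>' m t *\<^sub>R ?E (?y m)) = K2.Op n G t" by (simp only: K2.Op_def)
    qed
    ultimately show ?thesis by simp
  qed
  show ?thesis
  proof (rule appr_closed[OF G uU(1)])
    fix \<epsilon> :: real assume e: "\<epsilon> > 0"
    have "\<forall>\<^sub>F n in sequentially. L2_norm T (\<lambda>t. K2.Op n G t - G t) < \<epsilon>"
      by (rule order_tendstoD(2)[OF K2.Op_tendsto[OF G] e])
    moreover have "\<forall>\<^sub>F n in sequentially. L2_norm T (\<lambda>t. K1.Op n uU t - uU t) < \<epsilon>"
      by (rule order_tendstoD(2)[OF K1.Op_tendsto[OF uU(1)] e])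
    moreover have "\<forall>\<^sub>F n in sequentially. \<forall>t\<in>{0..T}. norm (K1.Op n u t - u t) < \<epsilon>"
      by (rule K1.Op_uniform[OF u e])
    ultimately have "\<forall>\<^sub>F n in sequentially. L2_norm T (\<lambda>t. K2.Op n G t - G t) < \<epsilon> \<and>
        L2_norm T (\<lambda>t. K1.Op n uU t - uU t) < \<epsilon> \<and> (\<forall>t\<in>{0..T}. norm (K1.Op n u t - u t) < \<epsilon>)"
      by eventually_elim blast
    then obtain n where "L2_norm T (\<lambda>t. K2.Op n G t - G t) < \<epsilon> \<and>
        L2_norm T (\<lambda>t. K1.Op n uU t - uU t) < \<epsilon> \<and> (\<forall>t\<in>{0..T}. norm (K1.Op n u t - u t) < \<epsilon>)"
      using eventually_happens'[OF sequentially_bot] by blast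
    then show "\<exists>G' u' h'. appr G' u' h' \<and> G' \<in> L2 T \<and> u' \<in> L2 T \<and> L2_norm T (\<lambda>t. G' t - G t) < \<epsilon> \<and>
      L2_norm T (\<lambda>t. u' t - uU t) < \<epsilon> \<and> (\<forall>t\<in>{0..T}. norm (h' t - u t) < \<epsilon>)"
      using base[of n] K1.Op_L2 K2.Op_L2 by blast
  qed
qed

text \<open>A Bernstein sum of averages of \<open>v\<close> is a polynomial in \<open>t\<close> with
  coefficients in U, however irregular \<open>v\<close> is, so \<open>appr_Bernstein\<close> applies
  to it; only the estimate in V is kept.\<close>

lemma Wn_dense:
  assumes v: "v \<in> L2 T" and e: "\<epsilon> > 0"
  shows "\<forall>\<^sub>F n in sequentially. \<exists>z\<in>Wnn n. L2_norm T (\<lambda>t. z t - v t) < \<epsilon>"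
proof -
  interpret K1: kantorovich T "w1 T" "\<lambda>n. n + 1" "\<lambda>n. 4 * width T n" "\<lambda>n. 1 / (real n + 2)" 4
    by (rule kantorovich_w1[OF D.T_pos])
  have e2: "\<epsilon> / 2 > 0" using e by simp
  obtain l where l: "L2_norm T (\<lambda>t. K1.Op l v t - v t) < \<epsilon> / 2"
    using order_tendstoD(2)[OF K1.Op_tendsto[OF v] e2] eventually_happens'[OF sequentially_bot] by blast
  have "\<forall>\<^sub>F n in sequentially. \<exists>z\<in>Wnn n. L2_norm T (\<lambda>t. z t - K1.Op l v t) < \<epsilon> / 2"
    using apprD[OF appr_Bernstein[of l "\<lambda>m. K1.avg l m v"] e2] unfolding K1.Op_def
    by (rule eventually_mono) blast
  then show ?thesis
  proof eventually_elim
    case (elim n)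
    then obtain z where z: "z \<in> Wnn n" "L2_norm T (\<lambda>t. z t - K1.Op l v t) < \<epsilon> / 2" by blast
    have "L2_norm T (\<lambda>t. z t - v t) < \<epsilon>"
      using L2_norm_diff_triangle[OF D.Wn_L2[OF z(1)] K1.Op_L2 v, of l v] z(2) l by simp
    then show ?case using z(1) by blast
  qed
qed

end

subsection \<open>The discrete problem\<close>

locale coercive_form =
  fixes T :: real and a :: "real \<Rightarrow> 'u \<Rightarrow> 'u::{real_inner,banach,second_countable_topology} \<Rightarrow> real" and M \<alpha> :: real
  assumes bilin: "\<And>t. t \<in> {0..T} \<Longrightarrow> bilinear (a t)"
    and meas: "\<And>v w. (\<lambda>t. a t v w) \<in> borel_measurable (I0 T)"
    and M1: "M \<ge> 1"
    and bnd: "AE t in I0 T. \<forall>v w. \<bar>a t v w\<bar> \<le> M * norm v * norm w"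
    and \<alpha>: "\<alpha> > 0"
    and coer: "\<And>t v. t \<in> {0..T} \<Longrightarrow> a t v v \<ge> \<alpha> * (norm v)\<^sup>2"
begin

lemma form_diff: "t \<in> {0..T} \<Longrightarrow> a t (x - y) z = a t x z - a t y z"
  using bilin by (simp add: bilinear_lsub)

text \<open>Caratheodory's argument: measurability for fixed arguments extends to simple functions
  by finite sums, and the passage to the limit uses the joint continuity of \<open>a t\<close>,
  available outside a null set.\<close>

lemma form_measurable:
  assumes v: "v \<in> L2 T" and w: "w \<in> L2 T"
  shows "(\<lambda>t. a t (v t) (w t)) \<in> borel_measurable (I0 T)"
proof -
  obtain F where F: "\<And>i. simple_function (I0 T) (F i)" "\<And>t. t \<in> {0..T} \<Longrightarrow> (\<lambda>i. F i t) \<longlonglongrightarrow> v t"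
    using borel_measurable_implies_sequence_metric[OF L2_measurable[OF v], of 0, unfolded space_lebesgue_on] by metis
  obtain H where H: "\<And>i. simple_function (I0 T) (H i)" "\<And>t. t \<in> {0..T} \<Longrightarrow> (\<lambda>i. H i t) \<longlonglongrightarrow> w t"
    using borel_measurable_implies_sequence_metric[OF L2_measurable[OF w], of 0, unfolded space_lebesgue_on] by metis
  have FH: "(\<lambda>t. a t (F i t) (H i t)) \<in> borel_measurable (I0 T)" for i
  proof -
    let ?X = "F i ` {0..T}" and ?Y = "H i ` {0..T}"
    have fin: "finite ?X" "finite ?Y" using F(1)[of i] H(1)[of i] by (auto simp: simple_function_def)
    have s: "F i -` {x} \<inter> {0..T} \<in> sets (I0 T)" "H i -` {x} \<inter> {0..T} \<in> sets (I0 T)" for x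
      using simple_functionD(2)[OF F(1)[of i], of "{x}"] simple_functionD(2)[OF H(1)[of i], of "{x}"] by auto
    let ?g = "\<lambda>t. \<Sum>x\<in>?X. \<Sum>y\<in>?Y. indicat_real (F i -` {x} \<inter> {0..T}) t * (indicat_real (H i -` {y} \<inter> {0..T}) t * a t x y)"
    have "?g \<in> borel_measurable (I0 T)"
      using s meas by (intro borel_measurable_sum borel_measurable_times borel_measurable_indicator) auto
    moreover have "?g t = a t (F i t) (H i t)" if t: "t \<in> {0..T}" for t
    proof -
      have "?g t = (\<Sum>x\<in>{F i t}. \<Sum>y\<in>?Y. indicat_real (F i -` {x} \<inter> {0..T}) t * (indicat_real (H i -` {y} \<inter> {0..T}) t * a t x y))"
      proof (rule sum.mono_neutral_right)
        have z: "indicat_real (F i -` {x} \<inter> {0..T}) t = 0" if "x \<noteq> F i t" for x using that by auto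
        show "\<forall>x\<in>?X - {F i t}. (\<Sum>y\<in>?Y. indicat_real (F i -` {x} \<inter> {0..T}) t * (indicat_real (H i -` {y} \<inter> {0..T}) t * a t x y)) = 0"
          by (simp add: z)
      qed (use fin t in auto)
      also have "\<dots> = (\<Sum>y\<in>?Y. indicat_real (H i -` {y} \<inter> {0..T}) t * a t (F i t) y)"
        using t by (simp add: indicator_def)
      also have "\<dots> = (\<Sum>y\<in>{H i t}. indicat_real (H i -` {y} \<inter> {0..T}) t * a t (F i t) y)"
        using fin t by (intro sum.mono_neutral_right) auto
      also have "\<dots> = a t (F i t) (H i t)" using t by (simp add: indicator_def)
      finally show ?thesis .
    qed
    ultimately show ?thesis
      using measurable_lebesgue_cong[of "{0..T}" ?g "\<lambda>t. a t (F i t) (H i t)" borel] by blast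
  qed
  obtain Z where Z: "{t \<in> {0..T}. \<not> (\<forall>v w. \<bar>a t v w\<bar> \<le> M * norm v * norm w)} \<subseteq> Z"
     "emeasure (I0 T) Z = 0" "Z \<in> sets (I0 T)"
    using bnd by (rule AE_E) auto
  \<comment> \<open>Set to 0 on the exceptional set, so that the limit exists at every point;
    completeness of the measure undoes the change.\<close>
  let ?h = "\<lambda>t. if t \<in> Z then 0 else a t (v t) (w t)"
  have hm: "?h \<in> borel_measurable (I0 T)"
  proof (rule borel_measurable_LIMSEQ_metric)
    show "(\<lambda>t. if t \<in> Z then 0 else a t (F i t) (H i t)) \<in> borel_measurable (I0 T)" for i
      using FH[of i] Z(3) by (intro measurable_If_set) auto
    fix t assume "t \<in> space (I0 T)"
    then have t: "t \<in> {0..T}" by simp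
    show "(\<lambda>i. if t \<in> Z then 0 else a t (F i t) (H i t)) \<longlonglongrightarrow> ?h t"
    proof (cases "t \<in> Z")
      case False
      then have b: "\<And>v w. \<bar>a t v w\<bar> \<le> M * norm v * norm w" using Z(1) t by blast
      note bl = bilin[OF t]
      have "bounded_bilinear (a t)"
      proof
        show "\<exists>K. \<forall>x y. norm (a t x y) \<le> norm x * norm y * K"
          by (rule exI[of _ M]) (use b in \<open>auto simp: mult_ac\<close>)
      qed (use bl in \<open>auto simp: bilinear_ladd bilinear_radd bilinear_lmul bilinear_rmul\<close>)
      from bounded_bilinear.tendsto[OF this F(2)[OF t] H(2)[OF t]] False show ?thesis by simp
    qed simp
  qed
  have ae: "AE t in I0 T. ?h t = a t (v t) (w t)"
  proof -
    have "AE t in I0 T. t \<notin> Z" using Z(2,3) by (intro AE_not_in) auto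
    then show ?thesis by eventually_elim simp
  qed
  show ?thesis by (rule AE_lebesgue_on_measurable_cong[OF hm _ ae]) simp
qed

lemma
  assumes v: "v \<in> L2 T" and w: "w \<in> L2 T"
  shows form_integrable: "integrable (I0 T) (\<lambda>t. a t (v t) (w t))"
    and form_bound: "\<bar>A_op T a v w\<bar> \<le> M * (L2_norm T v * L2_norm T w)"
proof -
  have nv: "(\<lambda>t. norm (v t)) \<in> L2 T" and nw: "(\<lambda>t. norm (w t)) \<in> L2 T"
    using L2_measurable[OF v] L2_measurable[OF w] L2_integrable[OF v] L2_integrable[OF w] by (auto intro!: L2I)
  have i: "integrable (I0 T) (\<lambda>t. M * (norm (v t) * norm (w t)))"
    using L2_inner_integrable[OF nv nw] by simp
  have ae: "AE t in I0 T. norm (a t (v t) (w t)) \<le> M * (norm (v t) * norm (w t))"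
    using bnd by eventually_elim (simp add: mult.assoc)
  show f: "integrable (I0 T) (\<lambda>t. a t (v t) (w t))"
  proof (rule Bochner_Integration.integrable_bound[OF i form_measurable[OF v w]])
    show "AE t in I0 T. norm (a t (v t) (w t)) \<le> norm (M * (norm (v t) * norm (w t)))"
      using ae by eventually_elim (use M1 in simp)
  qed
  have "\<bar>A_op T a v w\<bar> \<le> (LINT t|I0 T. norm (a t (v t) (w t)))"
    unfolding A_op_def real_norm_def[symmetric] by (rule integral_norm_bound)
  also have "\<dots> \<le> (LINT t|I0 T. M * (norm (v t) * norm (w t)))"
    by (rule integral_mono_AE[OF integrable_norm[OF f] i ae])
  also have "\<dots> = M * V_inner T (\<lambda>t. norm (v t)) (\<lambda>t. norm (w t))" by (simp add: V_inner_def)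
  also have "\<dots> \<le> M * (L2_norm T (\<lambda>t. norm (v t)) * L2_norm T (\<lambda>t. norm (w t)))"
    using V_inner_Cauchy_Schwarz[OF nv nw] M1 by (intro mult_left_mono) auto
  also have "\<dots> = M * (L2_norm T v * L2_norm T w)" by (simp add: L2_norm_def)
  finally show "\<bar>A_op T a v w\<bar> \<le> M * (L2_norm T v * L2_norm T w)" .
qed

lemma A_op_diff:
  assumes "v \<in> L2 T" "w \<in> L2 T" "y \<in> L2 T"
  shows "A_op T a (\<lambda>t. v t - w t) y = A_op T a v y - A_op T a w y"
proof -
  have "A_op T a (\<lambda>t. v t - w t) y = (LINT t|I0 T. a t (v t) (y t) - a t (w t) (y t))"
    unfolding A_op_def by (rule Bochner_Integration.integral_cong) (auto simp: form_diff)
  also have "\<dots> = A_op T a v y - A_op T a w y"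
    unfolding A_op_def by (rule Bochner_Integration.integral_diff) (intro form_integrable assms)+
  finally show ?thesis .
qed

lemma A_op_coercive:
  assumes v: "v \<in> L2 T" shows "\<alpha> * (L2_norm T v)\<^sup>2 \<le> A_op T a v v"
proof -
  have "(LINT t|I0 T. \<alpha> * (norm (v t))\<^sup>2) \<le> A_op T a v v"
    unfolding A_op_def by (rule integral_mono) (use form_integrable[OF v v] L2_integrable[OF v] coer in auto)
  then show ?thesis by (simp add: L2_norm_sq)
qed

end

context grid begin

lemma icell_integral_cong:
  fixes f g :: "real \<Rightarrow> real"
  assumes m: "m \<in> {1..N}" and f: "integrable (I0 T) f" and g: "integrable (I0 T) g" and fg: "\<And>t. t \<in> cell m \<Longrightarrow> f t = g t"
  shows "(LINT t|lebesgue_on {(real m - 1) * k..real m * k}. f t) = (LINT t|lebesgue_on {(real m - 1) * k..real m * k}. g t)"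
proof (rule integral_cong_AE)
  show "AE t in lebesgue_on {(real m - 1) * k..real m * k}. f t = g t"
    using AE_icell[OF m] by eventually_elim (rule fg)
qed (intro borel_measurable_integrable integrable_on_subinterval_I0[OF _ icell_subset[OF m]] f g)+

end

context dg begin

text \<open>The local equations, summed over the cells, become the counterpart of the continuous
  equation on all discrete test functions, with \<open>Gam w\<close> in place of the
  derivative.\<close>

lemma dg_solution_pairing:
  assumes form: "coercive_form T a M \<alpha>" and f: "f \<in> L2 T" and sol: "dg_solution T j a \<Phi> f \<xi>0 N q S w"
    and v: "pw q E v" and E: "\<And>m i. m \<in> {1..N} \<Longrightarrow> i \<le> q \<Longrightarrow> E m i \<in> S"
  shows "V_inner T (Gam w) v + A_op T a w v = V_pairing T f v"
proof -
  interpret coercive_form T a M \<alpha> by fact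
  have w: "w \<in> Wn" using sol by (simp add: dg_solution_def)
  note wL = Wn_L2[OF w] and vL = pw_in_L2[OF v] and rL = riesz_inv_L2[OF f]
  have fi: "integrable (I0 T) (\<lambda>t. blinfun_apply (f t) (y t))" if "y \<in> L2 T" for y
    using L2_inner_integrable[OF rL that] by (simp add: riesz_inv_inner)
  have local: "integral {0..1} (\<lambda>s. vpoly' q (\<lambda>i. j (Cf w m i)) s \<bullet> vpoly q (\<lambda>i. j (E m i)) s) + j (jump w m) \<bullet> j (E m 0)
      + (LINT t|lebesgue_on {(real m - 1) * k..real m * k}. a t (w t) (v t))
    = (LINT t|lebesgue_on {(real m - 1) * k..real m * k}. blinfun_apply (f t) (v t))" if m: "m \<in> {1..N}" for m
  proof -
    let ?I = "lebesgue_on {(real m - 1) * k..real m * k}"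
    \<comment> \<open>\<open>v\<close> is prescribed only inside the cells, while the scheme
      evaluates its test function at the left node; \<open>p\<close> continues \<open>v\<close> from
      the cell and has the value \<open>E m 0\<close> there.\<close>
    define p where "p t = vpoly q (E m) (loc m t)" for t
    obtain d where d: "\<forall>i\<le>q. d i \<in> S" "\<And>t. vpoly q (E m) ((1 / k) * t + (- (real m - 1))) = vpoly q d t"
      using vpoly_affine[OF sub, of q "E m" "1 / k" "- (real m - 1)"] E[OF m] by blast
    have l: "(1 / k) * t + (- (real m - 1)) = loc m t" for t using k_pos by (simp add: loc_def field_simps)
    have "p = vpoly q d" unfolding p_def d(2)[symmetric] by (intro ext) (simp only: l)
    then have pp: "p \<in> poly_funs q S" using d(1) by (auto simp: poly_funs_iff_vpoly)
    have pv: "p t = v t" if "t \<in> cell m" for t using pwD[OF v m that] by (simp add: p_def)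
    have "continuous_on {0..T} p"
      unfolding p_def loc_def by (intro continuous_intros) (use k_pos in auto)
    then have pL: "p \<in> L2 T" by (rule L2_continuous)
    have "(LINT t|?I. j (dg_b w t) \<bullet> j (p t)) + j (Cf w m 0 - w ((real m - 1) * k)) \<bullet> j (p ((real m - 1) * k))
        + (LINT t|?I. a t (w t) (p t)) = (LINT t|?I. blinfun_apply (f t) (p t))"
      using sol m pp unfolding dg_solution_def Let_def k_def[symmetric] by blast
    moreover have "(LINT t|?I. a t (w t) (p t)) = (LINT t|?I. a t (w t) (v t))"
      by (rule icell_integral_cong[OF m]) (auto intro: form_integrable wL pL vL simp: pv)
    moreover have "(LINT t|?I. blinfun_apply (f t) (p t)) = (LINT t|?I. blinfun_apply (f t) (v t))"
      by (rule icell_integral_cong[OF m]) (auto intro: fi pL vL simp: pv)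
    moreover have "p ((real m - 1) * k) = E m 0" by (simp add: p_def loc_def)
    moreover have "(LINT t|?I. j (dg_b w t) \<bullet> j (p t)) =
        k * integral {0..1} (\<lambda>s. (1 / k) * (vpoly' q (\<lambda>i. j (Cf w m i)) s \<bullet> vpoly q (\<lambda>i. j (E m i)) s))"
    proof (rule cell_integral(2)[OF m])
      show "continuous_on {0..1} (\<lambda>s. (1 / k) * (vpoly' q (\<lambda>i. j (Cf w m i)) s \<bullet> vpoly q (\<lambda>i. j (E m i)) s))"
        by (intro continuous_intros)
      show "j (dg_b w t) \<bullet> j (p t) = (1 / k) * (vpoly' q (\<lambda>i. j (Cf w m i)) (loc m t) \<bullet> vpoly q (\<lambda>i. j (E m i)) (loc m t))"
        if "t \<in> cell m" for t
        unfolding dg_b_cell[OF w m that] p_def by (simp add: j.scaleR vpoly_linear[OF j.linear] vpoly'_linear[OF j.linear])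
    qed
    ultimately show ?thesis using k_pos by (simp add: jump_def)
  qed
  have "V_inner T (Gam w) v + A_op T a w v = (\<Sum>m=1..N. integral {0..1} (\<lambda>s. vpoly' q (\<lambda>i. j (Cf w m i)) s \<bullet> vpoly q (\<lambda>i. j (E m i)) s) + j (jump w m) \<bullet> j (E m 0)
      + (LINT t|lebesgue_on {(real m - 1) * k..real m * k}. a t (w t) (v t)))"
  proof -
    have "V_inner T (Gam w) v = (\<Sum>m=1..N. integral {0..1} (\<lambda>s. vpoly' q (\<lambda>i. j (Cf w m i)) s \<bullet> vpoly q (\<lambda>i. j (E m i)) s) + j (jump w m) \<bullet> j (E m 0))"
      by (rule Gam_pairing[OF w v]) (rule E)
    then show ?thesis
      unfolding A_op_def sum_cells_integral[OF form_integrable[OF wL vL]] by (simp add: sum.distrib)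
  qed
  also have "\<dots> = (\<Sum>m=1..N. LINT t|lebesgue_on {(real m - 1) * k..real m * k}. blinfun_apply (f t) (v t))"
    by (rule sum.cong[OF refl local])
  also have "\<dots> = V_pairing T f v" unfolding V_pairing_def by (rule sum_cells_integral[OF fi[OF vL], symmetric])
  finally show ?thesis .
qed

lemma Wn_minus:
  assumes "z \<in> Wn" "y \<in> Wn"
  shows "(\<lambda>t. z t - y t) \<in> Wn"
    and "m \<in> {1..N} \<Longrightarrow> t \<in> cell m \<Longrightarrow> Gam (\<lambda>t. z t - y t) t = Gam z t - Gam y t"
  using Wn_lincomb(1)[OF assms, of 1 "-1"] Gam_lincomb_cell[OF assms, of m t 1 "-1"] by auto

lemma Gam_minus_norm:
  assumes z: "z \<in> Wn" and y: "y \<in> Wn"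
  shows "L2_norm T (Gam (\<lambda>t. z t - y t)) = L2_norm T (\<lambda>t. Gam z t - Gam y t)"
    and "v \<in> L2 T \<Longrightarrow> V_inner T (Gam (\<lambda>t. z t - y t)) v = V_inner T (Gam z) v - V_inner T (Gam y) v"
proof -
  note L = Gam_L2[OF z] Gam_L2[OF y] Gam_L2[OF Wn_minus(1)[OF z y]]
  have ae: "AE t in I0 T. Gam (\<lambda>t. z t - y t) t = Gam z t - Gam y t"
    by (rule AE_cellI) (rule Wn_minus(2)[OF z y])
  show "L2_norm T (Gam (\<lambda>t. z t - y t)) = L2_norm T (\<lambda>t. Gam z t - Gam y t)"
    by (rule L2_norm_cong_AE) (use ae L in \<open>auto elim: eventually_mono intro!: L2_measurable L2_diff\<close>)
  assume v: "v \<in> L2 T"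
  have "V_inner T (Gam (\<lambda>t. z t - y t)) v = V_inner T (\<lambda>t. Gam z t - Gam y t) v"
    unfolding V_inner_def
    by (rule integral_cong_AE) (use ae in \<open>auto elim: eventually_mono intro!: borel_measurable_integrable L2_inner_integrable L2_diff L v\<close>)
  then show "V_inner T (Gam (\<lambda>t. z t - y t)) v = V_inner T (Gam z) v - V_inner T (Gam y) v"
    by (simp add: V_inner_diff_left[OF L(1,2) v])
qed

text \<open>The error \<open>w - z\<close> between the discrete solution and an arbitrary \<open>z\<close> satisfies the hypotheses
  of the stability estimate, with the approximation error of \<open>z\<close> as data.\<close>

lemma error_equation:
  assumes form: "coercive_form T a M \<alpha>" and f: "f \<in> L2 T" and sol: "dg_solution T j a \<Phi> f \<xi>0 N q S w"
    and \<Phi>: "norm \<Phi> \<le> 1"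
    and G: "G \<in> L2 T" and uU: "uU \<in> L2 T"
    and eq: "\<And>v. v \<in> L2 T \<Longrightarrow> V_inner T G v + A_op T a uU v = V_pairing T f v"
    and ic: "u 0 - blinfun_apply \<Phi> (u T) = \<xi>0"
    and z: "z \<in> Wn" and c: "\<And>t. t \<in> {0..T} \<Longrightarrow> norm (j (z t) - u t) \<le> c"
    and \<delta>: "\<delta> = L2_norm T (\<lambda>t. Gam z t - G t) + M * L2_norm T (\<lambda>t. z t - uU t) + 2 * c"
  defines "e \<equiv> \<lambda>t. w t - z t"
  shows "V_inner T (Gam e) e + \<alpha> * (L2_norm T e)\<^sup>2 \<le> \<delta> * L2_norm T e"
    and "L2_norm T (Gam e) \<le> M * L2_norm T e + \<delta>"
    and "norm (j (e 0)) \<le> norm (j (e T)) + \<delta>"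
proof -
  interpret coercive_form T a M \<alpha> by fact
  have w: "w \<in> Wn" using sol by (simp add: dg_solution_def)
  have e: "e \<in> Wn" unfolding e_def by (rule Wn_minus(1)[OF w z])
  note L = Wn_L2[OF w] Wn_L2[OF z] Wn_L2[OF e] Gam_L2[OF w] Gam_L2[OF z] Gam_L2[OF e]
  have T0: "0 \<in> {0..T}" "T \<in> {0..T}" using T_pos by auto
  have c0: "c \<ge> 0" using c[OF T0(1)] norm_ge_zero order_trans by blast
  \<comment> \<open>Consistency: on discrete test functions the continuous equation can be
    subtracted, which leaves only the approximation error of \<open>z\<close> on the right.\<close>
  have res: "V_inner T (Gam e) v + A_op T a e v \<le> \<delta> * L2_norm T v"
    if v: "pw q E v" and E: "\<And>m i. m \<in> {1..N} \<Longrightarrow> i \<le> q \<Longrightarrow> E m i \<in> S" for v E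
  proof -
    have vL: "v \<in> L2 T" by (rule pw_in_L2[OF v])
    have 1: "V_inner T (Gam w) v + A_op T a w v = V_pairing T f v"
      by (rule dg_solution_pairing[OF form f sol v E])
    have "V_inner T (Gam e) v + A_op T a e v
        = (V_inner T (Gam w) v - V_inner T (Gam z) v) + (A_op T a w v - A_op T a z v)"
      unfolding e_def by (simp add: Gam_minus_norm(2)[OF w z vL] A_op_diff[OF L(1,2) vL])
    also have "\<dots> = - V_inner T (\<lambda>t. Gam z t - G t) v - A_op T a (\<lambda>t. z t - uU t) v"
      using 1 eq[OF vL] by (simp add: V_inner_diff_left[OF L(5) G vL] A_op_diff[OF L(2) uU vL])
    also have "\<dots> \<le> L2_norm T (\<lambda>t. Gam z t - G t) * L2_norm T v + M * (L2_norm T (\<lambda>t. z t - uU t) * L2_norm T v)"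
      using V_inner_Cauchy_Schwarz[OF L2_diff[OF L(5) G] vL] form_bound[OF L2_diff[OF L(2) uU] vL] by linarith
    also have "\<dots> = (\<delta> - 2 * c) * L2_norm T v" by (simp add: \<delta> algebra_simps)
    also have "\<dots> \<le> \<delta> * L2_norm T v" using c0 by (intro mult_right_mono) auto
    finally show ?thesis .
  qed
  show "V_inner T (Gam e) e + \<alpha> * (L2_norm T e)\<^sup>2 \<le> \<delta> * L2_norm T e"
    using res[OF Wn_pw[OF e] dg_coeff_in[OF e]] A_op_coercive[OF L(3)] by simp
  show "L2_norm T (Gam e) \<le> M * L2_norm T e + \<delta>"
  proof (cases "L2_norm T (Gam e) = 0")
    case True
    have "\<delta> \<ge> 0" unfolding \<delta> using c0 M1 by simp
    then show ?thesis using True M1 by simp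
  next
    case False
    \<comment> \<open>\<open>Gam e\<close> is itself an admissible test function, because its
      coefficients lie in \<open>S\<close>; this bounds its norm by that of \<open>e\<close> and the
      data.\<close>
    have "(L2_norm T (Gam e))\<^sup>2 + A_op T a e (Gam e) \<le> \<delta> * L2_norm T (Gam e)"
      using res[OF Gam_pw[OF e] Gam_coeff_in] by (simp add: V_inner_self)
    moreover have "- A_op T a e (Gam e) \<le> M * (L2_norm T e * L2_norm T (Gam e))"
      using form_bound[OF L(3,6)] by simp
    ultimately have "L2_norm T (Gam e) * L2_norm T (Gam e) \<le> (M * L2_norm T e + \<delta>) * L2_norm T (Gam e)"
      by (simp add: power2_eq_square algebra_simps)
    then show ?thesis using False L2_norm_nonneg[of T "Gam e"] by (simp add: mult_le_cancel_right)
  qed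
  show "norm (j (e 0)) \<le> norm (j (e T)) + \<delta>"
  proof -
    let ?P = "blinfun_apply \<Phi>"
    have \<Phi>1: "norm (?P x) \<le> norm x" for x
      using norm_blinfun[of \<Phi> x] mult_right_mono[OF \<Phi>, of "norm x"] by simp
    \<comment> \<open>The boundary condition is tested with \<open>e 0\<close>. The first term of
      \<open>?r\<close> is controlled by the contraction, the others by the errors of
      \<open>z\<close> at 0 and \<open>T\<close>, which is why \<delta> contains
      \<open>2 * c\<close>.\<close>
    let ?r = "?P (j (e T)) + (?P (j (z T) - u T) - (j (z 0) - u 0))"
    have eS: "e 0 \<in> S" by (rule Wn_in_S[OF e T0(1)])
    have "(j (w 0) - ?P (j (w T))) \<bullet> j (e 0) = \<xi>0 \<bullet> j (e 0)"
      using sol eS by (simp add: dg_solution_def)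
    then have "j (e 0) \<bullet> j (e 0) = ?r \<bullet> j (e 0)"
      unfolding ic[symmetric] e_def
      by (simp add: j.diff blinfun.diff_right inner_diff_left inner_add_left)
    also have "\<dots> \<le> norm ?r * norm (j (e 0))" by (rule norm_cauchy_schwarz)
    also have "norm ?r \<le> norm (j (e T)) + (c + c)"
      using norm_triangle_ineq[of "?P (j (e T))" "?P (j (z T) - u T) - (j (z 0) - u 0)"]
        norm_triangle_ineq4[of "?P (j (z T) - u T)" "j (z 0) - u 0"]
        \<Phi>1[of "j (e T)"] \<Phi>1[of "j (z T) - u T"] c[OF T0(1)] c[OF T0(2)] by linarith
    also have "\<dots> \<le> norm (j (e T)) + \<delta>" unfolding \<delta> using M1 by simp
    finally have "norm (j (e 0)) * norm (j (e 0)) \<le> (norm (j (e T)) + \<delta>) * norm (j (e 0))"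
      by (simp add: power2_norm_eq_inner[symmetric] power2_eq_square mult_right_mono)
    moreover have "\<delta> \<ge> 0" unfolding \<delta> using c0 M1 by simp
    ultimately show ?thesis by (cases "norm (j (e 0)) = 0") (auto simp: mult_le_cancel_right)
  qed
qed

end

subsection \<open>Convergence\<close>

context dg_seq begin

lemma to_U_j [simp]: "to_U j (\<lambda>t. j (z t)) = z"
  by (simp add: to_U_def inj)

lemma to_U_AE:
  assumes "defines_V T j w"
  shows "to_U j w \<in> L2 T" "AE t in I0 T. j (to_U j w t) = w t"
  using assms by (auto simp: defines_V_def to_U_def f_inv_into_f elim: eventually_mono)

text \<open>\<open>to_U\<close> is unspecified where \<open>w\<close> leaves the range of
  \<open>j\<close>, so it respects differences only almost everywhere, and measurability has to come
  from completeness.\<close>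

lemma to_U_diff_norm:
  assumes w: "defines_V T j w" and z: "z \<in> L2 T"
  shows "L2_norm T (to_U j ((\<lambda>t. j (z t)) - w)) = L2_norm T (\<lambda>t. z t - to_U j w t)"
proof -
  have ae: "AE t in I0 T. z t - to_U j w t = to_U j ((\<lambda>t. j (z t)) - w) t"
    using to_U_AE(2)[OF w]
  proof eventually_elim
    case (elim t)
    have "j (z t) - w t = j (z t - to_U j w t)" by (simp add: D.j.diff elim)
    then show ?case by (simp add: to_U_def fun_diff_def inj)
  qed
  have m: "(\<lambda>t. z t - to_U j w t) \<in> borel_measurable (I0 T)"
    by (intro L2_measurable L2_diff z to_U_AE(1)[OF w])
  have m': "to_U j ((\<lambda>t. j (z t)) - w) \<in> borel_measurable (I0 T)"
    by (rule AE_lebesgue_on_measurable_cong[OF m _ ae]) simp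
  show ?thesis by (rule L2_norm_cong_AE[OF _ m' m]) (use ae in \<open>auto elim: eventually_mono\<close>)
qed

lemma Wn_bounded:
  assumes "z \<in> Wnn n" shows "\<exists>B. \<forall>t\<in>{0..T}. norm (j (z t)) \<le> B"
  using D.sup_bound[OF assms] by (meson real_le_rsqrt)

lemma zero_Wn: "(\<lambda>t. 0) \<in> Wnn n"
  by (rule D.WnI[where c = "\<lambda>m i. 0"]) (auto intro: subspace_0[OF D.sub] simp: vpoly_def)

lemma Z_norm_bounds:
  assumes z: "z \<in> Wnn n" and x: "(g, w) \<in> Z_space T j"
  shows "L2_norm T (\<lambda>t. Gm n z t - riesz_inv (g t)) \<le> Z_norm T j ((dg_hat T j (N n) q (U n) z, \<lambda>t. j (z t)) - (g, w))" (is "?a \<le> ?Z")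
    and "t \<in> {0..T} \<Longrightarrow> norm (j (z t) - w t) \<le> Z_norm T j ((dg_hat T j (N n) q (U n) z, \<lambda>t. j (z t)) - (g, w))"
    and "\<epsilon> > 0 \<Longrightarrow> L2_norm T (\<lambda>t. Gm n z t - riesz_inv (g t)) < \<epsilon> / 2 \<Longrightarrow> L2_norm T (\<lambda>t. z t - to_U j w t) < \<epsilon> / 2 \<Longrightarrow>
      \<forall>t\<in>{0..T}. norm (j (z t) - w t) < \<epsilon> / 2 \<Longrightarrow> Z_norm T j ((dg_hat T j (N n) q (U n) z, \<lambda>t. j (z t)) - (g, w)) < \<epsilon>"
proof -
  have gL: "g \<in> L2 T" and wG: "defines_V T j w" "bounded (w ` {0..T})"
    using x by (auto simp: Z_space_def G_space_def)
  let ?s = "SUP t\<in>{0..T}. (norm (j (z t) - w t))\<^sup>2"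
  let ?b = "L2_norm T (\<lambda>t. z t - to_U j w t)"
  obtain B where B: "\<And>t. t \<in> {0..T} \<Longrightarrow> norm (j (z t)) \<le> B" using Wn_bounded[OF z] by blast
  obtain B' where B': "\<And>t. t \<in> {0..T} \<Longrightarrow> norm (w t) \<le> B'" using wG(2) unfolding bounded_iff by blast
  have bdd: "bdd_above ((\<lambda>t. (norm (j (z t) - w t))\<^sup>2) ` {0..T})"
  proof (rule bdd_aboveI2)
    fix t assume "t \<in> {0..T}"
    then have "norm (j (z t) - w t) \<le> B + B'" using B B' norm_triangle_ineq4[of "j (z t)" "w t"] by fastforce
    then show "(norm (j (z t) - w t))\<^sup>2 \<le> (B + B')\<^sup>2" by (rule power_mono) simp
  qed
  have T0: "0 \<in> {0..T}" using D.T_pos by simp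
  have s_upper: "(norm (j (z t) - w t))\<^sup>2 \<le> ?s" if "t \<in> {0..T}" for t by (rule cSUP_upper[OF that bdd])
  have s0: "0 \<le> ?s" using s_upper[OF T0] by (rule order_trans[rotated]) simp
  have a: "L2_norm T (dg_hat T j (N n) q (U n) z - g) = ?a"
    unfolding L2_norm_diff_riesz_inv by (rule D.dg_hat_norm[OF z riesz_inv_L2[OF gL]])
  have Z: "?Z = sqrt (?a\<^sup>2 + (?s + ?b\<^sup>2))"
    unfolding Z_norm_def G_norm_def by (simp add: a to_U_diff_norm[OF wG(1) D.Wn_L2[OF z]] s0)
  show "?a \<le> ?Z" unfolding Z by (rule real_le_rsqrt) (use s0 in simp)
  show "norm (j (z t) - w t) \<le> ?Z" if "t \<in> {0..T}" for t
    unfolding Z by (rule real_le_rsqrt) (use s_upper[OF that] zero_le_power2[of ?a] zero_le_power2[of ?b] in linarith)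
  assume e: "\<epsilon> > 0" and 1: "?a < \<epsilon> / 2" and 2: "?b < \<epsilon> / 2" and 3: "\<forall>t\<in>{0..T}. norm (j (z t) - w t) < \<epsilon> / 2"
  have "?s \<le> (\<epsilon> / 2)\<^sup>2"
    using T0 3 by (intro cSUP_least power_mono) (auto intro: less_imp_le)
  moreover have "?a\<^sup>2 \<le> (\<epsilon> / 2)\<^sup>2" "?b\<^sup>2 \<le> (\<epsilon> / 2)\<^sup>2" using 1 2 by (auto intro!: power_mono)
  \<comment> \<open>Three squares enter the norm, and three quarters are still less than
    one.\<close>
  moreover have "3 * (\<epsilon> / 2)\<^sup>2 < \<epsilon>\<^sup>2" using e by (simp add: power_divide)
  ultimately have "?a\<^sup>2 + (?s + ?b\<^sup>2) < \<epsilon>\<^sup>2" by linarith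
  then have "?Z < sqrt (\<epsilon>\<^sup>2)" unfolding Z by (rule real_sqrt_less_mono)
  then show "?Z < \<epsilon>" using e by simp
qed

lemma W_appr:
  assumes u: "u \<in> W_space T j" and wd: "has_weak_deriv T j u u'"
  shows "u' \<in> L2 T" "appr (\<lambda>t. riesz_inv (u' t)) (to_U j u) u" "defines_V T j u" "continuous_on {0..T} u"
proof -
  show 1: "defines_V T j u" and 2: "continuous_on {0..T} u" using u by (auto simp: W_space_def)
  show 3: "u' \<in> L2 T" using wd by (simp add: has_weak_deriv_def)
  show "appr (\<lambda>t. riesz_inv (u' t)) (to_U j u) u"
    by (rule appr_weak_deriv[OF 2 to_U_AE[OF 1] riesz_inv_L2[OF 3]])
       (use wd in \<open>auto simp: has_weak_deriv_def V_pairing_eq\<close>)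
qed

lemma X_limit: "X_space T j = lim_spaces (Z_space T j) (Z_norm T j) (\<lambda>n. Xn_space T j (N n) q (U n))"
proof (intro set_eqI iffI)
  fix x assume "x \<in> X_space T j"
  then obtain u' u where x: "x = (u', u)" and u: "u \<in> W_space T j" and wd: "has_weak_deriv T j u u'"
    by (auto simp: X_space_def)
  note W = W_appr[OF u wd]
  have "bounded (u ` {0..T})" using W(4) by (intro compact_imp_bounded compact_continuous_image) auto
  then have xZ: "(u', u) \<in> Z_space T j" using W by (auto simp: Z_space_def G_space_def)
  have "\<exists>xs. (\<forall>n. xs n \<in> Xn_space T j (N n) q (U n)) \<and> (\<lambda>n. Z_norm T j (xs n - (u', u))) \<longlonglongrightarrow> 0"
  proof (rule approx_seq)
    show "0 \<le> Z_norm T j (y - (u', u))" for y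
      using Z_norm_def[of T j "y - (u', u)"] by simp
    show "Xn_space T j (N n) q (U n) \<noteq> {}" for n using zero_Wn[of n] by (auto simp: Xn_space_def)
    fix \<epsilon> :: real assume e: "\<epsilon> > 0"
    then have e2: "\<epsilon> / 2 > 0" by simp
    show "\<forall>\<^sub>F n in sequentially. \<exists>y\<in>Xn_space T j (N n) q (U n). Z_norm T j (y - (u', u)) < \<epsilon>"
      using apprD[OF W(2) e2]
    proof eventually_elim
      case (elim n)
      then obtain z where z: "z \<in> Wnn n" "L2_norm T (\<lambda>t. Gm n z t - riesz_inv (u' t)) < \<epsilon> / 2"
        "L2_norm T (\<lambda>t. z t - to_U j u t) < \<epsilon> / 2" "\<forall>t\<in>{0..T}. norm (j (z t) - u t) < \<epsilon> / 2" by blast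
      show ?case
        using Z_norm_bounds(3)[OF z(1) xZ e z(2-4)] z(1) unfolding Xn_space_def by blast
    qed
  qed
  then show "x \<in> lim_spaces (Z_space T j) (Z_norm T j) (\<lambda>n. Xn_space T j (N n) q (U n))"
    using xZ by (simp add: lim_spaces_def x)
next
  fix x assume "x \<in> lim_spaces (Z_space T j) (Z_norm T j) (\<lambda>n. Xn_space T j (N n) q (U n))"
  then obtain g w xs where x: "x = (g, w)" and xZ: "(g, w) \<in> Z_space T j"
    and xs: "\<And>n. xs n \<in> Xn_space T j (N n) q (U n)" "(\<lambda>n. Z_norm T j (xs n - (g, w))) \<longlonglongrightarrow> 0"
    by (cases x) (auto simp: lim_spaces_def)
  obtain z where z: "\<And>n. z n \<in> Wnn n" and xz: "\<And>n. xs n = (dg_hat T j (N n) q (U n) (z n), \<lambda>t. j (z n t))"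
    using xs(1) unfolding Xn_space_def by (auto simp: set_eq_iff) metis
  note lim = xs(2)[unfolded xz]
  have gL: "g \<in> L2 T" and wV: "defines_V T j w" using xZ by (auto simp: Z_space_def G_space_def)
  \<comment> \<open>\<open>Z_norm\<close> controls the H norm at every \<open>t\<close>, so
    \<open>w\<close> itself, and not just some function agreeing with it almost everywhere, is a
    uniform limit.\<close>
  interpret dg_limit T j q U N z "\<lambda>t. riesz_inv (g t)" w
  proof
    show "z n \<in> Wnn n" for n by (rule z)
    show "(\<lambda>t. riesz_inv (g t)) \<in> L2 T" by (rule riesz_inv_L2[OF gL])
    show "(\<lambda>n. L2_norm T (\<lambda>t. Gm n (z n) t - riesz_inv (g t))) \<longlonglongrightarrow> 0"
      by (rule tendsto_sandwich[OF _ _ tendsto_const lim])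
         (use Z_norm_bounds(1)[OF z xZ] in \<open>auto intro: always_eventually\<close>)
    show "uniform_limit {0..T} (\<lambda>n t. j (z n t)) w sequentially"
    proof (rule uniform_limitI)
      fix e :: real assume "e > 0"
      from order_tendstoD(2)[OF lim this]
      show "\<forall>\<^sub>F n in sequentially. \<forall>t\<in>{0..T}. dist (j (z n t)) (w t) < e"
      proof eventually_elim
        case (elim n)
        show ?case
        proof
          fix t assume "t \<in> {0..T}"
          from le_less_trans[OF Z_norm_bounds(2)[OF z[of n] xZ this] elim]
          show "dist (j (z n t)) (w t) < e" by (simp only: dist_norm)
        qed
      qed
    qed
  qed
  have "has_weak_deriv T j w g"
    unfolding has_weak_deriv_def using gL limit_weak_deriv by (simp add: V_pairing_eq)
  then have "w \<in> W_space T j" using limit_continuous wV by (auto simp: W_space_def)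
  then show "x \<in> X_space T j" using \<open>has_weak_deriv T j w g\<close> by (simp add: X_space_def x)
qed

lemma Y_limit: "Y_space T = lim_spaces (Y_space T) (Y_norm T) (\<lambda>n. Yn_space T j (N n) q (U n))"
proof (intro set_eqI iffI)
  fix x :: "(real \<Rightarrow> 'u) \<times> 'h" assume xY: "x \<in> Y_space T"
  then obtain v h where x: "x = (v, h)" and v: "v \<in> L2 T" by (auto simp: Y_space_def)
  have "\<exists>xs. (\<forall>n. xs n \<in> Yn_space T j (N n) q (U n)) \<and> (\<lambda>n. Y_norm T (xs n - (v, h))) \<longlonglongrightarrow> 0"
  proof (rule approx_seq)
    show "0 \<le> Y_norm T (y - (v, h))" for y by (simp add: Y_norm_def)
    \<comment> \<open>Trial functions are also discrete test functions, so the density of the former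
      in V suffices.\<close>
    have Wn_Vn: "z \<in> Vn_space T (N n) q (U n)" if "z \<in> Wnn n" for z n
      unfolding D.Vn_iff_pw using D.Wn_L2[OF that] D.Wn_pw[OF that] D.dg_coeff_in[OF that] by blast
    show "Yn_space T j (N n) q (U n) \<noteq> {}" for n
      using Wn_Vn[OF zero_Wn] subspace_0[OF D.sub[of n]] by (auto simp: Yn_space_def)
    fix \<epsilon> :: real assume e: "\<epsilon> > 0"
    then have e2: "\<epsilon> / 2 > 0" by simp
    have "h \<in> closure (range j)" using dense by simp
    then obtain y where y: "dist (j y) h < \<epsilon> / 4" using e unfolding closure_approachable by (metis divide_pos_pos rangeE zero_less_numeral)
    have "(\<lambda>n. j (oproj (U n) y)) \<longlonglongrightarrow> j y" by (rule D.j.tendsto[OF oproj_lim])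
    from tendstoD[OF this, of "\<epsilon> / 4"] e
    have "\<forall>\<^sub>F n in sequentially. dist (j (oproj (U n) y)) (j y) < \<epsilon> / 4" by simp
    with Wn_dense[OF v e2]
    show "\<forall>\<^sub>F n in sequentially. \<exists>y\<in>Yn_space T j (N n) q (U n). Y_norm T (y - (v, h)) < \<epsilon>"
    proof eventually_elim
      case (elim n)
      from elim(1) obtain z where z: "z \<in> Wnn n" "L2_norm T (\<lambda>t. z t - v t) < \<epsilon> / 2" by blast
      let ?p = "j (oproj (U n) y)"
      have "norm (?p - h) < \<epsilon> / 2"
        using dist_triangle[of ?p h "j y"] elim(2) y by (simp add: dist_norm)
      then have "(norm (?p - h))\<^sup>2 \<le> (\<epsilon> / 2)\<^sup>2" "(L2_norm T (\<lambda>t. z t - v t))\<^sup>2 \<le> (\<epsilon> / 2)\<^sup>2"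
        using z(2) by (auto intro!: power_mono)
      moreover have "2 * (\<epsilon> / 2)\<^sup>2 < \<epsilon>\<^sup>2" using e by (simp add: power_divide)
      ultimately have "(L2_norm T (\<lambda>t. z t - v t))\<^sup>2 + (norm (?p - h))\<^sup>2 < \<epsilon>\<^sup>2" by linarith
      then have "sqrt ((L2_norm T (\<lambda>t. z t - v t))\<^sup>2 + (norm (?p - h))\<^sup>2) < sqrt (\<epsilon>\<^sup>2)" by (rule real_sqrt_less_mono)
      then have "Y_norm T ((z, ?p) - (v, h)) < \<epsilon>" using e by (simp add: Y_norm_def fun_diff_def)
      moreover have "(z, ?p) \<in> Yn_space T j (N n) q (U n)"
        using Wn_Vn[OF z(1)] D.oproj_in by (auto simp: Yn_space_def)
      ultimately show ?case by blast
    qed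
  qed
  then show "x \<in> lim_spaces (Y_space T) (Y_norm T) (\<lambda>n. Yn_space T j (N n) q (U n))"
    using xY by (simp add: lim_spaces_def x)
qed (simp add: lim_spaces_def)

lemma dg_convergence:
  assumes form: "coercive_form T a M \<alpha>" and f: "f \<in> L2 T" and \<Phi>: "norm \<Phi> \<le> 1"
    and sol: "is_solution T j a \<Phi> f \<xi>0 u u'"
    and dsol: "\<And>n. dg_solution T j a \<Phi> f \<xi>0 (N n) q (U n) (w n)"
  shows "(\<lambda>n. L2_norm T (u' - dg_hat T j (N n) q (U n) (w n)) + L2_norm T (to_U j u - w n)
              + (SUP t\<in>{0..T}. norm (u t - j (w n t)))) \<longlonglongrightarrow> 0"
proof -
  interpret coercive_form T a M \<alpha> by fact
  have T0: "T > 0" by (rule D.T_pos)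
  have u: "u \<in> W_space T j" and wd: "has_weak_deriv T j u u'"
    and eq: "\<And>v. v \<in> L2 T \<Longrightarrow> V_pairing T u' v + A_op T a (to_U j u) v = V_pairing T f v"
    and ic: "u 0 - blinfun_apply \<Phi> (u T) = \<xi>0"
    using sol by (auto simp: is_solution_def)
  note W = W_appr[OF u wd]
  define G where "G t = riesz_inv (u' t)" for t
  have G: "G \<in> L2 T" unfolding G_def[abs_def] by (rule riesz_inv_L2[OF W(1)])
  note uU = to_U_AE(1)[OF W(3)]
  have w: "w n \<in> Wnn n" for n using dsol by (simp add: dg_solution_def)
  have "M \<ge> 0" using M1 by simp
  from dg_stability[OF \<alpha> this T0, of j q]
  obtain C where C: "C \<ge> 0" and stab: "\<forall>S N z \<delta>. dg S T N j \<longrightarrow> z \<in> Wn_space T N q S \<longrightarrow> 0 \<le> \<delta> \<longrightarrow>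
     V_inner T (dg.Gam S T N j q z) z + \<alpha> * (L2_norm T z)\<^sup>2 \<le> \<delta> * L2_norm T z \<longrightarrow>
     L2_norm T (dg.Gam S T N j q z) \<le> M * L2_norm T z + \<delta> \<longrightarrow>
     norm (j (z 0)) \<le> norm (j (z T)) + \<delta> \<longrightarrow>
     L2_norm T z \<le> C * \<delta> \<and> L2_norm T (dg.Gam S T N j q z) \<le> C * \<delta> \<and> (\<forall>t\<in>{0..T}. norm (j (z t)) \<le> C * \<delta>)"
    by (elim exE conjE)
  show ?thesis
  proof (rule tendstoI)
    fix \<epsilon> :: real assume e: "\<epsilon> > 0"
    \<comment> \<open>Each of the three error terms will be at most
      \<open>C * (\<eta> * (1 + M + 2)) + \<eta>\<close>. \<open>K\<close> is the total factor of
      \<eta>, and \<eta> is chosen to make the sum \<open>\<epsilon> / 2\<close>.\<close>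
    define K where "K = 3 * C * (1 + M + 2) + 3"
    define \<eta> where "\<eta> = \<epsilon> / (2 * K)"
    have den: "K > 0" unfolding K_def using C M1 by (intro add_nonneg_pos mult_nonneg_nonneg) auto
    have \<eta>: "\<eta> > 0" and bound: "\<eta> * K = \<epsilon> / 2"
      using e den by (auto simp: \<eta>_def)
    have "\<forall>\<^sub>F n in sequentially. \<exists>z\<in>Wnn n. L2_norm T (\<lambda>t. Gm n z t - G t) < \<eta> \<and>
       L2_norm T (\<lambda>t. z t - to_U j u t) < \<eta> \<and> (\<forall>t\<in>{0..T}. norm (j (z t) - u t) < \<eta>)"
      unfolding G_def by (rule apprD[OF W(2) \<eta>])
    then show "\<forall>\<^sub>F n in sequentially. dist (L2_norm T (u' - dg_hat T j (N n) q (U n) (w n)) + L2_norm T (to_U j u - w n)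
              + (SUP t\<in>{0..T}. norm (u t - j (w n t)))) 0 < \<epsilon>"
    proof eventually_elim
      case (elim n)
      then obtain z where z: "z \<in> Wnn n" and a: "L2_norm T (\<lambda>t. Gm n z t - G t) < \<eta>"
        and b: "L2_norm T (\<lambda>t. z t - to_U j u t) < \<eta>" and c: "\<And>t. t \<in> {0..T} \<Longrightarrow> norm (j (z t) - u t) < \<eta>" by blast
      let ?e = "\<lambda>t. w n t - z t"
      let ?\<delta> = "L2_norm T (\<lambda>t. Gm n z t - G t) + M * L2_norm T (\<lambda>t. z t - to_U j u t) + 2 * \<eta>"
      have e': "?e \<in> Wnn n" by (rule D.Wn_minus(1)[OF w z])
      have "V_inner T G v + A_op T a (to_U j u) v = V_pairing T f v" if "v \<in> L2 T" for v
        using eq[OF that] by (simp add: V_pairing_eq G_def[abs_def])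
      note err = D.error_equation[OF form f dsol \<Phi> G uU this ic z less_imp_le[OF c] refl]
      have d0: "0 \<le> ?\<delta>" using M1 \<eta> by simp
      have S: "L2_norm T ?e \<le> C * ?\<delta>" "L2_norm T (Gm n ?e) \<le> C * ?\<delta>" "\<And>t. t \<in> {0..T} \<Longrightarrow> norm (j (?e t)) \<le> C * ?\<delta>"
        using stab[rule_format, OF dg e' d0 err] by auto
      have "?\<delta> \<le> \<eta> + M * \<eta> + 2 * \<eta>" using a b M1 by (intro add_mono mult_left_mono) auto
      then have dC: "C * ?\<delta> \<le> C * (\<eta> * (1 + M + 2))" using C by (intro mult_left_mono) (simp_all add: algebra_simps)
      have "L2_norm T (u' - dg_hat T j (N n) q (U n) (w n)) = L2_norm T (\<lambda>t. Gm n (w n) t - G t)"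
        unfolding L2_norm_diff_riesz_inv G_def
        by (subst L2_norm_minus_commute) (rule D.dg_hat_norm[OF w riesz_inv_L2[OF W(1)]])
      also have "\<dots> \<le> L2_norm T (\<lambda>t. Gm n (w n) t - Gm n z t) + L2_norm T (\<lambda>t. Gm n z t - G t)"
        by (rule L2_norm_diff_triangle[OF D.Gam_L2[OF w] D.Gam_L2[OF z] G])
      also have "L2_norm T (\<lambda>t. Gm n (w n) t - Gm n z t) = L2_norm T (Gm n ?e)"
        by (rule D.Gam_minus_norm(1)[OF w z, symmetric])
      finally have 1: "L2_norm T (u' - dg_hat T j (N n) q (U n) (w n)) \<le> C * (\<eta> * (1 + M + 2)) + \<eta>"
        using S(2) dC a by linarith
      have "L2_norm T (to_U j u - w n) = L2_norm T (\<lambda>t. w n t - to_U j u t)"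
        unfolding fun_diff_def by (rule L2_norm_minus_commute)
      also have "\<dots> \<le> L2_norm T ?e + L2_norm T (\<lambda>t. z t - to_U j u t)"
        by (rule L2_norm_diff_triangle[OF D.Wn_L2[OF w] D.Wn_L2[OF z] uU])
      finally have 2: "L2_norm T (to_U j u - w n) \<le> C * (\<eta> * (1 + M + 2)) + \<eta>"
        using S(1) dC b by linarith
      have pt: "norm (u t - j (w n t)) \<le> C * (\<eta> * (1 + M + 2)) + \<eta>" if t: "t \<in> {0..T}" for t
      proof -
        have eq: "u t - j (w n t) = - (j (z t) - u t) - j (?e t)" by (simp add: D.j.diff)
        show ?thesis unfolding eq
          using norm_triangle_ineq4[of "- (j (z t) - u t)" "j (?e t)"] S(3)[OF t] c[OF t] dC
          unfolding norm_minus_cancel by linarith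
      qed
      have T0': "0 \<in> {0..T}" using T0 by simp
      have 3: "(SUP t\<in>{0..T}. norm (u t - j (w n t))) \<le> C * (\<eta> * (1 + M + 2)) + \<eta>"
        using T0' by (intro cSUP_least pt) auto
      \<comment> \<open>The supremum of an unbounded set would be unspecified, so even its
        nonnegativity rests on the bound \<open>pt\<close>.\<close>
      have 4: "0 \<le> (SUP t\<in>{0..T}. norm (u t - j (w n t)))"
        by (rule order_trans[OF norm_ge_zero cSUP_upper[OF T0' bdd_aboveI2]]) (rule pt)
      have "3 * (C * (\<eta> * (1 + M + 2)) + \<eta>) = \<epsilon> / 2" using bound unfolding K_def by (simp add: algebra_simps)
      then show ?case using 1 2 3 4 L2_norm_nonneg[of T] e by (simp add: dist_real_def)
    qed
  qed
qed

end

theorem theorem5p12: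
  fixes T M \<alpha> :: real
    and j :: "'u::{real_inner, banach, second_countable_topology} \<Rightarrow>
              'h::{real_inner, banach, second_countable_topology}"
    and a :: "real \<Rightarrow> 'u \<Rightarrow> 'u \<Rightarrow> real"
    and \<Phi> :: "'h \<Rightarrow>\<^sub>L 'h"
    and q :: nat
    and U :: "nat \<Rightarrow> 'u set"
    and N :: "nat \<Rightarrow> nat"
  assumes T_pos: "T > 0"
    and embedding: "bounded_linear j" "inj j" "closure (range j) = UNIV"
    and a_bilinear: "\<And>t. t \<in> {0..T} \<Longrightarrow> bilinear (a t)"
    and a_measurable: "\<And>v w. (\<lambda>t. a t v w) \<in> borel_measurable (lebesgue_on {0..T})"
    and M_ge_1: "M \<ge> 1"
    and a_bounded: "AE t in lebesgue_on {0..T}. \<forall>v w. \<bar>a t v w\<bar> \<le> M * norm v * norm w"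
    and alpha_pos: "\<alpha> > 0"
    and a_coercive: "\<And>t v. t \<in> {0..T} \<Longrightarrow> a t v v \<ge> \<alpha> * (norm v)\<^sup>2"
    and Phi_contraction: "norm \<Phi> \<le> 1"
    and U_subspace: "\<And>n. subspace (U n)"
    and U_finite_dim: "\<And>n. \<exists>B. finite B \<and> span B = U n"
    and U_lim: "lim_spaces UNIV norm U = UNIV"
    and N_pos: "\<And>n. N n > 0"
    and N_lim: "filterlim N at_top sequentially"
  shows "X_space T j = lim_spaces (Z_space T j) (Z_norm T j) (\<lambda>n. Xn_space T j (N n) q (U n)) \<and>
         Y_space T = lim_spaces (Y_space T) (Y_norm T) (\<lambda>n. Yn_space T j (N n) q (U n)) \<and>
         (\<forall>f\<in>L2 T. \<forall>\<xi>0 u u' w.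
           is_solution T j a \<Phi> f \<xi>0 u u' \<longrightarrow>
           (\<forall>n. dg_solution T j a \<Phi> f \<xi>0 (N n) q (U n) (w n)) \<longrightarrow>
           (\<lambda>n. L2_norm T (u' - dg_hat T j (N n) q (U n) (w n))
              + L2_norm T (to_U j u - w n)
              + (SUP t\<in>{0..T}. norm (u t - j (w n t)))) \<longlonglongrightarrow> 0)"
proof -
  interpret dg_seq T j q U N
    by (intro dg_seq.intro dg.intro dg_axioms.intro fin_subspace.intro grid.intro) fact+
  have "coercive_form T a M \<alpha>" by (intro coercive_form.intro) fact+
  then show ?thesis using X_limit Y_limit dg_convergence Phi_contraction by blast
qed

end
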